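(* Let $\Omega\subset\mathbb{R}^3$ be a bounded domain with $C^1$ boundary and let $1<p<\infty$. Then $C^\infty(\overline{\Omega})^3$ is dense in $W^p_{\mathrm{imp}}(\operatorname{curl};\Omega)$.
   Context: $\mathbf{n}$ is the unit outward normal; $L^p_t(\partial\Omega)=\{\mathbf{w}\in L^p(\partial\Omega)^3:\mathbf{n}\cdot\mathbf{w}=0\}$. $W^p_{\mathrm{imp}}(\operatorname{curl};\Omega)=\{\mathbf{u}\in L^p(\Omega)^3:\nabla\times\mathbf{u}\in L^p(\Omega)^3,\ \mathbf{n}\times\mathbf{u}\in L^p_t(\partial\Omega)\}$ with norm $\|\mathbf{u}\|_{L^p(\Omega)^3}+\|\nabla\times\mathbf{u}\|_{L^p(\Omega)^3}+\|\mathbf{n}\times\mathbf{u}\|_{L^p(\partial\Omega)^3}$, where $\mathbf{n}\times\mathbf{u}$ is the tangential trace. *)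

theory Defs
  imports "HOL-Analysis.Analysis"
begin

fun Ck :: "nat \<Rightarrow> ('a::euclidean_space \<Rightarrow> 'b::real_normed_vector) \<Rightarrow> bool" where
  "Ck 0 f = continuous_on UNIV f"
| "Ck (Suc k) f = (continuous_on UNIV f \<and> (\<forall>x. f differentiable (at x)) \<and>
      (\<forall>i\<in>Basis. Ck k (\<lambda>x. frechet_derivative f (at x) i)))"

definition Cinf :: "('a::euclidean_space \<Rightarrow> 'b::real_normed_vector) \<Rightarrow> bool" where
  "Cinf f \<longleftrightarrow> (\<forall>k. Ck k f)"

definition partial :: "3 \<Rightarrow> (real^3 \<Rightarrow> real^3) \<Rightarrow> real^3 \<Rightarrow> real^3" where
  "partial j F x = frechet_derivative F (at x) (axis j 1)"

definition curl :: "(real^3 \<Rightarrow> real^3) \<Rightarrow> real^3 \<Rightarrow> real^3" where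
  "curl F x = vector [ partial 2 F x $ 3 - partial 3 F x $ 2,
                       partial 3 F x $ 1 - partial 1 F x $ 3,
                       partial 1 F x $ 2 - partial 2 F x $ 1 ]"

section \<open>Hausdorff measure (normalised so that H^2 is surface area)\<close>

definition hausdorff_delta :: "real \<Rightarrow> real \<Rightarrow> 'a::metric_space set \<Rightarrow> ennreal" where
  "hausdorff_delta s \<delta> A =
     (INF C \<in> {C :: nat \<Rightarrow> 'a set. A \<subseteq> (\<Union>i. C i) \<and> (\<forall>i. bounded (C i) \<and> diameter (C i) \<le> \<delta>)}.
        (\<Sum>i. ennreal (pi powr (s/2) / Gamma (s/2 + 1) * (diameter (C i) / 2) powr s)))"

definition hausdorff_outer :: "real \<Rightarrow> 'a::metric_space set \<Rightarrow> ennreal" where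
  "hausdorff_outer s A = (SUP \<delta> \<in> {0<..}. hausdorff_delta s \<delta> A)"

definition hausdorff_measure :: "real \<Rightarrow> 'a::metric_space measure" where
  "hausdorff_measure s = measure_of UNIV (sets borel) (hausdorff_outer s)"

definition surface_measure :: "(real^3) set \<Rightarrow> (real^3) measure" where
  "surface_measure \<Omega> = restrict_space (hausdorff_measure 2) (frontier \<Omega>)"

definition grad :: "(real^3 \<Rightarrow> real) \<Rightarrow> real^3 \<Rightarrow> real^3" where
  "grad \<rho> x = (\<chi> i. frechet_derivative \<rho> (at x) (axis i 1))"

definition local_defining_fun :: "(real^3) set \<Rightarrow> real^3 \<Rightarrow> real \<Rightarrow> (real^3 \<Rightarrow> real) \<Rightarrow> bool" where
  "local_defining_fun \<Omega> x r \<rho> \<longleftrightarrow> r > 0 \<and> Ck 1 \<rho> \<and>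
     (\<forall>y\<in>ball x r. (y \<in> \<Omega> \<longleftrightarrow> \<rho> y < 0) \<and> (y \<in> frontier \<Omega> \<longleftrightarrow> \<rho> y = 0) \<and> grad \<rho> y \<noteq> 0)"

definition C1_boundary :: "(real^3) set \<Rightarrow> bool" where
  "C1_boundary \<Omega> \<longleftrightarrow> (\<forall>x\<in>frontier \<Omega>. \<exists>r \<rho>. local_defining_fun \<Omega> x r \<rho>)"

definition bounded_C1_domain :: "(real^3) set \<Rightarrow> bool" where
  "bounded_C1_domain \<Omega> \<longleftrightarrow> open \<Omega> \<and> connected \<Omega> \<and> \<Omega> \<noteq> {} \<and> bounded \<Omega> \<and> C1_boundary \<Omega>"

definition outward_normal :: "(real^3) set \<Rightarrow> real^3 \<Rightarrow> real^3" where
  "outward_normal \<Omega> x = (SOME v. \<exists>r \<rho>. local_defining_fun \<Omega> x r \<rho> \<and> v = grad \<rho> x /\<^sub>R norm (grad \<rho> x))"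

definition Lp :: "'a measure \<Rightarrow> real \<Rightarrow> ('a \<Rightarrow> real^3) \<Rightarrow> bool" where
  "Lp M p f \<longleftrightarrow> f \<in> borel_measurable M \<and> integrable M (\<lambda>x. norm (f x) powr p)"

definition Lp_norm :: "'a measure \<Rightarrow> real \<Rightarrow> ('a \<Rightarrow> real^3) \<Rightarrow> real" where
  "Lp_norm M p f = (\<integral>x. norm (f x) powr p \<partial>M) powr (1/p)"

definition Lp_tangential :: "(real^3) set \<Rightarrow> real \<Rightarrow> (real^3 \<Rightarrow> real^3) \<Rightarrow> bool" where
  "Lp_tangential \<Omega> p w \<longleftrightarrow> Lp (surface_measure \<Omega>) p w \<and>
     (AE x in surface_measure \<Omega>. outward_normal \<Omega> x \<bullet> w x = 0)"

definition weak_curl :: "(real^3) set \<Rightarrow> (real^3 \<Rightarrow> real^3) \<Rightarrow> (real^3 \<Rightarrow> real^3) \<Rightarrow> bool" where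
  "weak_curl \<Omega> u w \<longleftrightarrow> (\<forall>\<phi>. Cinf \<phi> \<and> compact (closure {x. \<phi> x \<noteq> 0}) \<and> closure {x. \<phi> x \<noteq> 0} \<subseteq> \<Omega> \<longrightarrow>
      (\<integral>x. u x \<bullet> curl \<phi> x \<partial>lebesgue_on \<Omega>) = (\<integral>x. w x \<bullet> \<phi> x \<partial>lebesgue_on \<Omega>))"

text \<open>\<open>t\<close> is the tangential trace n \<times> u of \<open>u\<close> (with weak curl \<open>w\<close>), defined by Green's formula
  for all smooth test fields up to the boundary.\<close>
definition tangential_trace :: "(real^3) set \<Rightarrow> (real^3 \<Rightarrow> real^3) \<Rightarrow> (real^3 \<Rightarrow> real^3)
     \<Rightarrow> (real^3 \<Rightarrow> real^3) \<Rightarrow> bool" where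
  "tangential_trace \<Omega> u w t \<longleftrightarrow> (\<forall>\<phi>. Cinf \<phi> \<longrightarrow>
      (\<integral>x. w x \<bullet> \<phi> x - u x \<bullet> curl \<phi> x \<partial>lebesgue_on \<Omega>) = (\<integral>x. t x \<bullet> \<phi> x \<partial>surface_measure \<Omega>))"

definition W_imp_curl :: "(real^3) set \<Rightarrow> real \<Rightarrow> (real^3 \<Rightarrow> real^3) \<Rightarrow> (real^3 \<Rightarrow> real^3)
     \<Rightarrow> (real^3 \<Rightarrow> real^3) \<Rightarrow> bool" where
  "W_imp_curl \<Omega> p u w t \<longleftrightarrow> Lp (lebesgue_on \<Omega>) p u \<and> Lp (lebesgue_on \<Omega>) p w \<and> weak_curl \<Omega> u w \<and>
     Lp_tangential \<Omega> p t \<and> tangential_trace \<Omega> u w t"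

definition W_imp_dist :: "(real^3) set \<Rightarrow> real \<Rightarrow> (real^3 \<Rightarrow> real^3) \<Rightarrow> (real^3 \<Rightarrow> real^3)
     \<Rightarrow> (real^3 \<Rightarrow> real^3) \<Rightarrow> (real^3 \<Rightarrow> real^3) \<Rightarrow> real" where
  "W_imp_dist \<Omega> p u w t \<phi> =
     Lp_norm (lebesgue_on \<Omega>) p (\<lambda>x. u x - \<phi> x)
   + Lp_norm (lebesgue_on \<Omega>) p (\<lambda>x. w x - curl \<phi> x)
   + Lp_norm (surface_measure \<Omega>) p (\<lambda>x. t x - cross3 (outward_normal \<Omega> x) (\<phi> x))"

end

theory Submission
  imports Defs "HOL-Probability.Probability"
begin

text \<open>A partition of unity localises the field to boundary charts in which \<open>\<Omega>\<close> lies above the graph of a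
  \<open>C\<^sup>1\<close> function \<open>g\<close>. The shear \<open>y \<mapsto> y + g y e\<close> pulls \<open>u\<close> back as a 1-form, its curl as a 2-form and
  the trace, weighted by the area density, as a tangential density on the plane; Green's formula becomes its
  analogue in the half space. There the zero extension of \<open>u\<close> is convolved with an anisotropic kernel of
  width \<open>\<epsilon>\<close> along the plane and \<open>\<delta>\<close> across it, shifted so that near the closed half space only interior
  values are averaged. The convolution then has curl close to \<open>w\<close>, and by Green's formula its trace tends,
  as \<open>\<delta> \<rightarrow> 0\<close>, to the mollification of \<open>t\<close> in the plane; so \<open>\<epsilon>\<close> is chosen first. Pushing the result
  forward along the shear gives a field which is only continuous with continuous curl; replacing \<open>g\<close> by a
  mollification makes it smooth with uniformly small error.
  Identifying the 2-dimensional Hausdorff measure of the graph with the area formula rests on the isodiametric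
  inequality in the plane, proved by Steiner symmetrisation.\<close>

section \<open>Smooth functions and mollifiers\<close>

text \<open>The trace error is measured in \<open>Lp\<close> of the boundary, a norm that the
  \<open>Lp\<close> norms of a field and of its curl do not control, so Green's formula itself has
  to supply that error. This is why the kernel has two widths. Its vertical factor is the derivative
  of a cutoff; Green's formula tested with the cutoff times the planar kernel then compares the two
  traces exactly, and the discrepancy is an integral over a layer of height 2 \<delta>. The planar
  gradient in it is large for small \<epsilon>, but for fixed \<epsilon> Jensen's inequality bounds
  the p-th power of the error by a multiple of \<delta>^(p-1); here 1 < p enters. The second
  obstacle is that a chart of class C1 destroys smoothness, so that a pulled back test field is not
  admissible in Green's formula. A shear suits this situation: it preserves volume, and although the
  field obtained from it contains first derivatives of g, its curl contains no second ones. Hence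
  smoothing g disturbs field and curl only uniformly little. Interior points need no separate
  argument: their chart is a plane that misses the chart ball.\<close>

lemma Ck_SucI:
  assumes "\<And>x. (f has_derivative D x) (at x)" and "\<And>i. i \<in> Basis \<Longrightarrow> Ck k (\<lambda>x. D x i)"
  shows "Ck (Suc k) f"
proof -
  have D: "frechet_derivative f (at x) = D x" for x
    using frechet_derivative_at[OF assms(1)] by simp
  show ?thesis
    using assms by (auto simp: D differentiable_def intro!: continuous_at_imp_continuous_on has_derivative_continuous)
qed

lemma Ck_Suc_has_derivative:
  "Ck (Suc k) f \<Longrightarrow> (f has_derivative frechet_derivative f (at x)) (at x)"
  by (simp add: frechet_derivative_works[symmetric])

lemma Ck_Suc_partial:
  "Ck (Suc k) f \<Longrightarrow> i \<in> Basis \<Longrightarrow> Ck k (\<lambda>x. frechet_derivative f (at x) i)"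
  by simp

lemma Ck_Suc_imp: "Ck (Suc k) f \<Longrightarrow> Ck k f"
proof (induction k arbitrary: f)
  case (Suc k)
  then show ?case by (metis Ck.simps(2))
qed simp

lemma Ck_continuous: "Ck k f \<Longrightarrow> continuous_on UNIV f"
  by (cases k) auto

lemma Ck_const: "Ck k (\<lambda>x. c)"
proof (induction k arbitrary: c)
  case (Suc k)
  show ?case by (rule Ck_SucI[where D="\<lambda>x h. 0"]) (auto intro: Suc)
qed simp

lemma Ck_bounded_linear_comp:
  assumes "bounded_linear L" "Ck k f" shows "Ck k (\<lambda>x. L (f x))"
  using assms(2)
proof (induction k arbitrary: f)
  case 0
  then show ?case using bounded_linear.continuous_on[OF assms(1)] by simp
next
  case (Suc k)
  show ?case
    by (rule Ck_SucI[where D="\<lambda>x h. L (frechet_derivative f (at x) h)"])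
      (auto intro!: Suc.IH Ck_Suc_partial[OF Suc.prems]
        bounded_linear.has_derivative[OF assms(1)] Ck_Suc_has_derivative[OF Suc.prems])
qed

lemma Ck_id: "Ck k (\<lambda>x. x)"
proof (cases k)
  case (Suc j)
  show ?thesis unfolding Suc by (rule Ck_SucI[where D="\<lambda>x h. h"]) (auto intro: Ck_const)
qed simp

lemma Ck_bounded_linear: "bounded_linear L \<Longrightarrow> Ck k L"
  using Ck_bounded_linear_comp[OF _ Ck_id] by auto

lemma Ck_add:
  assumes "Ck k f" "Ck k g" shows "Ck k (\<lambda>x. f x + g x)"
  using assms
proof (induction k arbitrary: f g)
  case 0
  then show ?case by (auto intro: continuous_on_add)
next
  case (Suc k)
  show ?case
    by (rule Ck_SucI[where D="\<lambda>x h. frechet_derivative f (at x) h + frechet_derivative g (at x) h"])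
      (auto intro!: Suc.IH Ck_Suc_partial[OF Suc.prems(1)] Ck_Suc_partial[OF Suc.prems(2)]
        has_derivative_add Ck_Suc_has_derivative[OF Suc.prems(1)] Ck_Suc_has_derivative[OF Suc.prems(2)])
qed

lemma Ck_minus: "Ck k f \<Longrightarrow> Ck k (\<lambda>x. - f x)"
  by (rule Ck_bounded_linear_comp[OF bounded_linear_minus[OF bounded_linear_ident]])

lemma Ck_diff: "Ck k f \<Longrightarrow> Ck k g \<Longrightarrow> Ck k (\<lambda>x. f x - g x)"
  using Ck_add[OF _ Ck_minus] by fastforce

lemma Ck_sum: "(\<And>i. i \<in> I \<Longrightarrow> Ck k (f i)) \<Longrightarrow> Ck k (\<lambda>x. \<Sum>i\<in>I. f i x)"
  by (induction I rule: infinite_finite_induct) (auto intro: Ck_const Ck_add)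

text \<open>One Leibniz induction for an arbitrary bounded bilinear product serves scaling, inner,
  real and cross products at once.\<close>

lemma Ck_bilinear:
  assumes "bounded_bilinear pr" "Ck k f" "Ck k g" shows "Ck k (\<lambda>x. pr (f x) (g x))"
  using assms(2,3)
proof (induction k arbitrary: f g)
  case 0
  then show ?case using bounded_bilinear.continuous_on[OF assms(1)] by simp
next
  case (Suc k)
  show ?case
  proof (rule Ck_SucI)
    show "((\<lambda>x. pr (f x) (g x)) has_derivative
       (\<lambda>h. pr (f x) (frechet_derivative g (at x) h) + pr (frechet_derivative f (at x) h) (g x))) (at x)" for x
      by (rule bounded_bilinear.FDERIV[OF assms(1)]) (rule Ck_Suc_has_derivative Suc.prems)+
    show "Ck k (\<lambda>x. pr (f x) (frechet_derivative g (at x) i) + pr (frechet_derivative f (at x) i) (g x))"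
      if "i \<in> Basis" for i
      by (intro Ck_add Suc.IH Ck_Suc_partial[OF Suc.prems(1) that] Ck_Suc_partial[OF Suc.prems(2) that]
          Ck_Suc_imp[OF Suc.prems(1)] Ck_Suc_imp[OF Suc.prems(2)])
  qed
qed

lemmas Ck_scaleR = Ck_bilinear[OF bounded_bilinear_scaleR]
  and Ck_inner = Ck_bilinear[OF bounded_bilinear_inner]
  and Ck_mult = Ck_bilinear[OF bounded_bilinear_mult]

text \<open>The chain rule, expanded in the basis of the middle space, writes a partial derivative
  as a finite sum of products of functions of order k; composition of the outer partials with h is
  the induction hypothesis, hence the generalisation over f and h.\<close>

lemma Ck_compose:
  fixes f :: "'b::euclidean_space \<Rightarrow> 'c::real_normed_vector" and h :: "'a::euclidean_space \<Rightarrow> 'b"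
  assumes "Ck k f" "Ck k h" shows "Ck k (\<lambda>x. f (h x))"
  using assms
proof (induction k arbitrary: f h)
  case 0
  then show ?case using continuous_on_compose2[of UNIV f UNIV h] by simp
next
  case (Suc k)
  let ?f = "\<lambda>x. frechet_derivative f (at x)" and ?h = "\<lambda>x. frechet_derivative h (at x)"
  have expand: "?f (h x) v = (\<Sum>j\<in>Basis. (v \<bullet> j) *\<^sub>R ?f (h x) j)" for x v
  proof -
    have lin: "linear (?f (h x))"
      using Ck_Suc_has_derivative[OF Suc.prems(1)] has_derivative_linear by blast
    have "?f (h x) v = ?f (h x) (\<Sum>j\<in>Basis. (v \<bullet> j) *\<^sub>R j)" by (simp add: euclidean_representation)
    also have "\<dots> = (\<Sum>j\<in>Basis. (v \<bullet> j) *\<^sub>R ?f (h x) j)"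
      using lin by (simp add: linear_sum linear_cmul)
    finally show ?thesis .
  qed
  show ?case
  proof (rule Ck_SucI)
    show "((\<lambda>x. f (h x)) has_derivative (\<lambda>v. \<Sum>j\<in>Basis. (?h x v \<bullet> j) *\<^sub>R ?f (h x) j)) (at x)" for x
      using has_derivative_compose[OF Ck_Suc_has_derivative[OF Suc.prems(2)] Ck_Suc_has_derivative[OF Suc.prems(1)]]
      by (subst expand[symmetric])
    fix i :: 'a assume i: "i \<in> Basis"
    show "Ck k (\<lambda>x. \<Sum>j\<in>Basis. (?h x i \<bullet> j) *\<^sub>R ?f (h x) j)"
      by (intro Ck_sum Ck_scaleR Ck_inner Ck_const Suc.IH Ck_Suc_partial[OF Suc.prems(2) i]
          Ck_Suc_imp[OF Suc.prems(2)]) (rule Ck_Suc_partial[OF Suc.prems(1)])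
  qed
qed

lemma Cinf_Ck: "Cinf f \<Longrightarrow> Ck k f" by (simp add: Cinf_def)
lemma Cinf_continuous: "Cinf f \<Longrightarrow> continuous_on UNIV f" by (rule Ck_continuous[OF Cinf_Ck[of _ 0]])
lemma Cinf_has_derivative: "Cinf f \<Longrightarrow> (f has_derivative frechet_derivative f (at x)) (at x)"
  by (rule Ck_Suc_has_derivative[OF Cinf_Ck[of _ "Suc 0"]])
lemma Cinf_const: "Cinf (\<lambda>x. c)" by (simp add: Cinf_def Ck_const)
lemma Cinf_id: "Cinf (\<lambda>x. x)" by (simp add: Cinf_def Ck_id)
lemma Cinf_add: "Cinf f \<Longrightarrow> Cinf g \<Longrightarrow> Cinf (\<lambda>x. f x + g x)" by (simp add: Cinf_def Ck_add)
lemma Cinf_diff: "Cinf f \<Longrightarrow> Cinf g \<Longrightarrow> Cinf (\<lambda>x. f x - g x)" by (simp add: Cinf_def Ck_diff)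
lemma Cinf_minus: "Cinf f \<Longrightarrow> Cinf (\<lambda>x. - f x)" by (simp add: Cinf_def Ck_minus)
lemma Cinf_scaleR: "Cinf f \<Longrightarrow> Cinf g \<Longrightarrow> Cinf (\<lambda>x. f x *\<^sub>R g x)" by (simp add: Cinf_def Ck_scaleR)
lemma Cinf_mult: "Cinf f \<Longrightarrow> Cinf g \<Longrightarrow> Cinf (\<lambda>x. f x * g x :: real)" by (simp add: Cinf_def Ck_mult)
lemma Cinf_inner: "Cinf f \<Longrightarrow> Cinf g \<Longrightarrow> Cinf (\<lambda>x. f x \<bullet> g x)" by (simp add: Cinf_def Ck_inner)
lemma Cinf_compose: "Cinf f \<Longrightarrow> Cinf h \<Longrightarrow> Cinf (\<lambda>x. f (h x))" by (simp add: Cinf_def Ck_compose)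
lemma Cinf_partial: "Cinf f \<Longrightarrow> i \<in> Basis \<Longrightarrow> Cinf (\<lambda>x. frechet_derivative f (at x) i)"
  unfolding Cinf_def by (metis Ck.simps(2))

lemma CinfI_derivative:
  assumes "\<And>x. (f has_derivative D x) (at x)" "\<And>i. i \<in> Basis \<Longrightarrow> Cinf (\<lambda>x. D x i)"
  shows "Cinf f"
  unfolding Cinf_def
proof
  fix k show "Ck k f"
    by (rule Ck_Suc_imp, rule Ck_SucI[OF assms(1)]) (rule Cinf_Ck[OF assms(2)])
qed

section \<open>Gradients of real functions\<close>

lemma grad_inner:
  assumes "(f has_derivative D) (at x)" shows "grad f x \<bullet> h = D h"
proof -
  have lin: "linear D" using assms has_derivative_linear by blast
  have "h = (\<Sum>i\<in>UNIV. h $ i *\<^sub>R axis i 1)"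
    by (simp add: vec_eq_iff axis_def if_distrib cong: if_cong)
  then have "D h = D (\<Sum>i\<in>UNIV. h $ i *\<^sub>R axis i 1)" by (rule arg_cong)
  also have "\<dots> = (\<Sum>i\<in>UNIV. h $ i * D (axis i 1))"
    using lin by (simp add: linear_sum linear_cmul)
  also have "\<dots> = grad f x \<bullet> h"
    unfolding grad_def frechet_derivative_at[OF assms, symmetric]
    by (simp add: inner_vec_def mult.commute)
  finally show ?thesis by simp
qed

lemma grad_eqI:
  assumes "(f has_derivative (\<lambda>h. v \<bullet> h)) (at x)" shows "grad f x = v"
  by (rule vector_eq_rdot[THEN iffD1]) (simp add: grad_inner[OF assms])

lemma has_derivative_grad:
  assumes "Ck (Suc k) f" shows "(f has_derivative (\<lambda>h. grad f x \<bullet> h)) (at x)"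
proof -
  note d = Ck_Suc_has_derivative[OF assms, of x]
  have "(\<lambda>h. grad f x \<bullet> h) = frechet_derivative f (at x)" by (rule ext) (rule grad_inner[OF d])
  then show ?thesis using d by (simp only:)
qed

lemma Cinf_has_derivative_grad: "Cinf f \<Longrightarrow> (f has_derivative (\<lambda>h. grad f x \<bullet> h)) (at x)"
  by (rule has_derivative_grad[OF Cinf_Ck[of _ "Suc 0"]])

lemma grad_expand: "grad f x = (\<Sum>i\<in>UNIV. frechet_derivative f (at x) (axis i 1) *\<^sub>R axis i 1)"
  by (simp add: grad_def vec_eq_iff axis_def if_distrib cong: if_cong)

lemma Ck_grad: "Ck (Suc k) f \<Longrightarrow> Ck k (grad f)"
proof -
  assume "Ck (Suc k) f"
  then have "Ck k (\<lambda>x. \<Sum>i\<in>UNIV. frechet_derivative f (at x) (axis i 1) *\<^sub>R axis i (1::real))"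
    by (intro Ck_sum Ck_scaleR Ck_const Ck_Suc_partial) (auto simp: Basis_vec_def)
  then show ?thesis by (simp add: grad_expand[abs_def])
qed

lemma Cinf_grad: "Cinf f \<Longrightarrow> Cinf (grad f)"
  unfolding Cinf_def using Ck_grad by metis

lemma Ck1_I:
  fixes f :: "real^3 \<Rightarrow> real"
  assumes "\<And>x. (f has_derivative (\<lambda>h. D x \<bullet> h)) (at x)" "continuous_on UNIV D"
  shows "Ck 1 f"
  unfolding One_nat_def
  using assms(2) by (intro Ck_SucI[OF assms(1)]) (simp add: continuous_on_inner continuous_on_const)

section \<open>The flat function exp(-1/s), bumps and cutoffs\<close>

definition hexp :: "nat \<Rightarrow> real \<Rightarrow> real" where
  "hexp n s = (if 0 < s then exp (- 1 / s) / s ^ n else 0)"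

lemma hexp_tendsto_0: "(hexp n \<longlongrightarrow> 0) (at 0)"
proof -
  have "((\<lambda>z::real. z ^ n / exp z) \<longlongrightarrow> 0) at_top" by (rule tendsto_power_div_exp_0)
  moreover have "eventually (\<lambda>z. z ^ n / exp z = hexp n (inverse z)) at_top"
    using eventually_gt_at_top[of 0]
    by eventually_elim (simp add: hexp_def exp_minus field_simps)
  ultimately have "((\<lambda>z. hexp n (inverse z)) \<longlongrightarrow> 0) at_top"
    by (rule Lim_transform_eventually)
  then have right: "(hexp n \<longlongrightarrow> 0) (at_right 0)" by (simp add: filterlim_at_right_to_top)
  have "eventually (\<lambda>s. hexp n s = 0) (at_left 0)"
    by (auto simp: eventually_at_filter hexp_def)
  then have left: "(hexp n \<longlongrightarrow> 0) (at_left 0)" by (rule tendsto_eventually)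
  show ?thesis using left right by (rule filterlim_split_at)
qed

text \<open>The power n is carried along because differentiation stays in the linear span of the
  family, so that a single induction in \<open>Cinf_hexp\<close> makes all members smooth;
  \<open>hexp 0\<close> is the classical flat function.\<close>

lemma hexp_has_derivative:
  "(hexp n has_real_derivative hexp (n + 2) s - n * hexp (n + 1) s) (at s)"
proof -
  consider "s > 0" | "s < 0" | "s = 0" by linarith
  then show ?thesis
  proof cases
    case 1
    have "((\<lambda>s. exp (- 1 / s) / s ^ n) has_real_derivative hexp (n + 2) s - n * hexp (n + 1) s) (at s)"
    proof -
      \<comment> \<open>\<open>n - Suc 0\<close> truncates at n = 0, where the factor
        \<open>real n\<close> kills the term anyway.\<close>
      have n: "real n * s ^ (n - Suc 0) = real n * s ^ n / s"
        using 1 by (cases n) auto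
      have "((\<lambda>s. exp (- 1 / s) / s ^ n) has_real_derivative
          (exp (- 1 / s) * (1 / (s * s)) * s ^ n - exp (- 1 / s) * (real n * s ^ (n - Suc 0))) / (s ^ n * s ^ n)) (at s)"
        using 1 by (auto intro!: derivative_eq_intros)
      then show ?thesis
        unfolding n by (rule DERIV_cong) (use 1 in \<open>simp add: hexp_def field_simps\<close>)
    qed
    then show ?thesis
      by (rule has_field_derivative_transform_within_open[where S="{0<..}"]) (use 1 in \<open>auto simp: hexp_def\<close>)
  next
    case 2
    have "((\<lambda>s. 0) has_real_derivative hexp (n + 2) s - n * hexp (n + 1) s) (at s)"
      using 2 by (auto simp: hexp_def)
    then show ?thesis
      by (rule has_field_derivative_transform_within_open[where S="{..<0}"]) (use 2 in \<open>auto simp: hexp_def\<close>)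
  next
    case 3
    \<comment> \<open>At the origin the difference quotient of \<open>hexp n\<close> is the next
      member of the family, and every member tends to 0 there.\<close>
    have "eventually (\<lambda>t. hexp (n + 1) t = hexp n t / t) (at 0)"
      by (auto simp: eventually_at_filter hexp_def)
    then have "((\<lambda>t. hexp n t / t) \<longlongrightarrow> 0) (at 0)"
      using hexp_tendsto_0[of "n + 1"] by (rule Lim_transform_eventually[rotated])
    then have "(hexp n has_real_derivative 0) (at 0)"
      unfolding has_field_derivative_iff by (simp add: hexp_def)
    then show ?thesis using 3 by (simp add: hexp_def)
  qed
qed

lemma Cinf_realI:
  assumes "\<And>s::real. (f has_real_derivative f' s) (at s)" "Cinf f'"
  shows "Cinf f"
  by (rule CinfI_derivative[of f "\<lambda>s h. f' s * h"])
    (use assms in \<open>auto simp: has_field_derivative_def\<close>)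

lemma Cinf_hexp: "Cinf (hexp n)"
  unfolding Cinf_def
proof
  fix k show "Ck k (hexp n)"
  proof (induction k arbitrary: n)
    case 0
    have "continuous_on UNIV (hexp n)"
      by (intro continuous_at_imp_continuous_on ballI DERIV_isCont[OF hexp_has_derivative])
    then show ?case by simp
  next
    case (Suc k)
    show ?case
    proof (rule Ck_SucI)
      show "(hexp n has_derivative (\<lambda>h. (hexp (n + 2) s - n * hexp (n + 1) s) * h)) (at s)" for s
        using hexp_has_derivative[of n s] by (simp add: has_field_derivative_def)
      show "Ck k (\<lambda>s. (hexp (n + 2) s - n * hexp (n + 1) s) * i)" if "i \<in> Basis" for i
        by (intro Ck_mult Ck_diff Ck_const Suc.IH)
    qed
  qed
qed

text \<open>The support [1, 2] avoids 0, so that kernels built from this bump look strictly to one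
  side; a symmetric bump would mix in values from across the boundary.\<close>

definition bump0 :: "real \<Rightarrow> real" where "bump0 s = hexp 0 (s - 1) * hexp 0 (2 - s)"
definition bump0_int :: "real \<Rightarrow> real" where "bump0_int s = integral {0..s} bump0"
definition bump :: "real \<Rightarrow> real" where "bump s = bump0 s / bump0_int 2"

text \<open>The values are \<open>-1\<close> on the left and \<open>0\<close> on the right, so that a cutoff at the boundary of the
  half space vanishes inside it.\<close>
definition step :: "real \<Rightarrow> real" where "step s = bump0_int s / bump0_int 2 - 1"

lemma Cinf_bump0: "Cinf bump0"
  unfolding bump0_def[abs_def]
  by (intro Cinf_mult Cinf_compose[OF Cinf_hexp] Cinf_diff Cinf_id Cinf_const)

lemma bump0_nonneg: "bump0 s \<ge> 0" and bump0_eq_0: "s \<le> 1 \<or> 2 \<le> s \<Longrightarrow> bump0 s = 0"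
  and bump0_pos: "1 < s \<Longrightarrow> s < 2 \<Longrightarrow> bump0 s > 0"
  by (auto simp: bump0_def hexp_def)

lemma bump0_int_has_derivative: "(bump0_int has_real_derivative bump0 s) (at s)"
proof (cases "s < 1")
  case True
  have "((\<lambda>s. 0) has_real_derivative bump0 s) (at s)" using True bump0_eq_0 by simp
  then show ?thesis
  proof (rule has_field_derivative_transform_within_open[where S="{..<1}"])
    fix x :: real assume "x \<in> {..<1}"
    then have "integral {0..x} bump0 = integral {0..x} (\<lambda>_. 0)"
      by (intro Henstock_Kurzweil_Integration.integral_cong) (auto simp: bump0_eq_0)
    then show "0 = bump0_int x" by (simp add: bump0_int_def)
  qed (use True in auto)
next
  case False
  have "continuous_on {0..s+1} bump0"
    using Cinf_continuous[OF Cinf_bump0] continuous_on_subset by blast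
  then have "((\<lambda>u. integral {0..u} bump0) has_real_derivative bump0 s) (at s within {0..s+1})"
    by (rule integral_has_real_derivative) (use False in auto)
  moreover have "at s within {0..s+1} = at s"
    by (rule at_within_interior) (use False in auto)
  ultimately show ?thesis by (simp add: bump0_int_def[abs_def])
qed

lemma bump0_int_mono: "s \<le> t \<Longrightarrow> bump0_int s \<le> bump0_int t"
  using DERIV_nonneg_imp_nondecreasing[of s t bump0_int] bump0_int_has_derivative bump0_nonneg by blast

lemma bump0_int_left: "s \<le> 1 \<Longrightarrow> bump0_int s = 0"
proof -
  assume "s \<le> 1"
  then have "integral {0..s} bump0 = integral {0..s} (\<lambda>_. 0)"
    by (intro Henstock_Kurzweil_Integration.integral_cong) (auto simp: bump0_eq_0)
  then show ?thesis by (simp add: bump0_int_def)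
qed

lemma bump0_int_right: "2 \<le> s \<Longrightarrow> bump0_int s = bump0_int 2"
proof -
  assume s: "2 \<le> s"
  have "bump0_int 2 = bump0_int s" if "2 < s"
  proof (rule DERIV_isconst_end[OF that, symmetric])
    show "continuous_on {2..s} bump0_int"
      by (intro continuous_at_imp_continuous_on ballI DERIV_isCont[OF bump0_int_has_derivative])
    show "(bump0_int has_real_derivative 0) (at x)" if "2 < x" "x < s" for x
      using bump0_int_has_derivative[of x] bump0_eq_0[of x] that by simp
  qed
  then show ?thesis using s by (cases "s = 2") auto
qed

lemma bump0_int_pos: "bump0_int 2 > 0"
proof -
  obtain z where "1 < z" "z < 2" "bump0_int 2 - bump0_int 1 = (2 - 1) * bump0 z"
    using MVT2[of 1 2 bump0_int bump0] bump0_int_has_derivative by auto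
  then show ?thesis using bump0_pos[of z] bump0_int_left[of 1] by simp
qed

lemma Cinf_bump: "Cinf bump"
  using Cinf_mult[OF Cinf_bump0 Cinf_const[of "inverse (bump0_int 2)"]]
  by (simp add: bump_def[abs_def] divide_inverse)

lemma bump_nonneg: "bump s \<ge> 0"
  using bump0_nonneg bump0_int_pos by (simp add: bump_def less_imp_le)

lemma bump_eq_0: "s \<le> 1 \<or> 2 \<le> s \<Longrightarrow> bump s = 0"
  by (simp add: bump_def bump0_eq_0)

lemma step_has_derivative: "(step has_real_derivative bump s) (at s)"
  unfolding step_def[abs_def] bump_def using bump0_int_pos
  by (auto intro!: derivative_eq_intros bump0_int_has_derivative)

lemma Cinf_step: "Cinf step"
  by (rule Cinf_realI[OF step_has_derivative Cinf_bump])

lemma step_left: "s \<le> 1 \<Longrightarrow> step s = -1" and step_right: "2 \<le> s \<Longrightarrow> step s = 0"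
proof -
  show "s \<le> 1 \<Longrightarrow> step s = -1" by (simp add: step_def bump0_int_left)
  assume "2 \<le> s"
  then show "step s = 0" using bump0_int_pos bump0_int_right[of s] by (simp add: step_def)
qed

lemma step_bounds: "-1 \<le> step s" "step s \<le> 0"
proof -
  have "0 \<le> bump0_int s"
    using bump0_int_mono[of 1 s] bump0_int_left[of 1] bump0_int_left[of s] by linarith
  moreover have "bump0_int s \<le> bump0_int 2"
    using bump0_int_mono[of s 2] bump0_int_right[of s] by linarith
  ultimately show "-1 \<le> step s" "step s \<le> 0" using bump0_int_pos by (auto simp: step_def)
qed

text \<open>This is the derivative of \<open>step (s / r)\<close>, supported in [r, 2 r]; its mass 1
  is the jump of \<open>step\<close>.\<close>

definition bump_scaled :: "real \<Rightarrow> real \<Rightarrow> real" where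
  "bump_scaled r s = bump (s / r) / r"

lemma Cinf_bump_scaled: "Cinf (bump_scaled r)"
proof -
  have "Cinf (\<lambda>s. bump (s * inverse r) * inverse r)"
    by (intro Cinf_mult Cinf_compose[OF Cinf_bump] Cinf_id Cinf_const)
  then show ?thesis by (simp add: bump_scaled_def[abs_def] divide_inverse)
qed

lemma bump_scaled_nonneg: "r > 0 \<Longrightarrow> bump_scaled r s \<ge> 0"
  by (simp add: bump_scaled_def bump_nonneg)

lemma bump_scaled_eq_0: "r > 0 \<Longrightarrow> s \<le> r \<or> 2 * r \<le> s \<Longrightarrow> bump_scaled r s = 0"
  by (simp add: bump_scaled_def bump_eq_0 field_simps)

lemma step_scaled_has_derivative:
  "r > 0 \<Longrightarrow> ((\<lambda>s. step (s / r)) has_real_derivative bump_scaled r s) (at s)"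
  unfolding bump_scaled_def
  by (rule DERIV_chain'[OF _ step_has_derivative, THEN DERIV_cong]) (auto intro!: derivative_eq_intros)

lemma bump_scaled_borel [measurable]: "bump_scaled r \<in> borel_measurable borel"
  using Cinf_continuous[OF Cinf_bump_scaled] by (rule borel_measurable_continuous_onI)

lemma nn_integral_bump_scaled:
  assumes r: "r > 0" shows "(\<integral>\<^sup>+s. bump_scaled r s \<partial>lborel) = 1"
proof -
  have "(\<integral>\<^sup>+s. bump_scaled r s \<partial>lborel) = (\<integral>\<^sup>+s. ennreal (bump_scaled r s) * indicator {r..2*r} s \<partial>lborel)"
    by (rule nn_integral_cong) (auto simp: indicator_def bump_scaled_eq_0[OF r])
  also have "\<dots> = step (2 * r / r) - step (r / r)"
    by (rule nn_integral_FTC_Icc) (use r in \<open>auto intro!: step_scaled_has_derivative bump_scaled_nonneg\<close>)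
  also have "\<dots> = 1" using r by (simp add: step_left step_right)
  finally show ?thesis .
qed

lemma ex_plateau:
  fixes a :: "'a::euclidean_space"
  assumes "r > 0"
  obtains \<beta> :: "'a \<Rightarrow> real" where "Cinf \<beta>" "\<And>x. 0 \<le> \<beta> x" "\<And>x. \<beta> x \<le> 1"
    "\<And>x. dist a x \<le> r / 2 \<Longrightarrow> \<beta> x = 1" "\<And>x. r \<le> dist a x \<Longrightarrow> \<beta> x = 0"
proof
  \<comment> \<open>The squared distance keeps the cutoff smooth at its centre. The factor 2 / r^2
    sends the half ball below 1 and the outside of the ball above 2, where \<open>step\<close> is
    constant.\<close>
  let ?\<beta> = "\<lambda>x. - step (((x - a) \<bullet> (x - a)) * (2 / r\<^sup>2))"
  show "Cinf ?\<beta>"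
    by (intro Cinf_minus Cinf_compose[OF Cinf_step] Cinf_mult Cinf_inner Cinf_diff Cinf_id Cinf_const)
  show "0 \<le> ?\<beta> x" "?\<beta> x \<le> 1" for x using step_bounds[of "((x - a) \<bullet> (x - a)) * (2 / r\<^sup>2)"] by auto
  have n: "(x - a) \<bullet> (x - a) = (dist a x)\<^sup>2" for x
    by (metis dist_commute dist_norm power2_norm_eq_inner)
  show "?\<beta> x = 1" if "dist a x \<le> r / 2" for x
  proof -
    have "(dist a x)\<^sup>2 \<le> (r / 2)\<^sup>2" using that by (intro power_mono) auto
    moreover have "0 \<le> (dist a x)\<^sup>2" by simp
    moreover have "(r / 2)\<^sup>2 = r\<^sup>2 / 4" by (simp add: power_divide)
    ultimately have "2 * (dist a x)\<^sup>2 \<le> r\<^sup>2" by linarith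
    then have "(dist a x)\<^sup>2 * (2 / r\<^sup>2) \<le> 1" using assms by (simp add: field_simps)
    then show ?thesis by (simp add: n step_left)
  qed
  show "?\<beta> x = 0" if "r \<le> dist a x" for x
  proof -
    have "r\<^sup>2 \<le> (dist a x)\<^sup>2" using that assms by (intro power_mono) auto
    then have "2 \<le> (dist a x)\<^sup>2 * (2 / r\<^sup>2)" using assms by (simp add: field_simps)
    then show ?thesis by (simp add: n step_right)
  qed
qed

text \<open>The kernel is evaluated at y - x, not x - y: a kernel supported on one side averages f
  over points displaced from x to that side. In exchange, derivatives in x carry a minus
  sign.\<close>

definition conv :: "('a::euclidean_space \<Rightarrow> real) \<Rightarrow> ('a \<Rightarrow> 'b::euclidean_space) \<Rightarrow> 'a \<Rightarrow> 'b" where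
  "conv k f x = (\<integral>y. k (y - x) *\<^sub>R f y \<partial>lborel)"

definition loc_integrable :: "('a::euclidean_space \<Rightarrow> 'b::euclidean_space) \<Rightarrow> bool" where
  "loc_integrable f \<longleftrightarrow> (\<forall>r. integrable lborel (\<lambda>x. indicator (cball 0 r) x *\<^sub>R f x))"

lemma integrable_kernel:
  assumes k: "continuous_on UNIV k" "\<And>z. R < norm z \<Longrightarrow> k z = 0" and f: "loc_integrable f"
  shows "integrable lborel (\<lambda>y. k (y - x) *\<^sub>R f y)"
proof -
  have "bounded (k ` cball 0 R)"
    by (intro compact_imp_bounded compact_continuous_image continuous_on_subset[OF k(1)]) auto
  then obtain C where C: "\<And>z. z \<in> cball 0 R \<Longrightarrow> norm (k z) \<le> C" unfolding bounded_iff by blast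
  have [measurable]: "k \<in> borel_measurable borel" by (rule borel_measurable_continuous_onI[OF k(1)])
  let ?f = "\<lambda>y. indicator (cball 0 (R + norm x)) y *\<^sub>R f y"
  have int: "integrable lborel ?f" using f by (simp add: loc_integrable_def)
  then have [measurable]: "?f \<in> borel_measurable lborel" by simp
  have eq: "k (y - x) *\<^sub>R f y = k (y - x) *\<^sub>R ?f y" for y
  proof (cases "R < norm (y - x)")
    case False
    then have "norm y \<le> R + norm x" using norm_triangle_ineq[of "y - x" x] by simp
    then show ?thesis by simp
  qed (simp add: k)
  have C0: "norm (k (y - x)) \<le> max C 0" for y
    using C[of "y - x"] k(2)[of "y - x"] by (cases "R < norm (y - x)") auto
  show ?thesis unfolding eq
  proof (rule Bochner_Integration.integrable_bound)
    show "integrable lborel (\<lambda>y. max C 0 * norm (?f y))"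
      by (intro integrable_mult_right integrable_norm int)
    show "AE y in lborel. norm (k (y - x) *\<^sub>R ?f y) \<le> norm (max C 0 * norm (?f y))"
    proof (intro AE_I2)
      fix y
      have "\<bar>k (y - x)\<bar> * norm (?f y) \<le> max C 0 * norm (?f y)"
        using C0[of y] by (intro mult_right_mono) auto
      then show "norm (k (y - x) *\<^sub>R ?f y) \<le> norm (max C 0 * norm (?f y))"
        by (simp add: mult.assoc abs_mult)
    qed
  qed measurable
qed

lemma grad_kernel_eq_0:
  assumes "\<And>z. R < norm z \<Longrightarrow> k z = 0" "R < norm z" shows "grad k z = 0"
proof (rule grad_eqI)
  have "((\<lambda>z. 0) has_derivative (\<lambda>h. 0 \<bullet> h)) (at z)" by simp
  then show "(k has_derivative (\<lambda>h. 0 \<bullet> h)) (at z)"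
    by (rule has_derivative_transform_within_open[of _ _ _ _ "- cball 0 R"]) (use assms in auto)
qed

text \<open>The point is that d does not depend on z, which permits differentiation under the
  integral sign. The gradient is uniformly continuous on a compact neighbourhood of the support, and
  the mean value inequality is applied to k minus its linearisation at z; far away both terms
  vanish.\<close>

lemma kernel_taylor:
  assumes k: "Cinf k" "\<And>z. R < norm z \<Longrightarrow> k z = 0" and e: "e > 0"
  obtains d where "d > 0" "\<And>z h. norm h < d \<Longrightarrow> \<bar>k (z - h) - k z + grad k z \<bullet> h\<bar> \<le> e * norm h"
proof -
  have "continuous_on (cball 0 (R + 2)) (grad k)"
    using Cinf_continuous[OF Cinf_grad[OF k(1)]] continuous_on_subset by blast
  then have "uniformly_continuous_on (cball 0 (R + 2)) (grad k)"
    by (simp add: compact_uniformly_continuous)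
  then obtain d where d: "d > 0" "\<And>z w. z \<in> cball 0 (R+2) \<Longrightarrow> w \<in> cball 0 (R+2) \<Longrightarrow> dist w z < d
      \<Longrightarrow> dist (grad k w) (grad k z) < e"
    using e unfolding uniformly_continuous_on_def by metis
  show ?thesis
  proof
    show "min d 1 > 0" using d by simp
    fix z h :: "real^3" assume h: "norm h < min d 1"
    show "\<bar>k (z - h) - k z + grad k z \<bullet> h\<bar> \<le> e * norm h"
    proof (cases "norm z > R + 1")
      case True
      then have "R < norm (z - h)" using norm_triangle_ineq2[of z h] h by auto
      then show ?thesis using True k(2) grad_kernel_eq_0[of R k z] e by auto
    next
      case False
      let ?q = "\<lambda>w. k w - grad k z \<bullet> w"
      have "norm (?q (z - h) - ?q z) \<le> e * norm (z - h - z)"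
      proof (rule differentiable_bound[where S="closed_segment z (z - h)" and f'="\<lambda>w v. (grad k w - grad k z) \<bullet> v"])
        fix w assume w: "w \<in> closed_segment z (z - h)"
        show "(?q has_derivative (\<lambda>v. (grad k w - grad k z) \<bullet> v)) (at w within closed_segment z (z - h))"
          by (rule has_derivative_at_withinI)
            (auto intro!: derivative_eq_intros Cinf_has_derivative_grad[OF k(1)] simp: inner_diff_left)
        have "norm (w - z) \<le> norm h"
          using segment_bound1[OF w] by simp
        then have "norm w \<le> R + 2" "dist w z < d"
          using False h norm_triangle_ineq[of "w - z" z] by (auto simp: dist_norm)
        then have "norm (grad k w - grad k z) \<le> e"
          using d(2)[of z w] False by (auto simp: dist_norm)
        then show "onorm (\<lambda>v. (grad k w - grad k z) \<bullet> v) \<le> e"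
          by (intro onorm_bound) (use e in \<open>auto intro!: order_trans[OF Cauchy_Schwarz_ineq2] mult_right_mono\<close>)
      qed auto
      then show ?thesis by (simp add: inner_diff_right algebra_simps)
    qed
  qed
qed

text \<open>The uniform Taylor remainder of the kernel is integrated against f over one fixed ball,
  which gives the remainder of the convolution directly.\<close>

lemma conv_has_derivative:
  fixes f :: "real^3 \<Rightarrow> 'b::euclidean_space"
  assumes k: "Cinf k" "\<And>z. R < norm z \<Longrightarrow> k z = 0" and f: "loc_integrable f"
  shows "(conv k f has_derivative (\<lambda>h. - conv (\<lambda>z. grad k z \<bullet> h) f x)) (at x)"
  unfolding has_derivative_at_alt
proof (intro conjI allI impI)
  have gc: "continuous_on UNIV (\<lambda>z. grad k z \<bullet> h)" for h
    by (intro continuous_on_inner Cinf_continuous[OF Cinf_grad[OF k(1)]] continuous_on_const)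
  have g0: "R < norm z \<Longrightarrow> grad k z \<bullet> h = 0" for z h
    using grad_kernel_eq_0[of R k z, OF k(2)] by auto
  have kint: "integrable lborel (\<lambda>y. k (y - a) *\<^sub>R f y)" for a
    by (rule integrable_kernel[OF Cinf_continuous[OF k(1)] k(2) f])
  have gint: "integrable lborel (\<lambda>y. (grad k (y - a) \<bullet> h) *\<^sub>R f y)" for h a
    by (rule integrable_kernel[OF gc g0 f])
  show "bounded_linear (\<lambda>h. - conv (\<lambda>z. grad k z \<bullet> h) f x)"
    unfolding linear_conv_bounded_linear[symmetric]
  proof (rule linearI)
    fix a b show "- conv (\<lambda>z. grad k z \<bullet> (a + b)) f x = - conv (\<lambda>z. grad k z \<bullet> a) f x + - conv (\<lambda>z. grad k z \<bullet> b) f x"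
      unfolding conv_def using gint
      by (simp add: inner_add_right scaleR_add_left Bochner_Integration.integral_add)
    fix r show "- conv (\<lambda>z. grad k z \<bullet> (r *\<^sub>R a)) f x = r *\<^sub>R - conv (\<lambda>z. grad k z \<bullet> a) f x"
      unfolding conv_def by (simp flip: scaleR_scaleR)
  qed
  fix e :: real assume e: "e > 0"
  \<comment> \<open>This ball contains the supports of all kernels centred within distance 1 of x.
    Dividing e by A + 1 below avoids a case distinction for A = 0.\<close>
  define f1 where "f1 y = indicator (cball 0 (R + norm x + 1)) y *\<^sub>R f y" for y
  have f1: "integrable lborel f1" using f by (simp add: loc_integrable_def f1_def[abs_def])
  define A where "A = (\<integral>y. norm (f1 y) \<partial>lborel)"
  have A: "A \<ge> 0" by (simp add: A_def)
  obtain d where d: "d > 0" "\<And>z h. norm h < d \<Longrightarrow> \<bar>k (z - h) - k z + grad k z \<bullet> h\<bar> \<le> e / (A + 1) * norm h"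
    using kernel_taylor[OF k, where e="e / (A + 1)"] e A by (metis add_pos_nonneg add.commute divide_pos_pos zero_less_one)
  show "\<exists>d>0. \<forall>y. norm (y - x) < d \<longrightarrow>
     norm (conv k f y - conv k f x - - conv (\<lambda>z. grad k z \<bullet> (y - x)) f x) \<le> e * norm (y - x)"
  proof (intro exI[of _ "min d 1"] conjI allI impI)
    show "min d 1 > 0" using d by simp
    fix x' assume x': "norm (x' - x) < min d 1"
    define h where "h = x' - x"
    let ?K = "\<lambda>y. k (y - x - h) - k (y - x) + grad k (y - x) \<bullet> h"
    have "conv k f x' - conv k f x - - conv (\<lambda>z. grad k z \<bullet> h) f x = (\<integral>y. ?K y *\<^sub>R f y \<partial>lborel)"
      unfolding conv_def using kint gint
      by (simp add: scaleR_add_left scaleR_diff_left h_def)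
    also have "norm \<dots> \<le> (\<integral>y. e / (A + 1) * norm h * norm (f1 y) \<partial>lborel)"
    proof (rule Bochner_Integration.integral_norm_bound_integral)
      show "integrable lborel (\<lambda>y. ?K y *\<^sub>R f y)"
        using Bochner_Integration.integrable_add[OF Bochner_Integration.integrable_diff[OF kint[of "x + h"] kint[of x]] gint[of x h]]
        by (simp add: scaleR_add_left scaleR_diff_left diff_diff_eq)
      show "integrable lborel (\<lambda>y. e / (A + 1) * norm h * norm (f1 y))"
        using f1 by simp
      fix y
      show "norm (?K y *\<^sub>R f y) \<le> e / (A + 1) * norm h * norm (f1 y)"
      proof (cases "norm y \<le> R + norm x + 1")
        case True
        then have "f1 y = f y" by (simp add: f1_def)
        moreover have "\<bar>?K y\<bar> \<le> e / (A + 1) * norm h" using d(2)[of h "y - x"] x' by (simp add: h_def)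
        then have "\<bar>?K y\<bar> * norm (f y) \<le> e / (A + 1) * norm h * norm (f y)"
          by (intro mult_right_mono) auto
        ultimately show ?thesis by simp
      next
        case False
        then have 1: "R < norm (y - x)" using norm_triangle_ineq2[of y x] by linarith
        have 2: "R < norm (y - x - h)"
          using False x' norm_triangle_ineq2[of y x] norm_triangle_ineq2[of "y - x" h] unfolding h_def by linarith
        show ?thesis using e A 1 2 k(2) g0 by simp
      qed
    qed
    also have "\<dots> = e / (A + 1) * norm h * A" by (simp add: A_def)
    also have "\<dots> \<le> e * norm h"
    proof -
      have "e / (A + 1) * A \<le> e" using e A by (simp add: field_simps)
      then show ?thesis using mult_right_mono[of "e / (A + 1) * A" e "norm h"] by (simp add: ac_simps)
    qed
    finally show "norm (conv k f x' - conv k f x - - conv (\<lambda>z. grad k z \<bullet> (x' - x)) f x) \<le> e * norm (x' - x)"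
      by (simp add: h_def)
  qed
qed

text \<open>All derivatives fall on the kernel: a partial derivative of a convolution is again one,
  with a partial derivative of k, so the induction runs over all kernels.\<close>

lemma Cinf_conv:
  fixes f :: "real^3 \<Rightarrow> 'b::euclidean_space"
  assumes "Cinf k" "\<And>z. R < norm z \<Longrightarrow> k z = 0" and f: "loc_integrable f"
  shows "Cinf (conv k f)"
  unfolding Cinf_def
proof
  fix n show "Ck n (conv k f)" using assms(1,2)
  proof (induction n arbitrary: k)
    case 0
    have "continuous_on UNIV (conv k f)"
      by (intro continuous_at_imp_continuous_on ballI)
        (rule has_derivative_continuous[OF conv_has_derivative[OF 0 f]])
    then show ?case by simp
  next
    case (Suc n)
    show ?case
    proof (rule Ck_SucI)
      show "(conv k f has_derivative (\<lambda>h. - conv (\<lambda>z. grad k z \<bullet> h) f x)) (at x)" for x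
        by (rule conv_has_derivative[OF Suc.prems f])
      show "Ck n (\<lambda>x. - conv (\<lambda>z. grad k z \<bullet> i) f x)" if "i \<in> Basis" for i
        using grad_kernel_eq_0[of R k, OF Suc.prems(2)]
        by (intro Ck_minus Suc.IH Cinf_inner Cinf_grad Cinf_const Suc.prems(1)) auto
    qed
  qed
qed

section \<open>Lp estimates for convolutions\<close>

text \<open>The p-th power of the norm rather than the norm, with values in \<open>ennreal\<close>:
  no root, no integrability side conditions, and a triangle inequality with factor
  \<open>2 powr p\<close> in place of Minkowski's.\<close>

definition Lpe :: "real \<Rightarrow> 'a measure \<Rightarrow> ('a \<Rightarrow> 'b::real_normed_vector) \<Rightarrow> ennreal" where
  "Lpe p M f = (\<integral>\<^sup>+x. ennreal (norm (f x) powr p) \<partial>M)"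

text \<open>Convexity of the power function in tangent form. For positive m and h it is the weighted
  mean inequality for (h/m)^p and 1 with weights 1/p and 1 - 1/p.\<close>

lemma powr_above_tangent:
  fixes m h p :: real
  assumes "0 \<le> m" "0 \<le> h" "1 \<le> p"
  shows "m powr p + p * m powr (p - 1) * (h - m) \<le> h powr p"
proof (cases "m = 0 \<or> h = 0")
  case True
  have "m powr (p - 1) * m = m powr p" if "m > 0"
    using that by (metis powr_mult_base add.commute diff_add_cancel mult.commute less_imp_le)
  moreover have "m powr p \<le> p * m powr p"
    using assms mult_right_mono[of 1 p "m powr p"] by simp
  ultimately show ?thesis using True assms by (cases "m = 0") (auto simp: algebra_simps)
next
  case False
  then have pos: "m > 0" "h > 0" using assms by auto
  let ?x = "h / m"
  have x: "?x > 0" using pos by simp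
  have "(?x powr p) powr (1 / p) * 1 powr (1 - 1 / p) \<le> (1 / p) * (?x powr p) + (1 - 1 / p) * 1"
    by (rule Youngs_inequality_0) (use assms x in auto)
  then have "?x \<le> (1 / p) * (?x powr p) + (1 - 1 / p)"
    using x assms by (simp add: powr_powr)
  then have "p * ?x \<le> ?x powr p + (p - 1)"
  proof -
    assume *: "?x \<le> (1 / p) * (?x powr p) + (1 - 1 / p)"
    have "p * ?x \<le> p * ((1 / p) * (?x powr p) + (1 - 1 / p))"
      using * assms by (intro mult_left_mono) auto
    also have "\<dots> = ?x powr p + (p - 1)" using assms by (simp add: distrib_left right_diff_distrib)
    finally show ?thesis .
  qed
  then have "m powr p * (1 + p * (?x - 1)) \<le> m powr p * ?x powr p"
    by (intro mult_left_mono) (auto simp: algebra_simps)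
  also have "m powr p * ?x powr p = h powr p"
    using pos by (simp add: powr_divide)
  also have "m powr p * (1 + p * (?x - 1)) = m powr p + p * m powr (p - 1) * (h - m)"
  proof -
    have "m powr p = m powr (p - 1) * m"
      using pos by (metis powr_mult_base add.commute diff_add_cancel mult.commute less_imp_le)
    moreover have "m * (?x - 1) = h - m" using pos by (simp add: field_simps)
    ultimately show ?thesis by (simp add: algebra_simps)
  qed
  finally show ?thesis .
qed

text \<open>Integrate \<open>powr_above_tangent\<close> at the mean m of h: the linear term drops
  out. Total mass A instead of 1 produces the factor A^(p-1).\<close>

lemma jensen_powr:
  fixes h :: "'a \<Rightarrow> real"
  assumes fm: "finite_measure M" and [measurable]: "h \<in> borel_measurable M"
    and h0: "\<And>x. 0 \<le> h x" and p: "1 \<le> p"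
  shows "ennreal ((\<integral>x. h x \<partial>M) powr p)
    \<le> ennreal (measure M (space M) powr (p - 1)) * (\<integral>\<^sup>+x. ennreal (h x powr p) \<partial>M)"
proof (cases "integrable M h \<and> measure M (space M) \<noteq> 0")
  case False
  interpret finite_measure M by fact
  \<comment> \<open>Either M is null or h is not integrable, and in the second case the Bochner
    integral is 0 by convention.\<close>
  have "(\<integral>x. h x \<partial>M) = 0"
  proof (cases "integrable M h")
    case True
    then have "emeasure M (space M) = 0" using False by (simp add: emeasure_eq_measure)
    then have "AE x in M. h x = 0" by (metis AE_iff_null_sets Collect_mem_eq Collect_conj_eq null_setsI sets.top AE_I' subsetI mem_Collect_eq)
    then show ?thesis using integral_cong_AE[of h M "\<lambda>_. 0"] by simp
  qed (rule not_integrable_integral_eq)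
  then show ?thesis using p by simp
next
  case True
  interpret finite_measure M by fact
  define A where "A = measure M (space M)"
  define m where "m = (\<integral>x. h x \<partial>M) / A"
  have A: "A > 0" using True by (simp add: A_def zero_less_measure_iff)
  have I: "(\<integral>x. h x \<partial>M) = A * m" using A by (simp add: m_def)
  have m: "m \<ge> 0" using A by (simp add: m_def h0)
  show ?thesis
  proof (cases "integrable M (\<lambda>x. h x powr p)")
    case int: True
    have "(\<integral>x. m powr p + p * m powr (p - 1) * (h x - m) \<partial>M) \<le> (\<integral>x. h x powr p \<partial>M)"
      by (rule integral_mono) (use True int powr_above_tangent[OF m h0 p] in auto)
    also have "(\<integral>x. m powr p + p * m powr (p - 1) * (h x - m) \<partial>M) = A * m powr p"
      using True I by (simp add: A_def)
    finally have le: "A * m powr p \<le> (\<integral>x. h x powr p \<partial>M)" .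
    have "(A * m) powr p = A powr (p - 1) * (A * m powr p)"
      using A m by (simp add: powr_mult powr_diff)
    also have "\<dots> \<le> A powr (p - 1) * (\<integral>x. h x powr p \<partial>M)"
      using le by (intro mult_left_mono) auto
    finally show ?thesis
      using nn_integral_eq_integral[OF int] by (simp add: I A_def ennreal_mult[symmetric])
  next
    case False
    have "(\<integral>\<^sup>+x. ennreal (h x powr p) \<partial>M) = \<infinity>"
      using False by (subst (asm) integrable_iff_bounded) (simp add: less_top[symmetric])
    then show ?thesis using A by (simp add: A_def ennreal_mult_top)
  qed
qed

text \<open>The kernel is absorbed into the measure as a density. Its mass enters with exponent p -
  1, which is the source of smallness for the thin boundary layer.\<close>

lemma jensen_kernel:
  fixes f :: "'a \<Rightarrow> 'b::{banach, second_countable_topology}"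
  assumes [measurable]: "k \<in> borel_measurable M" "f \<in> borel_measurable M"
    and k0: "\<And>x. 0 \<le> k x" and k: "(\<integral>\<^sup>+x. ennreal (k x) \<partial>M) \<le> ennreal A" "0 \<le> A" and p: "1 \<le> p"
  shows "ennreal (norm (\<integral>x. k x *\<^sub>R f x \<partial>M) powr p)
    \<le> ennreal (A powr (p - 1)) * (\<integral>\<^sup>+x. ennreal (k x) * ennreal (norm (f x) powr p) \<partial>M)"
proof -
  let ?D = "density M (\<lambda>x. ennreal (k x))"
  have emD: "emeasure ?D (space ?D) = (\<integral>\<^sup>+x. ennreal (k x) \<partial>M)"
    by (simp add: emeasure_density cong: nn_integral_cong)
  have fm: "finite_measure ?D"
    by (rule finite_measureI) (use k emD in \<open>auto simp: top_unique\<close>)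
  have mA: "measure ?D (space ?D) \<le> A"
    using k emD unfolding measure_def by (metis enn2real_leI)
  have "norm (\<integral>x. k x *\<^sub>R f x \<partial>M) \<le> (\<integral>x. norm (k x *\<^sub>R f x) \<partial>M)"
    by (rule integral_norm_bound)
  also have "\<dots> = (\<integral>x. norm (f x) \<partial>?D)"
    by (subst integral_density) (use k0 in auto)
  finally have "ennreal (norm (\<integral>x. k x *\<^sub>R f x \<partial>M) powr p) \<le> ennreal ((\<integral>x. norm (f x) \<partial>?D) powr p)"
    using p by (intro ennreal_leI powr_mono2) auto
  also have "\<dots> \<le> ennreal (measure ?D (space ?D) powr (p - 1)) * (\<integral>\<^sup>+x. ennreal (norm (f x) powr p) \<partial>?D)"
    by (rule jensen_powr[OF fm]) (use p in auto)
  also have "\<dots> \<le> ennreal (A powr (p - 1)) * (\<integral>\<^sup>+x. ennreal (norm (f x) powr p) \<partial>?D)"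
    using mA p by (intro mult_right_mono ennreal_leI powr_mono2) auto
  also have "(\<integral>\<^sup>+x. ennreal (norm (f x) powr p) \<partial>?D) = (\<integral>\<^sup>+x. ennreal (k x) * ennreal (norm (f x) powr p) \<partial>M)"
    by (rule nn_integral_density) auto
  finally show ?thesis .
qed

lemma powr_add_le:
  fixes a b p :: real
  assumes "0 \<le> a" "0 \<le> b" "1 \<le> p"
  shows "(a + b) powr p \<le> 2 powr p * (a powr p + b powr p)"
proof -
  have "(a + b) powr p \<le> (2 * max a b) powr p" using assms by (intro powr_mono2) auto
  also have "\<dots> = 2 powr p * max a b powr p" using assms by (simp add: powr_mult)
  also have "\<dots> \<le> 2 powr p * (a powr p + b powr p)"
    by (intro mult_left_mono) (auto simp: max_def)
  finally show ?thesis .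
qed

lemma Lpe_add:
  assumes [measurable]: "f \<in> borel_measurable M" "g \<in> borel_measurable M" and p: "1 \<le> p"
  shows "Lpe p M (\<lambda>x. f x + g x :: 'b::{real_normed_vector, second_countable_topology})
    \<le> ennreal (2 powr p) * (Lpe p M f + Lpe p M g)"
proof -
  have "Lpe p M (\<lambda>x. f x + g x) \<le> (\<integral>\<^sup>+x. ennreal (2 powr p) * (ennreal (norm (f x) powr p) + ennreal (norm (g x) powr p)) \<partial>M)"
    unfolding Lpe_def
  proof (rule nn_integral_mono)
    fix x
    have "norm (f x + g x) powr p \<le> (norm (f x) + norm (g x)) powr p"
      using p by (intro powr_mono2 norm_triangle_ineq) auto
    also have "\<dots> \<le> 2 powr p * (norm (f x) powr p + norm (g x) powr p)"
      using p by (intro powr_add_le) auto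
    finally show "ennreal (norm (f x + g x) powr p)
        \<le> ennreal (2 powr p) * (ennreal (norm (f x) powr p) + ennreal (norm (g x) powr p))"
      by (simp add: ennreal_mult[symmetric] ennreal_plus[symmetric] del: ennreal_plus)
  qed
  also have "\<dots> = ennreal (2 powr p) * (Lpe p M f + Lpe p M g)"
    unfolding Lpe_def by (simp add: nn_integral_cmult nn_integral_add)
  finally show ?thesis .
qed

lemma Lpe_mono: "(\<And>x. x \<in> space M \<Longrightarrow> norm (f x) \<le> norm (g x)) \<Longrightarrow> 0 \<le> p \<Longrightarrow> Lpe p M f \<le> Lpe p M g"
  unfolding Lpe_def by (intro nn_integral_mono ennreal_leI powr_mono2) auto

lemma Lpe_loc_integrable:
  fixes f :: "'a::euclidean_space \<Rightarrow> 'b::euclidean_space"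
  assumes [measurable]: "f \<in> borel_measurable borel" and fin: "Lpe p lborel f < \<infinity>" and p: "1 \<le> p"
  shows "loc_integrable f"
  unfolding loc_integrable_def
proof
  fix r :: real
  have int: "integrable lborel (\<lambda>x. norm (f x) powr p)"
    using fin by (simp add: integrable_iff_bounded Lpe_def)
  have ind: "integrable lborel (\<lambda>x::'a. indicator (cball 0 r) x :: real)"
    using emeasure_lborel_cball_finite[of "0::'a" r] by (auto simp: integrable_indicator_iff)
  show "integrable lborel (\<lambda>x. indicator (cball 0 r) x *\<^sub>R f x)"
  proof (rule Bochner_Integration.integrable_bound[OF Bochner_Integration.integrable_add[OF ind int]])
    \<comment> \<open>On a set of finite measure this elementary bound does the work of Hoelder's
      inequality.\<close>
    have "norm y \<le> 1 + norm y powr p" for y :: 'b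
      using powr_mono[of 1 p "norm y"] p by (cases "norm y \<le> 1") (auto intro: add_increasing2)
    then show "AE x in lborel. norm (indicator (cball 0 r) x *\<^sub>R f x)
        \<le> norm (indicator (cball 0 r) x + norm (f x) powr p)"
      by (intro AE_I2) (auto simp: indicator_def)
    show "(\<lambda>x. indicator (cball 0 r) x *\<^sub>R f x) \<in> borel_measurable lborel"
      using assms(1) by (intro borel_measurable_scaleR borel_measurable_indicator) auto
  qed
qed

text \<open>Tolerances live in \<open>ennreal\<close> and may be infinite, hence the cut at 1. K
  collects the constants that later triangle inequalities cost.\<close>

lemma ex_ennreal_fraction:
  fixes e :: ennreal assumes "e > 0" "K \<ge> 0"
  obtains d :: real where "d > 0" "ennreal (K * d) < e"
proof -
  have "min e 1 > 0" "min e 1 < \<infinity>" using assms by (auto simp: min_less_iff_disj)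
  then obtain q where q: "min e 1 = ennreal q" "q > 0"
    by (cases "min e 1") (auto simp: ennreal_less_zero_iff)
  have "K * (q / (K + 1)) < q" using q assms by (simp add: field_simps)
  then have "ennreal (K * (q / (K + 1))) < ennreal q" using q by (intro ennreal_lessI) auto
  also have "\<dots> \<le> e" unfolding q(1)[symmetric] by simp
  finally show ?thesis using that[of "q / (K + 1)"] q assms by simp
qed

text \<open>Truncate f in size and position, then replace the truncation by continuous functions
  converging to it almost everywhere. Both errors vanish by dominated convergence.\<close>

lemma Lp_density:
  fixes f :: "'a::euclidean_space \<Rightarrow> 'b::euclidean_space"
  assumes [measurable]: "f \<in> borel_measurable borel" and fin: "Lpe p lborel f < \<infinity>" and p: "1 \<le> p"
    and e: "e > 0"
  obtains g R where "continuous_on UNIV g" "\<And>x. R < norm x \<Longrightarrow> g x = 0" "Lpe p lborel (\<lambda>x. f x - g x) < e"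
proof -
  obtain d where d: "d > 0" "ennreal ((2 powr p * 2) * d) < e"
    using ex_ennreal_fraction[OF e, of "2 powr p * 2"] by auto
  define e' where "e' = ennreal d"
  have e': "e' > 0" "ennreal (2 powr p) * (e' + e') < e"
    using d by (simp_all add: e'_def ennreal_mult[symmetric] ennreal_plus[symmetric] ac_simps del: ennreal_plus)
  define c where "c n x = (if norm (f x) \<le> real n \<and> norm x \<le> real n then f x else 0)" for n x
  have [measurable]: "c n \<in> borel_measurable borel" for n unfolding c_def by measurable
  have "(\<lambda>n. Lpe p lborel (\<lambda>x. f x - c n x)) \<longlonglongrightarrow> (\<integral>\<^sup>+x. 0 \<partial>(lborel :: 'a measure))"
    unfolding Lpe_def
  proof (rule nn_integral_dominated_convergence[where w="\<lambda>x. ennreal (norm (f x) powr p)"])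
    show "AE x in lborel. ennreal (norm (f x - c n x) powr p) \<le> ennreal (norm (f x) powr p)" for n
      using p by (intro AE_I2 ennreal_leI powr_mono2) (auto simp: c_def)
    show "(\<integral>\<^sup>+x. ennreal (norm (f x) powr p) \<partial>lborel) < \<infinity>" using fin by (simp add: Lpe_def)
    show "AE x in lborel. (\<lambda>n. ennreal (norm (f x - c n x) powr p)) \<longlonglongrightarrow> 0"
    proof (intro AE_I2)
      fix x
      obtain n0 :: nat where n0: "max (norm (f x)) (norm x) \<le> n0" using real_arch_simple by blast
      have "eventually (\<lambda>n. ennreal (norm (f x - c n x) powr p) = 0) sequentially"
        using eventually_ge_at_top[of n0] by eventually_elim (use n0 p in \<open>auto simp: c_def\<close>)
      then show "(\<lambda>n. ennreal (norm (f x - c n x) powr p)) \<longlonglongrightarrow> 0" by (rule tendsto_eventually)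
    qed
  qed measurable
  then have "eventually (\<lambda>n. Lpe p lborel (\<lambda>x. f x - c n x) < e') sequentially"
    by (rule order_tendstoD) (use e' in auto)
  then obtain n0 where n0: "\<And>n. n \<ge> n0 \<Longrightarrow> Lpe p lborel (\<lambda>x. f x - c n x) < e'"
    by (auto simp: eventually_sequentially)
  define n where "n = Suc n0"
  have cn: "Lpe p lborel (\<lambda>x. f x - c n x) < e'" and n: "real n > 0" using n0[of n] by (auto simp: n_def)
  \<comment> \<open>\<open>measurable_on\<close> yields continuous approximations off a negligible
    set, but with neither a bound nor a common support. Composing with the radial retraction
    \<open>cl\<close> and multiplying by \<beta> restores both without disturbing the limit.\<close>
  have "c n measurable_on UNIV"
    by (rule lebesgue_measurable_imp_measurable_on) (auto intro: measurable_completion)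
  then obtain N g where N: "negligible N" and g: "\<And>i. continuous_on UNIV (g i)"
     and lim: "\<And>x. x \<notin> N \<Longrightarrow> (\<lambda>i. g i x) \<longlonglongrightarrow> c n x"
    unfolding measurable_on_def by auto
  obtain \<beta> :: "'a \<Rightarrow> real" where \<beta>: "Cinf \<beta>" "\<And>x. 0 \<le> \<beta> x" "\<And>x. \<beta> x \<le> 1"
    "\<And>x. dist 0 x \<le> 2 * real n / 2 \<Longrightarrow> \<beta> x = 1" "\<And>x. 2 * real n \<le> dist 0 x \<Longrightarrow> \<beta> x = 0"
    using ex_plateau[of "2 * real n" "0::'a"] n by auto
  define cl :: "'b \<Rightarrow> 'b" where "cl y = (n / max n (norm y)) *\<^sub>R y" for y
  have cl: "continuous_on UNIV cl"
    unfolding cl_def[abs_def] using n by (intro continuous_intros) auto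
  have clid: "cl y = y" if "norm y \<le> n" for y using that n by (simp add: cl_def max_absorb1)
  have cln: "norm (cl y) \<le> n" for y
    using n by (cases "norm y \<le> n") (auto simp: cl_def max_def field_simps)
  define G where "G i x = \<beta> x *\<^sub>R cl (g i x)" for i x
  have contG: "continuous_on UNIV (G i)" for i
    unfolding G_def[abs_def]
    by (intro continuous_on_scaleR Cinf_continuous[OF \<beta>(1)] continuous_on_compose2[OF cl g]) auto
  then have [measurable]: "G i \<in> borel_measurable borel" for i by (rule borel_measurable_continuous_onI)
  have "(\<lambda>i. Lpe p lborel (\<lambda>x. c n x - G i x)) \<longlonglongrightarrow> (\<integral>\<^sup>+x. 0 \<partial>(lborel :: 'a measure))"
    unfolding Lpe_def
  proof (rule nn_integral_dominated_convergence[where w="\<lambda>x. ennreal ((2 * n) powr p) * indicator (cball 0 (2 * n)) x"])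
    show "AE x in lborel. ennreal (norm (c n x - G i x) powr p) \<le> ennreal ((2 * n) powr p) * indicator (cball 0 (2 * n)) x" for i
    proof (intro AE_I2)
      fix x
      show "ennreal (norm (c n x - G i x) powr p) \<le> ennreal ((2 * n) powr p) * indicator (cball 0 (2 * n)) x"
      proof (cases "norm x \<le> 2 * n")
        case True
        have "norm (G i x) \<le> 1 * real n"
          unfolding G_def norm_scaleR using \<beta>(2,3)[of x] cln n by (intro mult_mono) auto
        moreover have "norm (c n x) \<le> n" by (auto simp: c_def)
        ultimately have "norm (c n x - G i x) \<le> 2 * n"
          using norm_triangle_ineq4[of "c n x" "G i x"] by simp
        then show ?thesis using True p by (auto intro!: ennreal_leI powr_mono2)
      next
        case False
        then have "G i x = 0" "c n x = 0" using \<beta>(5)[of x] n by (auto simp: G_def c_def)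
        then show ?thesis using p by simp
      qed
    qed
    show "(\<integral>\<^sup>+x. ennreal ((2 * n) powr p) * indicator (cball 0 (2 * n)) x \<partial>(lborel :: 'a measure)) < \<infinity>"
      using emeasure_lborel_cball_finite[of "0::'a" "2*n"]
      by (simp add: nn_integral_cmult_indicator ennreal_mult_less_top)
    have "AE x in lebesgue. x \<notin> N"
      using N by (simp add: negligible_iff_null_sets AE_not_in)
    then have "AE x in lborel. x \<notin> N"
      by (simp add: AE_completion_iff)
    then show "AE x in lborel. (\<lambda>i. ennreal (norm (c n x - G i x) powr p)) \<longlonglongrightarrow> 0"
    proof eventually_elim
      fix x assume "x \<notin> N"
      have "(\<lambda>i. cl (g i x)) \<longlonglongrightarrow> cl (c n x)"
        using continuous_on_tendsto_compose[OF cl lim[OF \<open>x \<notin> N\<close>]] by simp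
      then have "(\<lambda>i. G i x) \<longlonglongrightarrow> \<beta> x *\<^sub>R cl (c n x)"
        unfolding G_def by (intro tendsto_intros)
      moreover have "\<beta> x *\<^sub>R cl (c n x) = c n x"
        using clid[of "c n x"] \<beta>(4)[of x] by (cases "norm x \<le> n") (auto simp: c_def cl_def)
      ultimately have "(\<lambda>i. G i x) \<longlonglongrightarrow> c n x" by simp
      then have "(\<lambda>i. norm (c n x - G i x) powr p) \<longlonglongrightarrow> norm (c n x - c n x) powr p"
        using p by (intro tendsto_powr2 tendsto_norm tendsto_diff tendsto_const) auto
      then have "(\<lambda>i. ennreal (norm (c n x - G i x) powr p)) \<longlonglongrightarrow> ennreal (norm (c n x - c n x) powr p)"
        by (rule tendsto_ennrealI)
      then show "(\<lambda>i. ennreal (norm (c n x - G i x) powr p)) \<longlonglongrightarrow> 0"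
        using p by simp
    qed
    show "(\<lambda>x. ennreal (norm (c n x - G i x) powr p)) \<in> borel_measurable lborel" for i by measurable
    show "(\<lambda>x::'a. ennreal ((2 * n) powr p) * indicator (cball 0 (2 * n)) x) \<in> borel_measurable lborel"
      by (intro borel_measurable_times_ennreal borel_measurable_indicator) auto
  qed auto
  then have "eventually (\<lambda>i. Lpe p lborel (\<lambda>x. c n x - G i x) < e') sequentially"
    by (rule order_tendstoD) (use e' in auto)
  then obtain i where i: "Lpe p lborel (\<lambda>x. c n x - G i x) < e'" by (auto simp: eventually_sequentially)
  show ?thesis
  proof
    show "continuous_on UNIV (G i)" by (rule contG)
    show "G i x = 0" if "2 * real n < norm x" for x using \<beta>(5)[of x] that by (simp add: G_def)
    have "Lpe p lborel (\<lambda>x. f x - G i x) = Lpe p lborel (\<lambda>x. (f x - c n x) + (c n x - G i x))" by simp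
    also have "\<dots> \<le> ennreal (2 powr p) * (Lpe p lborel (\<lambda>x. f x - c n x) + Lpe p lborel (\<lambda>x. c n x - G i x))"
      by (rule Lpe_add) (use p in auto)
    also have "\<dots> \<le> ennreal (2 powr p) * (e' + e')"
      using cn i by (intro mult_left_mono add_mono) auto
    also have "\<dots> < e" by fact
    finally show "Lpe p lborel (\<lambda>x. f x - G i x) < e" .
  qed
qed

section \<open>Continuity of translations and mollification in Lp\<close>

lemma nn_integral_lborel_translate:
  fixes z :: "'a::euclidean_space"
  assumes [measurable]: "F \<in> borel_measurable borel"
  shows "(\<integral>\<^sup>+x. F (x + z) \<partial>lborel) = (\<integral>\<^sup>+x. F x \<partial>lborel)"
  by (subst (2) lborel_distr_plus[of z, symmetric]) (simp add: nn_integral_distr add.commute)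

lemma integral_lborel_translate:
  fixes z :: "'a::euclidean_space" and F :: "'a \<Rightarrow> 'b::{banach, second_countable_topology}"
  assumes [measurable]: "F \<in> borel_measurable borel"
  shows "(\<integral>x. F (x + z) \<partial>lborel) = (\<integral>x. F x \<partial>lborel)"
  by (subst (2) lborel_distr_plus[of z, symmetric]) (simp add: integral_distr add.commute)

lemma Lpe_translate:
  fixes f :: "'a::euclidean_space \<Rightarrow> 'b::euclidean_space"
  assumes [measurable]: "f \<in> borel_measurable borel"
  shows "Lpe p lborel (\<lambda>x. f (x + z)) = Lpe p lborel f"
  unfolding Lpe_def by (rule nn_integral_lborel_translate) measurable

lemma Lpe_minus_commute: "Lpe p M (\<lambda>x. f x - g x) = Lpe p M (\<lambda>x. g x - f x)"
  unfolding Lpe_def by (simp add: norm_minus_commute)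

text \<open>Uniform continuity settles continuous functions of compact support; density and
  translation invariance of the norm carry this over to f.\<close>

lemma Lp_translation_continuous:
  fixes f :: "'a::euclidean_space \<Rightarrow> 'b::euclidean_space"
  assumes [measurable]: "f \<in> borel_measurable borel" and fin: "Lpe p lborel f < \<infinity>" and p: "1 \<le> p"
    and e: "e > 0"
  obtains r where "r > 0" "\<And>z. norm z < r \<Longrightarrow> Lpe p lborel (\<lambda>x. f (x + z) - f x) < e"
proof -
  define T where "T = (2::real) powr p"
  have T: "T > 0" by (simp add: T_def)
  \<comment> \<open>Three errors added by two nested uses of \<open>Lpe_add\<close> cost T (d + T (d
    + d)) = T (1 + 2 T) d.\<close>
  obtain d where d: "d > 0" "ennreal ((T * (1 + T * 2)) * d) < e"
    using ex_ennreal_fraction[OF e, of "T * (1 + T * 2)"] T by auto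
  obtain g R where g: "continuous_on UNIV g" and gR: "\<And>x. R < norm x \<Longrightarrow> g x = 0"
      and fg: "Lpe p lborel (\<lambda>x. f x - g x) < ennreal d"
    using Lp_density[OF assms(1) fin p, of "ennreal d"] d by auto
  have [measurable]: "g \<in> borel_measurable borel" by (rule borel_measurable_continuous_onI[OF g])
  define V where "V = measure lborel (cball (0::'a) (R + 1))"
  have V: "V \<ge> 0" by (simp add: V_def)
  \<comment> \<open>A function bounded by t on a ball of volume V has p-th power integral at most
    d.\<close>
  define t where "t = (d / (V + 1)) powr (1 / p)"
  have t: "t > 0" "t powr p * V \<le> d" 
  proof -
    have tp: "t powr p = d / (V + 1)" using d V p by (simp add: t_def powr_powr)
    show "t > 0" using d V by (simp add: t_def)
    show "t powr p * V \<le> d" unfolding tp using d V by (simp add: field_simps)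
  qed
  have "uniformly_continuous_on (cball 0 (R + 2)) g"
    using g continuous_on_subset by (intro compact_uniformly_continuous) auto
  then obtain r where r: "r > 0" "\<And>x y. x \<in> cball 0 (R + 2) \<Longrightarrow> y \<in> cball 0 (R + 2) \<Longrightarrow> dist y x < r \<Longrightarrow> dist (g y) (g x) < t"
    using t unfolding uniformly_continuous_on_def by metis
  show ?thesis
  proof
    show "min r 1 > 0" using r by simp
    fix z :: 'a assume z: "norm z < min r 1"
    have "Lpe p lborel (\<lambda>x. g (x + z) - g x) \<le> (\<integral>\<^sup>+x. ennreal (t powr p) * indicator (cball (0::'a) (R + 1)) x \<partial>lborel)"
      unfolding Lpe_def
    proof (rule nn_integral_mono)
      fix x
      show "ennreal (norm (g (x + z) - g x) powr p) \<le> ennreal (t powr p) * indicator (cball 0 (R + 1)) x"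
      proof (cases "norm x \<le> R + 1")
        case True
        then have "x + z \<in> cball 0 (R + 2)" "x \<in> cball 0 (R + 2)"
          using z norm_triangle_ineq[of x z] by auto
        then have "dist (g (x + z)) (g x) < t" using z by (intro r) (auto simp: dist_norm)
        then have "norm (g (x + z) - g x) powr p \<le> t powr p"
          using p by (intro powr_mono2) (auto simp: dist_norm)
        then show ?thesis using True by (auto intro: ennreal_leI)
      next
        case False
        then have "R < norm (x + z)" using z norm_triangle_ineq2[of x "- z"] by auto
        then show ?thesis using False gR p by simp
      qed
    qed
    also have "\<dots> = ennreal (t powr p) * ennreal V"
      using emeasure_lborel_cball_finite[of "0::'a" "R + 1"]
      by (simp add: nn_integral_cmult_indicator V_def emeasure_eq_ennreal_measure)
    also have "\<dots> \<le> ennreal d" using t V by (simp add: ennreal_mult[symmetric] ennreal_leI)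
    finally have gz: "Lpe p lborel (\<lambda>x. g (x + z) - g x) \<le> ennreal d" .
    have fz: "Lpe p lborel (\<lambda>x. f (x + z) - g (x + z)) \<le> ennreal d"
      using Lpe_translate[of "\<lambda>x. f x - g x" p z] fg by simp
    have "Lpe p lborel (\<lambda>x. f (x + z) - f x)
        = Lpe p lborel (\<lambda>x. (f (x + z) - g (x + z)) + ((g (x + z) - g x) + (g x - f x)))" by simp
    also have "\<dots> \<le> ennreal T * (Lpe p lborel (\<lambda>x. f (x + z) - g (x + z))
        + ennreal T * (Lpe p lborel (\<lambda>x. g (x + z) - g x) + Lpe p lborel (\<lambda>x. g x - f x)))"
      unfolding T_def using p
      by (intro order_trans[OF Lpe_add] mult_left_mono add_left_mono) measurable
    also have "\<dots> \<le> ennreal T * (ennreal d + ennreal T * (ennreal d + ennreal d))"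
      using fz gz fg by (intro mult_left_mono add_mono) (auto simp: Lpe_minus_commute[of p lborel g f])
    also have "\<dots> = ennreal ((T * (1 + T * 2)) * d)"
      using d T by (simp add: ennreal_mult[symmetric] ennreal_plus[symmetric] algebra_simps del: ennreal_plus)
    also have "\<dots> < e" by fact
    finally show "Lpe p lborel (\<lambda>x. f (x + z) - f x) < e" .
  qed
qed

text \<open>As k has mass one, the error at x is the k-average of the translation differences f (x +
  z) - f x. Jensen moves the power inside and Tonelli exchanges the integrals.\<close>

lemma Lpe_conv_diff_le:
  fixes f :: "'a::euclidean_space \<Rightarrow> 'b::euclidean_space"
  assumes f [measurable]: "f \<in> borel_measurable borel" and loc: "loc_integrable f" and p: "1 \<le> p"
    and k: "continuous_on UNIV k" "\<And>z. r \<le> norm z \<Longrightarrow> k z = 0" "\<And>z. 0 \<le> k z"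
    and k1: "(\<integral>\<^sup>+z. ennreal (k z) \<partial>lborel) = 1"
    and c: "\<And>z. norm z < r \<Longrightarrow> Lpe p lborel (\<lambda>x. f (x + z) - f x) \<le> c"
  shows "Lpe p lborel (\<lambda>x. conv k f x - f x) \<le> c"
proof -
  have [measurable]: "k \<in> borel_measurable borel" by (rule borel_measurable_continuous_onI[OF k(1)])
  have intk: "integrable lborel k"
    using k1 by (simp add: integrable_iff_bounded k)
  have Ik: "(\<integral>z. k z \<partial>lborel) = 1"
    using k1 nn_integral_eq_integral[OF intk] k by simp
  have pt: "ennreal (norm (conv k f x - f x) powr p)
      \<le> (\<integral>\<^sup>+z. ennreal (k z) * ennreal (norm (f (x + z) - f x) powr p) \<partial>lborel)" for x
  proof -
    have kz: "k z = 0" if "r < norm z" for z using k(2) that by simp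
    have int: "integrable lborel (\<lambda>y. k (y - x) *\<^sub>R f y)"
      by (rule integrable_kernel[OF k(1) kz loc])
    have shift: "(\<integral>z. G (z + x) \<partial>lborel) = (\<integral>y. G y \<partial>lborel)"
      if "G \<in> borel_measurable borel" for G :: "'a \<Rightarrow> 'b"
      by (rule integral_lborel_translate[OF that])
    have intz: "integrable lborel (\<lambda>z. k z *\<^sub>R f (z + x))"
    proof -
      have "integrable (distr lborel borel ((+) x)) (\<lambda>y. k (y - x) *\<^sub>R f y)"
        using int by (simp add: lborel_distr_plus)
      then show ?thesis by (simp add: integrable_distr_eq add.commute)
    qed
    have "conv k f x = (\<integral>z. k z *\<^sub>R f (z + x) \<partial>lborel)"
      unfolding conv_def using shift[of "\<lambda>y. k (y - x) *\<^sub>R f y"] by simp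
    then have "conv k f x - f x = (\<integral>z. k z *\<^sub>R (f (x + z) - f x) \<partial>lborel)"
      using intz intk Ik by (simp add: scaleR_diff_right add.commute)
    then have "ennreal (norm (conv k f x - f x) powr p)
      \<le> ennreal (1 powr (p - 1)) * (\<integral>\<^sup>+z. ennreal (k z) * ennreal (norm (f (x + z) - f x) powr p) \<partial>lborel)"
      using jensen_kernel[of k lborel "\<lambda>z. f (x + z) - f x" 1 p] k k1 p by simp
    then show ?thesis by simp
  qed
  have "Lpe p lborel (\<lambda>x. conv k f x - f x)
      \<le> (\<integral>\<^sup>+x. \<integral>\<^sup>+z. ennreal (k z) * ennreal (norm (f (x + z) - f x) powr p) \<partial>lborel \<partial>lborel)"
    unfolding Lpe_def by (rule nn_integral_mono) (rule pt)
  also have "\<dots> = (\<integral>\<^sup>+z. \<integral>\<^sup>+x. ennreal (k z) * ennreal (norm (f (x + z) - f x) powr p) \<partial>lborel \<partial>lborel)"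
    by (rule lborel_pair.Fubini') measurable
  also have "\<dots> = (\<integral>\<^sup>+z. ennreal (k z) * Lpe p lborel (\<lambda>x. f (x + z) - f x) \<partial>lborel)"
    unfolding Lpe_def by (simp add: nn_integral_cmult)
  also have "\<dots> \<le> (\<integral>\<^sup>+z. ennreal (k z) * c \<partial>lborel)"
  proof (rule nn_integral_mono)
    fix z show "ennreal (k z) * Lpe p lborel (\<lambda>x. f (x + z) - f x) \<le> ennreal (k z) * c"
      using c[of z] k(2)[of z] by (cases "norm z < r") (auto intro: mult_left_mono)
  qed
  also have "\<dots> = c" using k1 by (simp add: nn_integral_multc)
  finally show ?thesis .
qed

text \<open>The radius depends on f and e alone and not on the shape of the kernel. This leaves the
  ratio of the two widths of the anisotropic kernel free.\<close>

lemma conv_Lp_approx: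
  fixes f :: "'a::euclidean_space \<Rightarrow> 'b::euclidean_space"
  assumes f: "f \<in> borel_measurable borel" and fin: "Lpe p lborel f < \<infinity>" and p: "1 \<le> p" and e: "e > 0"
  obtains r where "r > 0" "\<And>k. continuous_on UNIV k \<Longrightarrow> (\<And>z. r \<le> norm z \<Longrightarrow> k z = 0) \<Longrightarrow> (\<And>z. 0 \<le> k z) \<Longrightarrow>
    (\<integral>\<^sup>+z. ennreal (k z) \<partial>lborel) = 1 \<Longrightarrow> Lpe p lborel (\<lambda>x. conv k f x - f x) \<le> e"
proof -
  obtain r where r: "r > 0" "\<And>z. norm z < r \<Longrightarrow> Lpe p lborel (\<lambda>x. f (x + z) - f x) < e"
    using Lp_translation_continuous[OF f fin p e] by blast
  show ?thesis
    using that[OF r(1)] Lpe_conv_diff_le[OF f Lpe_loc_integrable[OF f fin p] p] r(2) less_imp_le by blast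
qed

section \<open>Hausdorff measure\<close>

text \<open>The volume of an s-dimensional ball with the diameter of C; the fraction is the volume
  of the unit ball.\<close>

definition hgauge :: "real \<Rightarrow> 'a::metric_space set \<Rightarrow> ennreal" where
  "hgauge s C = ennreal (pi powr (s/2) / Gamma (s/2 + 1) * (diameter C / 2) powr s)"

lemma hgauge_empty [simp]: "hgauge s {} = 0"
  by (simp add: hgauge_def)

lemma hausdorff_delta_le:
  assumes "A \<subseteq> (\<Union>i. C i)" "\<And>i. bounded (C i)" "\<And>i. diameter (C i) \<le> \<delta>"
  shows "hausdorff_delta s \<delta> A \<le> (\<Sum>i. hgauge s (C i))"
  unfolding hausdorff_delta_def hgauge_def by (rule INF_lower) (use assms in auto)

lemma hausdorff_delta_mono: "A \<subseteq> B \<Longrightarrow> hausdorff_delta s \<delta> A \<le> hausdorff_delta s \<delta> B"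
  unfolding hausdorff_delta_def by (rule INF_superset_mono) auto

lemma hausdorff_delta_antimono: "\<delta> \<le> \<delta>' \<Longrightarrow> hausdorff_delta s \<delta>' A \<le> hausdorff_delta s \<delta> A"
  unfolding hausdorff_delta_def by (rule INF_superset_mono) (auto intro: order_trans)

lemma hausdorff_delta_cover:
  assumes "hausdorff_delta s \<delta> A < x"
  obtains C where "A \<subseteq> (\<Union>i. C i)" "\<And>i. bounded (C i)" "\<And>i. diameter (C i) \<le> \<delta>"
    "(\<Sum>i. hgauge s (C i)) < x"
  using assms unfolding hausdorff_delta_def INF_less_iff hgauge_def[symmetric] by blast

text \<open>Covers of the \<open>A i\<close> that are optimal up to e / 2^(i+1) are merged into one
  sequence by the pairing of natural numbers.\<close>

lemma hausdorff_delta_subadditive: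
  assumes "0 \<le> \<delta>"
  shows "hausdorff_delta s \<delta> (\<Union>i::nat. A i) \<le> (\<Sum>i. hausdorff_delta s \<delta> (A i))"
proof (rule ennreal_le_epsilon)
  fix e :: real
  assume fin: "(\<Sum>i. hausdorff_delta s \<delta> (A i)) < top" and e: "0 < e"
  have "\<exists>C. A i \<subseteq> (\<Union>j. C j) \<and> (\<forall>j. bounded (C j)) \<and> (\<forall>j. diameter (C j) \<le> \<delta>) \<and>
      (\<Sum>j. hgauge s (C j)) \<le> hausdorff_delta s \<delta> (A i) + ennreal (e * (1/2) ^ Suc i)" for i
  proof -
    have "hausdorff_delta s \<delta> (A i) \<noteq> top"
      using fin ennreal_suminf_lessD[of "\<lambda>i. hausdorff_delta s \<delta> (A i)" top i] by (auto simp: less_top)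
    then have "hausdorff_delta s \<delta> (A i) < hausdorff_delta s \<delta> (A i) + ennreal (e * (1/2) ^ Suc i)"
      using e by (cases "hausdorff_delta s \<delta> (A i)") (auto simp flip: ennreal_plus intro!: ennreal_lessI add_nonneg_pos)
    from hausdorff_delta_cover[OF this] show ?thesis by (metis order.strict_implies_order)
  qed
  then obtain C where C: "\<And>i. A i \<subseteq> (\<Union>j. C i j)" "\<And>i j. bounded (C i j)" "\<And>i j. diameter (C i j) \<le> \<delta>"
      "\<And>i. (\<Sum>j. hgauge s (C i j)) \<le> hausdorff_delta s \<delta> (A i) + ennreal (e * (1/2) ^ Suc i)"
    by metis
  let ?D = "\<lambda>k. case prod_decode k of (i, j) \<Rightarrow> C i j"
  have "hausdorff_delta s \<delta> (\<Union>i. A i) \<le> (\<Sum>k. hgauge s (?D k))"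
  proof (rule hausdorff_delta_le)
    show "(\<Union>i. A i) \<subseteq> (\<Union>k. ?D k)"
    proof
      fix x assume "x \<in> (\<Union>i. A i)"
      then obtain i j where "x \<in> C i j" using C(1) by blast
      then have "x \<in> ?D (prod_encode (i, j))" by simp
      then show "x \<in> (\<Union>k. ?D k)" by (rule UN_I[OF UNIV_I])
    qed
  qed (use C in \<open>auto split: prod.split\<close>)
  also have "\<dots> = (\<Sum>k. (\<lambda>(i, j). hgauge s (C i j)) (prod_decode k))"
    by (simp add: case_prod_beta)
  also have "\<dots> = (\<Sum>i. \<Sum>j. hgauge s (C i j))"
    by (rule suminf_ennreal_2dimen) simp
  also have "\<dots> \<le> (\<Sum>i. hausdorff_delta s \<delta> (A i) + ennreal (e * (1/2) ^ Suc i))"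
    by (intro suminf_le C(4) summableI)
  also have "\<dots> = (\<Sum>i. hausdorff_delta s \<delta> (A i)) + (\<Sum>i. ennreal (e * (1/2) ^ Suc i))"
    by (rule suminf_add[symmetric]) (auto intro: summableI)
  also have "(\<Sum>i. ennreal (e * (1/2) ^ Suc i)) = ennreal e"
    using sums_mult[OF power_half_series, of e] e by (intro suminf_ennreal_eq) auto
  finally show "hausdorff_delta s \<delta> (\<Union>i. A i) \<le> (\<Sum>i. hausdorff_delta s \<delta> (A i)) + ennreal e" .
qed

lemma hausdorff_delta_empty: "0 \<le> \<delta> \<Longrightarrow> hausdorff_delta s \<delta> {} = 0"
  using hausdorff_delta_le[of "{}" "\<lambda>_. {}" \<delta> s] by simp

lemma hausdorff_delta_Un:
  assumes "0 \<le> \<delta>"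
  shows "hausdorff_delta s \<delta> (A \<union> B) \<le> hausdorff_delta s \<delta> A + hausdorff_delta s \<delta> B"
proof -
  let ?F = "\<lambda>i::nat. if i = 0 then A else if i = 1 then B else {}"
  have "A \<union> B = (\<Union>i. ?F i)" by (auto split: if_splits)
  then have "hausdorff_delta s \<delta> (A \<union> B) \<le> (\<Sum>i. hausdorff_delta s \<delta> (?F i))"
    using hausdorff_delta_subadditive[OF assms, of s ?F] by simp
  also have "\<dots> = (\<Sum>i<2. hausdorff_delta s \<delta> (?F i))"
    by (rule suminf_finite) (auto simp: hausdorff_delta_empty assms)
  also have "\<dots> = hausdorff_delta s \<delta> A + hausdorff_delta s \<delta> B" by (simp add: numeral_2_eq_2)
  finally show ?thesis .
qed

section \<open>The Hausdorff outer measure and measurability of Borel sets\<close>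

lemma hausdorff_delta_le_outer: "0 < \<delta> \<Longrightarrow> hausdorff_delta s \<delta> A \<le> hausdorff_outer s A"
  unfolding hausdorff_outer_def by (rule SUP_upper) auto

lemma hausdorff_outer_leI: "(\<And>\<delta>. 0 < \<delta> \<Longrightarrow> hausdorff_delta s \<delta> A \<le> x) \<Longrightarrow> hausdorff_outer s A \<le> x"
  unfolding hausdorff_outer_def by (rule SUP_least) auto

lemma hausdorff_outer_empty [simp]: "hausdorff_outer s {} = 0"
  using hausdorff_outer_leI[of s "{}" 0] by (simp add: hausdorff_delta_empty)

lemma hausdorff_outer_mono: "A \<subseteq> B \<Longrightarrow> hausdorff_outer s A \<le> hausdorff_outer s B"
  by (meson hausdorff_outer_leI hausdorff_delta_mono hausdorff_delta_le_outer order_trans)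

lemma hausdorff_outer_subadditive:
  "hausdorff_outer s (\<Union>i::nat. A i) \<le> (\<Sum>i. hausdorff_outer s (A i))"
proof (rule hausdorff_outer_leI)
  fix \<delta> :: real assume d: "0 < \<delta>"
  have "hausdorff_delta s \<delta> (\<Union>i. A i) \<le> (\<Sum>i. hausdorff_delta s \<delta> (A i))"
    using d by (intro hausdorff_delta_subadditive) auto
  also have "\<dots> \<le> (\<Sum>i. hausdorff_outer s (A i))"
    by (intro suminf_le hausdorff_delta_le_outer d summableI)
  finally show "hausdorff_delta s \<delta> (\<Union>i. A i) \<le> (\<Sum>i. hausdorff_outer s (A i))" .
qed

lemma hausdorff_outer_Un: "hausdorff_outer s (A \<union> B) \<le> hausdorff_outer s A + hausdorff_outer s B"
proof (rule hausdorff_outer_leI)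
  fix \<delta> :: real assume d: "0 < \<delta>"
  then show "hausdorff_delta s \<delta> (A \<union> B) \<le> hausdorff_outer s A + hausdorff_outer s B"
    by (intro order_trans[OF hausdorff_delta_Un] add_mono hausdorff_delta_le_outer) auto
qed

text \<open>At scales below d no covering set meets both A and B, so a cover of the union splits
  into a cover of A and a cover of B.\<close>

lemma hausdorff_outer_separated:
  assumes d: "0 < d" and sep: "\<And>x y. x \<in> A \<Longrightarrow> y \<in> B \<Longrightarrow> d \<le> dist x y"
  shows "hausdorff_outer s A + hausdorff_outer s B \<le> hausdorff_outer s (A \<union> B)"
proof -
  have delta: "hausdorff_delta s \<delta> A + hausdorff_delta s \<delta> B \<le> hausdorff_delta s \<delta> (A \<union> B)"
    if \<delta>: "0 < \<delta>" "\<delta> < d" for \<delta>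
  proof (rule ccontr)
    assume "\<not> ?thesis"
    then obtain C where C: "A \<union> B \<subseteq> (\<Union>i. C i)" "\<And>i. bounded (C i)" "\<And>i. diameter (C i) \<le> \<delta>"
        and lt: "(\<Sum>i. hgauge s (C i)) < hausdorff_delta s \<delta> A + hausdorff_delta s \<delta> B"
      by (metis not_le hausdorff_delta_cover)
    define CA where "CA i = (if C i \<inter> A = {} then {} else C i)" for i
    define CB where "CB i = (if C i \<inter> B = {} then {} else C i)" for i
    have "hausdorff_delta s \<delta> A \<le> (\<Sum>i. hgauge s (CA i))"
      by (rule hausdorff_delta_le) (use C \<delta> in \<open>fastforce simp: CA_def\<close>)+
    moreover have "hausdorff_delta s \<delta> B \<le> (\<Sum>i. hgauge s (CB i))"
      by (rule hausdorff_delta_le) (use C \<delta> in \<open>fastforce simp: CB_def\<close>)+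
    ultimately have "hausdorff_delta s \<delta> A + hausdorff_delta s \<delta> B \<le> (\<Sum>i. hgauge s (CA i)) + (\<Sum>i. hgauge s (CB i))"
      by (rule add_mono)
    also have "\<dots> = (\<Sum>i. hgauge s (CA i) + hgauge s (CB i))"
      by (rule suminf_add) (auto intro: summableI)
    also have "\<dots> \<le> (\<Sum>i. hgauge s (C i))"
    proof (intro suminf_le summableI)
      fix i
      have "C i \<inter> A = {} \<or> C i \<inter> B = {}"
      proof (rule ccontr)
        assume "\<not> ?thesis"
        then obtain x y where "x \<in> C i" "x \<in> A" "y \<in> C i" "y \<in> B" by blast
        then show False using sep[of x y] diameter_bounded_bound[OF C(2), of x i y] C(3)[of i] \<delta> by force
      qed
      then show "hgauge s (CA i) + hgauge s (CB i) \<le> hgauge s (C i)"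
        by (auto simp: CA_def CB_def)
    qed
    finally show False using lt by simp
  qed
  \<comment> \<open>The supremum over all scales is taken along the monotone sequence 1/(n+1), for
    which the sum of suprema is the supremum of sums.\<close>
  let ?f = "\<lambda>X n. hausdorff_delta s (1 / real (Suc n)) X"
  have sup: "hausdorff_outer s X = (SUP n. ?f X n)" for X :: "'a set"
  proof (rule antisym)
    show "(SUP n. ?f X n) \<le> hausdorff_outer s X"
      by (intro SUP_least hausdorff_delta_le_outer) auto
    show "hausdorff_outer s X \<le> (SUP n. ?f X n)"
    proof (rule hausdorff_outer_leI)
      fix \<delta> :: real assume "0 < \<delta>"
      then obtain n where "1 / real (Suc n) < \<delta>" by (metis nat_approx_posE)
      then have "hausdorff_delta s \<delta> X \<le> ?f X n" by (intro hausdorff_delta_antimono) auto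
      also have "\<dots> \<le> (SUP n. ?f X n)" by (rule SUP_upper) auto
      finally show "hausdorff_delta s \<delta> X \<le> (SUP n. ?f X n)" .
    qed
  qed
  have inc: "incseq (?f X)" for X :: "'a set"
    by (auto simp: incseq_def intro!: hausdorff_delta_antimono divide_left_mono)
  have "hausdorff_outer s A + hausdorff_outer s B = (SUP n. ?f A n + ?f B n)"
    unfolding sup by (rule ennreal_SUP_add[OF inc inc, symmetric])
  also have "\<dots> \<le> hausdorff_outer s (A \<union> B)"
  proof (rule SUP_least)
    fix n
    define \<delta> where "\<delta> = min (1 / real (Suc n)) (d / 2)"
    have "?f A n + ?f B n \<le> hausdorff_delta s \<delta> A + hausdorff_delta s \<delta> B"
      by (intro add_mono hausdorff_delta_antimono) (auto simp: \<delta>_def)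
    also have "\<dots> \<le> hausdorff_delta s \<delta> (A \<union> B)" by (rule delta) (use d in \<open>auto simp: \<delta>_def\<close>)
    also have "\<dots> \<le> hausdorff_outer s (A \<union> B)"
      by (rule hausdorff_delta_le_outer) (use d in \<open>auto simp: \<delta>_def\<close>)
    finally show "?f A n + ?f B n \<le> hausdorff_outer s (A \<union> B)" .
  qed
  finally show ?thesis .
qed

lemma hausdorff_outer_separated_family:
  assumes "\<And>i j x y. i < j \<Longrightarrow> x \<in> R i \<Longrightarrow> y \<in> R j \<Longrightarrow> d i \<le> dist x y" "\<And>i::nat. 0 < d i"
    and fin: "\<And>m. \<exists>e>0. \<forall>i<m. e \<le> d i"
  shows "(\<Sum>i<m. hausdorff_outer s (R i)) \<le> hausdorff_outer s (\<Union>i<m. R i)"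
proof (induction m)
  case (Suc m)
  obtain e where e: "e > 0" "\<forall>i<m. e \<le> d i" using fin by blast
  have "(\<Sum>i<Suc m. hausdorff_outer s (R i)) \<le> hausdorff_outer s (\<Union>i<m. R i) + hausdorff_outer s (R m)"
    using Suc by (simp add: add_right_mono)
  also have "\<dots> \<le> hausdorff_outer s ((\<Union>i<m. R i) \<union> R m)"
  proof (rule hausdorff_outer_separated[OF e(1)])
    fix x y assume "x \<in> (\<Union>i<m. R i)" "y \<in> R m"
    then obtain i where "i < m" "x \<in> R i" by blast
    then show "e \<le> dist x y" using assms(1)[of i m x y] e \<open>y \<in> R m\<close> by force
  qed
  also have "(\<Union>i<m. R i) \<union> R m = (\<Union>i<Suc m. R i)" by (auto simp: less_Suc_eq)
  finally show ?case .
qed simp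

text \<open>Caratheodory's argument for metric outer measures. The part of T at distance at least
  1/(n+1) from C is separated from C; what lies closer splits into shells \<open>R k\<close> whose
  measures form a convergent series, so the remainder is a tail that tends to 0.\<close>

lemma hausdorff_outer_closed_measurable:
  fixes C :: "'a::metric_space set"
  assumes C: "closed C"
  shows "hausdorff_outer s (C \<inter> T) + hausdorff_outer s (T - C) \<le> hausdorff_outer s T"
proof (cases "C = {} \<or> hausdorff_outer s T = top")
  case False
  define R where "R k = {x\<in>T. 1 / real (k + 2) \<le> infdist x C \<and> infdist x C < 1 / real (k + 1)}" for k
  define I where "I n = {x\<in>T. 1 / real (n + 1) \<le> infdist x C}" for n
  let ?H = "hausdorff_outer s"
  have gap: "1 / real (k + 2) - 1 / real (k + 3) \<le> dist x y"
    if "x \<in> R k" "y \<in> R j" "k + 2 \<le> j" for x y k j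
  proof -
    have "infdist x C \<le> infdist y C + dist x y" by (rule infdist_triangle)
    moreover have "infdist y C < 1 / real (j + 1)" "1 / real (k + 2) \<le> infdist x C"
      using that by (auto simp: R_def)
    moreover have "1 / real (j + 1) \<le> 1 / real (k + 3)" using that by (intro divide_left_mono) auto
    ultimately show ?thesis by linarith
  qed
  \<comment> \<open>Neighbouring shells touch, but shells two steps apart are separated; b selects
    the parity.\<close>
  have sub: "(\<Sum>i<m. ?H (R (2 * i + b))) \<le> ?H T" for m b
  proof -
    have "(\<Sum>i<m. ?H (R (2 * i + b))) \<le> ?H (\<Union>i<m. R (2 * i + b))"
    proof (rule hausdorff_outer_separated_family[where d="\<lambda>i. 1 / real (2 * i + b + 2) - 1 / real (2 * i + b + 3)"])
      fix i j x y assume "i < j" "x \<in> R (2 * i + b)" "y \<in> R (2 * j + b)"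
      then show "1 / real (2 * i + b + 2) - 1 / real (2 * i + b + 3) \<le> dist x y" by (intro gap) auto
    next
      show pos: "0 < 1 / real (2 * i + b + 2) - 1 / real (2 * i + b + 3)" for i
      proof -
        have "1 / real (2 * i + b + 3) < 1 / real (2 * i + b + 2)" by (rule divide_strict_left_mono) auto
        then show ?thesis by simp
      qed
      fix m :: nat
      show "\<exists>e>0. \<forall>i<m. e \<le> 1 / real (2 * i + b + 2) - 1 / real (2 * i + b + 3)"
      proof (cases "m = 0")
        case False
        let ?S = "(\<lambda>i. 1 / real (2 * i + b + 2) - 1 / real (2 * i + b + 3)) ` {..<m}"
        have "0 < Min ?S" using False pos by (subst Min_gr_iff) auto
        then show ?thesis by (intro exI[of _ "Min ?S"]) auto
      qed (auto intro: exI[of _ 1])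
    qed
    also have "\<dots> \<le> ?H T" by (rule hausdorff_outer_mono) (auto simp: R_def)
    finally show ?thesis .
  qed
  have "(\<Sum>k. ?H (R k)) \<le> ?H T + ?H T"
  proof (rule suminf_le_const)
    show "summable (\<lambda>k. ?H (R k))" by (rule summableI)
    fix m
    have "(\<Sum>k<m. ?H (R k)) \<le> (\<Sum>k<2 * m. ?H (R k))" by (rule sum_mono2) auto
    also have "\<dots> = (\<Sum>i<m. ?H (R (2 * i + 0))) + (\<Sum>i<m. ?H (R (2 * i + 1)))"
      by (induction m) (auto simp: ac_simps)
    also have "\<dots> \<le> ?H T + ?H T" by (intro add_mono sub)
    finally show "(\<Sum>k<m. ?H (R k)) \<le> ?H T + ?H T" .
  qed
  then have fin: "(\<Sum>k. ?H (R k)) \<noteq> top" using False by (auto simp: top_unique)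
  then have "?H (R k) \<noteq> top" for k
    using ennreal_suminf_lessD[of "\<lambda>k. ?H (R k)" top k] by (auto simp: less_top)
  then have fink: "?H (R k) < top" for k by (simp add: less_top)
  define q where "q k = enn2real (?H (R k))" for k
  have q: "?H (R k) = ennreal (q k)" "0 \<le> q k" for k
    using fink[of k] by (simp_all add: q_def)
  have summ: "summable q" by (rule summable_suminf_not_top) (use q fin in auto)
  have sep: "?H (C \<inter> T) + ?H (I n) \<le> ?H T" for n
  proof -
    have "?H (C \<inter> T) + ?H (I n) \<le> ?H ((C \<inter> T) \<union> I n)"
    proof (rule hausdorff_outer_separated[where d="1 / real (n + 1)"])
      fix x y assume "x \<in> C \<inter> T" "y \<in> I n"
      then show "1 / real (n + 1) \<le> dist x y"
        using infdist_le[of x C y] by (auto simp: I_def dist_commute)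
    qed auto
    also have "\<dots> \<le> ?H T" by (rule hausdorff_outer_mono) (auto simp: I_def)
    finally show ?thesis .
  qed
  show ?thesis
  proof (rule ennreal_le_epsilon)
    fix e :: real assume e: "0 < e"
    obtain n where n: "norm (\<Sum>i. q (i + n)) < e" using suminf_exist_split[OF e summ] by blast
    have "T - C \<subseteq> I n \<union> (\<Union>i. R (i + n))"
    proof
      fix x assume x: "x \<in> T - C"
      then have pos: "0 < infdist x C"
        using infdist_pos_not_in_closed[OF C, of x] False by auto
      show "x \<in> I n \<union> (\<Union>i. R (i + n))"
      proof (cases "1 / real (n + 1) \<le> infdist x C")
        case True then show ?thesis using x by (simp add: I_def)
      next
        case False
        \<comment> \<open>The shell of x: the first index whose inner radius does not exceed the
          distance of x from C.\<close>
        define k where "k = (LEAST k. 1 / real (k + 2) \<le> infdist x C)"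
        obtain k0 where "1 / real (Suc k0) < infdist x C" using pos by (metis nat_approx_posE)
        moreover have "1 / real (k0 + 2) \<le> 1 / real (Suc k0)" by (intro divide_left_mono) auto
        ultimately have ex: "1 / real (k0 + 2) \<le> infdist x C" by linarith
        have k1: "1 / real (k + 2) \<le> infdist x C" 
          using LeastI[of "\<lambda>k. 1 / real (k + 2) \<le> infdist x C" k0] ex by (simp only: k_def)
        have k2: "infdist x C < 1 / real (k + 1)"
        proof (cases k)
          case 0
          have "1 / real (n + 1) \<le> 1" by simp
          then have "infdist x C < 1" using False by linarith
          then show ?thesis using 0 by simp
        next
          case (Suc j)
          then have "\<not> 1 / real (j + 2) \<le> infdist x C"
            using not_less_Least[of j "\<lambda>k. 1 / real (k + 2) \<le> infdist x C"] by (simp add: k_def)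
          then show ?thesis using Suc by simp
        qed
        have "n \<le> k"
        proof (rule ccontr)
          assume "\<not> n \<le> k"
          then have "1 / real (n + 1) \<le> 1 / real (k + 2)" by (intro divide_left_mono) auto
          then show False using k1 False by linarith
        qed
        then have "x \<in> R ((k - n) + n)" using x k1 k2 by (simp add: R_def)
        then show ?thesis by blast
      qed
    qed
    then have "?H (T - C) \<le> ?H (I n) + ?H (\<Union>i. R (i + n))"
      by (intro order_trans[OF hausdorff_outer_mono hausdorff_outer_Un])
    also have "?H (\<Union>i. R (i + n)) \<le> (\<Sum>i. ?H (R (i + n)))" by (rule hausdorff_outer_subadditive)
    also have "(\<Sum>i. ?H (R (i + n))) = ennreal (\<Sum>i. q (i + n))"
      unfolding q by (rule suminf_ennreal2) (use q summ in \<open>auto simp: summable_iff_shift\<close>)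
    also have "\<dots> \<le> ennreal e" using n by (intro ennreal_leI) auto
    finally have "?H (T - C) \<le> ?H (I n) + ennreal e" by (simp add: add_left_mono)
    then have "?H (C \<inter> T) + ?H (T - C) \<le> ?H (C \<inter> T) + ?H (I n) + ennreal e"
      by (simp add: add_left_mono add.assoc)
    also have "\<dots> \<le> ?H T + ennreal e" by (intro add_right_mono sep)
    finally show "?H (C \<inter> T) + ?H (T - C) \<le> ?H T + ennreal e" .
  qed
qed auto

text \<open>\<open>measure_of\<close> falls back to the zero measure when its argument is not a
  measure on the generated sigma algebra; this rules the fallback out for
  \<open>hausdorff_measure\<close>. The Caratheodory sets form a sigma algebra that contains the
  closed sets.\<close>

lemma hausdorff_outer_measure_space:
  "measure_space UNIV (sets borel) (hausdorff_outer s :: 'a::metric_space set \<Rightarrow> ennreal)"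
proof -
  let ?H = "hausdorff_outer s :: 'a set \<Rightarrow> ennreal"
  interpret P: sigma_algebra UNIV "Pow UNIV :: 'a set set" by (rule sigma_algebra_Pow)
  have oms: "outer_measure_space (Pow UNIV) ?H"
    unfolding outer_measure_space_def positive_def increasing_def countably_subadditive_def
    by (auto intro: hausdorff_outer_mono hausdorff_outer_subadditive)
  let ?L = "lambda_system UNIV (Pow UNIV) ?H"
  have ms: "measure_space UNIV ?L ?H" by (rule P.caratheodory_lemma[OF oms])
  then interpret L: sigma_algebra UNIV ?L by (simp add: measure_space_def)
  have closed: "C \<in> ?L" if "closed C" for C
  proof -
    have "?H (C \<inter> T) + ?H ((UNIV - C) \<inter> T) = ?H T" for T
    proof (rule antisym)
      have eq: "(UNIV - C) \<inter> T = T - C" by auto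
      show "?H (C \<inter> T) + ?H ((UNIV - C) \<inter> T) \<le> ?H T"
        unfolding eq by (rule hausdorff_outer_closed_measurable[OF that])
      have "?H ((C \<inter> T) \<union> ((UNIV - C) \<inter> T)) \<le> ?H (C \<inter> T) + ?H ((UNIV - C) \<inter> T)"
        by (rule hausdorff_outer_Un)
      moreover have "(C \<inter> T) \<union> ((UNIV - C) \<inter> T) = T" by auto
      ultimately show "?H T \<le> ?H (C \<inter> T) + ?H ((UNIV - C) \<inter> T)" by simp
    qed
    then show ?thesis by (simp add: lambda_system_def)
  qed
  have "{S. open S} \<subseteq> ?L"
  proof safe
    fix S :: "'a set" assume "open S"
    then have "UNIV - (UNIV - S) \<in> ?L" by (intro L.compl_sets closed) (simp add: closed_def double_diff Diff_Diff_Int)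
    then show "S \<in> ?L" by (simp add: Diff_Diff_Int)
  qed
  then have "sigma_sets UNIV {S. open S} \<subseteq> ?L" by (rule L.sigma_sets_subset)
  then have "sets borel \<subseteq> ?L" by (simp add: borel_def)
  then show ?thesis
    by (intro measure_down[OF ms]) (use sets.sigma_algebra_axioms[of borel] in auto)
qed

section \<open>The measure on Borel sets and its behaviour under Lipschitz maps\<close>

lemma sets_hausdorff_measure [simp, measurable_cong]: "sets (hausdorff_measure s) = sets borel"
  unfolding hausdorff_measure_def
  using sets.sigma_sets_eq[of borel] by simp

lemma space_hausdorff_measure [simp]: "space (hausdorff_measure s) = UNIV"
  using sets_eq_imp_space_eq[OF sets_hausdorff_measure] by simp

lemma emeasure_hausdorff_measure:
  "A \<in> sets borel \<Longrightarrow> emeasure (hausdorff_measure s) A = hausdorff_outer s A"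
  unfolding hausdorff_measure_def
  using hausdorff_outer_measure_space[of s] sets.sigma_algebra_axioms[of borel]
  by (intro emeasure_measure_of_sigma) (auto simp: measure_space_def)

text \<open>A cover of A at scale \<delta> / L is carried to a cover of the image at scale \<delta>.
  The covering sets are cut with A first, as the Lipschitz bound holds only there.\<close>

lemma hausdorff_outer_lipschitz:
  fixes f :: "'a::metric_space \<Rightarrow> 'b::metric_space"
  assumes L: "0 < L" and s: "0 \<le> s"
    and lip: "\<And>x y. x \<in> A \<Longrightarrow> y \<in> A \<Longrightarrow> dist (f x) (f y) \<le> L * dist x y"
  shows "hausdorff_outer s (f ` A) \<le> ennreal (L powr s) * hausdorff_outer s A"
proof (rule hausdorff_outer_leI)
  fix \<delta> :: real assume \<delta>: "0 < \<delta>"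
  let ?c = "pi powr (s/2) / Gamma (s/2 + 1)"
  have c: "0 \<le> ?c" using s by (auto intro!: divide_nonneg_pos Gamma_real_pos)
  have "hausdorff_delta s \<delta> (f ` A) \<le> ennreal (L powr s) * hausdorff_delta s (\<delta> / L) A"
  proof (rule ccontr)
    assume neg: "\<not> ?thesis"
    have inv: "ennreal (L powr - s) * (ennreal (L powr s) * x) = x"
      "ennreal (L powr s) * (ennreal (L powr - s) * x) = x" for x
      using L by (simp_all add: mult.assoc[symmetric] ennreal_mult[symmetric] powr_add[symmetric])
    have "ennreal (L powr - s) * (ennreal (L powr s) * hausdorff_delta s (\<delta> / L) A)
        < ennreal (L powr - s) * hausdorff_delta s \<delta> (f ` A)"
      using neg L by (intro ennreal_mult_strict_left_mono) (auto simp: not_le)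
    then have "hausdorff_delta s (\<delta> / L) A < ennreal (L powr - s) * hausdorff_delta s \<delta> (f ` A)"
      by (simp only: inv)
    then obtain C where C: "A \<subseteq> (\<Union>i. C i)" "\<And>i. bounded (C i)" "\<And>i. diameter (C i) \<le> \<delta> / L"
        "(\<Sum>i. hgauge s (C i)) < ennreal (L powr - s) * hausdorff_delta s \<delta> (f ` A)"
      by (rule hausdorff_delta_cover) (rule that)
    have dist: "dist u v \<le> L * diameter (C i)" if "u \<in> f ` (C i \<inter> A)" "v \<in> f ` (C i \<inter> A)" for u v i
    proof -
      obtain x y where xy: "x \<in> C i \<inter> A" "y \<in> C i \<inter> A" "u = f x" "v = f y" using \<open>u \<in> _\<close> \<open>v \<in> _\<close> by blast
      have "dist u v \<le> L * dist x y" using xy lip by auto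
      also have "\<dots> \<le> L * diameter (C i)"
        using xy L diameter_bounded_bound[OF C(2)] by (intro mult_left_mono) auto
      finally show ?thesis .
    qed
    have bdd: "bounded (f ` (C i \<inter> A))" for i
      unfolding bounded_two_points using dist by blast
    have diam: "diameter (f ` (C i \<inter> A)) \<le> L * diameter (C i)" for i
    proof (cases "f ` (C i \<inter> A) = {}")
      case True
      then show ?thesis using L diameter_ge_0[OF C(2)[of i]] by (simp add: diameter_def)
    next
      case False
      then have "diameter (f ` (C i \<inter> A)) = (SUP (u, v)\<in>f ` (C i \<inter> A) \<times> f ` (C i \<inter> A). dist u v)"
        by (simp add: diameter_def)
      also have "\<dots> \<le> L * diameter (C i)"
        using False dist[of _ i] by (intro cSUP_least) auto
      finally show ?thesis .
    qed
    have "hausdorff_delta s \<delta> (f ` A) \<le> (\<Sum>i. hgauge s (f ` (C i \<inter> A)))"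
    proof (rule hausdorff_delta_le[OF _ bdd])
      show "f ` A \<subseteq> (\<Union>i. f ` (C i \<inter> A))" using C(1) by blast
      show "diameter (f ` (C i \<inter> A)) \<le> \<delta>" for i
        using diam[of i] C(3)[of i] L by (simp add: field_simps)
    qed
    also have "\<dots> \<le> (\<Sum>i. ennreal (L powr s) * hgauge s (C i))"
    proof (intro suminf_le summableI)
      fix i
      have "(diameter (f ` (C i \<inter> A)) / 2) powr s \<le> (L * (diameter (C i) / 2)) powr s"
        using diam[of i] diameter_ge_0[OF bdd[of i]] s by (intro powr_mono2) auto
      also have "\<dots> = L powr s * (diameter (C i) / 2) powr s"
        by (rule powr_mult)
      finally have le: "(diameter (f ` (C i \<inter> A)) / 2) powr s \<le> L powr s * (diameter (C i) / 2) powr s" .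
      have "?c * (diameter (f ` (C i \<inter> A)) / 2) powr s \<le> L powr s * (?c * (diameter (C i) / 2) powr s)"
        using mult_left_mono[OF le c] by (simp only: ac_simps)
      moreover have "0 \<le> ?c * (diameter (C i) / 2) powr s" by (rule mult_nonneg_nonneg[OF c powr_ge_zero])
      ultimately show "hgauge s (f ` (C i \<inter> A)) \<le> ennreal (L powr s) * hgauge s (C i)"
        unfolding hgauge_def by (metis ennreal_leI ennreal_mult powr_ge_zero)
    qed
    also have "\<dots> = ennreal (L powr s) * (\<Sum>i. hgauge s (C i))" by simp
    also have "\<dots> < hausdorff_delta s \<delta> (f ` A)"
    proof -
      have "ennreal (L powr s) * (\<Sum>i. hgauge s (C i))
          < ennreal (L powr s) * (ennreal (L powr - s) * hausdorff_delta s \<delta> (f ` A))"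
        using C(4) L by (intro ennreal_mult_strict_left_mono) auto
      then show ?thesis by (simp only: inv)
    qed
    finally show False by simp
  qed
  also have "\<dots> \<le> ennreal (L powr s) * hausdorff_outer s A"
    using \<delta> L by (intro mult_left_mono hausdorff_delta_le_outer) auto
  finally show "hausdorff_delta s \<delta> (f ` A) \<le> ennreal (L powr s) * hausdorff_outer s A" .
qed

section \<open>Two-dimensional Hausdorff measure in the plane\<close>

text \<open>A bounded set of reals is no longer than the distance between its infimum and supremum,
  and each supremum exceeds the other infimum by at most D. This is the one-dimensional core of
  Steiner symmetrisation: centred intervals of these lengths have points at most D apart.\<close>

lemma le_of_slices:
  fixes S1 S2 :: "real set"
  assumes "S1 \<in> sets borel" "S2 \<in> sets borel" "bounded S1" "bounded S2" "S1 \<noteq> {}" "S2 \<noteq> {}"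
    and D: "\<And>a b. a \<in> S1 \<Longrightarrow> b \<in> S2 \<Longrightarrow> \<bar>a - b\<bar> \<le> D"
  shows "measure lborel S1 + measure lborel S2 \<le> 2 * D"
proof -
  have len: "measure lborel S \<le> Sup S - Inf S" if "S \<in> sets borel" "bounded S" "S \<noteq> {}" for S :: "real set"
  proof -
    have b: "bdd_above S" "bdd_below S" using that by (simp_all add: bounded_imp_bdd_above bounded_imp_bdd_below)
    have "S \<subseteq> {Inf S .. Sup S}" using b by (auto intro: cInf_lower cSup_upper)
    then have "measure lborel S \<le> measure lborel {Inf S .. Sup S}"
      using that by (intro measure_mono_fmeasurable) (auto simp: fmeasurable_def)
    also have "\<dots> = Sup S - Inf S"
      using b that by (simp add: cInf_le_cSup)
    finally show ?thesis .
  qed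
  have b: "bdd_above S1" "bdd_below S1" "bdd_above S2" "bdd_below S2"
    using assms by (simp_all add: bounded_imp_bdd_above bounded_imp_bdd_below)
  have "Sup S1 - Inf S2 \<le> D"
  proof -
    have "Sup S1 \<le> D + Inf S2"
    proof (rule cSup_least[OF \<open>S1 \<noteq> {}\<close>])
      fix a assume "a \<in> S1"
      have "a - D \<le> Inf S2"
        by (rule cInf_greatest[OF \<open>S2 \<noteq> {}\<close>]) (use D[OF \<open>a \<in> S1\<close>] in fastforce)
      then show "a \<le> D + Inf S2" by simp
    qed
    then show ?thesis by simp
  qed
  moreover have "Sup S2 - Inf S1 \<le> D"
  proof -
    have "Sup S2 \<le> D + Inf S1"
    proof (rule cSup_least[OF \<open>S2 \<noteq> {}\<close>])
      fix a assume "a \<in> S2"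
      have "a - D \<le> Inf S1"
        by (rule cInf_greatest[OF \<open>S1 \<noteq> {}\<close>]) (use D[OF _ \<open>a \<in> S2\<close>] in fastforce)
      then show "a \<le> D + Inf S1" by simp
    qed
    then show ?thesis by simp
  qed
  ultimately show ?thesis using len[of S1] len[of S2] assms by linarith
qed

text \<open>Each vertical slice becomes the centred open interval of the same length. The strict
  inequality makes null slices empty, so that a point of the result always certifies a nonempty
  slice of A.\<close>

definition steiner :: "(real \<times> real) set \<Rightarrow> (real \<times> real) set" where
  "steiner A = {z. 2 * \<bar>snd z\<bar> < measure lborel (Pair (fst z) -` A)}"

lemma bounded_slice: "bounded A \<Longrightarrow> bounded (Pair x -` A)"
  for A :: "('a::real_normed_vector \<times> 'b::real_normed_vector) set"
proof -
  assume "bounded A"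
  then obtain B where "\<forall>z\<in>A. norm z \<le> B" by (auto simp: bounded_iff)
  then show ?thesis
    unfolding bounded_iff by (intro exI[of _ B]) (auto intro: order_trans[OF norm_snd_le] simp del: norm_Pair)
qed

lemma sets_lborel_pair:
  "A \<in> sets borel \<Longrightarrow> A \<in> sets (lborel \<Otimes>\<^sub>M lborel)" for A :: "(real \<times> real) set"
  by (simp only: lborel_prod sets_lborel)

lemma steiner_sets [measurable]:
  assumes [measurable]: "A \<in> sets borel" shows "steiner A \<in> sets borel"
proof -
  have A2: "A \<in> sets (lborel \<Otimes>\<^sub>M lborel)" using assms by (metis lborel_prod sets_lborel)
  have "(\<lambda>x. measure lborel (Pair x -` A)) \<in> borel_measurable lborel"
    unfolding measure_def using lborel.measurable_emeasure_Pair[OF A2] by measurable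
  then have m: "(\<lambda>x. measure lborel (Pair x -` A)) \<in> borel_measurable borel" by simp
  have fst: "(fst :: real \<times> real \<Rightarrow> real) \<in> borel_measurable borel"
    and snd: "(\<lambda>z :: real \<times> real. 2 * \<bar>snd z\<bar>) \<in> borel_measurable borel"
    by (intro borel_measurable_continuous_onI continuous_intros)+
  have "{z \<in> space borel. 2 * \<bar>snd z\<bar> < measure lborel (Pair (fst z) -` A)} \<in> sets borel"
    by (rule borel_measurable_less[OF snd measurable_compose[OF fst m]])
  then show ?thesis by (simp add: steiner_def)
qed

text \<open>Cavalieri's principle. Boundedness makes slice lengths finite, so that the real-valued
  \<open>measure\<close> in the definition loses nothing.\<close>

lemma emeasure_steiner:
  assumes A: "A \<in> sets borel" "bounded A"
  shows "emeasure lborel (steiner A) = emeasure lborel A"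
proof -
  have eq: "emeasure lborel (Pair x -` steiner A) = emeasure lborel (Pair x -` A)" for x
  proof -
    define l where "l = measure lborel (Pair x -` A)"
    have "Pair x -` A \<in> sets borel" using A(1) by (metis borel_prod sets_Pair1)
    then have "emeasure lborel (Pair x -` A) \<noteq> \<infinity>"
      using emeasure_bounded_finite[OF bounded_slice[OF A(2)]] by (simp add: less_top)
    then have l: "emeasure lborel (Pair x -` A) = ennreal l" by (simp add: emeasure_eq_ennreal_measure l_def)
    have l0: "0 \<le> l" by (simp add: l_def)
    have "Pair x -` steiner A = {- (l/2) <..< l/2}"
      by (auto simp: steiner_def l_def)
    then show ?thesis using l l0 by simp
  qed
  have "emeasure (lborel \<Otimes>\<^sub>M lborel) (steiner A) = emeasure (lborel \<Otimes>\<^sub>M lborel) A"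
    by (subst (1 2) lborel.emeasure_pair_measure_alt) (rule sets_lborel_pair A steiner_sets[OF A(1)] | simp only: eq)+
  then show ?thesis by (simp add: lborel_prod)
qed

text \<open>The horizontal distance of two points is unchanged, and for given x1, x2 it bounds the
  vertical distances in A by D; \<open>le_of_slices\<close> passes this bound to the centred
  slices.\<close>

lemma steiner_dist:
  assumes A: "A \<in> sets borel" "bounded A" and d: "\<And>z w. z \<in> A \<Longrightarrow> w \<in> A \<Longrightarrow> dist z w \<le> d"
    and zw: "z \<in> steiner A" "w \<in> steiner A"
  shows "dist z w \<le> d"
proof -
  obtain x1 y1 x2 y2 where zw2: "z = (x1, y1)" "w = (x2, y2)" by (metis prod.exhaust)
  let ?S1 = "Pair x1 -` A" and ?S2 = "Pair x2 -` A"
  have meas: "?S1 \<in> sets borel" "?S2 \<in> sets borel" using A(1) by (metis borel_prod sets_Pair1)+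
  have l: "2 * \<bar>y1\<bar> < measure lborel ?S1" "2 * \<bar>y2\<bar> < measure lborel ?S2"
    using zw by (simp_all add: steiner_def zw2)
  then have ne: "?S1 \<noteq> {}" "?S2 \<noteq> {}" by fastforce+
  define D where "D = sqrt (d\<^sup>2 - (x1 - x2)\<^sup>2)"
  have sl: "(x1 - x2)\<^sup>2 + (a - b)\<^sup>2 \<le> d\<^sup>2" if "a \<in> ?S1" "b \<in> ?S2" for a b
  proof -
    have "dist (x1, a) (x2, b) \<le> d" using d that by auto
    then have "(dist (x1, a) (x2, b))\<^sup>2 \<le> d\<^sup>2" by (intro power_mono) auto
    then show ?thesis by (simp add: dist_Pair_Pair dist_real_def)
  qed
  have "measure lborel ?S1 + measure lborel ?S2 \<le> 2 * D"
  proof (rule le_of_slices[OF meas bounded_slice[OF A(2)] bounded_slice[OF A(2)] ne])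
    fix a b assume "a \<in> ?S1" "b \<in> ?S2"
    from sl[OF this] show "\<bar>a - b\<bar> \<le> D" unfolding D_def by (intro real_le_rsqrt) simp
  qed
  then have "\<bar>y1 - y2\<bar> \<le> D" using l by linarith
  then have "(y1 - y2)\<^sup>2 \<le> D\<^sup>2" by (metis power2_abs power_mono abs_ge_zero)
  moreover obtain a b where "a \<in> ?S1" "b \<in> ?S2" using ne by blast
  then have "D\<^sup>2 = d\<^sup>2 - (x1 - x2)\<^sup>2" using sl[of a b] unfolding D_def by (intro real_sqrt_pow2) (smt (verit) zero_le_power2)
  ultimately have "(x1 - x2)\<^sup>2 + (y1 - y2)\<^sup>2 \<le> d\<^sup>2" by simp
  moreover have "0 \<le> d" using d[of "(x1, a)" "(x1, a)"] \<open>a \<in> ?S1\<close> by simp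
  ultimately show ?thesis by (simp add: zw2 dist_Pair_Pair dist_real_def real_le_lsqrt)
qed

text \<open>Symmetrising in both directions keeps the area and the bound d and produces a set
  symmetric about the origin. There z and -z are at most d apart, so the set lies in the disc of
  radius d/2.\<close>

lemma isodiametric_product:
  fixes A :: "(real \<times> real) set"
  assumes A: "A \<in> sets borel" "bounded A" and d: "\<And>z w. z \<in> A \<Longrightarrow> w \<in> A \<Longrightarrow> dist z w \<le> d" and d0: "0 \<le> d"
  shows "emeasure lborel A \<le> ennreal (pi * (d / 2)\<^sup>2)"
proof -
  let ?sw = "\<lambda>(x, y). (y, x) :: real \<times> real"
  have bdd: "bounded B" if "\<And>z w. z \<in> B \<Longrightarrow> w \<in> B \<Longrightarrow> dist z w \<le> d" for B :: "(real \<times> real) set"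
    unfolding bounded_two_points using that by blast
  define A1 where "A1 = steiner A"
  have A1: "A1 \<in> sets borel" "\<And>z w. z \<in> A1 \<Longrightarrow> w \<in> A1 \<Longrightarrow> dist z w \<le> d"
    unfolding A1_def using steiner_sets[OF A(1)] steiner_dist[OF A d] by auto
  have sym1: "(x, - y) \<in> A1 \<longleftrightarrow> (x, y) \<in> A1" for x y by (simp add: A1_def steiner_def)
  \<comment> \<open>Swapping coordinates lets the same vertical symmetrisation act in the other
    direction.\<close>
  define A2 where "A2 = ?sw -` A1"
  have swm: "?sw \<in> borel_measurable borel"
    by (intro borel_measurable_continuous_onI) (auto simp: case_prod_beta intro!: continuous_intros)
  have A2m: "A2 \<in> sets borel" using measurable_sets[OF swm A1(1)] by (simp add: A2_def)
  have A2d: "dist z w \<le> d" if "z \<in> A2" "w \<in> A2" for z w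
  proof -
    obtain x1 y1 x2 y2 where zw: "z = (x1, y1)" "w = (x2, y2)" by (metis prod.exhaust)
    have "dist (y1, x1) (y2, x2) \<le> d" using that by (intro A1) (auto simp: A2_def zw)
    then show ?thesis by (simp add: zw dist_Pair_Pair add.commute)
  qed
  have e2: "emeasure lborel A2 = emeasure lborel A1"
  proof -
    have "emeasure (lborel \<Otimes>\<^sub>M lborel) A1 = emeasure (distr (lborel \<Otimes>\<^sub>M lborel) (lborel \<Otimes>\<^sub>M lborel) ?sw) A1"
      using lborel_pair.distr_pair_swap by metis
    also have "\<dots> = emeasure lborel A2"
      using sets_lborel_pair[OF A1(1)] by (subst emeasure_distr) (auto simp: A2_def lborel_prod[symmetric] space_pair_measure)
    finally show ?thesis by (simp add: lborel_prod)
  qed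
  define A3 where "A3 = steiner A2"
  have A3d: "dist z w \<le> d" if "z \<in> A3" "w \<in> A3" for z w
    using steiner_dist[OF A2m bdd[OF A2d] A2d] that by (auto simp: A3_def)
  \<comment> \<open>The second symmetrisation does not spoil the first: equal slices over x and -x
    have equal symmetrised slices.\<close>
  have sym3: "(- x, - y) \<in> A3" if "(x, y) \<in> A3" for x y
  proof -
    have "Pair (- x) -` A2 = Pair x -` A2" by (auto simp: A2_def sym1)
    then show ?thesis using that by (simp add: A3_def steiner_def)
  qed
  have "A3 \<subseteq> cball 0 (d / 2)"
  proof
    fix z assume z: "z \<in> A3"
    then have "- z \<in> A3" using sym3[of "fst z" "snd z"] by (simp add: uminus_prod_def)
    then have "dist z (- z) \<le> d" using A3d z by blast
    then have "norm (2 *\<^sub>R z) \<le> d" by (simp add: dist_norm scaleR_2)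
    then show "z \<in> cball 0 (d / 2)" by simp
  qed
  then have "emeasure lborel A3 \<le> emeasure lborel (cball (0 :: real \<times> real) (d / 2))"
    by (intro emeasure_mono) auto
  also have "\<dots> = ennreal (pi * (d / 2)\<^sup>2)"
    using d0 by (simp add: emeasure_cball unit_ball_vol_2 power2_eq_square)
  finally have "emeasure lborel A3 \<le> ennreal (pi * (d / 2)\<^sup>2)" .
  moreover have "emeasure lborel A3 = emeasure lborel A"
    unfolding A3_def using emeasure_steiner[OF A2m bdd[OF A2d]] e2 emeasure_steiner[OF A] by (simp add: A1_def)
  ultimately show ?thesis by simp
qed

section \<open>From \<open>real \<times> real\<close>, where Fubini applies, to
  \<open>real^2\<close>; comparison of Hausdorff and Lebesgue measure\<close>

definition plane_of_pair :: "real \<times> real \<Rightarrow> real^2" where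
  "plane_of_pair z = fst z *\<^sub>R axis 1 1 + snd z *\<^sub>R axis 2 1"

lemma plane_of_pair_nth [simp]: "plane_of_pair z $ 1 = fst z" "plane_of_pair z $ 2 = snd z"
  by (simp_all add: plane_of_pair_def axis_def)

lemma plane_of_pair_borel [measurable]: "plane_of_pair \<in> borel_measurable borel"
  unfolding plane_of_pair_def[abs_def] by (intro borel_measurable_continuous_onI continuous_intros)

lemma Basis_2: "(Basis :: (real^2) set) = {axis 1 1, axis 2 1}"
  by (auto simp: Basis_vec_def UNIV_2)

lemma Basis_3: "(Basis :: (real^3) set) = {axis 1 1, axis 2 1, axis 3 1}"
  by (auto simp: Basis_vec_def UNIV_3)

lemma lborel_plane: "(lborel :: (real^2) measure) = distr (lborel \<Otimes>\<^sub>M lborel) borel plane_of_pair"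
proof (rule lborel_eqI)
  fix l u :: "real^2" assume le: "\<And>b. b \<in> Basis \<Longrightarrow> l \<bullet> b \<le> u \<bullet> b"
  have le': "l $ 1 \<le> u $ 1" "l $ 2 \<le> u $ 2"
    using le[of "axis 1 1"] le[of "axis 2 1"] by (auto simp: Basis_2 inner_axis)
  have vi: "plane_of_pair -` box l u = {l$1<..<u$1} \<times> {l$2<..<u$2}"
    by (auto simp: mem_box_cart forall_2)
  have "emeasure (distr (lborel \<Otimes>\<^sub>M lborel) borel plane_of_pair) (box l u)
      = emeasure (lborel \<Otimes>\<^sub>M lborel) ({l$1<..<u$1} \<times> {l$2<..<u$2})"
    by (subst emeasure_distr) (auto simp: vi lborel_prod space_pair_measure)
  also have "\<dots> = ennreal (u$1 - l$1) * ennreal (u$2 - l$2)"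
    using le' by (subst lborel.emeasure_pair_measure_Times) auto
  also have "\<dots> = ennreal (\<Prod>b\<in>Basis. (u - l) \<bullet> b)"
    using le' by (simp add: Basis_2 axis_eq_axis inner_axis ennreal_mult)
  finally show "emeasure (distr (lborel \<Otimes>\<^sub>M lborel) borel plane_of_pair) (box l u) = (\<Prod>b\<in>Basis. (u - l) \<bullet> b)" .
qed simp

lemma isodiametric:
  fixes A :: "(real^2) set"
  assumes A: "A \<in> sets borel" "bounded A"
  shows "emeasure lborel A \<le> ennreal (pi * (diameter A / 2)\<^sup>2)"
proof -
  have d: "dist (plane_of_pair z) (plane_of_pair w) = dist z w" for z w
    by (simp add: dist_vec_def L2_set_def sum_2 dist_prod_def)
  let ?B = "plane_of_pair -` A"
  have Bd: "dist z w \<le> diameter A" if "z \<in> ?B" "w \<in> ?B" for z w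
    using diameter_bounded_bound[OF A(2)] that by (metis d vimageE)
  have Bm: "?B \<in> sets borel" using measurable_sets[OF plane_of_pair_borel A(1)] by simp
  have "emeasure lborel A = emeasure lborel ?B"
    by (subst lborel_plane, subst emeasure_distr) (use A in \<open>auto simp: lborel_prod space_pair_measure\<close>)
  also have "\<dots> \<le> ennreal (pi * (diameter A / 2)\<^sup>2)"
    using Bd Bm A by (intro isodiametric_product) (auto simp: bounded_two_points diameter_ge_0 intro!: exI[of _ "diameter A"])
  finally show ?thesis .
qed

lemma hgauge_2: "hgauge 2 C = ennreal (pi * (diameter C / 2)\<^sup>2)" if "bounded C"
  using diameter_ge_0[OF that] by (simp add: hgauge_def powr_numeral Gamma_numeral)

text \<open>The definition only admits sequences; a countable family is enumerated and padded with
  empty sets, whose gauge is 0.\<close>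

lemma hausdorff_delta_countable_cover:
  assumes I: "countable I" and d: "0 \<le> \<delta>" and cover: "A \<subseteq> (\<Union>i\<in>I. C i)"
    "\<And>i. i \<in> I \<Longrightarrow> bounded (C i)" "\<And>i. i \<in> I \<Longrightarrow> diameter (C i) \<le> \<delta>"
  shows "hausdorff_delta s \<delta> A \<le> (\<integral>\<^sup>+i. hgauge s (C i) \<partial>count_space I)"
proof -
  let ?e = "to_nat_on I"
  have bij: "bij_betw ?e I (?e ` I)" using inj_on_to_nat_on[OF I] by (simp add: bij_betw_def)
  define D where "D n = (if n \<in> ?e ` I then C (inv_into I ?e n) else {})" for n
  have De: "D (?e i) = C i" if "i \<in> I" for i
    using that inj_on_to_nat_on[OF I] by (simp add: D_def inv_into_f_f)
  have "hausdorff_delta s \<delta> A \<le> (\<Sum>n. hgauge s (D n))"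
  proof (rule hausdorff_delta_le)
    show "A \<subseteq> (\<Union>n. D n)" using cover(1) De by blast
    show "bounded (D n)" "diameter (D n) \<le> \<delta>" for n
      using cover(2,3) d by (auto simp: D_def inv_into_into diameter_def[of "{}"])
  qed
  also have "\<dots> = (\<integral>\<^sup>+n. hgauge s (D n) \<partial>count_space UNIV)" by (simp add: nn_integral_count_space_nat)
  also have "\<dots> = (\<integral>\<^sup>+n. hgauge s (D n) * indicator (?e ` I) n \<partial>count_space UNIV)"
    by (intro nn_integral_cong) (auto simp: D_def indicator_def)
  also have "\<dots> = (\<integral>\<^sup>+n. hgauge s (D n) \<partial>count_space (?e ` I))"
  proof (cases "?e ` I = UNIV")
    case False then show ?thesis by (subst nn_integral_count_space_indicator[of "?e ` I"]) (auto simp: NO_MATCH_def)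
  qed simp
  also have "\<dots> = (\<integral>\<^sup>+i. hgauge s (D (?e i)) \<partial>count_space I)"
    by (rule nn_integral_bij_count_space[OF bij, symmetric])
  also have "\<dots> = (\<integral>\<^sup>+i. hgauge s (C i) \<partial>count_space I)"
    by (rule nn_integral_cong) (simp add: De)
  finally show ?thesis .
qed

text \<open>Covering sets may be non-measurable. Their closures are Borel with the same diameter,
  and the isodiametric inequality bounds each area by the gauge.\<close>

lemma lborel_le_hausdorff:
  assumes A: "A \<in> sets borel"
  shows "emeasure lborel A \<le> hausdorff_outer 2 (A :: (real^2) set)"
proof -
  have "emeasure lborel A \<le> hausdorff_delta 2 1 A"
  proof (rule ccontr)
    assume "\<not> ?thesis"
    then have "hausdorff_delta 2 1 A < emeasure lborel A" by simp
    then obtain C where C: "A \<subseteq> (\<Union>i. C i)" "\<And>i. bounded (C i)" "\<And>i. diameter (C i) \<le> 1"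
        "(\<Sum>i. hgauge 2 (C i)) < emeasure lborel A"
      by (rule hausdorff_delta_cover) (rule that)
    have "emeasure lborel A \<le> emeasure lborel (\<Union>i. closure (C i))"
    proof (rule emeasure_mono)
      show "A \<subseteq> (\<Union>i. closure (C i))"
        using C(1) closure_subset[of "C _"] by blast
      show "(\<Union>i. closure (C i)) \<in> sets lborel"
        unfolding sets_lborel by (rule sets.countable_UN) auto
    qed
    also have "\<dots> \<le> (\<Sum>i. emeasure lborel (closure (C i)))"
      by (intro emeasure_subadditive_countably) auto
    also have "\<dots> \<le> (\<Sum>i. hgauge 2 (C i))"
    proof (intro suminf_le summableI)
      fix i
      have "emeasure lborel (closure (C i)) \<le> ennreal (pi * (diameter (closure (C i)) / 2)\<^sup>2)"
        by (rule isodiametric) (use C(2) in auto)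
      then show "emeasure lborel (closure (C i)) \<le> hgauge 2 (C i)"
        by (simp only: hgauge_2[OF C(2)] diameter_closure[OF C(2)])
    qed
    finally show False using C(4) by simp
  qed
  also have "\<dots> \<le> hausdorff_outer 2 A" by (intro hausdorff_delta_le_outer) simp
  finally show ?thesis .
qed

text \<open>Needed for the null set that a Vitali covering leaves over. Inside an open set of small
  area the null set is covered by nonoverlapping squares, and the gauge of a square is at most twice
  its area.\<close>

lemma hausdorff_delta_negligible:
  fixes S :: "(real^2) set"
  assumes S: "negligible S" and d: "0 < \<delta>"
  shows "hausdorff_delta 2 \<delta> S = 0"
proof -
  have box: "hausdorff_delta 2 \<delta> (S \<inter> cbox (- (\<chi> i. r)) (\<chi> i. r)) = 0" if r: "0 < r" for r
  proof -
    define a b :: "real^2" where "a = - (\<chi> i. r)" and "b = (\<chi> i. r)"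
    let ?S = "S \<inter> cbox a b"
    have eps: "hausdorff_delta 2 \<delta> ?S \<le> 0 + ennreal e" if e: "0 < e" for e
    proof -
      have "?S \<in> sets lebesgue" using negligible_Int[OF disjI1[OF S]] negligible_imp_sets by blast
      then obtain U where U: "open U" "?S \<subseteq> U" "U - ?S \<in> lmeasurable" "emeasure lebesgue (U - ?S) < ennreal (e / 2)"
        using sets_lebesgue_outer_open[of ?S "e / 2"] e by auto
      have Um: "emeasure lborel U \<le> ennreal (e / 2)"
      proof -
        have "?S \<in> null_sets lebesgue" using negligible_Int[OF disjI1[OF S]] by (simp add: negligible_iff_null_sets)
        then have "emeasure lebesgue U = emeasure lebesgue (U - ?S)"
          using U(1) by (intro emeasure_Diff_null_set[symmetric]) auto
        moreover have "emeasure lebesgue U = emeasure lborel U" using U(1) by simp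
        ultimately show ?thesis using U(4) by simp
      qed
      \<comment> \<open>This gauge forces every square to lie in U and in a ball of diameter
        \<delta>.\<close>
      define g where "g x = ball x (\<delta> / 2) \<inter> (if x \<in> U then U else UNIV)" for x
      have "gauge g" using d U(1) by (auto simp: gauge_def g_def)
      moreover have "box a b \<noteq> {}" using r by (auto simp: box_ne_empty Basis_2 a_def b_def inner_axis)
      ultimately obtain \<D> where D: "countable \<D>" "\<Union>\<D> \<subseteq> cbox a b"
          "\<And>K. K \<in> \<D> \<Longrightarrow> interior K \<noteq> {} \<and> (\<exists>c d. K = cbox c d)"
          "pairwise (\<lambda>A B. interior A \<inter> interior B = {}) \<D>"
          "\<And>K. K \<in> \<D> \<Longrightarrow> \<exists>x \<in> ?S \<inter> K. K \<subseteq> g x"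
          "\<And>u v. cbox u v \<in> \<D> \<Longrightarrow> \<exists>n. \<forall>i \<in> Basis. v \<bullet> i - u \<bullet> i = (b \<bullet> i - a \<bullet> i) / 2^n"
          "?S \<subseteq> \<Union>\<D>"
        using covering_lemma[of ?S a b g] by auto
      have KU: "K \<subseteq> U" "diameter K \<le> \<delta>" "bounded K" "hgauge 2 K \<le> 2 * emeasure lborel (interior K)" if K: "K \<in> \<D>" for K
      proof -
        obtain x where x: "x \<in> ?S" "x \<in> K" "K \<subseteq> g x" using D(5)[OF K] by auto
        then show "K \<subseteq> U" using U(2) by (auto simp: g_def split: if_splits)
        obtain u v where uv: "K = cbox u v" using D(3)[OF K] by auto
        show bK: "bounded K" by (simp add: uv bounded_cbox)
        have Kb: "K \<subseteq> ball x (\<delta> / 2)" using x(3) by (auto simp: g_def)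
        have "diameter K \<le> diameter (ball x (\<delta> / 2))" using Kb by (intro diameter_subset) auto
        then show "diameter K \<le> \<delta>" using d by (simp add: diameter_ball)
        obtain n where n: "\<forall>i\<in>Basis. v \<bullet> i - u \<bullet> i = (b \<bullet> i - a \<bullet> i) / 2^n" using D(6)[of u v] K uv by auto
        define t where "t = 2 * r / 2 ^ n"
        have t: "v $ 1 - u $ 1 = t" "v $ 2 - u $ 2 = t" "t > 0"
          using n r by (simp_all add: Basis_2 inner_axis a_def b_def t_def)
        have dist: "dist y z \<le> sqrt 2 * t" if "y \<in> K" "z \<in> K" for y z
        proof -
          have "\<bar>y $ i - z $ i\<bar> \<le> t" for i
          proof -
            have "u $ i \<le> y $ i" "y $ i \<le> v $ i" "u $ i \<le> z $ i" "z $ i \<le> v $ i"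
              using that by (auto simp: uv mem_box_cart)
            moreover have "v $ i - u $ i = t" using exhaust_2[of i] t by auto
            ultimately show ?thesis by linarith
          qed
          then have "(y $ i - z $ i)\<^sup>2 \<le> t\<^sup>2" for i
            using power_mono[of "\<bar>y $ i - z $ i\<bar>" t 2] by simp
          from this[of 1] this[of 2] have "(dist (y $ 1) (z $ 1))\<^sup>2 + (dist (y $ 2) (z $ 2))\<^sup>2 \<le> 2 * t\<^sup>2"
            by (simp add: dist_real_def)
          then have "dist y z \<le> sqrt (2 * t\<^sup>2)"
            unfolding dist_vec_def L2_set_def sum_2 by (rule real_sqrt_le_mono)
          also have "\<dots> = sqrt 2 * t" using t by (simp add: real_sqrt_mult)
          finally show ?thesis .
        qed
        have "diameter K \<le> sqrt 2 * t"
          using dist t x(2) by (intro diameter_le) (auto simp: dist_norm)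
        then have "(diameter K)\<^sup>2 \<le> (sqrt 2 * t)\<^sup>2"
          using diameter_ge_0[OF bK] by (intro power_mono) auto
        then have d2: "(diameter K)\<^sup>2 \<le> 2 * t\<^sup>2" by (simp add: power_mult_distrib)
        \<comment> \<open>The diameter is at most sqrt 2 t and pi < 4, so the gauge is at most 2
          t^2. A constant factor is harmless because the total area is at most e / 2.\<close>
        have "pi * (diameter K / 2)\<^sup>2 \<le> 4 * (2 * t\<^sup>2 / 4)"
          unfolding power_divide using d2 pi_less_4 by (intro mult_mono) auto
        then have "hgauge 2 K \<le> ennreal (2 * t\<^sup>2)"
          unfolding hgauge_2[OF bK] by (intro ennreal_leI) simp
        also have "\<dots> = 2 * emeasure lborel (interior K)"
        proof -
          have "emeasure lborel (box u v) = ennreal (t * t)"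
            using t by (subst emeasure_lborel_box) (auto simp: Basis_2 inner_axis axis_eq_axis)
          then show ?thesis using t by (simp add: uv power2_eq_square ennreal_mult)
        qed
        finally show "hgauge 2 K \<le> 2 * emeasure lborel (interior K)" .
      qed
      have "(\<integral>\<^sup>+K. emeasure lborel (interior K) \<partial>count_space \<D>) = emeasure lborel (\<Union>(interior ` \<D>))"
        by (rule emeasure_UN_countable[symmetric])
          (use D(1,4) in \<open>auto simp: disjoint_family_on_def pairwise_def\<close>)
      also have "\<dots> \<le> emeasure lborel U"
        by (intro emeasure_mono UN_least order_trans[OF interior_subset KU(1)]) (use U(1) in auto)
      finally have le: "(\<integral>\<^sup>+K. emeasure lborel (interior K) \<partial>count_space \<D>) \<le> ennreal (e / 2)"
        using Um by (rule order_trans)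
      have "hausdorff_delta 2 \<delta> ?S \<le> (\<integral>\<^sup>+K. hgauge 2 K \<partial>count_space \<D>)"
        by (rule hausdorff_delta_countable_cover[OF D(1)]) (use KU d D(7) in auto)
      also have "\<dots> \<le> (\<integral>\<^sup>+K. 2 * emeasure lborel (interior K) \<partial>count_space \<D>)"
        using KU(4) by (intro nn_integral_mono) auto
      also have "\<dots> = 2 * (\<integral>\<^sup>+K. emeasure lborel (interior K) \<partial>count_space \<D>)"
        by (simp add: nn_integral_cmult)
      also have "\<dots> \<le> 2 * ennreal (e / 2)" by (rule mult_left_mono[OF le]) simp
      also have "\<dots> = ennreal (2 * (e / 2))" using e by (subst ennreal_mult) auto
      finally show ?thesis by simp
    qed
    have "hausdorff_delta 2 \<delta> ?S \<le> 0" by (rule ennreal_le_epsilon) (rule eps)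
    then have "hausdorff_delta 2 \<delta> ?S = 0" by (simp only: le_zero_eq)
    then show ?thesis by (simp only: a_def b_def)
  qed
  have "S \<subseteq> (\<Union>n. S \<inter> cbox (- (\<chi> i. real (Suc n))) (\<chi> i. real (Suc n)))"
  proof
    fix x assume "x \<in> S"
    obtain n :: nat where n: "norm x \<le> n" using real_arch_simple by blast
    have "\<bar>x $ i\<bar> \<le> real (Suc n)" for i using component_le_norm_cart[of x i] n by simp
    then have "- real (Suc n) \<le> x $ i \<and> x $ i \<le> real (Suc n)" for i by (metis abs_le_iff minus_le_iff)
    then have "x \<in> cbox (- (\<chi> i. real (Suc n))) (\<chi> i. real (Suc n))"
      unfolding mem_box_cart uminus_vec_def vec_lambda_beta by blast
    then show "x \<in> (\<Union>n. S \<inter> cbox (- (\<chi> i. real (Suc n))) (\<chi> i. real (Suc n)))" using \<open>x \<in> S\<close> by blast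
  qed
  then have "hausdorff_delta 2 \<delta> S \<le> hausdorff_delta 2 \<delta> (\<Union>n. S \<inter> cbox (- (\<chi> i. real (Suc n))) (\<chi> i. real (Suc n)))"
    by (rule hausdorff_delta_mono)
  also have "\<dots> \<le> (\<Sum>n. hausdorff_delta 2 \<delta> (S \<inter> cbox (- (\<chi> i. real (Suc n))) (\<chi> i. real (Suc n))))"
    using d by (intro hausdorff_delta_subadditive) auto
  also have "\<dots> = 0" using box by simp
  finally show ?thesis by simp
qed

text \<open>For a ball the gauge equals the area. Vitali's theorem exhausts A up to a null set by
  disjoint small balls inside an open superset of almost the same area.\<close>

lemma hausdorff_le_lborel:
  fixes A :: "(real^2) set"
  assumes A: "A \<in> sets borel"
  shows "hausdorff_outer 2 A \<le> emeasure lborel A"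
proof (rule hausdorff_outer_leI)
  fix \<delta> :: real assume d: "0 < \<delta>"
  show "hausdorff_delta 2 \<delta> A \<le> emeasure lborel A"
  proof (rule ennreal_le_epsilon)
    fix e :: real assume e: "0 < e"
    obtain U where U: "open U" "A \<subseteq> U" "U - A \<in> lmeasurable" "emeasure lebesgue (U - A) < ennreal e"
      by (rule sets_lebesgue_outer_open[of A e]) (use A e in \<open>simp_all add: sets_completionI_sets\<close>)
    let ?K = "{(x, r). x \<in> A \<and> 0 < r \<and> r < \<delta> / 2 \<and> ball x r \<subseteq> U}"
    have ex: "\<exists>i. i \<in> ?K \<and> x \<in> ball (fst i) (snd i) \<and> snd i < t" if "x \<in> A" "0 < t" for x t
    proof -
      have "x \<in> U" using U(2) that by blast
      then obtain r where r: "r > 0" "ball x r \<subseteq> U" using U(1) open_contains_ball by blast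
      define r' where "r' = min (r / 2) (min (t / 2) (\<delta> / 4))"
      have "0 < r'" "r' < t" "r' < \<delta> / 2" "r' \<le> r" using r d that by (auto simp: r'_def)
      moreover have "ball x r' \<subseteq> U" using subset_ball[OF \<open>r' \<le> r\<close>, of x] r(2) by blast
      ultimately have "(x, r') \<in> ?K" using that by auto
      then show ?thesis using \<open>0 < r'\<close> \<open>r' < t\<close> by (intro exI[of _ "(x, r')"]) auto
    qed
    obtain C where C: "countable C" "C \<subseteq> ?K"
       "pairwise (\<lambda>i j. disjnt (ball (fst i) (snd i)) (ball (fst j) (snd j))) C"
       "negligible (A - (\<Union>i\<in>C. ball (fst i) (snd i)))"
      using Vitali_covering_theorem_balls[of A ?K fst snd, OF ex] by blast
    let ?B = "\<lambda>i. ball (fst i) (snd i)"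
    have Ci: "0 < snd i" "snd i < \<delta> / 2" "?B i \<subseteq> U" if "i \<in> C" for i
    proof -
      have "i \<in> ?K" using C(2) that by (rule subsetD)
      then show "0 < snd i" "snd i < \<delta> / 2" "?B i \<subseteq> U" by (simp_all only: mem_Collect_eq case_prod_beta)
    qed
    have "hausdorff_delta 2 \<delta> A \<le> hausdorff_delta 2 \<delta> ((A - (\<Union>i\<in>C. ?B i)) \<union> (\<Union>i\<in>C. ?B i))"
      by (rule hausdorff_delta_mono) auto
    also have "\<dots> \<le> hausdorff_delta 2 \<delta> (A - (\<Union>i\<in>C. ?B i)) + hausdorff_delta 2 \<delta> (\<Union>i\<in>C. ?B i)"
      using d by (intro hausdorff_delta_Un) auto
    also have "\<dots> = hausdorff_delta 2 \<delta> (\<Union>i\<in>C. ?B i)"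
      by (simp add: hausdorff_delta_negligible[OF C(4) d])
    also have "\<dots> \<le> (\<integral>\<^sup>+i. hgauge 2 (?B i) \<partial>count_space C)"
    proof (rule hausdorff_delta_countable_cover[OF C(1)])
      show "diameter (?B i) \<le> \<delta>" if "i \<in> C" for i using Ci(1,2)[OF that] by (simp only: diameter_ball) simp
    qed (use d in auto)
    also have "\<dots> = (\<integral>\<^sup>+i. emeasure lborel (?B i) \<partial>count_space C)"
    proof (rule nn_integral_cong)
      fix i assume "i \<in> space (count_space C)"
      then have "0 < snd i" using Ci by simp
      then show "hgauge 2 (?B i) = emeasure lborel (?B i)"
        by (subst hgauge_2) (auto simp: diameter_ball emeasure_ball unit_ball_vol_2)
    qed
    also have "\<dots> = emeasure lborel (\<Union>(?B ` C))"
      by (rule emeasure_UN_countable[symmetric])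
        (use C(1,3) in \<open>auto simp: disjoint_family_on_def pairwise_def disjnt_def\<close>)
    also have "\<dots> \<le> emeasure lborel U"
      by (intro emeasure_mono UN_least Ci(3)) (use U(1) in auto)
    also have "\<dots> = emeasure lborel A + emeasure lborel (U - A)"
      using U A by (subst plus_emeasure) (auto simp: Un_absorb1)
    also have "\<dots> \<le> emeasure lborel A + ennreal e"
    proof -
      have "emeasure lebesgue (U - A) = emeasure lborel (U - A)" using U(1) A by simp
      then show ?thesis using U(4) by (intro add_left_mono) simp
    qed
    finally show "hausdorff_delta 2 \<delta> A \<le> emeasure lborel A + ennreal e" .
  qed
qed

lemma hausdorff_outer_plane:
  "A \<in> sets borel \<Longrightarrow> hausdorff_outer 2 (A :: (real^2) set) = emeasure lborel A"
  by (intro antisym hausdorff_le_lborel lborel_le_hausdorff)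

section \<open>Orthonormal frames and graphs\<close>

lemma inner_real2: "z \<bullet> w = z $ 1 * w $ 1 + z $ 2 * w $ 2" for z w :: "real^2"
  by (simp add: inner_vec_def sum_2)

lemma norm_sq_real2: "(norm z)\<^sup>2 = (z $ 1)\<^sup>2 + (z $ 2)\<^sup>2" for z :: "real^2"
  unfolding power2_norm_eq_inner inner_real2 by (simp add: power2_eq_square)

locale frame =
  fixes f1 f2 e :: "real^3"
  assumes orth: "f1 \<bullet> f1 = 1" "f2 \<bullet> f2 = 1" "e \<bullet> e = 1" "f1 \<bullet> f2 = 0" "f1 \<bullet> e = 0" "f2 \<bullet> e = 0"
    and expand: "\<And>y. y = (y \<bullet> f1) *\<^sub>R f1 + (y \<bullet> f2) *\<^sub>R f2 + (y \<bullet> e) *\<^sub>R e"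

lemma ex_frame:
  assumes "norm e = 1" obtains f1 f2 where "frame f1 f2 e"
proof -
  obtain R :: "real^3 \<Rightarrow> real^3" where R: "orthogonal_transformation R" "R (axis 3 1) = e"
    using orthogonal_transformation_exists[of "axis 3 1 :: real^3" e] assms by auto
  have lin: "linear R" and ip: "\<And>v w. R v \<bullet> R w = v \<bullet> w"
    using R(1) by (auto simp: orthogonal_transformation_def)
  have "surj R" using R(1) orthogonal_transformation_surj by blast
  have "frame (R (axis 1 1)) (R (axis 2 1)) e"
  proof
    show "R (axis 1 1) \<bullet> R (axis 1 1) = 1" "R (axis 2 1) \<bullet> R (axis 2 1) = 1" "e \<bullet> e = 1"
      "R (axis 1 1) \<bullet> R (axis 2 1) = 0" "R (axis 1 1) \<bullet> e = 0" "R (axis 2 1) \<bullet> e = 0"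
      by (simp_all add: R(2)[symmetric] ip inner_axis_axis)
    fix y
    obtain x where y: "y = R x" using \<open>surj R\<close> by (metis surjD)
    have "x = (x $ 1) *\<^sub>R axis 1 1 + (x $ 2) *\<^sub>R axis 2 1 + (x $ 3) *\<^sub>R axis 3 1"
      by (simp add: vec_eq_iff forall_3 axis_def)
    then have "R x = R ((x $ 1) *\<^sub>R axis 1 1 + (x $ 2) *\<^sub>R axis 2 1 + (x $ 3) *\<^sub>R axis 3 1)" by (rule arg_cong)
    also have "\<dots> = (x $ 1) *\<^sub>R R (axis 1 1) + (x $ 2) *\<^sub>R R (axis 2 1) + (x $ 3) *\<^sub>R R (axis 3 1)"
      using lin by (simp add: linear_add linear_cmul)
    also have "\<dots> = (y \<bullet> R (axis 1 1)) *\<^sub>R R (axis 1 1) + (y \<bullet> R (axis 2 1)) *\<^sub>R R (axis 2 1) + (y \<bullet> e) *\<^sub>R e"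
      by (simp add: y R(2)[symmetric] ip inner_axis)
    finally show "y = (y \<bullet> R (axis 1 1)) *\<^sub>R R (axis 1 1) + (y \<bullet> R (axis 2 1)) *\<^sub>R R (axis 2 1) + (y \<bullet> e) *\<^sub>R e"
      by (simp add: y)
  qed
  then show ?thesis by (rule that)
qed

section \<open>Coordinates along and across e\<close>

context frame
begin

lemma orth' [simp]: "f1 \<bullet> f1 = 1" "f2 \<bullet> f2 = 1" "e \<bullet> e = 1" "f1 \<bullet> f2 = 0" "f1 \<bullet> e = 0" "f2 \<bullet> e = 0"
  "f2 \<bullet> f1 = 0" "e \<bullet> f1 = 0" "e \<bullet> f2 = 0"
  using orth by (simp_all add: inner_commute)

lemma norm_e [simp]: "norm e = 1" by (simp add: norm_eq_sqrt_inner)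

definition emb :: "real^2 \<Rightarrow> real^3" where "emb z = z $ 1 *\<^sub>R f1 + z $ 2 *\<^sub>R f2"
definition prj :: "real^3 \<Rightarrow> real^2" where "prj y = (y \<bullet> f1) *\<^sub>R axis 1 1 + (y \<bullet> f2) *\<^sub>R axis 2 1"

lemma prj_nth [simp]: "prj y $ 1 = y \<bullet> f1" "prj y $ 2 = y \<bullet> f2"
  by (simp_all add: prj_def axis_def)

lemma emb_inner [simp]: "emb z \<bullet> e = 0" "e \<bullet> emb z = 0" "emb z \<bullet> f1 = z $ 1" "emb z \<bullet> f2 = z $ 2"
  by (simp_all add: emb_def inner_add_left inner_add_right)

lemma emb_inner_emb: "emb z \<bullet> emb w = z \<bullet> w"
proof -
  have "z \<bullet> w = z $ 1 * w $ 1 + z $ 2 * w $ 2" by (simp add: inner_vec_def sum_2)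
  then show ?thesis by (simp add: emb_def inner_add_left inner_add_right)
qed

lemma linear_emb: "linear emb"
  by (rule linearI) (simp_all add: emb_def algebra_simps)

lemma bounded_linear_emb: "bounded_linear emb"
  using linear_emb by (simp add: linear_conv_bounded_linear)

lemma linear_prj: "linear prj"
  by (rule linearI) (simp_all add: prj_def algebra_simps)

lemma bounded_linear_prj: "bounded_linear prj"
  using linear_prj by (simp add: linear_conv_bounded_linear)

lemma emb_diff: "emb (z - w) = emb z - emb w"
  by (simp add: emb_def algebra_simps)

lemma prj_diff: "prj (z - w) = prj z - prj w"
  by (simp add: prj_def algebra_simps)

lemma norm_emb [simp]: "norm (emb z) = norm z"
  by (simp add: norm_eq_sqrt_inner emb_inner_emb)

lemma prj_emb_add [simp]: "prj (emb z + s *\<^sub>R e) = z"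
  by (simp add: vec_eq_iff forall_2 inner_add_left)

lemma prj_emb [simp]: "prj (emb z) = z"
  using prj_emb_add[of z 0] by simp

lemma decompose: "y = emb (prj y) + (y \<bullet> e) *\<^sub>R e"
  using expand[of y] by (simp add: emb_def)

lemma norm_prj_le: "norm (prj y) \<le> norm y"
proof -
  have "y \<bullet> y = (emb (prj y) + (y \<bullet> e) *\<^sub>R e) \<bullet> (emb (prj y) + (y \<bullet> e) *\<^sub>R e)"
    using decompose[of y] by simp
  also have "\<dots> = prj y \<bullet> prj y + (y \<bullet> e)\<^sup>2"
    by (simp only: inner_add_left inner_add_right inner_scaleR_left inner_scaleR_right emb_inner emb_inner_emb orth')
      (simp add: power2_eq_square)
  finally show ?thesis by (simp add: norm_eq_sqrt_inner)
qed

lemma continuous_emb [continuous_intros]: "continuous_on S h \<Longrightarrow> continuous_on S (\<lambda>x. emb (h x))"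
  by (rule bounded_linear.continuous_on[OF bounded_linear_emb])

lemma continuous_prj [continuous_intros]: "continuous_on S h \<Longrightarrow> continuous_on S (\<lambda>x. prj (h x))"
  by (rule bounded_linear.continuous_on[OF bounded_linear_prj])

lemma emb_borel [measurable]: "emb \<in> borel_measurable borel"
  by (intro borel_measurable_continuous_onI continuous_emb continuous_on_id)

lemma prj_borel [measurable]: "prj \<in> borel_measurable borel"
  by (intro borel_measurable_continuous_onI continuous_prj continuous_on_id)

definition coord :: "(real^2) \<times> real \<Rightarrow> real^3" where "coord q = emb (fst q) + snd q *\<^sub>R e"

lemma coord_borel [measurable]: "coord \<in> borel_measurable borel"
  unfolding coord_def[abs_def] by (intro borel_measurable_continuous_onI continuous_intros)

lemma coord_borel_pair [measurable]: "coord \<in> borel_measurable (lborel \<Otimes>\<^sub>M lborel)"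
  using coord_borel unfolding lborel_prod by simp

text \<open>\<open>coord\<close> is the canonical identification of plane times line with space,
  followed by an orthogonal map; each is checked on boxes.\<close>

lemma lborel_coord: "(lborel :: (real^3) measure) = distr (lborel \<Otimes>\<^sub>M lborel) borel coord"
proof -
  define can :: "(real^2) \<times> real \<Rightarrow> real^3"
    where "can q = fst q $ 1 *\<^sub>R axis 1 1 + fst q $ 2 *\<^sub>R axis 2 1 + snd q *\<^sub>R axis 3 1" for q
  have can_nth [simp]: "can q $ 1 = fst q $ 1" "can q $ 2 = fst q $ 2" "can q $ 3 = snd q" for q
    by (simp_all add: can_def axis_def)
  have can_borel: "can \<in> borel_measurable borel"
    unfolding can_def[abs_def] by (intro borel_measurable_continuous_onI continuous_intros)
  then have can_meas: "can \<in> measurable (lborel \<Otimes>\<^sub>M lborel) borel"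
    unfolding lborel_prod by simp
  have can: "(lborel :: (real^3) measure) = distr (lborel \<Otimes>\<^sub>M lborel) borel can"
  proof (rule lborel_eqI)
    fix l u :: "real^3" assume le: "\<And>b. b \<in> Basis \<Longrightarrow> l \<bullet> b \<le> u \<bullet> b"
    have le': "l $ 1 \<le> u $ 1" "l $ 2 \<le> u $ 2" "l $ 3 \<le> u $ 3"
      using le[of "axis 1 1"] le[of "axis 2 1"] le[of "axis 3 1"] by (auto simp: Basis_3 inner_axis)
    define l' u' :: "real^2" where "l' = plane_of_pair (l $ 1, l $ 2)" and "u' = plane_of_pair (u $ 1, u $ 2)"
    have vi: "can -` box l u = box l' u' \<times> {l$3<..<u$3}"
      by (auto simp: mem_box_cart forall_2 forall_3 l'_def u'_def)
    have "emeasure (distr (lborel \<Otimes>\<^sub>M lborel) borel can) (box l u)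
        = emeasure (lborel \<Otimes>\<^sub>M lborel) (box l' u' \<times> {l$3<..<u$3})"
      by (subst emeasure_distr[OF can_meas]) (simp_all add: vi space_pair_measure)
    also have "\<dots> = emeasure lborel (box l' u') * emeasure lborel {l$3<..<u$3}"
      by (rule lborel.emeasure_pair_measure_Times) auto
    also have "emeasure lborel (box l' u') = ennreal ((u$1 - l$1) * (u$2 - l$2))"
      using le' by (subst emeasure_lborel_box) (auto simp: Basis_2 inner_axis axis_eq_axis l'_def u'_def)
    also have "\<dots> * emeasure lborel {l$3<..<u$3} = ennreal ((u$1 - l$1) * (u$2 - l$2) * (u$3 - l$3))"
      using le' by (simp add: ennreal_mult)
    also have "\<dots> = ennreal (\<Prod>b\<in>Basis. (u - l) \<bullet> b)"
      using le' by (simp add: Basis_3 axis_eq_axis inner_axis mult.assoc)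
    finally show "emeasure (distr (lborel \<Otimes>\<^sub>M lborel) borel can) (box l u) = (\<Prod>b\<in>Basis. (u - l) \<bullet> b)" .
  qed simp
  define R :: "real^3 \<Rightarrow> real^3" where "R y = y $ 1 *\<^sub>R f1 + y $ 2 *\<^sub>R f2 + y $ 3 *\<^sub>R e" for y
  define R' :: "real^3 \<Rightarrow> real^3"
    where "R' y = (y \<bullet> f1) *\<^sub>R axis 1 1 + (y \<bullet> f2) *\<^sub>R axis 2 1 + (y \<bullet> e) *\<^sub>R axis 3 1" for y
  have R'nth: "R' y $ 1 = y \<bullet> f1" "R' y $ 2 = y \<bullet> f2" "R' y $ 3 = y \<bullet> e" for y
    by (simp_all add: R'_def axis_def)
  have RR: "R (R' y) = y" for y using expand[of y] by (simp add: R_def R'nth)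
  have R'R: "R' (R y) = y" for y by (simp add: vec_eq_iff forall_3 R'nth R_def inner_add_left)
  have linR': "linear R'" by (rule linearI) (simp_all add: R'_def algebra_simps)
  have "R v \<bullet> R w = v \<bullet> w" for v w
  proof -
    have "v \<bullet> w = v $ 1 * w $ 1 + v $ 2 * w $ 2 + v $ 3 * w $ 3" by (simp add: inner_vec_def sum_3)
    then show ?thesis by (simp add: R_def inner_add_left inner_add_right)
  qed
  then have "R' v \<bullet> R' w = v \<bullet> w" for v w by (metis RR)
  then have orthR': "orthogonal_transformation R'" using linR' by (simp add: orthogonal_transformation_def)
  have R_borel: "R \<in> borel_measurable borel"
    unfolding R_def[abs_def] by (intro borel_measurable_continuous_onI continuous_intros)
  have R: "(lborel :: (real^3) measure) = distr lborel borel R"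
  proof (rule lborel_eqI)
    fix l u :: "real^3" assume le: "\<And>b. b \<in> Basis \<Longrightarrow> l \<bullet> b \<le> u \<bullet> b"
    have img: "R -` box l u = R' ` box l u"
    proof (intro set_eqI iffI)
      fix x assume "x \<in> R -` box l u"
      then show "x \<in> R' ` box l u" using R'R[of x] by (intro image_eqI[of _ _ "R x"]) auto
    next
      fix x assume "x \<in> R' ` box l u"
      then show "x \<in> R -` box l u" using RR by auto
    qed
    have lm: "R' ` box l u \<in> lmeasurable" "measure lebesgue (R' ` box l u) = measure lebesgue (box l u)"
      using measurable_orthogonal_image[OF orthR'] measure_orthogonal_image[OF orthR'] by auto
    have sb: "R -` box l u \<in> sets borel" using measurable_sets[OF R_borel, of "box l u"] by simp
    have "emeasure lborel (R -` box l u) = emeasure lebesgue (R' ` box l u)"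
      using sb by (simp add: img)
    also have "\<dots> = ennreal (measure lebesgue (box l u))"
      using emeasure_eq_measure2[OF lm(1)] lm(2) by simp
    also have "\<dots> = emeasure lborel (box l u)"
      by (subst emeasure_eq_measure2[symmetric]) auto
    finally have "emeasure lborel (R -` box l u) = emeasure lborel (box l u)" .
    then show "emeasure (distr lborel borel R) (box l u) = (\<Prod>b\<in>Basis. (u - l) \<bullet> b)"
      using R_borel le by (simp add: emeasure_distr)
  qed simp
  have "coord = R \<circ> can" by (auto simp: fun_eq_iff R_def coord_def emb_def)
  then show ?thesis
    using R can distr_distr[OF R_borel can_meas] by simp
qed

lemma nn_integral_coord:
  assumes [measurable]: "F \<in> borel_measurable borel"
  shows "(\<integral>\<^sup>+y. F y \<partial>lborel) = (\<integral>\<^sup>+z. \<integral>\<^sup>+s. F (emb z + s *\<^sub>R e) \<partial>lborel \<partial>lborel)"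
proof -
  have "(\<integral>\<^sup>+y. F y \<partial>lborel) = (\<integral>\<^sup>+q. F (coord q) \<partial>(lborel \<Otimes>\<^sub>M lborel))"
    by (subst lborel_coord) (simp add: nn_integral_distr)
  also have "\<dots> = (\<integral>\<^sup>+z. \<integral>\<^sup>+s. F (coord (z, s)) \<partial>lborel \<partial>lborel)"
    by (rule lborel.nn_integral_fst[symmetric]) measurable
  finally show ?thesis by (simp add: coord_def)
qed

end

text \<open>The function g is defined on all of space and constant along e, instead of on the plane.
  Its gradient is then a vector of \<open>real^3\<close> orthogonal to e, and the shear and the
  pullbacks can be written without planar coordinates.\<close>

locale graph = frame +
  fixes g :: "real^3 \<Rightarrow> real" and B :: real
  assumes g1: "Ck 1 g" and g_inv: "\<And>x s. g (x + s *\<^sub>R e) = g x" and gB: "\<And>x. norm (grad g x) \<le> B"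
begin

lemma g_deriv: "(g has_derivative (\<lambda>h. grad g x \<bullet> h)) (at x)"
  using has_derivative_grad[of 0 g] g1 by simp

lemma g_cont: "continuous_on UNIV g"
  using Ck_continuous[OF g1] .

lemma grad_g_cont: "continuous_on UNIV (grad g)"
  using Ck_grad[of 0 g] g1 by simp

lemma g_borel [measurable]: "g \<in> borel_measurable borel"
  by (rule borel_measurable_continuous_onI[OF g_cont])

lemma grad_g_borel [measurable]: "grad g \<in> borel_measurable borel"
  by (rule borel_measurable_continuous_onI[OF grad_g_cont])

lemma grad_g_e [simp]: "grad g x \<bullet> e = 0" "e \<bullet> grad g x = 0"
proof -
  have "((\<lambda>s. g (x + s *\<^sub>R e)) has_derivative (\<lambda>s. grad g x \<bullet> (s *\<^sub>R e))) (at 0)"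
    by (rule has_derivative_compose[of "\<lambda>s. x + s *\<^sub>R e" _ 0, where g=g])
      (auto intro!: derivative_eq_intros g_deriv[of "x + 0 *\<^sub>R e", simplified])
  moreover have "((\<lambda>s::real. g x) has_derivative (\<lambda>s. 0)) (at 0)" by simp
  ultimately have "(\<lambda>s. grad g x \<bullet> (s *\<^sub>R e)) = (\<lambda>s. 0)"
    unfolding g_inv by (rule has_derivative_unique)
  from fun_cong[OF this, of 1] show "grad g x \<bullet> e = 0" by simp
  then show "e \<bullet> grad g x = 0" by (simp add: inner_commute)
qed

lemma g_inv_diff: "g (x - s *\<^sub>R e) = g x"
  using g_inv[of x "- s"] by simp

lemma g_emb_prj: "g (emb (prj x)) = g x"
  using g_inv[of "emb (prj x)" "x \<bullet> e"] decompose[of x] by simp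

lemma grad_g_inv: "grad g (x + s *\<^sub>R e) = grad g x"
proof (rule grad_eqI)
  have "((\<lambda>y. g (y + (- s) *\<^sub>R e)) has_derivative (\<lambda>h. grad g x \<bullet> h)) (at (x + s *\<^sub>R e))"
    by (rule has_derivative_compose[of "\<lambda>y. y + (- s) *\<^sub>R e" _ "x + s *\<^sub>R e", where g=g])
      (auto intro!: derivative_eq_intros g_deriv[of x])
  then show "(g has_derivative (\<lambda>h. grad g x \<bullet> h)) (at (x + s *\<^sub>R e))"
    unfolding g_inv .
qed

lemma grad_g_inv_diff: "grad g (x - s *\<^sub>R e) = grad g x"
  using grad_g_inv[of x "- s"] by simp

section \<open>The shear, its inverse and the parametrised graph\<close>

definition up :: "real^3 \<Rightarrow> real^3" where "up y = y + g y *\<^sub>R e"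
definition down :: "real^3 \<Rightarrow> real^3" where "down x = x - g x *\<^sub>R e"
definition par :: "real^2 \<Rightarrow> real^3" where "par z = up (emb z)"
definition jac :: "real^3 \<Rightarrow> real" where "jac y = sqrt (1 + (norm (grad g y))\<^sup>2)"
definition gr :: "(real^3) set" where "gr = {x. x \<bullet> e = g x}"

lemma up_down [simp]: "up (down x) = x" "down (up y) = y"
  by (simp_all add: up_def down_def g_inv g_inv_diff)

lemma down_par [simp]: "down (par z) = emb z" by (simp add: par_def)

lemma up_inner_e: "up y \<bullet> e = y \<bullet> e + g y" and g_up: "g (up y) = g y" and grad_up: "grad g (up y) = grad g y"
  and grad_down: "grad g (down y) = grad g y"
  and down_inner_e: "down y \<bullet> e = y \<bullet> e - g y"
  by (simp_all add: up_def down_def inner_add_left inner_diff_left g_inv g_inv_diff grad_g_inv grad_g_inv_diff)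

lemma continuous_up: "continuous_on UNIV up" and continuous_down: "continuous_on UNIV down"
  unfolding up_def[abs_def] down_def[abs_def] by (intro continuous_intros g_cont)+

lemma up_borel [measurable]: "up \<in> borel_measurable borel" and down_borel [measurable]: "down \<in> borel_measurable borel"
  by (intro borel_measurable_continuous_onI continuous_up continuous_down)+

lemma par_borel [measurable]: "par \<in> borel_measurable borel"
  unfolding par_def[abs_def] by measurable

lemma jac_borel [measurable]: "jac \<in> borel_measurable borel"
  unfolding jac_def[abs_def] by measurable

lemma jac_ge_1: "1 \<le> jac y" by (simp add: jac_def)
lemma jac_pos: "0 < jac y" using jac_ge_1[of y] by linarith

lemma gr_sets [measurable]: "gr \<in> sets borel"
  unfolding gr_def by (intro borel_closed closed_Collect_eq continuous_intros g_cont)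

lemma par_in_gr: "par z \<in> gr"
  by (simp add: gr_def par_def up_inner_e g_up)

lemma prj_par [simp]: "prj (par z) = z" by (simp add: par_def up_def)

lemma par_prj: "x \<in> gr \<Longrightarrow> par (prj x) = x"
  using decompose[of x] by (simp add: gr_def par_def up_def g_emb_prj)

lemma par_image: "par ` W = {x \<in> gr. prj x \<in> W}"
  using par_in_gr par_prj by (force simp: image_iff)

text \<open>On every line parallel to e the shear is a translation.\<close>

lemma nn_integral_up:
  assumes [measurable]: "F \<in> borel_measurable borel"
  shows "(\<integral>\<^sup>+y. F (up y) \<partial>lborel) = (\<integral>\<^sup>+x. F x \<partial>lborel)"
proof -
  have "(\<integral>\<^sup>+y. F (up y) \<partial>lborel) = (\<integral>\<^sup>+z. \<integral>\<^sup>+s. F (up (emb z + s *\<^sub>R e)) \<partial>lborel \<partial>lborel)"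
    by (rule nn_integral_coord) measurable
  also have "\<dots> = (\<integral>\<^sup>+z. \<integral>\<^sup>+s. F (emb z + (s + g (emb z)) *\<^sub>R e) \<partial>lborel \<partial>lborel)"
    by (simp only: up_def g_inv scaleR_add_left add.assoc)
  also have "\<dots> = (\<integral>\<^sup>+z. \<integral>\<^sup>+s. F (emb z + s *\<^sub>R e) \<partial>lborel \<partial>lborel)"
    by (rule nn_integral_cong, rule nn_integral_lborel_translate) measurable
  also have "\<dots> = (\<integral>\<^sup>+x. F x \<partial>lborel)"
    by (rule nn_integral_coord[symmetric]) measurable
  finally show ?thesis .
qed

lemma distr_up: "distr lborel borel up = lborel"
proof (rule measure_eqI)
  fix A assume "A \<in> sets (distr lborel borel up)"
  then have A [measurable]: "A \<in> sets borel" by simp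
  have "(\<integral>\<^sup>+y. indicator A (up y) \<partial>lborel) = (\<integral>\<^sup>+y. indicator (up -` A) y \<partial>lborel)"
    by (simp add: indicator_def)
  also have "\<dots> = emeasure lborel (up -` A)"
    using measurable_sets[OF up_borel A] by (intro nn_integral_indicator) simp
  finally have "emeasure lborel (up -` A) = emeasure lborel A"
    using nn_integral_up[of "indicator A"] A by simp
  then show "emeasure (distr lborel borel up) A = emeasure lborel A"
    using A by (simp add: emeasure_distr)
qed simp

lemma integral_up:
  fixes F :: "real^3 \<Rightarrow> 'b::{banach, second_countable_topology}"
  assumes [measurable]: "F \<in> borel_measurable borel"
  shows "(\<integral>y. F (up y) \<partial>lborel) = (\<integral>x. F x \<partial>lborel)"
  by (subst (2) distr_up[symmetric]) (simp add: integral_distr)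


section \<open>The area formula for the graph\<close>

definition tan_map :: "real^3 \<Rightarrow> real^2 \<Rightarrow> real^2" where
  "tan_map y h = (let a = grad g y \<bullet> f1; b = grad g y \<bullet> f2; c = sqrt (1 + a\<^sup>2) in
     plane_of_pair (c * h $ 1 + a * b / c * h $ 2, jac y / c * h $ 2))"

lemma grad_g_norm: "(norm (grad g y))\<^sup>2 = (grad g y \<bullet> f1)\<^sup>2 + (grad g y \<bullet> f2)\<^sup>2"
proof -
  have "grad g y = emb (prj (grad g y))" using decompose[of "grad g y"] by simp
  then have "(norm (grad g y))\<^sup>2 = (norm (prj (grad g y)))\<^sup>2" by (metis norm_emb)
  also have "\<dots> = (grad g y \<bullet> f1)\<^sup>2 + (grad g y \<bullet> f2)\<^sup>2"
    by (simp add: norm_sq_real2)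
  finally show ?thesis .
qed

lemma linear_tan_map: "linear (tan_map y)"
  by (rule linearI) (simp_all add: tan_map_def Let_def vec_eq_iff forall_2 algebra_simps add_divide_distrib)

text \<open>\<^term>\<open>tan_map\<close> is a Cholesky factor of the first fundamental form of the graph.\<close>

lemma norm_tan_map: "norm (tan_map y h) = norm (emb h + (grad g y \<bullet> emb h) *\<^sub>R e)"
proof -
  define a b c where "a = grad g y \<bullet> f1" and "b = grad g y \<bullet> f2" and "c = sqrt (1 + a\<^sup>2)"
  have c: "c > 0" "c\<^sup>2 = 1 + a\<^sup>2" by (auto simp: c_def add_pos_nonneg)
  have j: "(jac y)\<^sup>2 = 1 + a\<^sup>2 + b\<^sup>2" by (simp add: jac_def grad_g_norm a_def b_def)
  have gh: "grad g y \<bullet> emb h = a * h $ 1 + b * h $ 2"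
    by (simp add: emb_def inner_add_right a_def b_def)
  have "(norm (tan_map y h))\<^sup>2 = (c * h $ 1 + a * b / c * h $ 2)\<^sup>2 + (jac y / c * h $ 2)\<^sup>2"
    by (simp add: norm_sq_real2 tan_map_def Let_def a_def b_def c_def)
  also have "\<dots> = c\<^sup>2 * (h $ 1)\<^sup>2 + 2 * a * b * h $ 1 * h $ 2 + (a\<^sup>2 * b\<^sup>2 + (jac y)\<^sup>2) / c\<^sup>2 * (h $ 2)\<^sup>2"
    using c(1) by (simp add: field_simps power2_eq_square)
  also have "(a\<^sup>2 * b\<^sup>2 + (jac y)\<^sup>2) / c\<^sup>2 = 1 + b\<^sup>2"
  proof -
    have "a\<^sup>2 * b\<^sup>2 + (1 + a\<^sup>2 + b\<^sup>2) = (1 + b\<^sup>2) * (1 + a\<^sup>2)" by algebra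
    moreover have "1 + a\<^sup>2 \<noteq> 0" using c by (metis power_eq_0_iff less_irrefl)
    ultimately show ?thesis unfolding j c(2) by simp
  qed
  also have "c\<^sup>2 * (h $ 1)\<^sup>2 + 2 * a * b * h $ 1 * h $ 2 + (1 + b\<^sup>2) * (h $ 2)\<^sup>2
      = (h $ 1)\<^sup>2 + (h $ 2)\<^sup>2 + (a * h $ 1 + b * h $ 2)\<^sup>2"
    unfolding c(2) by algebra
  also have "\<dots> = (norm (emb h + (grad g y \<bullet> emb h) *\<^sub>R e))\<^sup>2"
    unfolding power2_norm_eq_inner
    by (simp add: inner_add_left inner_add_right emb_inner_emb gh inner_real2 power2_eq_square)
  finally show ?thesis by (simp add: power2_eq_iff_nonneg)
qed

lemma norm_tan_map_ge: "norm h \<le> norm (tan_map y h)"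
proof -
  have "norm h = norm (prj (emb h + (grad g y \<bullet> emb h) *\<^sub>R e))" by simp
  also have "\<dots> \<le> norm (tan_map y h)" unfolding norm_tan_map by (rule norm_prj_le)
  finally show ?thesis .
qed

lemma det_tan_map: "det (matrix (tan_map y)) = jac y"
proof -
  have "sqrt (1 + (grad g y \<bullet> f1)\<^sup>2) \<noteq> 0" by (metis add_pos_nonneg less_irrefl real_sqrt_eq_zero_cancel_iff zero_le_power2 zero_less_one)
  then show ?thesis
    by (simp add: det_2 matrix_def tan_map_def Let_def axis_def)
qed

text \<open>\<open>tan_map\<close> has the lengths of the tangent map but takes values in
  \<open>real^2\<close>, where Hausdorff measure is already known to be Lebesgue measure and the
  determinant formula applies.\<close>

lemma hausdorff_tan_map:
  assumes W: "W \<in> sets borel" "bounded W"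
  shows "hausdorff_outer 2 (tan_map y ` W) = ennreal (jac y) * emeasure lborel W"
proof -
  have inj: "inj (tan_map y)"
  proof (rule linear_injective_0[THEN iffD2, OF linear_tan_map], intro allI impI)
    fix h assume "tan_map y h = 0"
    then show "h = 0" using norm_tan_map_ge[of h y] by simp
  qed
  obtain T where T: "linear T" "\<And>h. T (tan_map y h) = h" "\<And>h. tan_map y (T h) = h"
    using linear_injective_isomorphism[OF linear_tan_map inj] by auto
  have "T \<in> borel_measurable borel"
    using T(1) by (intro borel_measurable_continuous_onI linear_continuous_on) (simp add: linear_conv_bounded_linear)
  from measurable_sets[OF this W(1)] have "T -` W \<in> sets borel" by simp
  moreover have "tan_map y ` W = T -` W" by (auto simp: T(2)) (metis T(3) image_eqI)
  ultimately have m: "tan_map y ` W \<in> sets borel" by simp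
  have Wl: "W \<in> lmeasurable" using W by (simp add: bounded_set_imp_lmeasurable)
  have "tan_map y ` W \<in> lmeasurable" by (rule measurable_linear_image[OF linear_tan_map Wl])
  then have "emeasure lebesgue (tan_map y ` W) = ennreal (measure lebesgue (tan_map y ` W))"
    by (rule emeasure_eq_measure2)
  also have "\<dots> = ennreal (jac y * measure lebesgue W)"
    using measure_linear_image[OF linear_tan_map Wl] jac_pos[of y] by (simp add: det_tan_map)
  also have "\<dots> = ennreal (jac y) * emeasure lebesgue W"
    using jac_pos[of y] emeasure_eq_measure2[OF Wl] by (simp add: ennreal_mult)
  finally show ?thesis using m W by (simp add: hausdorff_outer_plane)
qed

text \<open>Near a the parametrisation distorts distances almost exactly as the linear map
  \<open>tan_map (emb a)\<close> does, so comparing the two becomes a matter of Lipschitz constants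
  close to 1.\<close>

lemma par_local:
  assumes t: "0 < t"
  obtains r where "0 < r" "\<And>x y. x \<in> ball a r \<Longrightarrow> y \<in> ball a r \<Longrightarrow>
      \<bar>dist (par x) (par y) - dist (tan_map (emb a) x) (tan_map (emb a) y)\<bar> \<le> t * dist (tan_map (emb a) x) (tan_map (emb a) y)"
    "\<And>x. x \<in> ball a r \<Longrightarrow> \<bar>jac (emb x) - jac (emb a)\<bar> \<le> t * jac (emb a)"
proof -
  let ?L = "\<lambda>h. emb h + (grad g (emb a) \<bullet> emb h) *\<^sub>R e"
  have c1: "isCont (\<lambda>x. grad g (emb x)) a" and c2: "isCont (\<lambda>x. jac (emb x)) a"
  proof -
    have "continuous_on UNIV (\<lambda>x. grad g (emb x))"
      by (rule continuous_on_compose2[OF grad_g_cont]) (auto intro: continuous_intros)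
    then show "isCont (\<lambda>x. grad g (emb x)) a" by (simp add: continuous_on_eq_continuous_at)
    then show "isCont (\<lambda>x. jac (emb x)) a" unfolding jac_def by (intro continuous_intros) 
  qed
  obtain r1 where r1: "r1 > 0" "\<And>x. dist x a < r1 \<Longrightarrow> dist (grad g (emb x)) (grad g (emb a)) < t"
    using c1 t unfolding continuous_at_eps_delta by blast
  obtain r2 where r2: "r2 > 0" "\<And>x. dist x a < r2 \<Longrightarrow> dist (jac (emb x)) (jac (emb a)) < t"
    using c2 t unfolding continuous_at_eps_delta by blast
  show ?thesis
  proof
    show "0 < min r1 r2" using r1 r2 by simp
    fix x assume x: "x \<in> ball a (min r1 r2)"
    show "\<bar>jac (emb x) - jac (emb a)\<bar> \<le> t * jac (emb a)"
    proof -
      have "\<bar>jac (emb x) - jac (emb a)\<bar> \<le> t * 1"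
        using r2(2)[of x] x by (simp add: dist_real_def dist_commute)
      also have "\<dots> \<le> t * jac (emb a)" using t jac_ge_1 by (intro mult_left_mono) auto
      finally show ?thesis .
    qed
    fix y assume y: "y \<in> ball a (min r1 r2)"
    \<comment> \<open>The parametrisation and its linearisation differ only in the direction e, by
      increments of g minus its tangent plane; on the ball that function has gradient at most
      t.\<close>
    let ?q = "\<lambda>z. g (emb z) - grad g (emb a) \<bullet> emb z"
    have "norm (?q x - ?q y) \<le> t * norm (x - y)"
    proof (rule differentiable_bound[where S="ball a (min r1 r2)" and f'="\<lambda>z h. (grad g (emb z) - grad g (emb a)) \<bullet> emb h"])
      fix z assume z: "z \<in> ball a (min r1 r2)"
      have "((\<lambda>z. g (emb z)) has_derivative (\<lambda>h. grad g (emb z) \<bullet> emb h)) (at z)"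
        by (rule has_derivative_compose[OF bounded_linear_imp_has_derivative[OF bounded_linear_emb] g_deriv])
      then have "(?q has_derivative (\<lambda>h. grad g (emb z) \<bullet> emb h - grad g (emb a) \<bullet> emb h)) (at z)"
        by (intro has_derivative_diff has_derivative_inner_right bounded_linear_imp_has_derivative bounded_linear_emb)
      then show "(?q has_derivative (\<lambda>h. (grad g (emb z) - grad g (emb a)) \<bullet> emb h)) (at z within ball a (min r1 r2))"
        unfolding inner_diff_left by (rule has_derivative_at_withinI)
      have le: "norm (grad g (emb z) - grad g (emb a)) \<le> t"
        using r1(2)[of z] z by (simp add: dist_norm dist_commute norm_minus_commute)
      show "onorm (\<lambda>h. (grad g (emb z) - grad g (emb a)) \<bullet> emb h) \<le> t"
      proof (rule onorm_bound)
        fix h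
        have "norm ((grad g (emb z) - grad g (emb a)) \<bullet> emb h) \<le> norm (grad g (emb z) - grad g (emb a)) * norm (emb h)"
          unfolding real_norm_def by (rule Cauchy_Schwarz_ineq2)
        also have "\<dots> \<le> t * norm h" using le by (simp add: mult_right_mono)
        finally show "norm ((grad g (emb z) - grad g (emb a)) \<bullet> emb h) \<le> t * norm h" .
      qed (use t in simp)
    qed (use x y in auto)
    then have q: "\<bar>?q x - ?q y\<bar> \<le> t * norm (x - y)" by simp
    have "(par x - par y) - ?L (x - y) = (?q x - ?q y) *\<^sub>R e"
      by (simp add: par_def up_def emb_diff inner_diff_right algebra_simps)
    then have "norm ((par x - par y) - ?L (x - y)) = \<bar>?q x - ?q y\<bar>" by (simp only: norm_scaleR norm_e mult_1_right)
    moreover have "t * norm (x - y) \<le> t * norm (tan_map (emb a) (x - y))"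
      using t by (intro mult_left_mono norm_tan_map_ge) auto
    ultimately have "norm ((par x - par y) - ?L (x - y)) \<le> t * norm (tan_map (emb a) (x - y))"
      using q by linarith
    moreover have tm: "tan_map (emb a) (x - y) = tan_map (emb a) x - tan_map (emb a) y"
      by (rule linear_diff[OF linear_tan_map])
    ultimately show "\<bar>dist (par x) (par y) - dist (tan_map (emb a) x) (tan_map (emb a) y)\<bar>
        \<le> t * dist (tan_map (emb a) x) (tan_map (emb a) y)"
      unfolding dist_norm tm[symmetric] using norm_triangle_ineq3[of "par x - par y" "?L (x - y)"] norm_tan_map[of "emb a" "x - y"]
      by linarith
  qed
qed

text \<open>Factor \<open>par\<close> through \<open>tan_map (emb a)\<close>: both transition maps
  are nearly isometric, and \<open>jac\<close> is nearly constant on the ball.\<close>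

lemma area_local:
  assumes q: "1 < q"
  obtains r where "0 < r" "\<And>W. W \<in> sets borel \<Longrightarrow> W \<subseteq> ball a r \<Longrightarrow>
      hausdorff_outer 2 (par ` W) \<le> ennreal q * (\<integral>\<^sup>+z\<in>W. ennreal (jac (emb z)) \<partial>lborel) \<and>
      (\<integral>\<^sup>+z\<in>W. ennreal (jac (emb z)) \<partial>lborel) \<le> ennreal q * hausdorff_outer 2 (par ` W)"
proof -
  \<comment> \<open>A single t must absorb the squared Lipschitz constants and the oscillation of
    \<open>jac\<close>. The two products that arise are bounded by q in \<open>q1\<close>
    below.\<close>
  have "((\<lambda>t. ((1 + t) / (1 - t))\<^sup>2) \<longlongrightarrow> ((1 + 0) / (1 - 0))\<^sup>2) (at_right (0::real))"
    by (intro tendsto_intros) auto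
  then have "eventually (\<lambda>t. ((1 + t) / (1 - t))\<^sup>2 < q) (at_right 0)"
    by (rule order_tendstoD) (use q in auto)
  moreover have "eventually (\<lambda>t::real. 0 < t \<and> t < 1) (at_right 0)"
    unfolding eventually_at_right_field by (intro exI[of _ 1]) auto
  ultimately have "eventually (\<lambda>t::real. ((1 + t) / (1 - t))\<^sup>2 < q \<and> 0 < t \<and> t < 1) (at_right 0)"
    by (rule eventually_conj)
  then obtain t :: real where t: "((1 + t) / (1 - t))\<^sup>2 < q" "0 < t" "t < 1"
    using eventually_happens[of _ "at_right (0::real)"] by (auto simp: trivial_limit_at_right_real)
  let ?T = "tan_map (emb a)" and ?c = "jac (emb a)"
  obtain r where r: "0 < r" and dd: "\<And>x y. x \<in> ball a r \<Longrightarrow> y \<in> ball a r \<Longrightarrow>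
      \<bar>dist (par x) (par y) - dist (?T x) (?T y)\<bar> \<le> t * dist (?T x) (?T y)"
    and jj: "\<And>x. x \<in> ball a r \<Longrightarrow> \<bar>jac (emb x) - ?c\<bar> \<le> t * ?c"
    by (rule par_local[OF t(2), of a]) (rule that)
  show ?thesis
  proof
    show "0 < r" by fact
    fix W :: "(real^2) set" assume W [measurable]: "W \<in> sets borel" and Wr: "W \<subseteq> ball a r"
    have bW: "bounded W" using Wr bounded_ball bounded_subset by blast
    let ?H = "hausdorff_outer 2 (par ` W)" and ?I = "\<integral>\<^sup>+z\<in>W. ennreal (jac (emb z)) \<partial>lborel"
      and ?l = "emeasure lborel W"
    have HT: "hausdorff_outer 2 (?T ` W) = ennreal ?c * ?l" by (rule hausdorff_tan_map[OF W bW])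
    have inj: "x = y" if "?T x = ?T y" for x y
    proof -
      have "?T (x - y) = 0" using linear_diff[OF linear_tan_map, of "emb a" x y] that by simp
      then show ?thesis using norm_tan_map_ge[of "x - y" "emb a"] by simp
    qed
    have im1: "par ` W = (\<lambda>w. par (inv ?T w)) ` (?T ` W)"
      unfolding image_image using inj by (simp add: inv_f_f inj_def)
    have h1: "?H \<le> ennreal ((1 + t) powr 2) * (ennreal ?c * ?l)"
      unfolding HT[symmetric] im1
    proof (rule hausdorff_outer_lipschitz)
      fix u v assume "u \<in> ?T ` W" "v \<in> ?T ` W"
      then obtain x y where xy: "x \<in> W" "y \<in> W" "u = ?T x" "v = ?T y" by blast
      have "inv ?T (?T x) = x" "inv ?T (?T y) = y" using inj by (simp_all add: inv_f_f inj_def)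
      then show "dist (par (inv ?T u)) (par (inv ?T v)) \<le> (1 + t) * dist u v"
      proof -
        have "x \<in> ball a r" "y \<in> ball a r" using xy Wr by auto
        from dd[OF this] have "dist (par x) (par y) \<le> (1 + t) * dist (?T x) (?T y)"
          by (simp add: distrib_right abs_le_iff)
        then show ?thesis using xy \<open>inv ?T (?T x) = x\<close> \<open>inv ?T (?T y) = y\<close> by simp
      qed
    qed (use t in auto)
    have im2: "?T ` W = (\<lambda>x. ?T (prj x)) ` (par ` W)" unfolding image_image by simp
    have h2: "ennreal ?c * ?l \<le> ennreal ((1 / (1 - t)) powr 2) * ?H"
      unfolding HT[symmetric] im2
    proof (rule hausdorff_outer_lipschitz)
      fix u v assume "u \<in> par ` W" "v \<in> par ` W"
      then obtain x y where xy: "x \<in> W" "y \<in> W" "u = par x" "v = par y" by blast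
      have "(1 - t) * dist (?T x) (?T y) \<le> dist u v"
      proof -
        have "x \<in> ball a r" "y \<in> ball a r" using xy Wr by auto
        from dd[OF this] show ?thesis by (simp add: xy left_diff_distrib abs_le_iff)
      qed
      then show "dist (?T (prj u)) (?T (prj v)) \<le> 1 / (1 - t) * dist u v"
        using t xy by (simp add: field_simps)
    qed (use t in auto)
    have i1: "?I \<le> ennreal ((1 + t) * ?c) * ?l"
    proof -
      have "?I \<le> (\<integral>\<^sup>+z. ennreal ((1 + t) * ?c) * indicator W z \<partial>lborel)"
        using jj Wr by (intro nn_integral_mono) (auto simp: indicator_def algebra_simps abs_le_iff intro!: ennreal_leI)
      then show ?thesis by (simp add: nn_integral_cmult_indicator)
    qed
    have i2: "ennreal ((1 - t) * ?c) * ?l \<le> ?I"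
    proof -
      have "(\<integral>\<^sup>+z. ennreal ((1 - t) * ?c) * indicator W z \<partial>lborel) \<le> ?I"
        using jj Wr by (intro nn_integral_mono) (auto simp: indicator_def algebra_simps abs_le_iff intro!: ennreal_leI)
      then show ?thesis by (simp add: nn_integral_cmult_indicator)
    qed
    have c0: "0 \<le> ?c" using jac_pos less_imp_le by blast
    have q1: "(1 + t)\<^sup>2 \<le> q * (1 - t)" "(1 + t) * (1 / (1 - t))\<^sup>2 \<le> q"
    proof -
      have a: "(1 + t)\<^sup>2 \<le> q * (1 - t)\<^sup>2" using t by (simp add: power_divide divide_less_eq less_imp_le)
      have "q * (1 - t)\<^sup>2 \<le> q * (1 - t)"
        using t q by (intro mult_left_mono) (auto simp: power2_eq_square mult_le_cancel_right1)
      then show "(1 + t)\<^sup>2 \<le> q * (1 - t)" using a by linarith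
      have "1 + t \<le> (1 + t)\<^sup>2" using t by (simp add: power2_eq_square)
      then have "1 + t \<le> q * (1 - t)\<^sup>2" using a by linarith
      then show "(1 + t) * (1 / (1 - t))\<^sup>2 \<le> q" using t by (simp add: power_divide divide_le_eq)
    qed
    have "?H \<le> ennreal ((1 + t)\<^sup>2 * ?c) * ?l"
      using h1 t c0 by (simp add: ennreal_mult mult.assoc powr_numeral)
    also have "\<dots> \<le> ennreal (q * ((1 - t) * ?c)) * ?l"
      using mult_right_mono[OF q1(1) c0] by (intro mult_right_mono ennreal_leI) (auto simp: mult.assoc)
    also have "\<dots> = ennreal q * (ennreal ((1 - t) * ?c) * ?l)"
      using t q c0 by (subst ennreal_mult) (auto simp: mult.assoc)
    also have "\<dots> \<le> ennreal q * ?I" by (intro mult_left_mono i2) simp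
    finally have A: "?H \<le> ennreal q * ?I" .
    have "?I \<le> ennreal (1 + t) * (ennreal ?c * ?l)"
      using i1 t c0 by (simp add: ennreal_mult mult.assoc)
    also have "\<dots> \<le> ennreal (1 + t) * (ennreal ((1 / (1 - t)) powr 2) * ?H)"
      by (intro mult_left_mono h2) simp
    also have "\<dots> = ennreal ((1 + t) * (1 / (1 - t))\<^sup>2) * ?H"
      using t by (subst ennreal_mult) (auto simp: mult.assoc powr_numeral)
    also have "\<dots> \<le> ennreal q * ?H" by (intro mult_right_mono ennreal_leI q1) simp
    finally show "?H \<le> ennreal q * ?I \<and> ?I \<le> ennreal q * ?H" using A by blast
  qed
qed

text \<open>By Lindelof every Borel set splits into countably many pieces, each inside a ball of
  \<open>area_local\<close>. Summation keeps the factor q, and q > 1 is arbitrary.\<close>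

lemma area_measure:
  "distr (density (hausdorff_measure 2) (indicator gr)) borel prj = density lborel (\<lambda>z. ennreal (jac (emb z)))"
  (is "?M1 = ?M2")
proof (rule measure_eqI)
  have e1: "emeasure ?M1 W = hausdorff_outer 2 (par ` W)" if [measurable]: "W \<in> sets borel" for W
  proof -
    have m: "prj -` W \<in> sets borel" using measurable_sets[OF prj_borel that] by simp
    then have "emeasure ?M1 W = (\<integral>\<^sup>+x. indicator gr x * indicator (prj -` W) x \<partial>hausdorff_measure 2)"
      by (subst emeasure_distr) (auto simp: emeasure_density)
    also have "\<dots> = (\<integral>\<^sup>+x. indicator (gr \<inter> prj -` W) x \<partial>hausdorff_measure 2)"
      by (intro nn_integral_cong) (simp add: indicator_inter_arith)
    also have "\<dots> = hausdorff_outer 2 (gr \<inter> prj -` W)"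
      using m gr_sets by (subst nn_integral_indicator) (auto simp: emeasure_hausdorff_measure)
    also have "gr \<inter> prj -` W = par ` W" by (auto simp: par_image)
    finally show ?thesis .
  qed
  have e2: "emeasure ?M2 W = (\<integral>\<^sup>+z\<in>W. ennreal (jac (emb z)) \<partial>lborel)" if "W \<in> sets borel" for W
    using that by (simp add: emeasure_density)
  show "sets ?M1 = sets ?M2" by simp
  fix W assume "W \<in> sets ?M1"
  then have W: "W \<in> sets borel" by simp
  have comp: "emeasure ?M1 W \<le> ennreal q * emeasure ?M2 W \<and> emeasure ?M2 W \<le> ennreal q * emeasure ?M1 W" if q: "1 < q" for q
  proof -
    define Q where "Q W \<longleftrightarrow> emeasure ?M1 W \<le> ennreal q * emeasure ?M2 W \<and> emeasure ?M2 W \<le> ennreal q * emeasure ?M1 W" for W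
    have "\<exists>r>0. \<forall>W. W \<in> sets borel \<longrightarrow> W \<subseteq> ball a r \<longrightarrow> Q W" for a
      by (rule area_local[OF q, of a]) (use e1 e2 in \<open>auto simp: Q_def\<close>)
    then obtain r where r: "\<And>a. 0 < r a" "\<And>a W. W \<in> sets borel \<Longrightarrow> W \<subseteq> ball a (r a) \<Longrightarrow> Q W"
      by metis
    obtain F where F: "F \<subseteq> range (\<lambda>a. ball a (r a))" "countable F" "\<Union>F = \<Union>(range (\<lambda>a. ball a (r a)))"
      using Lindelof[of "range (\<lambda>a. ball a (r a))"] by auto
    have UF: "\<Union>F = UNIV"
    proof (intro set_eqI iffI UNIV_I)
      fix x :: "real^2"
      have "x \<in> ball x (r x)" using r(1) by simp
      then show "x \<in> \<Union>F" unfolding F(3) by blast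
    qed
    then have "F \<noteq> {}" by auto
    define S where "S n = from_nat_into F n" for n
    have S: "\<exists>a. S n = ball a (r a)" for n
      using subsetD[OF F(1) from_nat_into[OF \<open>F \<noteq> {}\<close>, of n]] unfolding S_def image_iff by simp
    have US: "(\<Union>n. S n) = UNIV" unfolding S_def using UF range_from_nat_into[OF \<open>F \<noteq> {}\<close> F(2)] by simp
    define D where "D n = W \<inter> disjointed S n" for n
    have Sb: "S n \<in> sets borel" for n using S[of n] by auto
    have Db: "D n \<in> sets borel" for n
      unfolding D_def disjointed_def using W Sb by (intro sets.Int sets.Diff sets.finite_UN) auto
    have DS: "D n \<subseteq> S n" for n unfolding D_def disjointed_def by auto
    have disj: "disjoint_family D" using disjoint_family_disjointed[of S] by (auto simp: D_def disjoint_family_on_def)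
    have UD: "(\<Union>n. D n) = W" using UN_disjointed_eq[of S] US by (auto simp: D_def)
    have Dr: "range D \<subseteq> sets borel" using Db by blast
    have sum1: "emeasure ?M1 W = (\<Sum>n. emeasure ?M1 (D n))"
      using suminf_emeasure[of D ?M1] Dr disj UD by simp
    have sum2: "emeasure ?M2 W = (\<Sum>n. emeasure ?M2 (D n))"
      using suminf_emeasure[of D ?M2] Dr disj UD by simp
    have loc: "emeasure ?M1 (D n) \<le> ennreal q * emeasure ?M2 (D n)" "emeasure ?M2 (D n) \<le> ennreal q * emeasure ?M1 (D n)" for n
      using S[of n] r(2)[OF Db[of n]] DS[of n] unfolding Q_def by auto
    have "emeasure ?M1 W \<le> (\<Sum>n. ennreal q * emeasure ?M2 (D n))" unfolding sum1 by (intro suminf_le loc summableI)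
    moreover have "emeasure ?M2 W \<le> (\<Sum>n. ennreal q * emeasure ?M1 (D n))" unfolding sum2 by (intro suminf_le loc summableI)
    ultimately show ?thesis unfolding sum1 sum2 by simp
  qed
  have le: "x \<le> y" if "\<And>q. 1 < q \<Longrightarrow> x \<le> ennreal q * y" for x y :: ennreal
  proof (cases y)
    case (real b)
    show ?thesis
    proof (rule ennreal_le_epsilon)
      fix e' :: real assume e': "0 < e'"
      have "x \<le> ennreal (1 + e' / (b + 1)) * ennreal b" using that[of "1 + e' / (b + 1)"] e' real by simp
      also have "\<dots> = ennreal (b + e' * b / (b + 1))" using e' real by (simp add: ennreal_mult[symmetric] algebra_simps)
      also have "\<dots> \<le> ennreal (b + e')" using e' real by (intro ennreal_leI) (simp add: field_simps)
      finally show "x \<le> y + ennreal e'" using real e' by simp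
    qed
  qed simp
  show "emeasure ?M1 W = emeasure ?M2 W"
  proof (rule antisym)
    show "emeasure ?M1 W \<le> emeasure ?M2 W" by (rule le) (use comp in blast)
    show "emeasure ?M2 W \<le> emeasure ?M1 W" by (rule le) (use comp in blast)
  qed
qed

lemma nn_integral_gr:
  assumes [measurable]: "h \<in> borel_measurable borel"
  shows "(\<integral>\<^sup>+x. indicator gr x * h x \<partial>hausdorff_measure 2) = (\<integral>\<^sup>+z. ennreal (jac (emb z)) * h (par z) \<partial>lborel)"
proof -
  have "(\<integral>\<^sup>+x. indicator gr x * h x \<partial>hausdorff_measure 2) = (\<integral>\<^sup>+x. indicator gr x * h (par (prj x)) \<partial>hausdorff_measure 2)"
    by (intro nn_integral_cong) (auto simp: indicator_def par_prj)
  also have "\<dots> = (\<integral>\<^sup>+z. h (par z) \<partial>distr (density (hausdorff_measure 2) (indicator gr)) borel prj)"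
    by (subst nn_integral_distr) (auto simp: nn_integral_density)
  also have "\<dots> = (\<integral>\<^sup>+z. ennreal (jac (emb z)) * h (par z) \<partial>lborel)"
    unfolding area_measure by (subst nn_integral_density) auto
  finally show ?thesis .
qed

lemma integral_gr:
  fixes h :: "real^3 \<Rightarrow> 'b::{banach, second_countable_topology}"
  assumes [measurable]: "h \<in> borel_measurable borel"
  shows "(\<integral>x. indicator gr x *\<^sub>R h x \<partial>hausdorff_measure 2) = (\<integral>z. jac (emb z) *\<^sub>R h (par z) \<partial>lborel)"
proof -
  have "(\<integral>x. indicator gr x *\<^sub>R h x \<partial>hausdorff_measure 2) = (\<integral>x. indicator gr x *\<^sub>R h (par (prj x)) \<partial>hausdorff_measure 2)"
    by (intro Bochner_Integration.integral_cong) (auto simp: indicator_def par_prj)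
  also have "\<dots> = (\<integral>z. h (par z) \<partial>distr (density (hausdorff_measure 2) (\<lambda>x. ennreal (indicator gr x))) borel prj)"
    by (subst integral_distr, simp, simp) (subst integral_density, auto)
  also have "\<dots> = (\<integral>z. jac (emb z) *\<^sub>R h (par z) \<partial>lborel)"
    unfolding ennreal_indicator area_measure by (subst integral_density) (auto simp: less_imp_le[OF jac_pos])
  finally show ?thesis .
qed

end

section \<open>Curl identities\<close>

lemma norm_cross3_le: "norm (cross3 x y) \<le> norm x * norm y"
proof -
  have "(norm (cross3 x y))\<^sup>2 \<le> (norm x * norm y)\<^sup>2"
    using norm_cross_dot[of x y] by (metis le_add_same_cancel1 zero_le_power2)
  then show ?thesis by (rule power2_le_imp_le) simp
qed

lemma bounded_bilinear_cross3: "bounded_bilinear cross3"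
  using bilinear_cross by (simp add: bilinear_conv_bounded_bilinear)

lemmas bounded_linear_cross3_left = bounded_bilinear.bounded_linear_left[OF bounded_bilinear_cross3]
  and bounded_linear_cross3_right = bounded_bilinear.bounded_linear_right[OF bounded_bilinear_cross3]
  and Ck_cross3 = Ck_bilinear[OF bounded_bilinear_cross3]

lemma cross3_borel [measurable]:
  "f \<in> borel_measurable M \<Longrightarrow> h \<in> borel_measurable M \<Longrightarrow> (\<lambda>x. cross3 (f x) (h x)) \<in> borel_measurable M"
  by (rule borel_measurable_continuous_Pair)
    (auto intro!: bounded_bilinear.continuous_on[OF bounded_bilinear_cross3] continuous_intros)

lemma vec3_eqI: "a $ 1 = b $ 1 \<Longrightarrow> a $ 2 = b $ 2 \<Longrightarrow> a $ 3 = b $ 3 \<Longrightarrow> a = b" for a b :: "real^3"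
  by (simp add: vec_eq_iff forall_3)

lemma inner_axis_1: "a \<bullet> axis j (1::real) = a $ j"
  by (simp add: inner_axis)

text \<open>The curl as the sum of the cross products of the basis vectors with the directional
  derivatives. It is valid for any derivative D at the point and is the form from which the curl
  rules below follow by vector algebra.\<close>

lemma curl_cross:
  assumes "(F has_derivative D) (at x)"
  shows "curl F x = cross3 (axis 1 1) (D (axis 1 1)) + cross3 (axis 2 1) (D (axis 2 1)) + cross3 (axis 3 1) (D (axis 3 1))"
  unfolding curl_def partial_def frechet_derivative_at[OF assms, symmetric]
  by (rule vec3_eqI) (simp_all add: cross3_def axis_def)

lemma curl_scaleR_const_plus:
  fixes \<psi> :: "real^3 \<Rightarrow> real"
  assumes psi: "(\<psi> has_derivative (\<lambda>h. a \<bullet> h)) (at x)" and F: "(F has_derivative D) (at x)"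
  shows "curl (\<lambda>y. \<psi> y *\<^sub>R F y) x = \<psi> x *\<^sub>R curl F x + cross3 a (F x)"
proof -
  have d: "((\<lambda>y. \<psi> y *\<^sub>R F y) has_derivative (\<lambda>h. \<psi> x *\<^sub>R D h + (a \<bullet> h) *\<^sub>R F x)) (at x)"
    by (rule has_derivative_scaleR[OF psi F])
  show ?thesis
    unfolding curl_cross[OF d] curl_cross[OF F]
    by (rule vec3_eqI) (simp_all add: cross3_def axis_def inner_vec_def sum_3 algebra_simps)
qed

lemma curl_const: "curl (\<lambda>x. c) x = 0"
  by (subst curl_cross[of _ "\<lambda>_. 0"]) auto

lemma Cinf_curl: "Cinf F \<Longrightarrow> continuous_on UNIV (curl F)"
proof -
  assume F: "Cinf F"
  have d: "curl F x = cross3 (axis 1 1) (frechet_derivative F (at x) (axis 1 1))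
      + cross3 (axis 2 1) (frechet_derivative F (at x) (axis 2 1)) + cross3 (axis 3 1) (frechet_derivative F (at x) (axis 3 1))" for x
    by (rule curl_cross[OF Cinf_has_derivative[OF F]])
  have c: "continuous_on UNIV (\<lambda>x. frechet_derivative F (at x) (axis j 1))" for j
    by (rule Cinf_continuous[OF Cinf_partial[OF F]]) (auto simp: Basis_vec_def)
  show ?thesis unfolding d[abs_def]
    by (intro continuous_on_add continuous_on_cross continuous_on_const c)
qed

lemma integrable_kernel_cross:
  assumes k: "Cinf k" "\<And>z. R < norm z \<Longrightarrow> k z = 0" and u: "loc_integrable u"
  shows "integrable lborel (\<lambda>y. cross3 (u y) (grad k (y - x)))"
proof -
  have "integrable lborel (\<lambda>y. (grad k (y - x) \<bullet> axis j 1) *\<^sub>R u y)" for j :: 3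
  proof (rule integrable_kernel[OF _ _ u])
    show "continuous_on UNIV (\<lambda>z. grad k z \<bullet> axis j 1)"
      by (intro continuous_on_inner Cinf_continuous[OF Cinf_grad[OF k(1)]] continuous_on_const)
    show "grad k z \<bullet> axis j 1 = 0" if "R < norm z" for z
      using grad_kernel_eq_0[of R k z, OF k(2)] that by auto
  qed
  then have "integrable lborel (\<lambda>y. - (cross3 (axis 1 1) ((grad k (y - x) \<bullet> axis 1 1) *\<^sub>R u y)
      + cross3 (axis 2 1) ((grad k (y - x) \<bullet> axis 2 1) *\<^sub>R u y) + cross3 (axis 3 1) ((grad k (y - x) \<bullet> axis 3 1) *\<^sub>R u y)))"
    by (intro Bochner_Integration.integrable_minus Bochner_Integration.integrable_add
        integrable_bounded_linear[OF bounded_linear_cross3_right])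
  also have "(\<lambda>y. - (cross3 (axis 1 1) ((grad k (y - x) \<bullet> axis 1 1) *\<^sub>R u y)
      + cross3 (axis 2 1) ((grad k (y - x) \<bullet> axis 2 1) *\<^sub>R u y) + cross3 (axis 3 1) ((grad k (y - x) \<bullet> axis 3 1) *\<^sub>R u y)))
      = (\<lambda>y. cross3 (u y) (grad k (y - x)))"
    unfolding inner_axis_1 by (rule ext, rule vec3_eqI) (simp_all add: cross3_def axis_def)
  finally show ?thesis .
qed

text \<open>The minus sign from differentiating k (y - x) in x is absorbed by exchanging the factors
  of the cross product. The right side is then a term of Green's formula.\<close>

lemma curl_conv:
  assumes k: "Cinf k" "\<And>z. R < norm z \<Longrightarrow> k z = 0" and u: "loc_integrable u"
  shows "curl (conv k u) x = (\<integral>y. cross3 (u y) (grad k (y - x)) \<partial>lborel)"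
proof -
  let ?i = "\<lambda>j y. (grad k (y - x) \<bullet> axis j 1) *\<^sub>R u y"
  have int: "integrable lborel (?i j)" for j :: 3
  proof (rule integrable_kernel[OF _ _ u])
    show "continuous_on UNIV (\<lambda>z. grad k z \<bullet> axis j 1)"
      by (intro continuous_on_inner Cinf_continuous[OF Cinf_grad[OF k(1)]] continuous_on_const)
    show "grad k z \<bullet> axis j 1 = 0" if "R < norm z" for z
      using grad_kernel_eq_0[of R k z, OF k(2)] that by auto
  qed
  have tm: "cross3 (axis j 1) (- conv (\<lambda>z. grad k z \<bullet> axis j 1) u x) = (\<integral>y. - cross3 (axis j 1) (?i j y) \<partial>lborel)" for j
    unfolding conv_def
    by (simp add: integral_bounded_linear[OF bounded_linear_cross3_right int])
  have int2: "integrable lborel (\<lambda>y. - cross3 (axis j 1) (?i j y))" for j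
    by (intro Bochner_Integration.integrable_minus integrable_bounded_linear[OF bounded_linear_cross3_right] int)
  have "curl (conv k u) x = cross3 (axis 1 1) (- conv (\<lambda>z. grad k z \<bullet> axis 1 1) u x)
      + cross3 (axis 2 1) (- conv (\<lambda>z. grad k z \<bullet> axis 2 1) u x) + cross3 (axis 3 1) (- conv (\<lambda>z. grad k z \<bullet> axis 3 1) u x)"
    by (rule curl_cross[OF conv_has_derivative[OF k u]])
  also have "\<dots> = (\<integral>y. - cross3 (axis 1 1) (?i 1 y) \<partial>lborel)
      + (\<integral>y. - cross3 (axis 2 1) (?i 2 y) \<partial>lborel) + (\<integral>y. - cross3 (axis 3 1) (?i 3 y) \<partial>lborel)"
    by (simp only: tm)
  also have "\<dots> = (\<integral>y. - cross3 (axis 1 1) (?i 1 y) + - cross3 (axis 2 1) (?i 2 y) + - cross3 (axis 3 1) (?i 3 y) \<partial>lborel)"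
    using int2 by (simp only: Bochner_Integration.integral_add Bochner_Integration.integrable_add)
  also have "(\<lambda>y. - cross3 (axis 1 1) (?i 1 y) + - cross3 (axis 2 1) (?i 2 y) + - cross3 (axis 3 1) (?i 3 y))
      = (\<lambda>y. cross3 (u y) (grad k (y - x)))"
    unfolding inner_axis_1 by (rule ext, rule vec3_eqI) (simp_all add: cross3_def axis_def)
  finally show ?thesis .
qed

text \<open>\<open>pr\<close> stands for scaling or for the cross product. Since u has bounded
  support, a continuous h matters only on a ball and is bounded there.\<close>

lemma integrable_bounded_support:
  fixes u :: "real^3 \<Rightarrow> real^3" and pr :: "real^3 \<Rightarrow> 'b::euclidean_space \<Rightarrow> 'c::{banach, second_countable_topology}"
  assumes u: "loc_integrable u" and K: "\<And>y. M < norm y \<Longrightarrow> u y = 0" and h: "continuous_on UNIV h"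
    and pr: "\<And>a b. norm (pr a b) \<le> norm a * norm b" "\<And>b. pr 0 b = 0"
    and meas: "(\<lambda>y. pr (u y) (h y)) \<in> borel_measurable borel"
  shows "integrable lborel (\<lambda>y. pr (u y) (h y))"
proof -
  have "bounded (h ` cball 0 M)"
    by (intro compact_imp_bounded compact_continuous_image continuous_on_subset[OF h]) auto
  then obtain C where C: "\<And>z. z \<in> cball 0 M \<Longrightarrow> norm (h z) \<le> C" unfolding bounded_iff by blast
  have "integrable lborel (\<lambda>y. indicator (cball 0 M) y *\<^sub>R u y)" using u by (simp add: loc_integrable_def)
  moreover have "(\<lambda>y. indicator (cball 0 M) y *\<^sub>R u y) = u" using K by (auto simp: fun_eq_iff indicator_def not_le)
  ultimately have int: "integrable lborel u" by simp
  show ?thesis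
  proof (rule Bochner_Integration.integrable_bound)
    show "integrable lborel (\<lambda>y. max C 0 * norm (u y))" by (intro integrable_mult_right integrable_norm int)
    show "AE y in lborel. norm (pr (u y) (h y)) \<le> norm (max C 0 * norm (u y))"
    proof (intro AE_I2)
      fix y
      have "norm (pr (u y) (h y)) \<le> max C 0 * norm (u y)"
      proof (cases "M < norm y")
        case False
        then have "norm (h y) \<le> max C 0" using C[of y] by auto
        then have "norm (u y) * norm (h y) \<le> norm (u y) * max C 0" by (intro mult_left_mono) auto
        then show ?thesis using pr(1)[of "u y" "h y"] by (simp add: mult.commute)
      qed (simp add: K pr)
      then show "norm (pr (u y) (h y)) \<le> norm (max C 0 * norm (u y))" by simp
    qed
    show "(\<lambda>y. pr (u y) (h y)) \<in> borel_measurable lborel" using meas by simp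
  qed
qed

section \<open>Approximation in a half space\<close>

definition mollifier :: "real \<Rightarrow> ('a::euclidean_space \<Rightarrow> real) \<Rightarrow> bool" where
  "mollifier r k \<longleftrightarrow> continuous_on UNIV k \<and> (\<forall>z. r \<le> norm z \<longrightarrow> k z = 0) \<and> (\<forall>z. 0 \<le> k z) \<and>
     (\<integral>\<^sup>+z. ennreal (k z) \<partial>lborel) = 1"

lemma ex_mollifier_radius:
  fixes f :: "'a::euclidean_space \<Rightarrow> 'b::euclidean_space"
  assumes "f \<in> borel_measurable borel" "Lpe p lborel f < \<infinity>" "1 \<le> p" "e > 0"
  shows "\<exists>r>0. \<forall>k. mollifier r k \<longrightarrow> Lpe p lborel (\<lambda>x. conv k f x - f x) \<le> e"
  by (rule conv_Lp_approx[OF assms]) (unfold mollifier_def, blast)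

lemma grad_translate:
  assumes "Cinf f" shows "grad (\<lambda>y. f (y - c)) x = grad f (x - c)"
proof (rule grad_eqI)
  show "((\<lambda>y. f (y - c)) has_derivative (\<lambda>h. grad f (x - c) \<bullet> h)) (at x)"
    by (rule has_derivative_compose[of "\<lambda>y. y - c" "\<lambda>h. h" x UNIV f, simplified])
      (auto intro!: derivative_eq_intros Cinf_has_derivative_grad[OF assms])
qed

section \<open>Anisotropic kernels and the half-space Green formula\<close>

context frame
begin

definition plane_kernel :: "real \<Rightarrow> real^2 \<Rightarrow> real" where
  "plane_kernel \<epsilon> z = bump_scaled \<epsilon> (z $ 1) * bump_scaled \<epsilon> (z $ 2)"

text \<open>With the convention of \<open>conv\<close> this averages over points that lie between
  \<delta> and 2 \<delta> higher than x, with a planar displacement of order \<epsilon>.\<close>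

definition kernel :: "real \<Rightarrow> real \<Rightarrow> real^3 \<Rightarrow> real" where
  "kernel \<epsilon> \<delta> y = plane_kernel \<epsilon> (prj y) * bump_scaled \<delta> (y \<bullet> e)"

lemma plane_kernel_nonneg: "\<epsilon> > 0 \<Longrightarrow> 0 \<le> plane_kernel \<epsilon> z"
  by (simp add: plane_kernel_def bump_scaled_nonneg)

lemma kernel_nonneg: "\<epsilon> > 0 \<Longrightarrow> \<delta> > 0 \<Longrightarrow> 0 \<le> kernel \<epsilon> \<delta> z"
  by (simp add: kernel_def plane_kernel_nonneg bump_scaled_nonneg)

lemma Cinf_plane_kernel_prj: "Cinf (\<lambda>y. plane_kernel \<epsilon> (prj y))"
  unfolding plane_kernel_def prj_nth
  by (intro Cinf_mult Cinf_compose[OF Cinf_bump_scaled] Cinf_inner Cinf_id Cinf_const)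

lemma Cinf_kernel: "Cinf (kernel \<epsilon> \<delta>)"
  unfolding kernel_def[abs_def]
  by (intro Cinf_mult Cinf_plane_kernel_prj Cinf_compose[OF Cinf_bump_scaled] Cinf_inner Cinf_id Cinf_const)

lemma continuous_plane_kernel: "continuous_on UNIV (plane_kernel \<epsilon>)"
  unfolding plane_kernel_def[abs_def]
  by (intro continuous_on_mult continuous_on_compose2[OF Cinf_continuous[OF Cinf_bump_scaled]] continuous_intros) auto

lemma plane_kernel_borel [measurable]: "plane_kernel \<epsilon> \<in> borel_measurable borel"
  by (rule borel_measurable_continuous_onI[OF continuous_plane_kernel])

lemma plane_kernel_eq_0:
  assumes "\<epsilon> > 0" "4 * \<epsilon> \<le> norm z" shows "plane_kernel \<epsilon> z = 0"
proof (rule ccontr)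
  assume "plane_kernel \<epsilon> z \<noteq> 0"
  then have "bump_scaled \<epsilon> (z $ 1) \<noteq> 0" "bump_scaled \<epsilon> (z $ 2) \<noteq> 0" by (auto simp: plane_kernel_def)
  then have "\<bar>z $ 1\<bar> < 2 * \<epsilon>" "\<bar>z $ 2\<bar> < 2 * \<epsilon>"
    using bump_scaled_eq_0[OF assms(1)] assms(1) by (smt (verit))+
  moreover have "norm z \<le> \<bar>z $ 1\<bar> + \<bar>z $ 2\<bar>"
    using norm_le_l1_cart[of z] by (simp add: sum_2)
  ultimately show False using assms by linarith
qed

lemma kernel_eq_0:
  assumes "\<epsilon> > 0" "\<delta> > 0" "4 * \<epsilon> + 2 * \<delta> \<le> norm y" shows "kernel \<epsilon> \<delta> y = 0"
proof (rule ccontr)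
  assume "kernel \<epsilon> \<delta> y \<noteq> 0"
  then have 1: "plane_kernel \<epsilon> (prj y) \<noteq> 0" and 2: "bump_scaled \<delta> (y \<bullet> e) \<noteq> 0" by (auto simp: kernel_def)
  have "norm (prj y) < 4 * \<epsilon>" using plane_kernel_eq_0[OF assms(1), of "prj y"] 1 by linarith
  moreover have "\<bar>y \<bullet> e\<bar> < 2 * \<delta>" using bump_scaled_eq_0[OF assms(2)] assms(2) 2 by (smt (verit))
  moreover have "norm y \<le> norm (prj y) + \<bar>y \<bullet> e\<bar>"
    using norm_triangle_ineq[of "emb (prj y)" "(y \<bullet> e) *\<^sub>R e"] decompose[of y] by simp
  ultimately show False using assms by linarith
qed

lemma nn_integral_plane_kernel:
  assumes "\<epsilon> > 0" shows "(\<integral>\<^sup>+z. ennreal (plane_kernel \<epsilon> z) \<partial>lborel) = 1"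
proof -
  have "(\<integral>\<^sup>+z. ennreal (plane_kernel \<epsilon> z) \<partial>lborel) = (\<integral>\<^sup>+z. (\<Prod>b\<in>Basis. ennreal (bump_scaled \<epsilon> (z \<bullet> b))) \<partial>(lborel :: (real^2) measure))"
    using assms by (simp add: plane_kernel_def Basis_2 axis_eq_axis inner_axis ennreal_mult bump_scaled_nonneg)
  also have "\<dots> = (\<Prod>b\<in>(Basis :: (real^2) set). (\<integral>\<^sup>+x. ennreal (bump_scaled \<epsilon> x) \<partial>lborel))"
    by (rule nn_integral_lborel_prod) auto
  also have "\<dots> = 1" using nn_integral_bump_scaled[OF assms] by simp
  finally show ?thesis .
qed

lemma nn_integral_kernel:
  assumes "\<epsilon> > 0" "\<delta> > 0" shows "(\<integral>\<^sup>+y. ennreal (kernel \<epsilon> \<delta> y) \<partial>lborel) = 1"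
proof -
  have [measurable]: "kernel \<epsilon> \<delta> \<in> borel_measurable borel"
    by (rule borel_measurable_continuous_onI[OF Cinf_continuous[OF Cinf_kernel]])
  have "(\<integral>\<^sup>+y. ennreal (kernel \<epsilon> \<delta> y) \<partial>lborel) = (\<integral>\<^sup>+z. \<integral>\<^sup>+s. ennreal (kernel \<epsilon> \<delta> (emb z + s *\<^sub>R e)) \<partial>lborel \<partial>lborel)"
    by (rule nn_integral_coord) measurable
  also have "\<dots> = (\<integral>\<^sup>+z. \<integral>\<^sup>+s. ennreal (plane_kernel \<epsilon> z) * ennreal (bump_scaled \<delta> s) \<partial>lborel \<partial>lborel)"
    using assms by (simp add: kernel_def inner_add_left ennreal_mult plane_kernel_nonneg bump_scaled_nonneg)
  also have "\<dots> = 1"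
    by (simp add: nn_integral_cmult nn_integral_bump_scaled assms nn_integral_plane_kernel)
  finally show ?thesis .
qed

text \<open>The planar kernel, viewed on space, is constant along e and hence not compactly
  supported; that same invariance reduces the bounds to a compact set in the plane.\<close>

lemma plane_kernel_grad_bounds:
  assumes "\<epsilon> > 0"
  obtains C where "0 \<le> C" "\<And>y. \<bar>plane_kernel \<epsilon> (prj y)\<bar> \<le> C" "\<And>y. norm (grad (\<lambda>x. plane_kernel \<epsilon> (prj x)) y) \<le> C"
    "\<And>y. 4 * \<epsilon> < norm (prj y) \<Longrightarrow> grad (\<lambda>y. plane_kernel \<epsilon> (prj y)) y = 0"
proof -
  let ?A = "\<lambda>y. plane_kernel \<epsilon> (prj y)"
  have A: "Cinf ?A" by (rule Cinf_plane_kernel_prj)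
  have z1: "grad ?A y = 0" if "4 * \<epsilon> < norm (prj y)" for y
  proof (rule grad_eqI)
    have "open {y. 4 * \<epsilon> < norm (prj y)}"
      by (intro open_Collect_less continuous_intros)
    then show "(?A has_derivative (\<lambda>h. 0 \<bullet> h)) (at y)"
    proof (rule has_derivative_transform_within_open[rotated])
      show "y \<in> {y. 4 * \<epsilon> < norm (prj y)}" using that by simp
      show "0 = ?A x" if "x \<in> {y. 4 * \<epsilon> < norm (prj y)}" for x
        using plane_kernel_eq_0[OF assms, of "prj x"] that by simp
      show "((\<lambda>_. 0) has_derivative (\<lambda>h. 0 \<bullet> h)) (at y)" by simp
    qed
  qed
  have inv: "grad ?A y = grad ?A (emb (prj y))" for y
  proof -
    have "(\<lambda>x. ?A (x - (y \<bullet> e) *\<^sub>R e)) = ?A"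
      by (simp add: fun_eq_iff plane_kernel_def inner_diff_left)
    then have "grad ?A y = grad ?A (y - (y \<bullet> e) *\<^sub>R e)"
      using grad_translate[OF A, of "(y \<bullet> e) *\<^sub>R e" y] by simp
    also have "y - (y \<bullet> e) *\<^sub>R e = emb (prj y)" using decompose[of y] by (simp add: diff_eq_eq)
    finally show ?thesis .
  qed
  have "bounded (grad ?A ` cball 0 (4 * \<epsilon>))" "bounded (?A ` cball 0 (4 * \<epsilon>))"
    using continuous_on_subset[OF Cinf_continuous[OF Cinf_grad[OF A]], of "cball 0 (4 * \<epsilon>)"]
      continuous_on_subset[OF Cinf_continuous[OF A], of "cball 0 (4 * \<epsilon>)"]
    by (simp_all add: compact_imp_bounded compact_continuous_image)
  then obtain C1 C2 where C: "\<And>y. y \<in> cball 0 (4 * \<epsilon>) \<Longrightarrow> norm (grad ?A y) \<le> C1"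
      "\<And>y. y \<in> cball 0 (4 * \<epsilon>) \<Longrightarrow> norm (?A y) \<le> C2"
    unfolding bounded_iff by blast
  show ?thesis
  proof
    show "0 \<le> max 0 (max C1 C2)" by simp
    fix y
    show "\<bar>?A y\<bar> \<le> max 0 (max C1 C2)"
      using C(2)[of "emb (prj y)"] plane_kernel_eq_0[OF assms, of "prj y"]
      by (cases "norm (prj y) \<le> 4 * \<epsilon>") auto
    show "norm (grad ?A y) \<le> max 0 (max C1 C2)"
      using C(1)[of "emb (prj y)"] z1[of y] inv[of y]
      by (cases "norm (prj y) \<le> 4 * \<epsilon>") auto
    show "4 * \<epsilon> < norm (prj y) \<Longrightarrow> grad ?A y = 0" by (rule z1)
  qed
qed

text \<open>The weak Green formula in the half space \<open>y \<bullet> e > 0\<close>, tested with \<open>\<psi> c\<close> for constant \<open>c\<close>.\<close>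
definition flat_green :: "(real^3 \<Rightarrow> real^3) \<Rightarrow> (real^3 \<Rightarrow> real^3) \<Rightarrow> (real^2 \<Rightarrow> real^3) \<Rightarrow> bool" where
  "flat_green u w t \<longleftrightarrow> (\<forall>\<psi>. Cinf \<psi> \<longrightarrow>
     (\<integral>y. \<psi> y *\<^sub>R w y - cross3 (u y) (grad \<psi> y) \<partial>lborel) = (\<integral>z. \<psi> (emb z) *\<^sub>R t z \<partial>lborel))"

end

section \<open>Mollification of the half-space data and convergence of traces\<close>

locale flat_data = frame +
  fixes u w :: "real^3 \<Rightarrow> real^3" and t :: "real^2 \<Rightarrow> real^3" and p M :: real
  assumes uwt [measurable]: "u \<in> borel_measurable borel" "w \<in> borel_measurable borel" "t \<in> borel_measurable borel"
    and p: "1 < p"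
    and fin: "Lpe p lborel u < \<infinity>" "Lpe p lborel w < \<infinity>" "Lpe p lborel t < \<infinity>"
    and supp: "\<And>y. M < norm y \<or> y \<bullet> e \<le> 0 \<Longrightarrow> u y = 0 \<and> w y = 0"
    and green: "flat_green u w t"
begin

lemma loc: "loc_integrable u" "loc_integrable w" "loc_integrable t"
  using Lpe_loc_integrable[OF uwt(1) fin(1)] Lpe_loc_integrable[OF uwt(2) fin(2)] Lpe_loc_integrable[OF uwt(3) fin(3)] p
  by simp_all

lemma kernel_far: "\<epsilon> > 0 \<Longrightarrow> \<delta> > 0 \<Longrightarrow> 4 * \<epsilon> + 2 * \<delta> < norm z \<Longrightarrow> kernel \<epsilon> \<delta> z = 0"
  by (intro kernel_eq_0) auto

text \<open>For x above height -\<delta> the kernel centred at x vanishes on the boundary plane.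
  Green's formula tested with it has no boundary term, so mollification commutes with the curl
  although u jumps across the plane.\<close>

lemma curl_flat_conv:
  assumes "\<epsilon> > 0" "\<delta> > 0" "- \<delta> < x \<bullet> e"
  shows "curl (conv (kernel \<epsilon> \<delta>) u) x = conv (kernel \<epsilon> \<delta>) w x"
proof -
  let ?k = "kernel \<epsilon> \<delta>"
  let ?\<psi> = "\<lambda>y. ?k (y - x)"
  have psi: "Cinf ?\<psi>" by (intro Cinf_compose[OF Cinf_kernel] Cinf_diff Cinf_id Cinf_const)
  \<comment> \<open>The vertical argument on the plane is -(x \<bullet> e), which is below \<delta>,
    left of the support of the bump.\<close>
  have "?\<psi> (emb z) = 0" for z
    using bump_scaled_eq_0[OF assms(2), of "- (x \<bullet> e)"] assms(3) by (simp add: kernel_def inner_diff_left)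
  then have "(\<integral>y. ?\<psi> y *\<^sub>R w y - cross3 (u y) (grad ?\<psi> y) \<partial>lborel) = 0"
    using green psi unfolding flat_green_def by simp
  moreover have "integrable lborel (\<lambda>y. ?\<psi> y *\<^sub>R w y)"
    by (rule integrable_kernel[OF Cinf_continuous[OF Cinf_kernel] kernel_far[OF assms(1,2)] loc(2)])
  moreover have "integrable lborel (\<lambda>y. cross3 (u y) (grad ?k (y - x)))"
    by (rule integrable_kernel_cross[OF Cinf_kernel kernel_far[OF assms(1,2)] loc(1)])
  ultimately show ?thesis
    by (simp add: curl_conv[OF Cinf_kernel kernel_far[OF assms(1,2)] loc(1)] conv_def grad_translate[OF Cinf_kernel])
qed

text \<open>Test Green's formula with the planar kernel times
  \<open>step (y \<bullet> e / \<delta>)\<close>. The vertical derivative of \<open>step\<close>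
  reproduces the full kernel and so the trace of the mollified field; on the plane
  \<open>step\<close> is -1 and yields the mollified t. What remains contains only the planar
  gradient and is weighted by \<open>step\<close>.\<close>

lemma trace_identity:
  assumes "\<epsilon> > 0" "\<delta> > 0"
  shows "cross3 (conv (kernel \<epsilon> \<delta>) u (emb z)) e - conv (plane_kernel \<epsilon>) t z
    = (\<integral>y. step (y \<bullet> e / \<delta>) *\<^sub>R (plane_kernel \<epsilon> (prj y - z) *\<^sub>R w y
        - cross3 (u y) (grad (\<lambda>y. plane_kernel \<epsilon> (prj y)) (y - emb z))) \<partial>lborel)"
proof -
  let ?Pk = "\<lambda>y. plane_kernel \<epsilon> (prj y)"
  let ?A = "\<lambda>y. ?Pk (y - emb z)"
  let ?S = "\<lambda>y. step (y \<bullet> e / \<delta>)"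
  let ?\<psi> = "\<lambda>y. ?A y * ?S y"
  let ?k = "kernel \<epsilon> \<delta>"
  have A: "Cinf ?A" by (intro Cinf_compose[OF Cinf_plane_kernel_prj] Cinf_diff Cinf_id Cinf_const)
  have S: "Cinf ?S"
    unfolding divide_inverse by (intro Cinf_compose[OF Cinf_step] Cinf_mult Cinf_inner Cinf_id Cinf_const)
  have psi: "Cinf ?\<psi>" by (intro Cinf_mult A S)
  have gpsi: "grad ?\<psi> y = ?S y *\<^sub>R grad ?Pk (y - emb z) + (?A y * bump_scaled \<delta> (y \<bullet> e)) *\<^sub>R e" for y
  proof (rule grad_eqI)
    have dS: "(?S has_derivative (\<lambda>h. bump_scaled \<delta> (y \<bullet> e) * (h \<bullet> e))) (at y)"
      using has_derivative_compose[of "\<lambda>y. y \<bullet> e" "\<lambda>h. h \<bullet> e" y UNIV "\<lambda>s. step (s / \<delta>)" "\<lambda>h. bump_scaled \<delta> (y \<bullet> e) * h"]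
        step_scaled_has_derivative[OF assms(2), of "y \<bullet> e"]
      by (simp add: has_field_derivative_def bounded_linear_imp_has_derivative[OF bounded_linear_inner_left])
    have dA: "(?A has_derivative (\<lambda>h. grad ?Pk (y - emb z) \<bullet> h)) (at y)"
    proof -
      have eq: "grad ?A y = grad ?Pk (y - emb z)" by (rule grad_translate[OF Cinf_plane_kernel_prj])
      show ?thesis using Cinf_has_derivative_grad[OF A, of y] unfolding eq .
    qed
    show "(?\<psi> has_derivative (\<lambda>h. (?S y *\<^sub>R grad ?Pk (y - emb z) + (?A y * bump_scaled \<delta> (y \<bullet> e)) *\<^sub>R e) \<bullet> h)) (at y)"
      by (rule has_derivative_eq_rhs[OF has_derivative_mult[OF dA dS]])
        (simp add: fun_eq_iff inner_add_left inner_commute[of e] mult.commute mult.left_commute)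
  qed
  \<comment> \<open>The vertical part of the gradient of the test function is the kernel itself,
    which is how the mollified field enters.\<close>
  have keq: "?A y * bump_scaled \<delta> (y \<bullet> e) = ?k (y - emb z)" for y
    by (simp add: kernel_def inner_diff_left)
  have cA0: "continuous_on UNIV (\<lambda>y. ?S y *\<^sub>R grad ?Pk (y - emb z))"
    by (intro continuous_on_scaleR Cinf_continuous[OF S]
        continuous_on_compose2[OF Cinf_continuous[OF Cinf_grad[OF Cinf_plane_kernel_prj]]] continuous_intros) auto
  have suppu: "u y = 0" and suppw: "w y = 0" if "M < norm y" for y using supp that by auto
  have i1: "integrable lborel (\<lambda>y. ?\<psi> y *\<^sub>R w y)"
    by (rule integrable_bounded_support[OF loc(2) suppw Cinf_continuous[OF psi], where pr="\<lambda>a b. b *\<^sub>R a"])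
      (use borel_measurable_continuous_onI[OF Cinf_continuous[OF psi]] in \<open>auto simp: mult.commute\<close>)
  have i2: "integrable lborel (\<lambda>y. cross3 (u y) (?S y *\<^sub>R grad ?Pk (y - emb z)))"
    by (rule integrable_bounded_support[OF loc(1) suppu cA0 norm_cross3_le])
      (use borel_measurable_continuous_onI[OF cA0] in auto)
  have i3: "integrable lborel (\<lambda>y. ?k (y - emb z) *\<^sub>R u y)"
    by (rule integrable_kernel[OF Cinf_continuous[OF Cinf_kernel] kernel_far[OF assms] loc(1)])
  have i4: "integrable lborel (\<lambda>y. cross3 (?k (y - emb z) *\<^sub>R u y) e)"
    by (rule integrable_bounded_linear[OF bounded_linear_cross3_left i3])
  have split: "?\<psi> y *\<^sub>R w y - cross3 (u y) (grad ?\<psi> y)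
      = ?\<psi> y *\<^sub>R w y - cross3 (u y) (?S y *\<^sub>R grad ?Pk (y - emb z)) - cross3 (?k (y - emb z) *\<^sub>R u y) e" for y
    unfolding gpsi keq by (simp add: cross_add_right cross_mult_right cross_mult_left)
  have "(\<integral>y. ?\<psi> y *\<^sub>R w y - cross3 (u y) (grad ?\<psi> y) \<partial>lborel)
      = (\<integral>y. ?\<psi> y *\<^sub>R w y - cross3 (u y) (?S y *\<^sub>R grad ?Pk (y - emb z)) \<partial>lborel)
        - (\<integral>y. cross3 (?k (y - emb z) *\<^sub>R u y) e \<partial>lborel)"
    unfolding split using i1 i2 i4 by (intro Bochner_Integration.integral_diff Bochner_Integration.integrable_diff)
  also have "(\<integral>y. cross3 (?k (y - emb z) *\<^sub>R u y) e \<partial>lborel) = cross3 (conv ?k u (emb z)) e"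
    unfolding conv_def by (rule integral_bounded_linear[OF bounded_linear_cross3_left i3])
  finally have eq1: "(\<integral>y. ?\<psi> y *\<^sub>R w y - cross3 (u y) (grad ?\<psi> y) \<partial>lborel)
      = (\<integral>y. ?\<psi> y *\<^sub>R w y - cross3 (u y) (?S y *\<^sub>R grad ?Pk (y - emb z)) \<partial>lborel) - cross3 (conv ?k u (emb z)) e" .
  have "(\<integral>y. ?\<psi> y *\<^sub>R w y - cross3 (u y) (grad ?\<psi> y) \<partial>lborel) = (\<integral>x. ?\<psi> (emb x) *\<^sub>R t x \<partial>lborel)"
    using green psi unfolding flat_green_def by blast
  \<comment> \<open>The argument of \<open>step\<close> is 0 on the plane, where its value is
    -1.\<close>
  also have "\<dots> = (\<integral>x. - (plane_kernel \<epsilon> (x - z) *\<^sub>R t x) \<partial>lborel)"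
    by (simp add: step_left prj_diff)
  also have "\<dots> = - conv (plane_kernel \<epsilon>) t z" by (simp add: conv_def)
  finally have "cross3 (conv ?k u (emb z)) e - conv (plane_kernel \<epsilon>) t z
      = (\<integral>y. ?\<psi> y *\<^sub>R w y - cross3 (u y) (?S y *\<^sub>R grad ?Pk (y - emb z)) \<partial>lborel)"
    unfolding eq1 by (simp add: algebra_simps)
  also have "\<dots> = (\<integral>y. ?S y *\<^sub>R (plane_kernel \<epsilon> (prj y - z) *\<^sub>R w y - cross3 (u y) (grad ?Pk (y - emb z))) \<partial>lborel)"
    by (simp add: prj_diff cross_mult_right scaleR_diff_right mult.commute)
  finally show ?thesis .
qed

text \<open>For fixed \<epsilon> the right side of \<open>trace_identity\<close> lives in a layer of
  height 2 \<delta>. Jensen with a kernel of mass proportional to \<delta> leaves the factor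
  \<delta>^(p-1). The constant C depends on \<epsilon>, which forces the order of the
  choices.\<close>

lemma kernel_trace_estimate:
  assumes eps: "\<epsilon> > 0" and e': "e' > 0"
  obtains d where "d > 0" "\<And>\<delta>. 0 < \<delta> \<Longrightarrow> \<delta> < d \<Longrightarrow>
    Lpe p lborel (\<lambda>z. cross3 (conv (kernel \<epsilon> \<delta>) u (emb z)) e - conv (plane_kernel \<epsilon>) t z) \<le> e'"
proof -
  let ?Pk = "\<lambda>y. plane_kernel \<epsilon> (prj y)"
  obtain C where C: "0 \<le> C" "\<And>y. \<bar>?Pk y\<bar> \<le> C" "\<And>y. norm (grad ?Pk y) \<le> C"
    "\<And>y. 4 * \<epsilon> < norm (prj y) \<Longrightarrow> grad ?Pk y = 0"
    by (rule plane_kernel_grad_bounds[OF eps]) (rule that)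
  define h where "h y = norm (w y) + norm (u y)" for y
  have h0: "0 \<le> h y" for y by (simp add: h_def)
  have [measurable]: "h \<in> borel_measurable borel" unfolding h_def[abs_def] by measurable
  have [measurable]: "grad ?Pk \<in> borel_measurable borel" "step \<in> borel_measurable borel"
    by (rule borel_measurable_continuous_onI[OF Cinf_continuous[OF Cinf_grad[OF Cinf_plane_kernel_prj]]])
      (rule borel_measurable_continuous_onI[OF Cinf_continuous[OF Cinf_step]])
  have loc_int: "integrable lborel f" if "loc_integrable f" "\<And>y. M < norm y \<Longrightarrow> f y = 0" for f :: "real^3 \<Rightarrow> real^3"
  proof -
    have "integrable lborel (\<lambda>y. indicator (cball 0 M) y *\<^sub>R f y)" using that(1) by (simp add: loc_integrable_def)
    moreover have "(\<lambda>y. indicator (cball 0 M) y *\<^sub>R f y) = f" using that(2) by (auto simp: fun_eq_iff indicator_def not_le)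
    ultimately show ?thesis by simp
  qed
  have hint: "integrable lborel h"
    unfolding h_def[abs_def] using supp
    by (intro Bochner_Integration.integrable_add integrable_norm loc_int loc) auto
  define V where "V = pi * (4 * \<epsilon>)\<^sup>2"
  have V: "emeasure lborel (cball z (4 * \<epsilon>)) = ennreal V" for z :: "real^2"
    using eps by (simp add: emeasure_cball unit_ball_vol_2 V_def)
  have V0: "0 \<le> V" by (simp add: V_def)
  have "Lpe p lborel h \<le> ennreal (2 powr p) * (Lpe p lborel (\<lambda>y. norm (w y)) + Lpe p lborel (\<lambda>y. norm (u y)))"
    unfolding h_def[abs_def] by (rule Lpe_add) (use p in auto)
  also have "\<dots> < \<infinity>" using fin by (simp add: Lpe_def ennreal_mult_less_top)
  finally obtain i where i: "Lpe p lborel h = ennreal i" "0 \<le> i" by (cases "Lpe p lborel h") auto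
  \<comment> \<open>A majorant of the coefficients in the identity: below the plane the data vanish,
    above height 2 \<delta> the cutoff vanishes, and beyond planar distance 4 \<epsilon> the planar
    kernel vanishes.\<close>
  define k where "k \<delta> z y = C * (indicator {y. 0 < y \<bullet> e \<and> y \<bullet> e < 2 * \<delta>} y * indicator {..4 * \<epsilon>} (dist z (prj y)))" for \<delta> z and y :: "real^3"
  have k0: "0 \<le> k \<delta> z y" for \<delta> z y using C(1) by (simp add: k_def)
  have kC: "k \<delta> z y \<le> C" for \<delta> z y using C(1) by (simp add: k_def indicator_def)
  have [measurable]: "(\<lambda>y. k \<delta> z y) \<in> borel_measurable borel" for \<delta> z
    unfolding k_def by measurable
  have [measurable]: "(\<lambda>(z, y). k \<delta> z y) \<in> borel_measurable (borel \<Otimes>\<^sub>M borel)" for \<delta>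
  proof -
    have "(\<lambda>(z, y). k \<delta> z y) = (\<lambda>q. C * (indicator {y. 0 < y \<bullet> e \<and> y \<bullet> e < 2 * \<delta>} (snd q) * indicator {..4 * \<epsilon>} (dist (fst q) (prj (snd q)))))"
      by (auto simp: fun_eq_iff k_def indicator_def)
    then show ?thesis by simp
  qed
  have ky: "(\<integral>\<^sup>+y. ennreal (k \<delta> z y) \<partial>lborel) = ennreal (C * (2 * \<delta>) * V)" if "\<delta> > 0" for \<delta> z
  proof -
    have "(\<integral>\<^sup>+y. ennreal (k \<delta> z y) \<partial>lborel) = (\<integral>\<^sup>+z'. \<integral>\<^sup>+s. ennreal (k \<delta> z (emb z' + s *\<^sub>R e)) \<partial>lborel \<partial>lborel)"
      by (rule nn_integral_coord) measurable
    also have "\<dots> = (\<integral>\<^sup>+z'. \<integral>\<^sup>+s. (ennreal C * indicator (cball z (4 * \<epsilon>)) z') * indicator {0<..<2 * \<delta>} s \<partial>lborel \<partial>lborel)"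
      using C(1) by (intro nn_integral_cong) (simp add: k_def inner_add_left indicator_def)
    also have "\<dots> = (\<integral>\<^sup>+z'. (ennreal C * ennreal (2 * \<delta>)) * indicator (cball z (4 * \<epsilon>)) z' \<partial>lborel)"
    proof (rule nn_integral_cong)
      fix z'
      have "(\<integral>\<^sup>+s. (ennreal C * indicator (cball z (4 * \<epsilon>)) z') * indicator {0<..<2 * \<delta>} s \<partial>lborel)
          = (ennreal C * indicator (cball z (4 * \<epsilon>)) z') * emeasure lborel {0<..<2 * \<delta>}"
        by (rule nn_integral_cmult_indicator) simp
      then show "(\<integral>\<^sup>+s. (ennreal C * indicator (cball z (4 * \<epsilon>)) z') * indicator {0<..<2 * \<delta>} s \<partial>lborel)
          = (ennreal C * ennreal (2 * \<delta>)) * indicator (cball z (4 * \<epsilon>)) z'"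
        using that by (simp add: mult.commute mult.left_commute mult.assoc)
    qed
    also have "\<dots> = ennreal C * ennreal (2 * \<delta>) * ennreal V"
      by (subst nn_integral_cmult_indicator) (auto simp: V)
    also have "\<dots> = ennreal (C * (2 * \<delta>) * V)" using C(1) V0 that by (simp add: ennreal_mult)
    finally show ?thesis .
  qed
  \<comment> \<open>Integrated over z the mass of the majorant does not shrink with \<delta>;
    integrated over y it does. Tonelli needs the former, Jensen the latter.\<close>
  have kz: "(\<integral>\<^sup>+z. ennreal (k \<delta> z y) \<partial>lborel) \<le> ennreal (C * V)" for \<delta> y
  proof -
    have "(\<integral>\<^sup>+z. ennreal (k \<delta> z y) \<partial>lborel) \<le> (\<integral>\<^sup>+z. ennreal C * indicator (cball (prj y) (4 * \<epsilon>)) z \<partial>lborel)"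
      using C(1) by (intro nn_integral_mono) (simp add: k_def indicator_def dist_commute)
    also have "\<dots> = ennreal (C * V)"
      using C(1) V0 by (subst nn_integral_cmult_indicator) (auto simp: V ennreal_mult)
    finally show ?thesis .
  qed
  have est: "Lpe p lborel (\<lambda>z. cross3 (conv (kernel \<epsilon> \<delta>) u (emb z)) e - conv (plane_kernel \<epsilon>) t z)
      \<le> ennreal ((C * (2 * \<delta>) * V) powr (p - 1) * (C * V * i))" if \<delta>: "\<delta> > 0" for \<delta>
  proof -
    let ?E = "\<lambda>z. cross3 (conv (kernel \<epsilon> \<delta>) u (emb z)) e - conv (plane_kernel \<epsilon>) t z"
    have pt: "ennreal (norm (?E z) powr p)
        \<le> ennreal ((C * (2 * \<delta>) * V) powr (p - 1)) * (\<integral>\<^sup>+y. ennreal (k \<delta> z y) * ennreal (norm (h y) powr p) \<partial>lborel)" for z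
    proof -
      let ?I = "\<lambda>y. step (y \<bullet> e / \<delta>) *\<^sub>R (plane_kernel \<epsilon> (prj y - z) *\<^sub>R w y - cross3 (u y) (grad ?Pk (y - emb z)))"
      have le: "norm (?I y) \<le> k \<delta> z y * h y" for y
      proof -
        consider "y \<bullet> e \<le> 0" | "2 * \<delta> \<le> y \<bullet> e" | "4 * \<epsilon> < norm (prj y - z)" 
          | "0 < y \<bullet> e" "y \<bullet> e < 2 * \<delta>" "norm (prj y - z) \<le> 4 * \<epsilon>" by linarith
        then show ?thesis
        proof cases
          case 1
          then show ?thesis using supp[of y] h0[of y] k0[of \<delta> z y] by simp
        next
          case 2
          then have "step (y \<bullet> e / \<delta>) = 0" using \<delta> by (intro step_right) (simp add: field_simps)
          then show ?thesis using h0[of y] k0[of \<delta> z y] by simp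
        next
          case 3
          then have "grad ?Pk (y - emb z) = 0" "plane_kernel \<epsilon> (prj y - z) = 0"
            using C(4)[of "y - emb z"] plane_kernel_eq_0[OF eps, of "prj y - z"] by (simp_all add: prj_diff)
          then show ?thesis using h0[of y] k0[of \<delta> z y] by simp
        next
          case 4
          then have kk: "k \<delta> z y = C" by (simp add: k_def dist_norm norm_minus_commute)
          have s1: "\<bar>step (y \<bullet> e / \<delta>)\<bar> \<le> 1" using step_bounds[of "y \<bullet> e / \<delta>"] by (simp add: abs_le_iff)
          have a1: "norm (plane_kernel \<epsilon> (prj y - z) *\<^sub>R w y) \<le> C * norm (w y)"
            using C(2)[of "y - emb z"] by (simp add: prj_diff mult_right_mono)
          have a2: "norm (cross3 (u y) (grad ?Pk (y - emb z))) \<le> C * norm (u y)"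
          proof -
            have "norm (cross3 (u y) (grad ?Pk (y - emb z))) \<le> norm (u y) * norm (grad ?Pk (y - emb z))" by (rule norm_cross3_le)
            also have "\<dots> \<le> norm (u y) * C" by (intro mult_left_mono C) simp
            finally show ?thesis by (simp add: mult.commute)
          qed
          have "norm (plane_kernel \<epsilon> (prj y - z) *\<^sub>R w y - cross3 (u y) (grad ?Pk (y - emb z))) \<le> C * norm (w y) + C * norm (u y)"
            by (rule order_trans[OF norm_triangle_ineq4 add_mono[OF a1 a2]])
          then have "\<bar>step (y \<bullet> e / \<delta>)\<bar> * norm (plane_kernel \<epsilon> (prj y - z) *\<^sub>R w y - cross3 (u y) (grad ?Pk (y - emb z))) \<le> 1 * (C * norm (w y) + C * norm (u y))"
            using s1 by (intro mult_mono) auto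
          then show ?thesis by (simp add: kk h_def distrib_left)
        qed
      qed
      have ki: "integrable lborel (\<lambda>y. k \<delta> z y *\<^sub>R h y)"
      proof (rule Bochner_Integration.integrable_bound)
        show "integrable lborel (\<lambda>y. C * h y)" using hint by simp
        show "AE y in lborel. norm (k \<delta> z y *\<^sub>R h y) \<le> norm (C * h y)"
          using k0 kC h0 C(1) by (intro AE_I2) (simp add: abs_mult mult_right_mono)
      qed measurable
      have Im: "?I \<in> borel_measurable lborel"
        by measurable
      have Ii: "integrable lborel ?I"
        by (rule Bochner_Integration.integrable_bound[OF ki Im]) (use le k0 h0 in \<open>auto simp: abs_mult intro!: AE_I2\<close>)
      have "norm (?E z) \<le> (\<integral>y. k \<delta> z y *\<^sub>R h y \<partial>lborel)"
        unfolding trace_identity[OF eps \<delta>]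
        by (rule Bochner_Integration.integral_norm_bound_integral[OF Ii ki]) (use le in simp)
      also have "\<dots> \<le> norm (\<integral>y. k \<delta> z y *\<^sub>R h y \<partial>lborel)" by simp
      finally have "ennreal (norm (?E z) powr p) \<le> ennreal (norm (\<integral>y. k \<delta> z y *\<^sub>R h y \<partial>lborel) powr p)"
        using p by (intro ennreal_leI powr_mono2) auto
      also have "\<dots> \<le> ennreal ((C * (2 * \<delta>) * V) powr (p - 1)) * (\<integral>\<^sup>+y. ennreal (k \<delta> z y) * ennreal (norm (h y) powr p) \<partial>lborel)"
        by (rule jensen_kernel) (use k0 p ky[OF \<delta>] C(1) V0 \<delta> in auto)
      finally show ?thesis .
    qed
    have "Lpe p lborel ?E \<le> (\<integral>\<^sup>+z. ennreal ((C * (2 * \<delta>) * V) powr (p - 1)) *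
        (\<integral>\<^sup>+y. ennreal (k \<delta> z y) * ennreal (norm (h y) powr p) \<partial>lborel) \<partial>lborel)"
      unfolding Lpe_def by (rule nn_integral_mono) (rule pt)
    also have "\<dots> = ennreal ((C * (2 * \<delta>) * V) powr (p - 1)) *
        (\<integral>\<^sup>+z. \<integral>\<^sup>+y. ennreal (k \<delta> z y) * ennreal (norm (h y) powr p) \<partial>lborel \<partial>lborel)"
      by (rule nn_integral_cmult) measurable
    also have "(\<integral>\<^sup>+z. \<integral>\<^sup>+y. ennreal (k \<delta> z y) * ennreal (norm (h y) powr p) \<partial>lborel \<partial>lborel)
        = (\<integral>\<^sup>+y. \<integral>\<^sup>+z. ennreal (k \<delta> z y) * ennreal (norm (h y) powr p) \<partial>lborel \<partial>lborel)"
      by (rule lborel_pair.Fubini') measurable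
    also have "\<dots> = (\<integral>\<^sup>+y. (\<integral>\<^sup>+z. ennreal (k \<delta> z y) \<partial>lborel) * ennreal (norm (h y) powr p) \<partial>lborel)"
      by (intro nn_integral_cong nn_integral_multc) measurable
    also have "\<dots> \<le> (\<integral>\<^sup>+y. ennreal (C * V) * ennreal (norm (h y) powr p) \<partial>lborel)"
      by (intro nn_integral_mono mult_right_mono kz) simp
    also have "\<dots> = ennreal (C * V) * ennreal i"
      unfolding i(1)[symmetric] Lpe_def by (rule nn_integral_cmult) measurable
    finally show ?thesis
      using C(1) V0 i(2) by (simp add: ennreal_mult mult_left_mono)
  qed
  obtain d1 where d1: "d1 > 0" "ennreal (1 * d1) < e'" using ex_ennreal_fraction[OF e', of 1] by auto
  \<comment> \<open>The exponent p - 1 is positive because 1 < p; this is where the layer term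
    becomes small.\<close>
  have "((\<lambda>\<delta>. (C * (2 * \<delta>) * V) powr (p - 1) * (C * V * i)) \<longlongrightarrow> 0 * (C * V * i)) (at_right 0)"
  proof (intro tendsto_mult tendsto_const tendsto_zero_powrI)
    have "((\<lambda>\<delta>. C * (2 * \<delta>) * V) \<longlongrightarrow> C * (2 * 0) * V) (at_right 0)" by (intro tendsto_intros)
    then show "((\<lambda>\<delta>. C * (2 * \<delta>) * V) \<longlongrightarrow> 0) (at_right 0)" by simp
    show "\<forall>\<^sub>F \<delta> in at_right 0. 0 \<le> C * (2 * \<delta>) * V"
      using eventually_at_right_less[of "0::real"] by eventually_elim (use C(1) V0 in simp)
  qed (use p in auto)
  then have "eventually (\<lambda>\<delta>. (C * (2 * \<delta>) * V) powr (p - 1) * (C * V * i) < d1) (at_right 0)"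
    using d1(1) by (intro order_tendstoD) auto
  then obtain d where d: "d > 0" "\<And>\<delta>. 0 < \<delta> \<Longrightarrow> \<delta> < d \<Longrightarrow> (C * (2 * \<delta>) * V) powr (p - 1) * (C * V * i) < d1"
    unfolding eventually_at_right_field by auto
  show ?thesis
  proof
    show "d > 0" by fact
    fix \<delta> assume \<delta>: "0 < \<delta>" "\<delta> < d"
    have "ennreal ((C * (2 * \<delta>) * V) powr (p - 1) * (C * V * i)) \<le> ennreal (1 * d1)"
      using d(2)[OF \<delta>] by (intro ennreal_leI) simp
    then show "Lpe p lborel (\<lambda>z. cross3 (conv (kernel \<epsilon> \<delta>) u (emb z)) e - conv (plane_kernel \<epsilon>) t z) \<le> e'"
      using est[OF \<delta>(1)] d1(2) by (meson order_trans less_imp_le)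
  qed
qed

lemma conv_far_0:
  assumes "\<And>z. r \<le> norm z \<Longrightarrow> k z = 0" "conv k f x \<noteq> 0"
  shows "\<exists>y. f y \<noteq> 0 \<and> dist x y < r"
proof (rule ccontr)
  assume "\<not> ?thesis"
  then have "k (y - x) *\<^sub>R f y = 0" for y
    using assms(1)[of "y - x"] by (cases "f y = 0") (auto simp: dist_norm norm_minus_commute not_less)
  then have "(\<lambda>y. k (y - x) *\<^sub>R f y) = (\<lambda>_. 0)" by (rule ext)
  then have "conv k f x = 0" unfolding conv_def by (simp only:) simp
  then show False using assms(2) by simp
qed

text \<open>The curl is compared only above height -\<delta>, a neighbourhood of the closed half
  space; further down the jump of the zero extension is felt. The radius r keeps the support near
  that of u.\<close>

lemma flat_approx:
  assumes e': "e' > 0" and r: "r > 0"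
  obtains F \<delta> where "Cinf F" "\<delta> > 0" "\<And>x. F x \<noteq> 0 \<Longrightarrow> \<exists>y. u y \<noteq> 0 \<and> dist x y < r"
    "Lpe p lborel (\<lambda>x. F x - u x) \<le> e'"
    "Lpe p lborel (\<lambda>x. if - \<delta> < x \<bullet> e then curl F x - w x else 0) \<le> e'"
    "Lpe p lborel (\<lambda>z. cross3 (F (emb z)) e - t z) \<le> e'"
proof -
  have p1: "1 \<le> p" using p by simp
  obtain c where c: "c > 0" "ennreal ((2 powr p * 2) * c) < e'" using ex_ennreal_fraction[OF e', of "2 powr p * 2"] by auto
  obtain r1 where r1: "r1 > 0" "\<And>k. mollifier r1 k \<Longrightarrow> Lpe p lborel (\<lambda>x. conv k u x - u x) \<le> e'"
    using ex_mollifier_radius[OF uwt(1) fin(1) p1 e'] by blast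
  obtain r2 where r2: "r2 > 0" "\<And>k. mollifier r2 k \<Longrightarrow> Lpe p lborel (\<lambda>x. conv k w x - w x) \<le> e'"
    using ex_mollifier_radius[OF uwt(2) fin(2) p1 e'] by blast
  have "ennreal c > 0" using c by simp
  then obtain r3 where r3: "r3 > 0" "\<And>k. mollifier r3 k \<Longrightarrow> Lpe p lborel (\<lambda>x. conv k t x - t x) \<le> ennreal c"
    using ex_mollifier_radius[OF uwt(3) fin(3) p1] by blast
  \<comment> \<open>The kernel lives within radius 4 \<epsilon> + 2 \<delta>, at most 6 \<epsilon>
    once \<delta> \<le> \<epsilon>; division by 8 puts this below all four radii.\<close>
  define \<epsilon> where "\<epsilon> = min (min r1 r2) (min r3 r) / 8"
  have \<epsilon>: "\<epsilon> > 0" "6 * \<epsilon> < r1" "6 * \<epsilon> < r2" "6 * \<epsilon> < r3" "6 * \<epsilon> < r" using r1(1) r2(1) r3(1) r by (auto simp: \<epsilon>_def)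
  obtain d where d: "d > 0" "\<And>\<delta>. 0 < \<delta> \<Longrightarrow> \<delta> < d \<Longrightarrow>
    Lpe p lborel (\<lambda>z. cross3 (conv (kernel \<epsilon> \<delta>) u (emb z)) e - conv (plane_kernel \<epsilon>) t z) \<le> ennreal c"
    by (rule kernel_trace_estimate[OF \<epsilon>(1) \<open>ennreal c > 0\<close>]) (rule that)
  define \<delta> where "\<delta> = min \<epsilon> (d / 2)"
  have \<delta>: "0 < \<delta>" "\<delta> < d" "\<delta> \<le> \<epsilon>" using d(1) \<epsilon>(1) by (auto simp: \<delta>_def)
  let ?k = "kernel \<epsilon> \<delta>"
  have kz: "?k z = 0" if "6 * \<epsilon> < R" "R \<le> norm z" for z R
    using kernel_eq_0[OF \<epsilon>(1) \<delta>(1), of z] \<delta>(3) that by simp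
  have moll: "mollifier R ?k" if "6 * \<epsilon> < R" for R
    unfolding mollifier_def
    using Cinf_continuous[OF Cinf_kernel] kz[OF that] kernel_nonneg[OF \<epsilon>(1) \<delta>(1)] nn_integral_kernel[OF \<epsilon>(1) \<delta>(1)] by blast
  have [measurable]: "conv ?k u \<in> borel_measurable borel"
    by (intro borel_measurable_continuous_onI Cinf_continuous Cinf_conv[OF Cinf_kernel kernel_far[OF \<epsilon>(1) \<delta>(1)] loc(1)])
  have [measurable]: "conv (plane_kernel \<epsilon>) t \<in> borel_measurable borel"
    unfolding conv_def[abs_def] by (rule lborel.borel_measurable_lebesgue_integral) measurable
  show ?thesis
  proof
    show "Cinf (conv ?k u)" by (rule Cinf_conv[OF Cinf_kernel kernel_far[OF \<epsilon>(1) \<delta>(1)] loc(1)])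
    show "\<delta> > 0" by fact
    show "\<exists>y. u y \<noteq> 0 \<and> dist x y < r" if "conv ?k u x \<noteq> 0" for x
      by (rule conv_far_0[OF kz[OF \<epsilon>(5)] that])
    show "Lpe p lborel (\<lambda>x. conv ?k u x - u x) \<le> e'"
      by (rule r1(2)[OF moll[OF \<epsilon>(2)]])
    have "Lpe p lborel (\<lambda>x. if - \<delta> < x \<bullet> e then curl (conv ?k u) x - w x else 0) \<le> Lpe p lborel (\<lambda>x. conv ?k w x - w x)"
      by (rule Lpe_mono) (use curl_flat_conv[OF \<epsilon>(1) \<delta>(1)] p in auto)
    also have "\<dots> \<le> e'"
      by (rule r2(2)[OF moll[OF \<epsilon>(3)]])
    finally show "Lpe p lborel (\<lambda>x. if - \<delta> < x \<bullet> e then curl (conv ?k u) x - w x else 0) \<le> e'" .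
    have pkz: "plane_kernel \<epsilon> z = 0" if "r3 \<le> norm z" for z
      using plane_kernel_eq_0[OF \<epsilon>(1), of z] that \<epsilon>(1,4) by simp
    have t3: "Lpe p lborel (\<lambda>x. conv (plane_kernel \<epsilon>) t x - t x) \<le> ennreal c"
      using r3(2) continuous_plane_kernel pkz plane_kernel_nonneg[OF \<epsilon>(1)] nn_integral_plane_kernel[OF \<epsilon>(1)]
      unfolding mollifier_def by blast
    have "Lpe p lborel (\<lambda>z. cross3 (conv ?k u (emb z)) e - t z)
        = Lpe p lborel (\<lambda>z. (cross3 (conv ?k u (emb z)) e - conv (plane_kernel \<epsilon>) t z) + (conv (plane_kernel \<epsilon>) t z - t z))"
      by simp
    also have "\<dots> \<le> ennreal (2 powr p) * (Lpe p lborel (\<lambda>z. cross3 (conv ?k u (emb z)) e - conv (plane_kernel \<epsilon>) t z)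
        + Lpe p lborel (\<lambda>z. conv (plane_kernel \<epsilon>) t z - t z))"
      by (rule Lpe_add) (use p in auto)
    also have "\<dots> \<le> ennreal (2 powr p) * (ennreal c + ennreal c)"
      by (intro mult_left_mono add_mono d(2) \<delta> t3) simp
    also have "\<dots> = ennreal ((2 powr p * 2) * c)"
      using c(1) by (simp add: ennreal_plus[symmetric] ennreal_mult[symmetric] del: ennreal_plus)
    also have "\<dots> \<le> e'" using c(2) by (rule less_imp_le)
    finally show "Lpe p lborel (\<lambda>z. cross3 (conv ?k u (emb z)) e - t z) \<le> e'" .
  qed
qed

end

section \<open>Pullback along smooth graphs\<close>

lemma second_difference:
  fixes f :: "real^3 \<Rightarrow> real"
  assumes f: "Cinf f" and h: "0 < h"
  obtains s t where "0 < s" "s < h" "0 < t" "t < h"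
    "f (x + h *\<^sub>R a + h *\<^sub>R b) - f (x + h *\<^sub>R a) - (f (x + h *\<^sub>R b) - f x)
      = h * h * (grad (\<lambda>y. grad f y \<bullet> a) (x + s *\<^sub>R a + t *\<^sub>R b) \<bullet> b)"
proof -
  have line: "((\<lambda>s. q (y + s *\<^sub>R v)) has_real_derivative grad q (y + s *\<^sub>R v) \<bullet> v) (at s)" if "Cinf q" for q :: "real^3 \<Rightarrow> real" and y v s
  proof -
    have "((\<lambda>s. y + s *\<^sub>R v) has_derivative (\<lambda>r. r *\<^sub>R v)) (at s)" by (auto intro!: derivative_eq_intros)
    from has_derivative_compose[OF this Cinf_has_derivative_grad[OF that]]
    have "((\<lambda>s. q (y + s *\<^sub>R v)) has_derivative (\<lambda>r. grad q (y + s *\<^sub>R v) \<bullet> (r *\<^sub>R v))) (at s)" .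
    then show ?thesis unfolding has_field_derivative_def
      by (rule has_derivative_eq_rhs) (simp add: fun_eq_iff mult.commute)
  qed
  let ?A = "\<lambda>y. grad f y \<bullet> a"
  have A: "Cinf ?A" by (intro Cinf_inner Cinf_grad f Cinf_const)
  have d1: "((\<lambda>s. f ((x + h *\<^sub>R b) + s *\<^sub>R a) - f (x + s *\<^sub>R a)) has_real_derivative
      ?A ((x + h *\<^sub>R b) + s *\<^sub>R a) - ?A (x + s *\<^sub>R a)) (at s)" for s
    by (rule DERIV_diff[OF line[OF f] line[OF f]])
  obtain s where s: "0 < s" "s < h"
    "(f ((x + h *\<^sub>R b) + h *\<^sub>R a) - f (x + h *\<^sub>R a)) - (f ((x + h *\<^sub>R b) + 0 *\<^sub>R a) - f (x + 0 *\<^sub>R a))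
      = (h - 0) * (?A ((x + h *\<^sub>R b) + s *\<^sub>R a) - ?A (x + s *\<^sub>R a))"
    using MVT2[OF h, of "\<lambda>s. f ((x + h *\<^sub>R b) + s *\<^sub>R a) - f (x + s *\<^sub>R a)", OF d1] by auto
  obtain t where t: "0 < t" "t < h"
    "?A ((x + s *\<^sub>R a) + h *\<^sub>R b) - ?A ((x + s *\<^sub>R a) + 0 *\<^sub>R b) = (h - 0) * (grad ?A ((x + s *\<^sub>R a) + t *\<^sub>R b) \<bullet> b)"
    using MVT2[OF h, of "\<lambda>t. ?A ((x + s *\<^sub>R a) + t *\<^sub>R b)", OF line[OF A]] by auto
  have "f (x + h *\<^sub>R a + h *\<^sub>R b) - f (x + h *\<^sub>R a) - (f (x + h *\<^sub>R b) - f x)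
      = h * (?A ((x + s *\<^sub>R a) + h *\<^sub>R b) - ?A ((x + s *\<^sub>R a) + 0 *\<^sub>R b))"
    using s(3) by (simp add: add.commute add.left_commute)
  also have "\<dots> = h * h * (grad ?A (x + s *\<^sub>R a + t *\<^sub>R b) \<bullet> b)" unfolding t(3) by simp
  finally show ?thesis using that[OF s(1,2) t(1,2)] by blast
qed

text \<open>The second difference over the parallelogram spanned by h a and h b is symmetric in a
  and b. Two mean value theorems express it by either mixed derivative at nearby points, and
  continuity gives equality as h tends to 0.\<close>

lemma second_derivative_symmetric:
  fixes f :: "real^3 \<Rightarrow> real"
  assumes f: "Cinf f"
  shows "grad (\<lambda>y. grad f y \<bullet> a) x \<bullet> b = grad (\<lambda>y. grad f y \<bullet> b) x \<bullet> a"
proof -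
  let ?D = "\<lambda>a b y. grad (\<lambda>y. grad f y \<bullet> a) y \<bullet> b"
  have cont: "isCont (?D a b) x" for a b
  proof -
    have "continuous_on UNIV (?D a b)"
      by (intro continuous_on_inner continuous_on_const Cinf_continuous Cinf_grad Cinf_inner f Cinf_const)
    then show ?thesis by (simp add: continuous_on_eq_continuous_at)
  qed
  have lim: "(\<lambda>n. ?D a b (x + s n *\<^sub>R a + t n *\<^sub>R b)) \<longlonglongrightarrow> ?D a b x"
    if "\<And>n. 0 < s n \<and> s n < 1 / Suc n \<and> 0 < t n \<and> t n < 1 / Suc n" for s t :: "nat \<Rightarrow> real" and a b
  proof -
    have z: "q \<longlonglongrightarrow> 0" if "\<And>n. 0 < q n \<and> q n < 1 / Suc n" for q :: "nat \<Rightarrow> real"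
    proof (rule tendsto_sandwich[of "\<lambda>_. 0" q sequentially "\<lambda>n. 1 / real (Suc n)"])
      show "(\<lambda>n. 1 / real (Suc n)) \<longlonglongrightarrow> 0" using LIMSEQ_inverse_real_of_nat by (simp add: inverse_eq_divide)
    qed (use that in \<open>auto intro!: always_eventually less_imp_le\<close>)
    have "(\<lambda>n. x + s n *\<^sub>R a + t n *\<^sub>R b) \<longlonglongrightarrow> x + 0 *\<^sub>R a + 0 *\<^sub>R b"
      using that by (intro tendsto_intros z) auto
    then have "(\<lambda>n. x + s n *\<^sub>R a + t n *\<^sub>R b) \<longlonglongrightarrow> x" by simp
    then show ?thesis by (rule isCont_tendsto_compose[OF cont])
  qed
  have "\<exists>s t s' t'. 0 < s \<and> s < 1 / Suc n \<and> 0 < t \<and> t < 1 / Suc n \<and> 0 < s' \<and> s' < 1 / Suc n \<and> 0 < t' \<and> t' < 1 / Suc n \<and>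
      ?D a b (x + s *\<^sub>R a + t *\<^sub>R b) = ?D b a (x + s' *\<^sub>R b + t' *\<^sub>R a)" for n
  proof -
    define h where "h = 1 / real (Suc n)"
    have h: "0 < h" by (simp add: h_def)
    obtain s t where 1: "0 < s" "s < h" "0 < t" "t < h"
      "f (x + h *\<^sub>R a + h *\<^sub>R b) - f (x + h *\<^sub>R a) - (f (x + h *\<^sub>R b) - f x) = h * h * ?D a b (x + s *\<^sub>R a + t *\<^sub>R b)"
      using second_difference[OF f h] by blast
    obtain s' t' where 2: "0 < s'" "s' < h" "0 < t'" "t' < h"
      "f (x + h *\<^sub>R b + h *\<^sub>R a) - f (x + h *\<^sub>R b) - (f (x + h *\<^sub>R a) - f x) = h * h * ?D b a (x + s' *\<^sub>R b + t' *\<^sub>R a)"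
      using second_difference[OF f h] by blast
    have "x + h *\<^sub>R b + h *\<^sub>R a = x + h *\<^sub>R a + h *\<^sub>R b" by (simp add: add.commute add.left_commute)
    then have "h * h * ?D a b (x + s *\<^sub>R a + t *\<^sub>R b) = h * h * ?D b a (x + s' *\<^sub>R b + t' *\<^sub>R a)"
      using 1(5) 2(5) by (simp only:)
    then have "?D a b (x + s *\<^sub>R a + t *\<^sub>R b) = ?D b a (x + s' *\<^sub>R b + t' *\<^sub>R a)" using h by simp
    then show ?thesis using 1 2 unfolding h_def by blast
  qed
  then obtain s t s' t' where st: "\<And>n. 0 < s n \<and> s n < 1 / Suc n \<and> 0 < t n \<and> t n < 1 / Suc n \<and>
      0 < s' n \<and> s' n < 1 / Suc n \<and> 0 < t' n \<and> t' n < 1 / Suc n \<and>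
      ?D a b (x + s n *\<^sub>R a + t n *\<^sub>R b) = ?D b a (x + s' n *\<^sub>R b + t' n *\<^sub>R a)"
    by metis
  have eq: "?D a b (x + s n *\<^sub>R a + t n *\<^sub>R b) = ?D b a (x + s' n *\<^sub>R b + t' n *\<^sub>R a)" for n
    using st[of n] by (elim conjE)
  have b1: "0 < s n \<and> s n < 1 / Suc n \<and> 0 < t n \<and> t n < 1 / Suc n" for n
    using st[of n] by (elim conjE, intro conjI)
  have b2: "0 < s' n \<and> s' n < 1 / Suc n \<and> 0 < t' n \<and> t' n < 1 / Suc n" for n
    using st[of n] by (elim conjE, intro conjI)
  have "(\<lambda>n. ?D b a (x + s' n *\<^sub>R b + t' n *\<^sub>R a)) \<longlonglongrightarrow> ?D a b x"
    using lim[of s t a b, OF b1] by (simp only: eq)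
  then show ?thesis by (rule LIMSEQ_unique) (rule lim[OF b2])
qed

lemma symmetric_cross_sum:
  fixes a b c :: "real^3"
  assumes "a $ 2 = b $ 1" "a $ 3 = c $ 1" "b $ 3 = c $ 2"
  shows "cross3 (axis 1 1) a + cross3 (axis 2 1) b + cross3 (axis 3 1) c = 0"
  by (rule vec3_eqI) (simp_all add: cross3_def axis_def assms)

lemma curl_grad:
  assumes f: "Cinf f" shows "curl (grad f) x = 0"
proof -
  let ?D = "frechet_derivative (grad f) (at x)"
  have d: "(grad f has_derivative ?D) (at x)" by (rule Cinf_has_derivative[OF Cinf_grad[OF f]])
  have comp: "?D v $ i = grad (\<lambda>y. grad f y \<bullet> axis i 1) x \<bullet> v" for v i
  proof -
    have "((\<lambda>y. grad f y \<bullet> axis i 1) has_derivative (\<lambda>v. ?D v \<bullet> axis i 1)) (at x)"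
      by (rule has_derivative_inner_left[OF d])
    from grad_inner[OF this] show ?thesis by (simp add: inner_axis_1)
  qed
  have sym: "?D (axis j 1) $ i = ?D (axis i 1) $ j" for i j
    unfolding comp by (rule second_derivative_symmetric[OF f])
  show ?thesis
    unfolding curl_cross[OF d] by (rule symmetric_cross_sum) (rule sym)+
qed

text \<open>For a linear map \<open>A\<close> the antisymmetric part \<open>transpose A - A\<close> is the cross product with the vector
  \<open>c = \<Sum>j. axis j 1 \<times> A (axis j 1)\<close>.\<close>

lemma pullback_algebra:
  fixes A :: "real^3 \<Rightarrow> real^3" and e n :: "real^3"
  assumes A: "linear A" and e: "e \<bullet> e = 1" and ne: "n \<bullet> e = 0"
  defines "c \<equiv> cross3 (axis 1 1) (A (axis 1 1)) + cross3 (axis 2 1) (A (axis 2 1)) + cross3 (axis 3 1) (A (axis 3 1))"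
  defines "v \<equiv> (\<chi> j. e \<bullet> A (axis j 1 - (n \<bullet> axis j 1) *\<^sub>R e))"
  shows "cross3 (axis 1 1) (A (axis 1 1 - (n \<bullet> axis 1 1) *\<^sub>R e)) + cross3 (axis 2 1) (A (axis 2 1 - (n \<bullet> axis 2 1) *\<^sub>R e))
      + cross3 (axis 3 1) (A (axis 3 1 - (n \<bullet> axis 3 1) *\<^sub>R e)) - cross3 v n
    = c + (n \<bullet> c) *\<^sub>R e"
proof -
  \<comment> \<open>The transpose of A applied to e. Hence \<open>w - A e\<close> is the
    antisymmetric part acting on e, and the claim becomes a double cross product with n.\<close>
  define w :: "real^3" where "w = (\<chi> j. e \<bullet> A (axis j 1))"
  have lin: "A (x - r *\<^sub>R y) = A x - r *\<^sub>R A y" for x y r using A by (simp add: linear_diff linear_cmul)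
  have v: "v = w - (e \<bullet> A e) *\<^sub>R n"
    by (simp add: vec_eq_iff v_def w_def lin inner_diff_right inner_axis mult.commute)
  have e_exp: "e = e $ 1 *\<^sub>R axis 1 1 + e $ 2 *\<^sub>R axis 2 1 + e $ 3 *\<^sub>R axis 3 1"
    by (rule vec3_eqI) (simp_all add: axis_def)
  have "A e = A (e $ 1 *\<^sub>R axis 1 1 + e $ 2 *\<^sub>R axis 2 1 + e $ 3 *\<^sub>R axis 3 1)" using e_exp by (rule arg_cong)
  then have Ae: "A e = e $ 1 *\<^sub>R A (axis 1 1) + e $ 2 *\<^sub>R A (axis 2 1) + e $ 3 *\<^sub>R A (axis 3 1)"
    using A by (simp add: linear_add linear_cmul)
  have 1: "w - A e = cross3 e c"
    unfolding Ae w_def c_def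
    by (rule vec3_eqI) (simp_all add: cross3_def axis_def inner_vec_def sum_3 algebra_simps)
  have 2: "cross3 n (cross3 e c) = (n \<bullet> c) *\<^sub>R e - (n \<bullet> e) *\<^sub>R c"
    by (rule vec3_eqI) (simp_all add: cross3_def inner_vec_def sum_3 algebra_simps)
  have "cross3 (axis 1 1) (A (axis 1 1 - (n \<bullet> axis 1 1) *\<^sub>R e)) + cross3 (axis 2 1) (A (axis 2 1 - (n \<bullet> axis 2 1) *\<^sub>R e))
      + cross3 (axis 3 1) (A (axis 3 1 - (n \<bullet> axis 3 1) *\<^sub>R e)) = c - cross3 n (A e)"
    unfolding lin c_def inner_axis_1
    by (rule vec3_eqI) (simp_all add: cross3_def axis_def algebra_simps)
  moreover have "cross3 v n = - cross3 n w"
    unfolding v by (rule vec3_eqI) (simp_all add: cross3_def algebra_simps)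
  ultimately have "cross3 (axis 1 1) (A (axis 1 1 - (n \<bullet> axis 1 1) *\<^sub>R e)) + cross3 (axis 2 1) (A (axis 2 1 - (n \<bullet> axis 2 1) *\<^sub>R e))
      + cross3 (axis 3 1) (A (axis 3 1 - (n \<bullet> axis 3 1) *\<^sub>R e)) - cross3 v n = c + cross3 n (w - A e)"
    by (simp add: Cross3.right_diff_distrib)
  also have "\<dots> = c + (n \<bullet> c) *\<^sub>R e" unfolding 1 2 ne by simp
  finally show ?thesis .
qed

text \<open>The pullback of the 1-form \<open>F\<close> along \<open>x \<mapsto> x - h x e\<close>, with \<open>n\<close> the gradient of \<open>h\<close>.\<close>
definition pull :: "real^3 \<Rightarrow> (real^3 \<Rightarrow> real) \<Rightarrow> (real^3 \<Rightarrow> real^3) \<Rightarrow> (real^3 \<Rightarrow> real^3) \<Rightarrow> real^3 \<Rightarrow> real^3" where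
  "pull e h n F x = F (x - h x *\<^sub>R e) - (e \<bullet> F (x - h x *\<^sub>R e)) *\<^sub>R n x"

text \<open>The same pullback on 2-forms, written as vector fields: they transform with determinant
  times inverse differential. The determinant is 1 when n is orthogonal to e, and the inverse of 1 -
  e n^T is then 1 + e n^T.\<close>

definition pull_curl :: "real^3 \<Rightarrow> (real^3 \<Rightarrow> real) \<Rightarrow> (real^3 \<Rightarrow> real^3) \<Rightarrow> (real^3 \<Rightarrow> real^3) \<Rightarrow> real^3 \<Rightarrow> real^3" where
  "pull_curl e h n c x = c (x - h x *\<^sub>R e) + (n x \<bullet> c (x - h x *\<^sub>R e)) *\<^sub>R e"

lemma Cinf_pull:
  assumes "Cinf h" "Cinf F" shows "Cinf (pull e h (grad h) F)"
proof -
  have "Cinf (\<lambda>x. F (x - h x *\<^sub>R e))"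
    by (intro Cinf_compose[OF assms(2)] Cinf_diff Cinf_id Cinf_scaleR Cinf_const assms)
  then show ?thesis
    unfolding pull_def[abs_def] by (intro Cinf_diff Cinf_scaleR Cinf_inner Cinf_const Cinf_grad assms)
qed

text \<open>Exterior derivative commutes with pullback. The only second derivatives, those of h,
  enter through the curl of \<open>grad h\<close>, which is 0; this is why the right side makes
  sense for g of class C1 as well.\<close>

lemma curl_pull:
  assumes h: "Cinf h" and F: "Cinf F" and e: "e \<bullet> e = 1" and he: "grad h x \<bullet> e = 0"
  shows "curl (pull e h (grad h) F) x = pull_curl e h (grad h) (curl F) x"
proof -
  define n where "n = grad h x"
  define A where "A = frechet_derivative F (at (x - h x *\<^sub>R e))"
  define H where "H = frechet_derivative (grad h) (at x)"
  let ?y = "x - h x *\<^sub>R e"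
  let ?FG = "\<lambda>x. F (x - h x *\<^sub>R e)"
  let ?s = "\<lambda>x. e \<bullet> F (x - h x *\<^sub>R e)"
  have dF: "(F has_derivative A) (at ?y)" unfolding A_def by (rule Cinf_has_derivative[OF F])
  have linA: "linear A" using dF has_derivative_linear by blast
  have dh: "(h has_derivative (\<lambda>v. n \<bullet> v)) (at x)" unfolding n_def by (rule Cinf_has_derivative_grad[OF h])
  have "((\<lambda>x. x - h x *\<^sub>R e) has_derivative (\<lambda>v. v - (n \<bullet> v) *\<^sub>R e)) (at x)"
    by (intro has_derivative_diff has_derivative_ident has_derivative_scaleR_left dh)
  from has_derivative_compose[OF this dF]
  have dFG: "(?FG has_derivative (\<lambda>v. A (v - (n \<bullet> v) *\<^sub>R e))) (at x)" .
  have ds: "(?s has_derivative (\<lambda>v. e \<bullet> A (v - (n \<bullet> v) *\<^sub>R e))) (at x)"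
    by (rule has_derivative_inner_right[OF dFG])
  define v :: "real^3" where "v = (\<chi> j. e \<bullet> A (axis j 1 - (n \<bullet> axis j 1) *\<^sub>R e))"
  have gs: "grad ?s x = v"
    unfolding grad_def frechet_derivative_at[OF ds, symmetric] v_def ..
  have ds': "(?s has_derivative (\<lambda>u. v \<bullet> u)) (at x)"
  proof -
    have "v \<bullet> u = e \<bullet> A (u - (n \<bullet> u) *\<^sub>R e)" for u using grad_inner[OF ds, of u] by (simp add: gs)
    then show ?thesis using ds by simp
  qed
  have dH: "(grad h has_derivative H) (at x)" unfolding H_def by (rule Cinf_has_derivative[OF Cinf_grad[OF h]])
  have "curl (\<lambda>x. ?s x *\<^sub>R grad h x) x = ?s x *\<^sub>R curl (grad h) x + cross3 v n"
    unfolding n_def by (rule curl_scaleR_const_plus[OF ds' dH])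
  then have c2: "curl (\<lambda>x. ?s x *\<^sub>R grad h x) x = cross3 v n" by (simp add: curl_grad[OF h])
  have dsg: "((\<lambda>x. ?s x *\<^sub>R grad h x) has_derivative (\<lambda>u. ?s x *\<^sub>R H u + (v \<bullet> u) *\<^sub>R grad h x)) (at x)"
    by (rule has_derivative_scaleR[OF ds' dH])
  have "curl (\<lambda>x. ?FG x - ?s x *\<^sub>R grad h x) x = curl ?FG x - curl (\<lambda>x. ?s x *\<^sub>R grad h x) x"
    unfolding curl_cross[OF has_derivative_diff[OF dFG dsg]] curl_cross[OF dFG] curl_cross[OF dsg]
    by (simp add: Cross3.right_diff_distrib)
  also have "\<dots> = pull_curl e h (grad h) (curl F) x"
    unfolding c2 curl_cross[OF dFG] pull_curl_def curl_cross[OF dF] n_def[symmetric] v_def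
    by (rule pullback_algebra[OF linA e]) (simp add: n_def he)
  finally show ?thesis by (simp add: pull_def[abs_def])
qed

section \<open>Smoothing the graph\<close>

lemma continuous_loc_integrable:
  fixes f :: "'a::euclidean_space \<Rightarrow> 'b::euclidean_space"
  assumes "continuous_on UNIV f" shows "loc_integrable f"
  unfolding loc_integrable_def
proof
  fix r :: real
  have "bounded (f ` cball 0 r)"
    by (intro compact_imp_bounded compact_continuous_image continuous_on_subset[OF assms]) auto
  then obtain C where C: "\<And>z. z \<in> cball 0 r \<Longrightarrow> norm (f z) \<le> C" unfolding bounded_iff by blast
  have [measurable]: "f \<in> borel_measurable borel" by (rule borel_measurable_continuous_onI[OF assms])
  show "integrable lborel (\<lambda>x. indicator (cball 0 r) x *\<^sub>R f x)"
  proof (rule integrableI_bounded_set[where A="cball 0 r" and B=C])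
    show "emeasure lborel (cball (0::'a) r) < \<infinity>" by (rule emeasure_lborel_cball_finite)
    show "AE x in lborel. x \<in> cball 0 r \<longrightarrow> norm (indicator (cball 0 r) x *\<^sub>R f x) \<le> C"
      using C by (intro AE_I2) auto
    show "(\<lambda>x. indicator (cball 0 r) x *\<^sub>R f x) \<in> borel_measurable lborel"
      by (intro borel_measurable_scaleR borel_measurable_indicator) auto
  qed auto
qed

text \<open>Differentiate along D itself: the derivative is the squared norm of D, while difference
  quotients are at most c times its norm.\<close>

lemma lipschitz_has_derivative_bound:
  fixes q :: "real^3 \<Rightarrow> real"
  assumes d: "(q has_derivative (\<lambda>h. D \<bullet> h)) (at x)" and r: "r > 0"
    and lip: "\<And>y. dist y x < r \<Longrightarrow> \<bar>q y - q x\<bar> \<le> c * dist y x"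
  shows "norm D \<le> c"
proof (cases "D = 0")
  case True
  have "\<bar>q (x + (r/2) *\<^sub>R axis 1 1) - q x\<bar> \<le> c * (r / 2)" using lip[of "x + (r/2) *\<^sub>R axis 1 1"] r by (simp add: dist_norm)
  then have "0 \<le> c * (r / 2)" by linarith
  then show ?thesis using True r by (simp add: zero_le_mult_iff)
next
  case False
  have "((\<lambda>s. x + s *\<^sub>R D) has_derivative (\<lambda>s. s *\<^sub>R D)) (at 0)" by (auto intro!: derivative_eq_intros)
  moreover have "(q has_derivative (\<lambda>h. D \<bullet> h)) (at (x + 0 *\<^sub>R D))" using d by simp
  ultimately have "((\<lambda>s. q (x + s *\<^sub>R D)) has_derivative (\<lambda>s. D \<bullet> (s *\<^sub>R D))) (at 0)"
    by (rule has_derivative_compose)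
  then have "((\<lambda>s. q (x + s *\<^sub>R D)) has_real_derivative D \<bullet> D) (at 0)"
    unfolding has_field_derivative_def by (rule has_derivative_eq_rhs) (simp add: fun_eq_iff mult.commute)
  then have "((\<lambda>s. (q (x + s *\<^sub>R D) - q x) / s) \<longlongrightarrow> D \<bullet> D) (at 0)"
    unfolding has_field_derivative_iff by simp
  moreover have "eventually (\<lambda>s. (q (x + s *\<^sub>R D) - q x) / s \<le> c * norm D) (at 0)"
    unfolding eventually_at
  proof (intro exI[of _ "r / norm D"] conjI ballI impI)
    show "0 < r / norm D" using r False by simp
    fix s :: real assume s: "s \<noteq> 0 \<and> dist s 0 < r / norm D"
    then have "\<bar>s\<bar> * norm D < r" using False by (simp add: field_simps)
    then have "\<bar>q (x + s *\<^sub>R D) - q x\<bar> \<le> c * (\<bar>s\<bar> * norm D)" using lip[of "x + s *\<^sub>R D"] by (simp add: dist_norm)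
    then have "\<bar>(q (x + s *\<^sub>R D) - q x) / s\<bar> \<le> c * norm D" using s by (simp add: field_simps)
    then show "(q (x + s *\<^sub>R D) - q x) / s \<le> c * norm D" by linarith
  qed
  ultimately have "D \<bullet> D \<le> c * norm D" by (rule tendsto_upperbound) simp
  then have "norm D * norm D \<le> c * norm D" by (simp add: power2_norm_eq_inner[symmetric] power2_eq_square)
  then show ?thesis using False by simp
qed

lemma invariant_grad:
  assumes h: "Cinf h" and inv: "\<And>x s. h (x + s *\<^sub>R e) = h x" shows "grad h x \<bullet> e = 0"
proof -
  have "((\<lambda>s. x + s *\<^sub>R e) has_derivative (\<lambda>s. s *\<^sub>R e)) (at 0)" by (auto intro!: derivative_eq_intros)
  moreover have "(h has_derivative (\<lambda>v. grad h x \<bullet> v)) (at (x + 0 *\<^sub>R e))" using Cinf_has_derivative_grad[OF h, of x] by simp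
  ultimately have "((\<lambda>s. h (x + s *\<^sub>R e)) has_derivative (\<lambda>s. grad h x \<bullet> (s *\<^sub>R e))) (at 0)"
    by (rule has_derivative_compose)
  moreover have "((\<lambda>s::real. h x) has_derivative (\<lambda>s. 0)) (at 0)" by simp
  ultimately have "(\<lambda>s. grad h x \<bullet> (s *\<^sub>R e)) = (\<lambda>s. 0)"
    unfolding inv by (rule has_derivative_unique)
  from fun_cong[OF this, of 1] show ?thesis by simp
qed

context graph
begin

text \<open>Mollify g with a kernel of small isotropic width; averaging keeps the invariance along
  e. The gradient is not computed under the integral: h minus the tangent map of g at x has a small
  difference quotient at x, and \<open>lipschitz_has_derivative_bound\<close> converts this.\<close>

lemma smooth_graph_approx:
  assumes \<eta>: "\<eta> > 0"
  obtains h where "Cinf h" "\<And>x. grad h x \<bullet> e = 0"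
    "\<And>x. norm x \<le> R \<Longrightarrow> \<bar>h x - g x\<bar> \<le> \<eta>" "\<And>x. norm x \<le> R \<Longrightarrow> norm (grad h x - grad g x) \<le> \<eta>"
proof -
  have "uniformly_continuous_on (cball 0 (R + 2)) g" "uniformly_continuous_on (cball 0 (R + 2)) (grad g)"
    by (intro compact_uniformly_continuous continuous_on_subset[OF g_cont] continuous_on_subset[OF grad_g_cont]; simp)+
  then obtain d1 d2 where d1: "d1 > 0" "\<And>x y. x \<in> cball 0 (R + 2) \<Longrightarrow> y \<in> cball 0 (R + 2) \<Longrightarrow> dist y x < d1 \<Longrightarrow> dist (g y) (g x) < \<eta>"
    and d2: "d2 > 0" "\<And>x y. x \<in> cball 0 (R + 2) \<Longrightarrow> y \<in> cball 0 (R + 2) \<Longrightarrow> dist y x < d2 \<Longrightarrow> dist (grad g y) (grad g x) < \<eta>"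
    using \<eta> unfolding uniformly_continuous_on_def by metis
  define d where "d = min (min d1 d2) 1"
  have d: "0 < d" "d \<le> d1" "d \<le> d2" "d \<le> 1" using d1(1) d2(1) by (auto simp: d_def)
  \<comment> \<open>With both widths equal to r the kernel lives within radius 6 r, which is below d
    / 2.\<close>
  define r where "r = d / 20"
  have r: "0 < r" "6 * r < d / 2" using d(1) by (simp_all add: r_def)
  define k where "k = kernel r r"
  have k: "Cinf k" "\<And>z. 0 \<le> k z" using Cinf_kernel kernel_nonneg[OF r(1) r(1)] by (simp_all add: k_def)
  have kz: "d / 2 \<le> norm z \<Longrightarrow> k z = 0" for z unfolding k_def using r by (intro kernel_eq_0) auto
  have kfar: "d / 2 < norm z \<Longrightarrow> k z = 0" for z by (rule kz) simp
  have kint: "integrable lborel k" and k1: "(\<integral>z. k z \<partial>lborel) = 1"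
  proof -
    have n1: "(\<integral>\<^sup>+z. ennreal (k z) \<partial>lborel) = 1" unfolding k_def by (rule nn_integral_kernel[OF r(1) r(1)])
    have "k \<in> borel_measurable lborel" using borel_measurable_continuous_onI[OF Cinf_continuous[OF k(1)]] by simp
    then show "integrable lborel k" using n1 k(2) by (intro integrableI_nonneg) auto
    then show "(\<integral>z. k z \<partial>lborel) = 1" using n1 nn_integral_eq_integral[of lborel k] k(2) by simp
  qed
  have [measurable]: "k \<in> borel_measurable borel" by (rule borel_measurable_continuous_onI[OF Cinf_continuous[OF k(1)]])
  define h where "h = conv k g"
  note lg = continuous_loc_integrable[OF g_cont]
  have int: "integrable lborel (\<lambda>y. k (y - x) *\<^sub>R g y)" for x
    by (rule integrable_kernel[OF Cinf_continuous[OF k(1)] kfar lg])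
  have shift: "h x = (\<integral>z. k z * g (z + x) \<partial>lborel)" and intz: "integrable lborel (\<lambda>z. k z * g (z + x))" for x
  proof -
    show "h x = (\<integral>z. k z * g (z + x) \<partial>lborel)"
      unfolding h_def conv_def using integral_lborel_translate[of "\<lambda>y. k (y - x) *\<^sub>R g y" x] by simp
    have "integrable (distr lborel borel ((+) x)) (\<lambda>y. k (y - x) *\<^sub>R g y)" using int by (simp add: lborel_distr_plus)
    then show "integrable lborel (\<lambda>z. k z * g (z + x))" by (simp add: integrable_distr_eq add.commute)
  qed
  have Ch: "Cinf h" unfolding h_def by (rule Cinf_conv[OF k(1) kfar lg])
  have inv: "h (x + s *\<^sub>R e) = h x" for x s
    unfolding shift using g_inv by (simp add: add.assoc[symmetric])
  have avg: "\<bar>\<integral>z. k z * q z \<partial>lborel\<bar> \<le> c"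
    if "integrable lborel (\<lambda>z. k z * q z)" "\<And>z. norm z < d / 2 \<Longrightarrow> \<bar>q z\<bar> \<le> c" for q c
  proof -
    have "norm (\<integral>z. k z * q z \<partial>lborel) \<le> (\<integral>z. k z * c \<partial>lborel)"
    proof (rule Bochner_Integration.integral_norm_bound_integral[OF that(1)])
      show "integrable lborel (\<lambda>z. k z * c)" using kint by simp
      show "norm (k z * q z) \<le> k z * c" for z
        using that(2)[of z] kz[of z] k(2)[of z] by (cases "norm z < d / 2") (auto simp: abs_mult mult_left_mono)
    qed
    then show ?thesis using k1 by simp
  qed
  show ?thesis
  proof
    show "Cinf h" by fact
    show "grad h x \<bullet> e = 0" for x by (rule invariant_grad[OF Ch inv])
    fix x :: "real^3" assume x: "norm x \<le> R"
    have "h x - g x = (\<integral>z. k z * (g (z + x) - g x) \<partial>lborel)"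
      unfolding shift using intz[of x] kint k1 by (simp add: algebra_simps)
    moreover have "\<bar>\<integral>z. k z * (g (z + x) - g x) \<partial>lborel\<bar> \<le> \<eta>"
    proof (rule avg)
      show "integrable lborel (\<lambda>z. k z * (g (z + x) - g x))"
        using intz[of x] kint by (simp add: algebra_simps)
      fix z :: "real^3" assume z: "norm z < d / 2"
      have "z + x \<in> cball 0 (R + 2)" "x \<in> cball 0 (R + 2)"
        using z x d norm_triangle_ineq[of z x] by auto
      then have "dist (g (z + x)) (g x) < \<eta>" using z d by (intro d1(2)) (auto simp: dist_norm)
      then show "\<bar>g (z + x) - g x\<bar> \<le> \<eta>" by (simp add: dist_real_def)
    qed
    ultimately show "\<bar>h x - g x\<bar> \<le> \<eta>" by simp
    \<comment> \<open>Near x this function has gradient at most \<eta>; its averages inherit the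
      Lipschitz constant.\<close>
    let ?l = "\<lambda>y. g y - grad g x \<bullet> y"
    have lip0: "\<bar>?l a - ?l b\<bar> \<le> \<eta> * norm (a - b)" if "a \<in> ball x d" "b \<in> ball x d" for a b
    proof -
      have "norm (?l a - ?l b) \<le> \<eta> * norm (a - b)"
      proof (rule differentiable_bound[where S="ball x d" and f'="\<lambda>y v. (grad g y - grad g x) \<bullet> v"])
        fix y assume y: "y \<in> ball x d"
        have "(?l has_derivative (\<lambda>v. grad g y \<bullet> v - grad g x \<bullet> v)) (at y)"
          by (intro has_derivative_diff g_deriv has_derivative_inner_right has_derivative_ident)
        then show "(?l has_derivative (\<lambda>v. (grad g y - grad g x) \<bullet> v)) (at y within ball x d)"
          unfolding inner_diff_left by (rule has_derivative_at_withinI)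
        have "norm y \<le> R + 2" using y x d norm_triangle_ineq[of "y - x" x] by (simp add: dist_norm norm_minus_commute)
        then have "dist (grad g y) (grad g x) < \<eta>" using x y d by (intro d2(2)) (auto simp: dist_commute)
        then have le: "norm (grad g y - grad g x) \<le> \<eta>" by (simp add: dist_norm)
        show "onorm (\<lambda>v. (grad g y - grad g x) \<bullet> v) \<le> \<eta>"
        proof (rule onorm_bound)
          fix v
          have "norm ((grad g y - grad g x) \<bullet> v) \<le> norm (grad g y - grad g x) * norm v"
            unfolding real_norm_def by (rule Cauchy_Schwarz_ineq2)
          also have "\<dots> \<le> \<eta> * norm v" using le by (simp add: mult_right_mono)
          finally show "norm ((grad g y - grad g x) \<bullet> v) \<le> \<eta> * norm v" .
        qed (use \<eta> in simp)
      qed (use that in auto)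
      then show ?thesis by simp
    qed
    let ?q = "\<lambda>y. h y - grad g x \<bullet> y"
    show "norm (grad h x - grad g x) \<le> \<eta>"
    proof (rule lipschitz_has_derivative_bound[of ?q _ x "d / 2"])
      show "(?q has_derivative (\<lambda>v. (grad h x - grad g x) \<bullet> v)) (at x)"
        unfolding inner_diff_left
        by (intro has_derivative_diff Cinf_has_derivative_grad[OF Ch] has_derivative_inner_right has_derivative_ident)
      show "0 < d / 2" using d by simp
      fix y assume y: "dist y x < d / 2"
      have i: "integrable lborel (\<lambda>z. k z * (?l (z + y) - ?l (z + x)))"
      proof -
        have "integrable lborel (\<lambda>z. k z * g (z + y) - k z * g (z + x) - k z * (grad g x \<bullet> (y - x)))"
          by (intro Bochner_Integration.integrable_diff intz integrable_mult_left kint)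
        then show ?thesis by (simp add: algebra_simps inner_add_right inner_diff_right)
      qed
      have "?q y - ?q x = (\<integral>z. k z * g (z + y) \<partial>lborel) - (\<integral>z. k z * g (z + x) \<partial>lborel) - (\<integral>z. k z * (grad g x \<bullet> (y - x)) \<partial>lborel)"
        unfolding shift using k1 by (simp add: inner_diff_right)
      also have "\<dots> = (\<integral>z. k z * g (z + y) - k z * g (z + x) - k z * (grad g x \<bullet> (y - x)) \<partial>lborel)"
        using kint intz by simp
      also have "\<dots> = (\<integral>z. k z * (?l (z + y) - ?l (z + x)) \<partial>lborel)"
        by (simp add: algebra_simps inner_add_right inner_diff_right)
      finally have "?q y - ?q x = (\<integral>z. k z * (?l (z + y) - ?l (z + x)) \<partial>lborel)" .
      moreover have "\<bar>\<integral>z. k z * (?l (z + y) - ?l (z + x)) \<partial>lborel\<bar> \<le> \<eta> * dist y x"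
      proof (rule avg[OF i])
        fix z :: "real^3" assume z: "norm z < d / 2"
        have "dist x (z + y) < d" "dist x (z + x) < d"
          using z y norm_triangle_ineq[of z "y - x"] d by (auto simp: dist_norm norm_minus_commute add_diff_eq)
        then have "\<bar>?l (z + y) - ?l (z + x)\<bar> \<le> \<eta> * norm ((z + y) - (z + x))" by (intro lip0) auto
        then show "\<bar>?l (z + y) - ?l (z + x)\<bar> \<le> \<eta> * dist y x" by (simp add: dist_norm)
      qed
      ultimately show "\<bar>?q y - ?q x\<bar> \<le> \<eta> * dist y x" by simp
    qed
  qed
qed

lemma B_nonneg: "0 \<le> B" using gB[of 0] norm_ge_zero order_trans by blast

text \<open>Pulling back along the C1 function g gives a continuous field whose curl is only
  formally \<open>pull_curl\<close>. Along a smooth h the identity is genuine, and neither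
  expression involves more than h and its gradient, both uniformly close to those of g.\<close>

lemma pull_approx:
  assumes F: "Cinf F" and t: "t > 0"
  obtains \<Phi> where "Cinf \<Phi>" "\<And>x. norm x \<le> R \<Longrightarrow> norm (\<Phi> x - pull e g (grad g) F x) \<le> t"
    "\<And>x. norm x \<le> R \<Longrightarrow> norm (curl \<Phi> x - pull_curl e g (grad g) (curl F) x) \<le> t"
proof -
  have cF: "continuous_on UNIV F" "continuous_on UNIV (curl F)" using Cinf_continuous[OF F] Cinf_curl[OF F] .
  have "bounded (g ` cball 0 R)"
    by (intro compact_imp_bounded compact_continuous_image continuous_on_subset[OF g_cont]) auto
  then obtain G where G: "\<And>z. norm z \<le> R \<Longrightarrow> \<bar>g z\<bar> \<le> G" unfolding bounded_iff by fastforce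
  define R' where "R' = R + G + 1"
  have "bounded (F ` cball 0 R')" "bounded (curl F ` cball 0 R')"
    by (intro compact_imp_bounded compact_continuous_image continuous_on_subset[OF cF(1)] continuous_on_subset[OF cF(2)]; simp)+
  then obtain C1 C2 where C12: "\<And>z. z \<in> cball 0 R' \<Longrightarrow> norm (F z) \<le> C1" "\<And>z. z \<in> cball 0 R' \<Longrightarrow> norm (curl F z) \<le> C2"
    unfolding bounded_iff by blast
  define C where "C = max (max C1 C2) 0"
  have C: "0 \<le> C" "\<And>z. z \<in> cball 0 R' \<Longrightarrow> norm (F z) \<le> C" "\<And>z. z \<in> cball 0 R' \<Longrightarrow> norm (curl F z) \<le> C"
  proof -
    have le: "C1 \<le> C" "C2 \<le> C" by (simp_all add: C_def)
    show "0 \<le> C" by (simp add: C_def)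
    show "norm (F z) \<le> C" "norm (curl F z) \<le> C" if "z \<in> cball 0 R'" for z
      using order_trans[OF C12(1)[OF that] le(1)] order_trans[OF C12(2)[OF that] le(2)] .
  qed
  \<comment> \<open>The perturbation bound is s (1 + (B + 1) + C), taken from \<open>close\<close>
    below; B + C + 3 exceeds this factor.\<close>
  define s where "s = t / (B + C + 3)"
  have s: "s > 0" "s * (B + C + 3) = t" using t B_nonneg C(1) by (auto simp: s_def)
  have "uniformly_continuous_on (cball 0 R') F" "uniformly_continuous_on (cball 0 R') (curl F)"
    by (intro compact_uniformly_continuous continuous_on_subset[OF cF(1)] continuous_on_subset[OF cF(2)]; simp)+
  then obtain d1 d2 where d1: "d1 > 0" "\<And>x y. x \<in> cball 0 R' \<Longrightarrow> y \<in> cball 0 R' \<Longrightarrow> dist y x < d1 \<Longrightarrow> dist (F y) (F x) < s"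
    and d2: "d2 > 0" "\<And>x y. x \<in> cball 0 R' \<Longrightarrow> y \<in> cball 0 R' \<Longrightarrow> dist y x < d2 \<Longrightarrow> dist (curl F y) (curl F x) < s"
    using s(1) unfolding uniformly_continuous_on_def by metis
  define \<eta> where "\<eta> = min (min (d1 / 2) (d2 / 2)) (min s 1)"
  have \<eta>: "\<eta> > 0" "\<eta> < d1" "\<eta> < d2" "\<eta> \<le> s" "\<eta> \<le> 1" using d1(1) d2(1) s(1) by (auto simp: \<eta>_def)
  obtain h where h: "Cinf h" "\<And>x. grad h x \<bullet> e = 0" "\<And>x. norm x \<le> R \<Longrightarrow> \<bar>h x - g x\<bar> \<le> \<eta>"
      "\<And>x. norm x \<le> R \<Longrightarrow> norm (grad h x - grad g x) \<le> \<eta>"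
    by (rule smooth_graph_approx[OF \<eta>(1), of R]) (rule that)
  \<comment> \<open>One estimate for field and curl alike: both are a vector plus a product linear
    in that vector and in the gradient, here perturbed from (v, n) to (u, m).\<close>
  have close: "norm a \<le> t" if "norm (u - v) \<le> s" "norm v \<le> C" "norm (m - n) \<le> s" "norm n \<le> B" "norm (m - n) \<le> 1"
      "norm a \<le> norm (u - v) + (norm (u - v) * norm m + norm v * norm (m - n))" for a u v m n :: "real^3"
  proof -
    have "norm m \<le> B + 1" using norm_triangle_ineq[of "m - n" n] that by simp
    then have "norm (u - v) * norm m \<le> s * (B + 1)" using that s(1) by (intro mult_mono) auto
    moreover have "norm v * norm (m - n) \<le> C * s" using that C(1) by (intro mult_mono) auto
    ultimately have "norm a \<le> s + (s * (B + 1) + C * s)" using that by linarith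
    also have "\<dots> \<le> s * (B + C + 3)" using s(1) by (simp add: algebra_simps)
    finally show ?thesis using s(2) by simp
  qed
  show ?thesis
  proof
    show "Cinf (pull e h (grad h) F)" by (rule Cinf_pull[OF h(1) F])
    fix x :: "real^3" assume x: "norm x \<le> R"
    have hg: "\<bar>h x - g x\<bar> \<le> \<eta>" "norm (grad h x - grad g x) \<le> \<eta>" using h(3,4) x by auto
    let ?y = "x - h x *\<^sub>R e" and ?z = "x - g x *\<^sub>R e"
    have ny: "norm ?y \<le> R'" "norm ?z \<le> R'"
      using x G[OF x] hg(1) \<eta>(5) norm_triangle_ineq4[of x "h x *\<^sub>R e"] norm_triangle_ineq4[of x "g x *\<^sub>R e"]
      by (auto simp: R'_def)
    have "dist ?y ?z = \<bar>h x - g x\<bar>"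
      by (simp add: dist_norm scaleR_diff_left[symmetric] abs_minus_commute)
    then have dyz: "dist ?y ?z < d1" "dist ?y ?z < d2" using hg(1) \<eta> by auto
    have yb: "?y \<in> cball 0 R'" "?z \<in> cball 0 R'" using ny by (simp_all only: mem_cball_0)
    have FF: "norm (F ?y - F ?z) \<le> s" "norm (curl F ?y - curl F ?z) \<le> s"
      using d1(2)[OF yb(2) yb(1) dyz(1)] d2(2)[OF yb(2) yb(1) dyz(2)] unfolding dist_norm by linarith+
    have ee: "\<bar>e \<bullet> v\<bar> \<le> norm v" for v using Cauchy_Schwarz_ineq2[of e v] by simp
    show "norm (pull e h (grad h) F x - pull e g (grad g) F x) \<le> t"
    proof (rule close[of "F ?y" "F ?z" "grad h x" "grad g x"])
      have eq: "pull e h (grad h) F x - pull e g (grad g) F x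
          = (F ?y - F ?z) - ((e \<bullet> (F ?y - F ?z)) *\<^sub>R grad h x + (e \<bullet> F ?z) *\<^sub>R (grad h x - grad g x))"
        by (simp add: pull_def inner_diff_right algebra_simps)
      have "norm ((e \<bullet> (F ?y - F ?z)) *\<^sub>R grad h x + (e \<bullet> F ?z) *\<^sub>R (grad h x - grad g x))
          \<le> norm (F ?y - F ?z) * norm (grad h x) + norm (F ?z) * norm (grad h x - grad g x)"
        by (rule order_trans[OF norm_triangle_ineq]) (auto intro!: add_mono mult_right_mono ee)
      then show "norm (pull e h (grad h) F x - pull e g (grad g) F x)
          \<le> norm (F ?y - F ?z) + (norm (F ?y - F ?z) * norm (grad h x) + norm (F ?z) * norm (grad h x - grad g x))"
        unfolding eq using norm_triangle_ineq4[of "F ?y - F ?z"] by (meson add_left_mono order_trans)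
    qed (use FF hg \<eta> C(2)[OF yb(2)] gB in auto)
    have cp: "curl (pull e h (grad h) F) x = pull_curl e h (grad h) (curl F) x"
      by (rule curl_pull[OF h(1) F _ h(2)]) simp
    show "norm (curl (pull e h (grad h) F) x - pull_curl e g (grad g) (curl F) x) \<le> t"
      unfolding cp
    proof (rule close[of "curl F ?y" "curl F ?z" "grad h x" "grad g x"])
      have eq: "pull_curl e h (grad h) (curl F) x - pull_curl e g (grad g) (curl F) x
          = (curl F ?y - curl F ?z) + ((grad h x \<bullet> (curl F ?y - curl F ?z)) *\<^sub>R e + ((grad h x - grad g x) \<bullet> curl F ?z) *\<^sub>R e)"
        by (simp add: pull_curl_def inner_diff_right inner_diff_left algebra_simps)
      have "norm ((grad h x \<bullet> (curl F ?y - curl F ?z)) *\<^sub>R e + ((grad h x - grad g x) \<bullet> curl F ?z) *\<^sub>R e)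
          \<le> norm (curl F ?y - curl F ?z) * norm (grad h x) + norm (curl F ?z) * norm (grad h x - grad g x)"
        using Cauchy_Schwarz_ineq2[of "grad h x" "curl F ?y - curl F ?z"] Cauchy_Schwarz_ineq2[of "grad h x - grad g x" "curl F ?z"]
        by (intro order_trans[OF norm_triangle_ineq] add_mono) (simp_all add: mult.commute)
      then show "norm (pull_curl e h (grad h) (curl F) x - pull_curl e g (grad g) (curl F) x)
          \<le> norm (curl F ?y - curl F ?z) + (norm (curl F ?y - curl F ?z) * norm (grad h x) + norm (curl F ?z) * norm (grad h x - grad g x))"
        unfolding eq using norm_triangle_ineq[of "curl F ?y - curl F ?z"] by (meson add_left_mono order_trans)
    qed (use FF hg \<eta> C(3)[OF yb(2)] gB in auto)
  qed
qed

end

section \<open>Local approximation near a graph\<close>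

abbreviation H2 :: "(real^3) measure" where "H2 \<equiv> hausdorff_measure 2"

lemma Lpe_scale_le:
  assumes "\<And>x. x \<in> space M \<Longrightarrow> norm (f x) \<le> c * norm (h x)" "0 \<le> c" "0 \<le> p" "h \<in> borel_measurable M"
  shows "Lpe p M (f :: 'a \<Rightarrow> 'b::real_normed_vector) \<le> ennreal (c powr p) * Lpe p M (h :: 'a \<Rightarrow> 'c::{real_normed_vector, second_countable_topology})"
proof -
  have [measurable]: "h \<in> borel_measurable M" by fact
  have "Lpe p M f \<le> (\<integral>\<^sup>+x. ennreal (c powr p) * ennreal (norm (h x) powr p) \<partial>M)"
    unfolding Lpe_def
  proof (rule nn_integral_mono)
    fix x assume "x \<in> space M"
    then have "norm (f x) powr p \<le> (c * norm (h x)) powr p" using assms by (intro powr_mono2) auto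
    also have "\<dots> = c powr p * norm (h x) powr p" using assms by (intro powr_mult)
    finally show "ennreal (norm (f x) powr p) \<le> ennreal (c powr p) * ennreal (norm (h x) powr p)"
      by (simp add: ennreal_mult[symmetric] ennreal_leI)
  qed
  also have "\<dots> = ennreal (c powr p) * Lpe p M h" unfolding Lpe_def by (rule nn_integral_cmult) measurable
  finally show ?thesis .
qed

lemma Lpe_const_le:
  assumes "\<And>x. x \<in> space M \<Longrightarrow> norm (f x) \<le> c * indicator S x" "0 \<le> c" "1 \<le> p" "S \<in> sets M"
  shows "Lpe p M f \<le> ennreal (c powr p) * emeasure M S"
proof -
  have "Lpe p M f \<le> (\<integral>\<^sup>+x. ennreal (c powr p) * indicator S x \<partial>M)"
    unfolding Lpe_def
  proof (rule nn_integral_mono)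
    fix x assume x: "x \<in> space M"
    have "norm (f x) powr p \<le> (c * indicator S x) powr p" using assms x by (intro powr_mono2) auto
    also have "\<dots> = c powr p * indicator S x" using assms by (cases "x \<in> S") auto
    finally have "ennreal (norm (f x) powr p) \<le> ennreal (c powr p * indicator S x)" by (rule ennreal_leI)
    then show "ennreal (norm (f x) powr p) \<le> ennreal (c powr p) * indicator S x"
      by (cases "x \<in> S") auto
  qed
  also have "\<dots> = ennreal (c powr p) * emeasure M S"
    using assms by (simp add: nn_integral_cmult_indicator)
  finally show ?thesis .
qed

lemma integrable_of_Lpe:
  fixes f :: "'a \<Rightarrow> 'b::{banach, second_countable_topology}"
  assumes [measurable]: "f \<in> borel_measurable M" "S \<in> sets M" and fin: "Lpe p M f < \<infinity>" "emeasure M S < \<infinity>"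
    and p: "1 \<le> p" and supp: "\<And>x. x \<in> space M \<Longrightarrow> x \<notin> S \<Longrightarrow> f x = 0"
  shows "integrable M f"
proof -
  have int: "integrable M (\<lambda>x. norm (f x) powr p)"
    using fin by (simp add: integrable_iff_bounded Lpe_def)
  have ind: "integrable M (\<lambda>x. indicator S x :: real)"
    using fin assms(2) by (simp add: integrable_indicator_iff less_top)
  show ?thesis
  proof (rule Bochner_Integration.integrable_bound[OF Bochner_Integration.integrable_add[OF ind int]])
    have "norm y \<le> 1 + norm y powr p" for y :: 'b
      using powr_mono[of 1 p "norm y"] p by (cases "norm y \<le> 1") (auto intro: add_increasing2)
    then show "AE x in M. norm (f x) \<le> norm (indicator S x + norm (f x) powr p)"
      using supp by (intro AE_I2) (auto simp: indicator_def)
  qed measurable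
qed

lemma integrable_inner_bounded:
  fixes f :: "'a \<Rightarrow> 'b::euclidean_space"
  assumes f: "integrable M f" and [measurable]: "h \<in> borel_measurable M"
    and b: "\<And>x. x \<in> space M \<Longrightarrow> f x \<noteq> 0 \<Longrightarrow> norm (h x) \<le> C"
  shows "integrable M (\<lambda>x. f x \<bullet> h x)" "\<bar>\<integral>x. f x \<bullet> h x \<partial>M\<bar> \<le> C * (\<integral>x. norm (f x) \<partial>M)"
proof -
  have [measurable]: "f \<in> borel_measurable M" using f by simp
  have le: "norm (f x \<bullet> h x) \<le> C * norm (f x)" if "x \<in> space M" for x
  proof (cases "f x = 0")
    case False
    have "\<bar>f x \<bullet> h x\<bar> \<le> norm (f x) * norm (h x)" by (rule Cauchy_Schwarz_ineq2)
    also have "\<dots> \<le> norm (f x) * C" using b that False by (intro mult_left_mono) auto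
    finally show ?thesis by (simp add: mult.commute)
  qed simp
  show i: "integrable M (\<lambda>x. f x \<bullet> h x)"
  proof (rule Bochner_Integration.integrable_bound)
    show "integrable M (\<lambda>x. C * norm (f x))" using f by simp
    show "AE x in M. norm (f x \<bullet> h x) \<le> norm (C * norm (f x))" using le by (intro AE_I2) fastforce
  qed measurable
  have "norm (\<integral>x. f x \<bullet> h x \<partial>M) \<le> (\<integral>x. norm (f x \<bullet> h x) \<partial>M)" by (rule integral_norm_bound)
  also have "\<dots> \<le> (\<integral>x. C * norm (f x) \<partial>M)"
    by (rule integral_mono) (use f le integrable_norm[OF i] in auto)
  finally have "norm (\<integral>x. f x \<bullet> h x \<partial>M) \<le> (\<integral>x. C * norm (f x) \<partial>M)" .
  then show "\<bar>\<integral>x. f x \<bullet> h x \<partial>M\<bar> \<le> C * (\<integral>x. norm (f x) \<partial>M)" by simp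
qed

lemma curl_locally_zero:
  assumes "open U" "x \<in> U" "\<And>y. y \<in> U \<Longrightarrow> F y = 0" shows "curl F x = 0"
proof -
  have "(F has_derivative (\<lambda>_. 0)) (at x)"
  proof (rule has_derivative_transform_within_open[OF _ assms(1,2)])
    show "((\<lambda>_. 0) has_derivative (\<lambda>_. 0)) (at x)" by simp
  qed (use assms(3) in auto)
  from curl_cross[OF this] show ?thesis by simp
qed

text \<open>A field \<open>u\<close> on \<open>\<Omega>\<close> with curl \<open>w\<close> and tangential trace \<open>t\<close> on \<open>S\<close>, all extended by zero.\<close>
definition green_triple :: "(real^3) set \<Rightarrow> (real^3) set \<Rightarrow> real \<Rightarrow> (real^3 \<Rightarrow> real^3) \<Rightarrow> (real^3 \<Rightarrow> real^3) \<Rightarrow> (real^3 \<Rightarrow> real^3) \<Rightarrow> bool" where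
  "green_triple \<Omega> S p u w t \<longleftrightarrow>
     u \<in> borel_measurable borel \<and> w \<in> borel_measurable borel \<and> t \<in> borel_measurable borel \<and>
     Lpe p lborel u < \<infinity> \<and> Lpe p lborel w < \<infinity> \<and> Lpe p H2 t < \<infinity> \<and>
     (\<forall>x. x \<notin> \<Omega> \<longrightarrow> u x = 0 \<and> w x = 0) \<and> (\<forall>x. x \<notin> S \<longrightarrow> t x = 0) \<and>
     (\<forall>\<phi>. Cinf \<phi> \<longrightarrow> (\<integral>x. w x \<bullet> \<phi> x - u x \<bullet> curl \<phi> x \<partial>lborel) = (\<integral>x. t x \<bullet> \<phi> x \<partial>H2))"

text \<open>The tolerance is for p-th powers, as in \<open>Lpe\<close>. The indicators are needed
  because \<Phi>, unlike the data, does not vanish off \<Omega> and S.\<close>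

definition approximable :: "(real^3) set \<Rightarrow> (real^3) set \<Rightarrow> (real^3 \<Rightarrow> real^3) \<Rightarrow> real \<Rightarrow> (real^3 \<Rightarrow> real^3) \<Rightarrow> (real^3 \<Rightarrow> real^3) \<Rightarrow> (real^3 \<Rightarrow> real^3) \<Rightarrow> bool" where
  "approximable \<Omega> S \<nu> p u w t \<longleftrightarrow> (\<forall>e'>0. \<exists>\<Phi>. Cinf \<Phi> \<and>
     Lpe p lborel (\<lambda>x. indicator \<Omega> x *\<^sub>R (u x - \<Phi> x)) \<le> e' \<and>
     Lpe p lborel (\<lambda>x. indicator \<Omega> x *\<^sub>R (w x - curl \<Phi> x)) \<le> e' \<and>
     Lpe p H2 (\<lambda>x. indicator S x *\<^sub>R (t x - cross3 (\<nu> x) (\<Phi> x))) \<le> e')"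

lemma (in graph) jac_le: "jac y \<le> 1 + B"
proof -
  have "1 + (norm (grad g y))\<^sup>2 \<le> (1 + B)\<^sup>2"
    using power_mono[OF gB[of y], of 2] B_nonneg by (simp add: power2_eq_square algebra_simps)
  then show ?thesis unfolding jac_def using B_nonneg real_le_lsqrt by (metis add_nonneg_nonneg zero_le_one real_sqrt_le_iff real_sqrt_abs abs_of_nonneg)
qed

text \<open>All data live in a compact part K of the chart region N, so nothing has to be known
  about \<Omega> and S elsewhere. S and \<nu> stand for the frontier and its normal; as \<Omega>
  lies above the graph, \<open>grad g x - e\<close> points outward.\<close>

locale local_chart = graph +
  fixes \<Omega> N K S :: "(real^3) set" and \<nu> :: "real^3 \<Rightarrow> real^3" and p R :: real and u w t :: "real^3 \<Rightarrow> real^3"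
  assumes N: "open N" and K: "compact K" "K \<subseteq> N" and \<Omega>: "open \<Omega>" "\<Omega> \<subseteq> cball 0 R" and S: "closed S" "S \<subseteq> cball 0 R"
    and chart: "\<And>x. x \<in> N \<Longrightarrow> (x \<in> \<Omega> \<longleftrightarrow> g x < x \<bullet> e) \<and> (x \<in> S \<longleftrightarrow> x \<bullet> e = g x)"
    and normal: "\<And>x. x \<in> S \<Longrightarrow> norm (\<nu> x) \<le> 1" "\<And>x. x \<in> S \<Longrightarrow> x \<in> N \<Longrightarrow> \<nu> x = (grad g x - e) /\<^sub>R jac x"
    and \<nu>_meas: "(\<lambda>x. indicator S x *\<^sub>R \<nu> x) \<in> borel_measurable borel"
    and p: "1 < p" and gt: "green_triple \<Omega> S p u w t"
    and suppK: "\<And>x. x \<notin> K \<Longrightarrow> u x = 0 \<and> w x = 0 \<and> t x = 0"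
    and finS: "emeasure H2 S < \<infinity>"
begin

lemma meas [measurable]: "u \<in> borel_measurable borel" "w \<in> borel_measurable borel" "t \<in> borel_measurable borel"
  and fin: "Lpe p lborel u < \<infinity>" "Lpe p lborel w < \<infinity>" "Lpe p H2 t < \<infinity>"
  and zero: "x \<notin> \<Omega> \<Longrightarrow> u x = 0" "x \<notin> \<Omega> \<Longrightarrow> w x = 0" "x \<notin> S \<Longrightarrow> t x = 0"
  and green: "Cinf \<phi> \<Longrightarrow> (\<integral>x. w x \<bullet> \<phi> x - u x \<bullet> curl \<phi> x \<partial>lborel) = (\<integral>x. t x \<bullet> \<phi> x \<partial>H2)"
  using gt unfolding green_triple_def by auto

lemma sets_S [measurable]: "S \<in> sets borel" and sets_\<Omega> [measurable]: "\<Omega> \<in> sets borel"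
  using S \<Omega> by auto

lemma t_gr: "x \<notin> gr \<Longrightarrow> t x = 0"
  using zero(3)[of x] suppK[of x] chart[of x] K(2) by (auto simp: gr_def)

lemma p1: "1 \<le> p" using p by simp

lemma finR: "emeasure lborel (cball (0 :: real^3) R) < \<infinity>"
  by (rule emeasure_lborel_cball_finite)

lemma zero_R: "\<not> norm x \<le> R \<Longrightarrow> u x = 0 \<and> w x = 0 \<and> t x = 0"
proof -
  assume "\<not> norm x \<le> R"
  then have "x \<notin> cball 0 R" by simp
  then have "x \<notin> \<Omega>" "x \<notin> S" using \<Omega>(2) S(2) by blast+
  then show ?thesis by (simp add: zero)
qed

lemma ints: "integrable lborel u" "integrable lborel w" "integrable H2 t"
proof -
  show "integrable lborel u" "integrable lborel w"
    by (rule integrable_of_Lpe[where S="cball 0 R", OF _ _ _ finR p1]; use fin zero_R in simp)+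
  show "integrable H2 t"
    by (rule integrable_of_Lpe[where S=S, OF _ _ fin(3) finS p1]) (use zero(3) in auto)
qed

text \<open>Pullback along \<open>up\<close>, with differential 1 + e n^T: the 1-form u is hit by
  the transpose, the 2-form w by the inverse. The trace transforms like w, and \<open>jac\<close>
  turns surface area into planar area.\<close>

definition uf :: "real^3 \<Rightarrow> real^3" where "uf y = u (up y) + (e \<bullet> u (up y)) *\<^sub>R grad g y"
definition wf :: "real^3 \<Rightarrow> real^3" where "wf y = w (up y) - (grad g y \<bullet> w (up y)) *\<^sub>R e"
definition tf :: "real^2 \<Rightarrow> real^3" where
  "tf z = jac (emb z) *\<^sub>R (t (par z) - (grad g (emb z) \<bullet> t (par z)) *\<^sub>R e)"

lemma meas_f [measurable]: "uf \<in> borel_measurable borel" "wf \<in> borel_measurable borel" "tf \<in> borel_measurable borel"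
  unfolding uf_def[abs_def] wf_def[abs_def] tf_def[abs_def] by measurable

text \<open>The pulled back field is only continuous and not admissible in \<open>green\<close>. The
  smooth fields of \<open>pull_approx\<close> are, and they differ uniformly by \<tau>; as the data
  are integrable, the formula survives \<tau> tending to 0.\<close>

lemma green_pull:
  assumes F: "Cinf F"
  shows "(\<integral>x. w x \<bullet> pull e g (grad g) F x - u x \<bullet> pull_curl e g (grad g) (curl F) x \<partial>lborel)
    = (\<integral>x. t x \<bullet> pull e g (grad g) F x \<partial>H2)"
proof -
  let ?P = "pull e g (grad g) F" and ?Q = "pull_curl e g (grad g) (curl F)"
  have cd: "continuous_on UNIV (\<lambda>x. x - g x *\<^sub>R e)" by (intro continuous_intros g_cont)
  have cP: "continuous_on UNIV ?P" "continuous_on UNIV ?Q"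
    unfolding pull_def[abs_def] pull_curl_def[abs_def]
    by (intro continuous_intros grad_g_cont continuous_on_compose2[OF Cinf_continuous[OF F] cd]
        continuous_on_compose2[OF Cinf_curl[OF F] cd]; simp)+
  have "bounded (?P ` cball 0 R)" "bounded (?Q ` cball 0 R)"
    by (intro compact_imp_bounded compact_continuous_image continuous_on_subset[OF cP(1)] continuous_on_subset[OF cP(2)]; simp)+
  then obtain C1 C2 where C: "\<And>z. z \<in> cball 0 R \<Longrightarrow> norm (?P z) \<le> C1" "\<And>z. z \<in> cball 0 R \<Longrightarrow> norm (?Q z) \<le> C2"
    unfolding bounded_iff by blast
  have [measurable]: "?P \<in> borel_measurable borel" "?Q \<in> borel_measurable borel"
    by (rule borel_measurable_continuous_onI[OF cP(1)], rule borel_measurable_continuous_onI[OF cP(2)])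
  have iP: "integrable lborel (\<lambda>x. w x \<bullet> ?P x)" "integrable lborel (\<lambda>x. u x \<bullet> ?Q x)" "integrable H2 (\<lambda>x. t x \<bullet> ?P x)"
    using zero_R C by (auto intro!: integrable_inner_bounded(1)[OF ints(2), of _ C1] integrable_inner_bounded(1)[OF ints(1), of _ C2]
        integrable_inner_bounded(1)[OF ints(3), of _ C1])
  define I where "I = (\<integral>x. norm (w x) \<partial>lborel) + (\<integral>x. norm (u x) \<partial>lborel) + (\<integral>x. norm (t x) \<partial>H2)"
  have "\<bar>(\<integral>x. w x \<bullet> ?P x - u x \<bullet> ?Q x \<partial>lborel) - (\<integral>x. t x \<bullet> ?P x \<partial>H2)\<bar> \<le> \<tau> * I" if \<tau>: "0 < \<tau>" for \<tau>
  proof -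
    obtain \<Phi> where \<Phi>: "Cinf \<Phi>" "\<And>x. norm x \<le> R \<Longrightarrow> norm (\<Phi> x - ?P x) \<le> \<tau>" "\<And>x. norm x \<le> R \<Longrightarrow> norm (curl \<Phi> x - ?Q x) \<le> \<tau>"
      by (rule pull_approx[OF F \<tau>, of R]) (rule that)
    have [measurable]: "\<Phi> \<in> borel_measurable borel" "curl \<Phi> \<in> borel_measurable borel"
      by (rule borel_measurable_continuous_onI[OF Cinf_continuous[OF \<Phi>(1)]], rule borel_measurable_continuous_onI[OF Cinf_curl[OF \<Phi>(1)]])
    have b1: "w x \<noteq> 0 \<Longrightarrow> norm (\<Phi> x - ?P x) \<le> \<tau>" and b2: "u x \<noteq> 0 \<Longrightarrow> norm (curl \<Phi> x - ?Q x) \<le> \<tau>"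
      and b3: "t x \<noteq> 0 \<Longrightarrow> norm (\<Phi> x - ?P x) \<le> \<tau>" for x
      using zero_R[of x] \<Phi>(2,3)[of x] by blast+
    note i1 = integrable_inner_bounded[OF ints(2), of "\<lambda>x. \<Phi> x - ?P x" \<tau>]
    note i2 = integrable_inner_bounded[OF ints(1), of "\<lambda>x. curl \<Phi> x - ?Q x" \<tau>]
    note i3 = integrable_inner_bounded[OF ints(3), of "\<lambda>x. \<Phi> x - ?P x" \<tau>]
    have j1: "integrable lborel (\<lambda>x. w x \<bullet> (\<Phi> x - ?P x))" "\<bar>\<integral>x. w x \<bullet> (\<Phi> x - ?P x) \<partial>lborel\<bar> \<le> \<tau> * (\<integral>x. norm (w x) \<partial>lborel)"
      using i1 b1 by auto
    have j2: "integrable lborel (\<lambda>x. u x \<bullet> (curl \<Phi> x - ?Q x))" "\<bar>\<integral>x. u x \<bullet> (curl \<Phi> x - ?Q x) \<partial>lborel\<bar> \<le> \<tau> * (\<integral>x. norm (u x) \<partial>lborel)"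
      using i2 b2 by auto
    have j3: "integrable H2 (\<lambda>x. t x \<bullet> (\<Phi> x - ?P x))" "\<bar>\<integral>x. t x \<bullet> (\<Phi> x - ?P x) \<partial>H2\<bar> \<le> \<tau> * (\<integral>x. norm (t x) \<partial>H2)"
      using i3 b3 by auto
    have "(\<integral>x. w x \<bullet> \<Phi> x - u x \<bullet> curl \<Phi> x \<partial>lborel)
        = (\<integral>x. (w x \<bullet> ?P x - u x \<bullet> ?Q x) + (w x \<bullet> (\<Phi> x - ?P x) - u x \<bullet> (curl \<Phi> x - ?Q x)) \<partial>lborel)"
      by (simp add: inner_diff_right algebra_simps)
    also have "\<dots> = (\<integral>x. w x \<bullet> ?P x - u x \<bullet> ?Q x \<partial>lborel)
        + ((\<integral>x. w x \<bullet> (\<Phi> x - ?P x) \<partial>lborel) - (\<integral>x. u x \<bullet> (curl \<Phi> x - ?Q x) \<partial>lborel))"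
      using iP j1(1) j2(1) by simp
    finally have l: "(\<integral>x. w x \<bullet> \<Phi> x - u x \<bullet> curl \<Phi> x \<partial>lborel) = (\<integral>x. w x \<bullet> ?P x - u x \<bullet> ?Q x \<partial>lborel)
        + ((\<integral>x. w x \<bullet> (\<Phi> x - ?P x) \<partial>lborel) - (\<integral>x. u x \<bullet> (curl \<Phi> x - ?Q x) \<partial>lborel))" .
    have "(\<integral>x. t x \<bullet> \<Phi> x \<partial>H2) = (\<integral>x. t x \<bullet> ?P x + t x \<bullet> (\<Phi> x - ?P x) \<partial>H2)"
      by (simp add: inner_diff_right)
    also have "\<dots> = (\<integral>x. t x \<bullet> ?P x \<partial>H2) + (\<integral>x. t x \<bullet> (\<Phi> x - ?P x) \<partial>H2)"
      by (rule Bochner_Integration.integral_add[OF iP(3) j3(1)])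
    finally show ?thesis
      using green[OF \<Phi>(1)] l j1(2) j2(2) j3(2) unfolding I_def distrib_left by linarith
  qed
  note est = this
  have I0: "0 \<le> I" by (simp add: I_def)
  have "\<bar>(\<integral>x. w x \<bullet> ?P x - u x \<bullet> ?Q x \<partial>lborel) - (\<integral>x. t x \<bullet> ?P x \<partial>H2)\<bar> \<le> 0"
  proof (rule field_le_epsilon)
    fix d :: real assume d: "0 < d"
    have "d / (I + 1) * I \<le> d" using d I0 by (simp add: field_simps)
    then show "\<bar>(\<integral>x. w x \<bullet> ?P x - u x \<bullet> ?Q x \<partial>lborel) - (\<integral>x. t x \<bullet> ?P x \<partial>H2)\<bar> \<le> 0 + d"
      using est[of "d / (I + 1)"] d I0 by simp
  qed
  then show ?thesis by simp
qed

text \<open>Adjunction: moving data down to the half space is dual to pulling test fields up to the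
  graph.\<close>

lemma uf_inner: "uf y \<bullet> c = u (up y) \<bullet> pull_curl e g (grad g) (\<lambda>_. c) (up y)"
  unfolding uf_def pull_curl_def grad_up by (simp add: inner_add_left inner_add_right inner_commute mult.commute)

lemma wf_inner: "wf y \<bullet> c = w (up y) \<bullet> pull e g (grad g) (\<lambda>_. c) (up y)"
  unfolding wf_def pull_def grad_up by (simp add: inner_diff_left inner_diff_right inner_commute mult.commute)

lemma norm_uf_le: "norm (uf y) \<le> (1 + B) * norm (u (up y))"
proof -
  have "norm (uf y) \<le> norm (u (up y)) + \<bar>e \<bullet> u (up y)\<bar> * norm (grad g y)"
    unfolding uf_def by (rule order_trans[OF norm_triangle_ineq]) simp
  also have "\<bar>e \<bullet> u (up y)\<bar> * norm (grad g y) \<le> norm (u (up y)) * B"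
    using Cauchy_Schwarz_ineq2[of e "u (up y)"] by (intro mult_mono gB) auto
  finally show ?thesis by (simp add: algebra_simps)
qed

lemma norm_shear_le: "norm (a - (grad g y \<bullet> a) *\<^sub>R e) \<le> (1 + B) * norm a" "norm (a + (grad g y \<bullet> a) *\<^sub>R e) \<le> (1 + B) * norm a"
  "norm (a - (e \<bullet> a) *\<^sub>R grad g y) \<le> (1 + B) * norm a"
proof -
  have "\<bar>grad g y \<bullet> a\<bar> \<le> norm (grad g y) * norm a" by (rule Cauchy_Schwarz_ineq2)
  also have "\<dots> \<le> B * norm a" by (intro mult_right_mono gB) simp
  finally have le: "\<bar>grad g y \<bullet> a\<bar> \<le> B * norm a" .
  show "norm (a - (grad g y \<bullet> a) *\<^sub>R e) \<le> (1 + B) * norm a" "norm (a + (grad g y \<bullet> a) *\<^sub>R e) \<le> (1 + B) * norm a"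
    using le norm_triangle_ineq4[of a "(grad g y \<bullet> a) *\<^sub>R e"] norm_triangle_ineq[of a "(grad g y \<bullet> a) *\<^sub>R e"]
    by (simp_all add: distrib_right)
  have "\<bar>e \<bullet> a\<bar> * norm (grad g y) \<le> norm a * B"
    using Cauchy_Schwarz_ineq2[of e a] by (intro mult_mono gB) auto
  then show "norm (a - (e \<bullet> a) *\<^sub>R grad g y) \<le> (1 + B) * norm a"
  proof -
    assume *: "\<bar>e \<bullet> a\<bar> * norm (grad g y) \<le> norm a * B"
    have "norm ((e \<bullet> a) *\<^sub>R grad g y) = \<bar>e \<bullet> a\<bar> * norm (grad g y)" by simp
    moreover have "(1 + B) * norm a = norm a + norm a * B" by (simp add: algebra_simps)
    ultimately show ?thesis using * norm_triangle_ineq4[of a "(e \<bullet> a) *\<^sub>R grad g y"] by linarith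
  qed
qed

lemma flat_supp: "uf y \<noteq> 0 \<or> wf y \<noteq> 0 \<Longrightarrow> up y \<in> K \<and> 0 < y \<bullet> e"
proof -
  assume "uf y \<noteq> 0 \<or> wf y \<noteq> 0"
  then have "u (up y) \<noteq> 0 \<or> w (up y) \<noteq> 0" by (auto simp: uf_def wf_def)
  then have k: "up y \<in> K" "up y \<in> \<Omega>" using suppK zero by blast+
  then have "g (up y) < up y \<bullet> e" using chart K(2) by blast
  then show ?thesis using k by (simp add: g_up up_inner_e)
qed

lemma flat_bdd: "\<exists>M. \<forall>y. M < norm y \<longrightarrow> uf y = 0 \<and> wf y = 0"
proof -
  have "compact (down ` K)" by (intro compact_continuous_image continuous_on_subset[OF continuous_down] K(1)) simp
  then obtain M where M: "\<forall>y\<in>down ` K. norm y \<le> M" using compact_imp_bounded bounded_iff by blast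
  have "uf y = 0 \<and> wf y = 0" if "M < norm y" for y
  proof (rule ccontr)
    assume "\<not> ?thesis"
    then have "up y \<in> K" using flat_supp[of y] by blast
    then have "down (up y) \<in> down ` K" by (rule imageI)
    then have "y \<in> down ` K" by (simp only: up_down)
    then have "norm y \<le> M" using M by blast
    then show False using that by simp
  qed
  then show ?thesis by blast
qed

lemma Lpe_up: "f \<in> borel_measurable borel \<Longrightarrow> Lpe p lborel (\<lambda>y. f (up y)) = Lpe p lborel f" for f :: "real^3 \<Rightarrow> real^3"
  unfolding Lpe_def by (intro nn_integral_up[of "\<lambda>x. ennreal (norm (f x) powr p)"]) measurable

lemma flat_fin: "Lpe p lborel uf < \<infinity>" "Lpe p lborel wf < \<infinity>" "Lpe p lborel tf < \<infinity>"
proof -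
  have c: "ennreal x * Y < \<infinity>" if "Y < \<infinity>" for x Y using that by (simp add: ennreal_mult_less_top)
  have "Lpe p lborel uf \<le> ennreal ((1 + B) powr p) * Lpe p lborel (\<lambda>y. u (up y))"
    by (rule Lpe_scale_le) (use norm_uf_le B_nonneg p in auto)
  then show "Lpe p lborel uf < \<infinity>" using c[OF fin(1)] unfolding Lpe_up[OF meas(1)] by (rule order_le_less_trans)
  have "Lpe p lborel wf \<le> ennreal ((1 + B) powr p) * Lpe p lborel (\<lambda>y. w (up y))"
    by (rule Lpe_scale_le) (use norm_shear_le(1) B_nonneg p in \<open>auto simp: wf_def\<close>)
  then show "Lpe p lborel wf < \<infinity>" using c[OF fin(2)] unfolding Lpe_up[OF meas(2)] by (rule order_le_less_trans)
  let ?c = "((1 + B) * (1 + B)) powr p"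
  have "Lpe p lborel tf \<le> (\<integral>\<^sup>+z. ennreal (jac (emb z)) * (ennreal ?c * ennreal (norm (t (par z)) powr p)) \<partial>lborel)"
    unfolding Lpe_def
  proof (rule nn_integral_mono)
    fix z
    have "norm (tf z) = jac (emb z) * norm (t (par z) - (grad g (emb z) \<bullet> t (par z)) *\<^sub>R e)"
      using jac_pos[of "emb z"] by (simp add: tf_def)
    also have "\<dots> \<le> (1 + B) * ((1 + B) * norm (t (par z)))"
      using B_nonneg by (intro mult_mono jac_le norm_shear_le) auto
    finally have "norm (tf z) powr p \<le> ((1 + B) * (1 + B) * norm (t (par z))) powr p"
      using p by (intro powr_mono2) (auto simp: mult.assoc)
    also have "\<dots> = ?c * norm (t (par z)) powr p" by (rule powr_mult)
    \<comment> \<open>The area density is inserted, being at least 1, so that the planar integral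
      can be read as a surface integral.\<close>
    also have "\<dots> \<le> jac (emb z) * (?c * norm (t (par z)) powr p)"
      using mult_right_mono[OF jac_ge_1[of "emb z"], of "?c * norm (t (par z)) powr p"] by simp
    finally have "ennreal (norm (tf z) powr p) \<le> ennreal (jac (emb z) * (?c * norm (t (par z)) powr p))" by (rule ennreal_leI)
    then show "ennreal (norm (tf z) powr p) \<le> ennreal (jac (emb z)) * (ennreal ?c * ennreal (norm (t (par z)) powr p))"
      using less_imp_le[OF jac_pos[of "emb z"]] by (simp add: ennreal_mult)
  qed
  also have "\<dots> = (\<integral>\<^sup>+x. indicator gr x * (ennreal ?c * ennreal (norm (t x) powr p)) \<partial>H2)"
    by (rule nn_integral_gr[symmetric]) measurable
  also have "\<dots> \<le> (\<integral>\<^sup>+x. ennreal ?c * ennreal (norm (t x) powr p) \<partial>H2)"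
    by (intro nn_integral_mono) (auto simp: indicator_def)
  also have "\<dots> = ennreal ?c * Lpe p H2 t" unfolding Lpe_def by (rule nn_integral_cmult) measurable
  finally show "Lpe p lborel tf < \<infinity>" using c[OF fin(3)] by (rule order_le_less_trans)
qed

text \<open>Apply \<open>green_pull\<close> to \<psi> c. The adjunctions, volume invariance of the
  shear and the area formula turn it into the flat formula paired with c. As c is arbitrary, the
  vector identity follows; pulling c out of the integrals requires the integrability facts
  \<open>i1\<close> to \<open>i3\<close>.\<close>

lemma flat_green_fields: "flat_green uf wf tf"
  unfolding flat_green_def
proof (intro allI impI)
  fix \<psi> :: "real^3 \<Rightarrow> real" assume psi: "Cinf \<psi>"
  obtain M where M: "\<And>y. M < norm y \<Longrightarrow> uf y = 0 \<and> wf y = 0" using flat_bdd by blast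
  have lu: "loc_integrable uf" "loc_integrable wf"
    using Lpe_loc_integrable[OF meas_f(1) flat_fin(1) p1] Lpe_loc_integrable[OF meas_f(2) flat_fin(2) p1] .
  have cg: "continuous_on UNIV (grad \<psi>)" by (rule Cinf_continuous[OF Cinf_grad[OF psi]])
  have i1: "integrable lborel (\<lambda>y. \<psi> y *\<^sub>R wf y)"
    by (rule integrable_bounded_support[OF lu(2) _ Cinf_continuous[OF psi], where pr="\<lambda>a b. b *\<^sub>R a"])
      (use M borel_measurable_continuous_onI[OF Cinf_continuous[OF psi]] in \<open>auto simp: mult.commute\<close>)
  have i2: "integrable lborel (\<lambda>y. cross3 (uf y) (grad \<psi> y))"
    by (rule integrable_bounded_support[OF lu(1) _ cg norm_cross3_le])
      (use M borel_measurable_continuous_onI[OF cg] in auto)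
  have [measurable]: "\<psi> \<in> borel_measurable borel" by (rule borel_measurable_continuous_onI[OF Cinf_continuous[OF psi]])
  have i3: "integrable lborel (\<lambda>z. \<psi> (emb z) *\<^sub>R tf z)"
  proof -
    define h where "h x = indicator gr x *\<^sub>R (\<psi> (down x) *\<^sub>R (t x - (grad g x \<bullet> t x) *\<^sub>R e))" for x
    have "bounded ((\<lambda>x. \<psi> (down x)) ` cball 0 R)"
      by (intro compact_imp_bounded compact_continuous_image continuous_on_compose2[OF Cinf_continuous[OF psi]] continuous_on_subset[OF continuous_down]) auto
    then obtain C where C: "\<And>x. x \<in> cball 0 R \<Longrightarrow> norm (\<psi> (down x)) \<le> C" unfolding bounded_iff by blast
    have le: "norm (h x) \<le> norm (\<bar>C\<bar> * ((1 + B) * norm (t x)))" for x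
    proof (cases "t x = 0")
      case False
      then have "\<bar>\<psi> (down x)\<bar> \<le> \<bar>C\<bar>" using C[of x] zero_R[of x] by force
      then have "\<bar>\<psi> (down x)\<bar> * norm (t x - (grad g x \<bullet> t x) *\<^sub>R e) \<le> \<bar>C\<bar> * ((1 + B) * norm (t x))"
        by (intro mult_mono norm_shear_le) auto
      then show ?thesis using B_nonneg by (auto simp: h_def indicator_def)
    qed (simp add: h_def)
    have h: "integrable H2 h"
      by (rule Bochner_Integration.integrable_bound[of H2 "\<lambda>x. \<bar>C\<bar> * ((1 + B) * norm (t x))"])
        (use ints(3) le in \<open>auto simp: h_def[abs_def]\<close>)
    have "(\<integral>\<^sup>+z. ennreal (norm (\<psi> (emb z) *\<^sub>R tf z)) \<partial>lborel) = (\<integral>\<^sup>+z. ennreal (jac (emb z)) * ennreal (norm (h (par z))) \<partial>lborel)"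
    proof (rule nn_integral_cong)
      fix z
      have j: "0 \<le> jac (emb z)" using jac_pos[of "emb z"] by simp
      have "norm (\<psi> (emb z) *\<^sub>R tf z) = jac (emb z) * norm (h (par z))"
        using j par_in_gr[of z] grad_up[of "emb z"]
        by (simp add: tf_def h_def abs_mult par_def[symmetric])
      then show "ennreal (norm (\<psi> (emb z) *\<^sub>R tf z)) = ennreal (jac (emb z)) * ennreal (norm (h (par z)))"
        using j by (simp add: ennreal_mult)
    qed
    also have "\<dots> = (\<integral>\<^sup>+x. indicator gr x * ennreal (norm (h x)) \<partial>H2)"
      by (rule nn_integral_gr[symmetric]) (simp add: h_def[abs_def])
    also have "\<dots> \<le> (\<integral>\<^sup>+x. ennreal (norm (h x)) \<partial>H2)"
      by (intro nn_integral_mono) (auto simp: indicator_def)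
    also have "\<dots> < \<infinity>" using h by (simp add: integrable_iff_bounded)
    finally show ?thesis by (intro integrableI_bounded) measurable
  qed
  show "(\<integral>y. \<psi> y *\<^sub>R wf y - cross3 (uf y) (grad \<psi> y) \<partial>lborel) = (\<integral>z. \<psi> (emb z) *\<^sub>R tf z \<partial>lborel)"
  proof (rule vector_eq_rdot[THEN iffD1], rule allI)
    fix c :: "real^3"
    let ?F = "\<lambda>y. \<psi> y *\<^sub>R c"
    have F: "Cinf ?F" by (intro Cinf_scaleR psi Cinf_const)
    have cF: "curl ?F y = cross3 (grad \<psi> y) c" for y
      using curl_scaleR_const_plus[OF Cinf_has_derivative_grad[OF psi] has_derivative_const[of c], of y] by (simp add: curl_const)
    let ?P = "pull e g (grad g) ?F" and ?Q = "pull_curl e g (grad g) (curl ?F)"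
    have PQ: "w (up y) \<bullet> ?P (up y) = wf y \<bullet> ?F y" "u (up y) \<bullet> ?Q (up y) = uf y \<bullet> curl ?F y" for y
      unfolding wf_inner uf_inner pull_def pull_curl_def down_def[symmetric] by simp_all
    have cm: "continuous_on UNIV (\<lambda>x. x - g x *\<^sub>R e)" by (intro continuous_intros g_cont)
    have cP: "continuous_on UNIV ?P" "continuous_on UNIV ?Q"
      unfolding pull_def[abs_def] pull_curl_def[abs_def]
      by (intro continuous_intros grad_g_cont continuous_on_compose2[OF Cinf_continuous[OF F] cm]
          continuous_on_compose2[OF Cinf_curl[OF F] cm]; simp)+
    have [measurable]: "?P \<in> borel_measurable borel" "?Q \<in> borel_measurable borel"
      by (rule borel_measurable_continuous_onI[OF cP(1)], rule borel_measurable_continuous_onI[OF cP(2)])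
    have "(\<integral>y. \<psi> y *\<^sub>R wf y - cross3 (uf y) (grad \<psi> y) \<partial>lborel) \<bullet> c
        = (\<integral>y. (\<psi> y *\<^sub>R wf y - cross3 (uf y) (grad \<psi> y)) \<bullet> c \<partial>lborel)"
      by (rule integral_inner_left[symmetric]) (intro Bochner_Integration.integrable_diff i1 i2)
    also have "\<dots> = (\<integral>y. wf y \<bullet> ?F y - uf y \<bullet> curl ?F y \<partial>lborel)"
    proof (rule Bochner_Integration.integral_cong[OF refl])
      fix y
      have "cross3 a b \<bullet> c = a \<bullet> cross3 b c" for a b by (simp add: cross3_def inner_vec_def sum_3 algebra_simps)
      then show "(\<psi> y *\<^sub>R wf y - cross3 (uf y) (grad \<psi> y)) \<bullet> c = wf y \<bullet> ?F y - uf y \<bullet> curl ?F y"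
        by (simp add: cF inner_diff_left)
    qed
    also have "\<dots> = (\<integral>y. w (up y) \<bullet> ?P (up y) - u (up y) \<bullet> ?Q (up y) \<partial>lborel)" by (simp only: PQ)
    also have "\<dots> = (\<integral>x. w x \<bullet> ?P x - u x \<bullet> ?Q x \<partial>lborel)"
      by (rule integral_up[of "\<lambda>x. w x \<bullet> ?P x - u x \<bullet> ?Q x"]) measurable
    also have "\<dots> = (\<integral>x. t x \<bullet> ?P x \<partial>H2)" by (rule green_pull[OF F])
    also have "\<dots> = (\<integral>x. indicator gr x *\<^sub>R (t x \<bullet> ?P x) \<partial>H2)"
      by (rule Bochner_Integration.integral_cong[OF refl]) (use t_gr in \<open>auto simp: indicator_def\<close>)
    also have "\<dots> = (\<integral>z. jac (emb z) *\<^sub>R (t (par z) \<bullet> ?P (par z)) \<partial>lborel)"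
      by (rule integral_gr) measurable
    also have "\<dots> = (\<integral>z. (\<psi> (emb z) *\<^sub>R tf z) \<bullet> c \<partial>lborel)"
    proof (rule Bochner_Integration.integral_cong[OF refl])
      fix z
      have Pz: "?P (par z) = ?F (emb z) - (e \<bullet> ?F (emb z)) *\<^sub>R grad g (emb z)"
        unfolding pull_def down_def[symmetric] down_par by (simp add: par_def grad_up)
      then show "jac (emb z) *\<^sub>R (t (par z) \<bullet> ?P (par z)) = (\<psi> (emb z) *\<^sub>R tf z) \<bullet> c"
        unfolding Pz by (simp add: tf_def inner_diff_left inner_diff_right inner_commute algebra_simps)
    qed
    also have "\<dots> = (\<integral>z. \<psi> (emb z) *\<^sub>R tf z \<partial>lborel) \<bullet> c" by (rule integral_inner_left[OF i3])
    finally show "(\<integral>y. \<psi> y *\<^sub>R wf y - cross3 (uf y) (grad \<psi> y) \<partial>lborel) \<bullet> c = (\<integral>z. \<psi> (emb z) *\<^sub>R tf z \<partial>lborel) \<bullet> c" .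
  qed
qed

text \<open>The left side is the unnormalised trace of a pulled back field on the graph; the right
  side is the flat trace -e x F = F x e transformed like a 2-form. After removal of the e component
  from F, the product with n is parallel to e, which leaves one coefficient to compare.\<close>

lemma normal_algebra:
  fixes F n :: "real^3"
  assumes ne: "n \<bullet> e = 0"
  shows "cross3 (n - e) (F - (e \<bullet> F) *\<^sub>R n) = cross3 F e + (n \<bullet> cross3 F e) *\<^sub>R e"
proof -
  define F' where "F' = F - (e \<bullet> F) *\<^sub>R e"
  define X where "X = cross3 n F'"
  have bac: "cross3 a (cross3 b c) = (a \<bullet> c) *\<^sub>R b - (a \<bullet> b) *\<^sub>R c" for a b c :: "real^3"
    by (rule vec3_eqI) (simp_all add: cross3_def inner_vec_def sum_3 algebra_simps)
  have "e \<bullet> F' = 0" by (simp add: F'_def inner_diff_right)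
  then have "cross3 e X = 0" using ne unfolding X_def bac by (simp add: inner_commute)
  then have X: "X = (e \<bullet> X) *\<^sub>R e" using bac[of e e X] by simp
  have "cross3 n F' \<bullet> e = n \<bullet> cross3 F' e" by (simp add: cross3_def inner_vec_def sum_3 algebra_simps)
  moreover have "cross3 F' e = cross3 F e"
    by (simp add: F'_def Cross3.left_diff_distrib cross_mult_left)
  ultimately have eX: "e \<bullet> X = n \<bullet> cross3 F e" by (simp add: X_def inner_commute)
  have "cross3 (n - e) (F - (e \<bullet> F) *\<^sub>R n) = X + cross3 F e"
    unfolding X_def F'_def
    by (rule vec3_eqI) (simp_all add: cross3_def algebra_simps)
  then show ?thesis using X eX by simp
qed

text \<open>Every transfer between half space and chart costs a constant: each shear at most 1 + B
  pointwise, the surface density at most 1 + B under the integral, and smoothing the graph a uniform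
  \<tau>.\<close>

lemma local_approximable: "approximable \<Omega> S \<nu> p u w t"
  unfolding approximable_def
proof (intro allI impI)
  fix e' :: ennreal assume e': "0 < e'"
  define A where "A = (1 + B) powr p"
  have A: "0 \<le> A" by (simp add: A_def)
  define T where "T = (2::real) powr p"
  have T: "0 < T" by (simp add: T_def)
  \<comment> \<open>The factor 1 + B beside A comes from \<open>jac\<close> in the trace estimate
    and is granted to all three estimates, so that \<open>sum\<close> closes them alike; the summand
    1 is the smoothing error.\<close>
  define A2 where "A2 = A * (1 + B) + 1"
  have A2: "0 \<le> A2" "A \<le> A * (1 + B)" using A B_nonneg by (auto simp: A2_def algebra_simps)
  obtain c where c: "c > 0" "ennreal ((T * A2) * c) < e'" using ex_ennreal_fraction[OF e', of "T * A2"] T A2 by auto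
  define l where "l = measure lborel (cball (0 :: real^3) R)"
  define hS where "hS = measure H2 S"
  have l: "emeasure lborel (cball (0 :: real^3) R) = ennreal l" "0 \<le> l"
    using finR by (auto simp: l_def emeasure_eq_ennreal_measure)
  have hS: "emeasure H2 S = ennreal hS" "0 \<le> hS" using finS by (auto simp: hS_def emeasure_eq_ennreal_measure)
  \<comment> \<open>A pointwise error \<tau> on volume l or area \<open>hS\<close> has p-th power
    integral at most c.\<close>
  define \<tau> where "\<tau> = (c / (l + hS + 1)) powr (1 / p)"
  have \<tau>: "0 < \<tau>" "\<tau> powr p * l \<le> c" "\<tau> powr p * hS \<le> c"
  proof -
    have tp: "\<tau> powr p = c / (l + hS + 1)" using c l(2) hS(2) p by (simp add: \<tau>_def powr_powr)
    show "0 < \<tau>" using c l(2) hS(2) by (simp add: \<tau>_def)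
    show "\<tau> powr p * l \<le> c" "\<tau> powr p * hS \<le> c" unfolding tp using c l(2) hS(2) by (simp_all add: field_simps)
  qed
  have sum: "ennreal T * (X + Y) \<le> e'" if "X \<le> ennreal (A * (1 + B) * c)" "Y \<le> ennreal c" for X Y
  proof -
    have "ennreal T * (X + Y) \<le> ennreal T * (ennreal (A * (1 + B) * c) + ennreal c)"
      using that by (intro mult_left_mono add_mono) auto
    also have "\<dots> = ennreal ((T * A2) * c)"
      using T A B_nonneg c(1) by (simp add: ennreal_plus[symmetric] ennreal_mult[symmetric] A2_def algebra_simps del: ennreal_plus)
    finally show ?thesis using c(2) by (meson less_imp_le order_trans)
  qed
  have "compact (down ` K)" by (intro compact_continuous_image continuous_on_subset[OF continuous_down] K(1)) simp
  moreover have "open (up -` N)" by (rule open_vimage[OF N continuous_up])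
  moreover have "down ` K \<subseteq> up -` N" using K(2) by auto
  ultimately obtain r0 where r0: "0 < r0" "(\<Union>x\<in>down ` K. ball x r0) \<subseteq> up -` N"
    by (rule compact_subset_open_imp_ball_epsilon_subset)
  \<comment> \<open>A margin around the compact support, so that the mollified field, moved back by
    the shear, still lives in N.\<close>
  have nearN: "up y \<in> N" if "uf k \<noteq> 0" "dist y k < r0" for y k
  proof -
    have "up k \<in> K" using flat_supp[of k] that by blast
    then have "down (up k) \<in> down ` K" by (rule imageI)
    then have "y \<in> (\<Union>x\<in>down ` K. ball x r0)" using that(2) by (auto simp: dist_commute)
    then show ?thesis using r0(2) by blast
  qed
  obtain M where M: "\<And>y. M < norm y \<Longrightarrow> uf y = 0 \<and> wf y = 0" using flat_bdd by blast
  have supp': "M < norm y \<or> y \<bullet> e \<le> 0 \<Longrightarrow> uf y = 0 \<and> wf y = 0" for y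
    using M[of y] flat_supp[of y] by (metis not_le)
  interpret fd: flat_data f1 f2 e uf wf tf p M
    by unfold_locales (fact meas_f p flat_fin flat_green_fields | rule supp', assumption)+
  obtain F \<delta> where F: "Cinf F" "\<delta> > 0" "\<And>x. F x \<noteq> 0 \<Longrightarrow> \<exists>y. uf y \<noteq> 0 \<and> dist x y < r0 / 2"
    "Lpe p lborel (\<lambda>x. F x - uf x) \<le> ennreal c"
    "Lpe p lborel (\<lambda>x. if - \<delta> < x \<bullet> e then curl F x - wf x else 0) \<le> ennreal c"
    "Lpe p lborel (\<lambda>z. cross3 (F (emb z)) e - tf z) \<le> ennreal c"
    by (rule fd.flat_approx[of "ennreal c" "r0 / 2"]) (use c r0 that in auto)
  \<comment> \<open>Mollification used only half of the margin; the other half makes F vanish on a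
    whole ball around such points, hence its curl too.\<close>
  have F0: "F (down x) = 0" "curl F (down x) = 0" if x: "x \<notin> N" for x
  proof -
    have z: "F y = 0" if "y \<in> ball (down x) (r0 / 2)" for y
    proof (rule ccontr)
      assume "F y \<noteq> 0"
      then obtain k where k: "uf k \<noteq> 0" "dist y k < r0 / 2" using F(3) by blast
      have "dist (down x) k < r0" using that k(2) dist_triangle[of "down x" k y] by simp
      then show False using nearN[OF k(1)] x by (metis up_down(1))
    qed
    show "F (down x) = 0" using z[of "down x"] r0(1) by simp
    show "curl F (down x) = 0" by (rule curl_locally_zero[of "ball (down x) (r0 / 2)"]) (use z r0(1) in auto)
  qed
  have cF: "continuous_on UNIV F" "continuous_on UNIV (curl F)" using Cinf_continuous[OF F(1)] Cinf_curl[OF F(1)] .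
  have [measurable]: "F \<in> borel_measurable borel" "curl F \<in> borel_measurable borel"
    by (rule borel_measurable_continuous_onI[OF cF(1)], rule borel_measurable_continuous_onI[OF cF(2)])
  let ?v = "pull e g (grad g) F" and ?c = "pull_curl e g (grad g) (curl F)"
  have v: "?v x = F (down x) - (e \<bullet> F (down x)) *\<^sub>R grad g x" and cc: "?c x = curl F (down x) + (grad g x \<bullet> curl F (down x)) *\<^sub>R e" for x
    by (simp_all add: pull_def pull_curl_def down_def)
  have [measurable]: "?v \<in> borel_measurable borel" "?c \<in> borel_measurable borel"
    unfolding v[abs_def] cc[abs_def] by measurable
  obtain \<Phi> where \<Phi>: "Cinf \<Phi>" "\<And>x. norm x \<le> R \<Longrightarrow> norm (\<Phi> x - ?v x) \<le> \<tau>" "\<And>x. norm x \<le> R \<Longrightarrow> norm (curl \<Phi> x - ?c x) \<le> \<tau>"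
    by (rule pull_approx[OF F(1) \<tau>(1), of R]) (rule that)
  have [measurable]: "\<Phi> \<in> borel_measurable borel" "curl \<Phi> \<in> borel_measurable borel"
    by (rule borel_measurable_continuous_onI[OF Cinf_continuous[OF \<Phi>(1)]], rule borel_measurable_continuous_onI[OF Cinf_curl[OF \<Phi>(1)]])
  have inR: "x \<in> \<Omega> \<or> x \<in> S \<Longrightarrow> norm x \<le> R" for x using \<Omega>(2) S(2) by (auto dest!: subsetD)
  have small: "Lpe p lborel (\<lambda>x. indicator \<Omega> x *\<^sub>R (f x)) \<le> ennreal c"
    if "\<And>x. norm x \<le> R \<Longrightarrow> norm (f x) \<le> \<tau>" for f :: "real^3 \<Rightarrow> real^3"
  proof -
    have "Lpe p lborel (\<lambda>x. indicator \<Omega> x *\<^sub>R (f x)) \<le> ennreal (\<tau> powr p) * emeasure lborel (cball (0 :: real^3) R)"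
    proof (rule Lpe_const_le)
      show "norm (indicator \<Omega> x *\<^sub>R f x) \<le> \<tau> * indicator (cball 0 R) x" for x
        using that[of x] inR[of x] \<tau>(1) by (cases "x \<in> \<Omega>") auto
    qed (use p \<tau> in auto)
    also have "\<dots> \<le> ennreal c" unfolding l(1) using \<tau>(2) l(2) by (simp add: ennreal_mult[symmetric] ennreal_leI)
    finally show ?thesis .
  qed
  have ubound: "Lpe p lborel (\<lambda>x. indicator \<Omega> x *\<^sub>R (u x - ?v x)) \<le> ennreal (A * (1 + B) * c)"
  proof -
    have "Lpe p lborel (\<lambda>x. indicator \<Omega> x *\<^sub>R (u x - ?v x)) \<le> Lpe p lborel (\<lambda>x. u x - ?v x)"
      by (rule Lpe_mono) (use p in \<open>auto simp: indicator_def\<close>)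
    also have "\<dots> = Lpe p lborel (\<lambda>y. u (up y) - ?v (up y))" by (rule Lpe_up[symmetric]) measurable
    also have "\<dots> \<le> ennreal A * Lpe p lborel (\<lambda>y. F y - uf y)"
      unfolding A_def
    proof (rule Lpe_scale_le)
      fix y
      have "u (up y) - ?v (up y) = - ((F y - uf y) - (e \<bullet> (F y - uf y)) *\<^sub>R grad g y)"
        by (simp add: v grad_up uf_def inner_add_right inner_diff_right algebra_simps)
      then show "norm (u (up y) - ?v (up y)) \<le> (1 + B) * norm (F y - uf y)"
        using norm_shear_le(3)[of "F y - uf y" y] by (simp only: norm_minus_cancel)
    qed (use B_nonneg p in auto)
    also have "\<dots> \<le> ennreal A * ennreal c" by (rule mult_left_mono[OF F(4)]) simp
    also have "\<dots> \<le> ennreal (A * (1 + B) * c)"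
      using A A2(2) c(1) by (simp add: ennreal_mult[symmetric] ennreal_leI mult_right_mono)
    finally show ?thesis .
  qed
  let ?q = "\<lambda>y. if - \<delta> < y \<bullet> e then curl F y - wf y else 0"
  have wbound: "Lpe p lborel (\<lambda>x. indicator \<Omega> x *\<^sub>R (w x - ?c x)) \<le> ennreal (A * (1 + B) * c)"
  proof -
    have "Lpe p lborel (\<lambda>x. indicator \<Omega> x *\<^sub>R (w x - ?c x)) \<le> ennreal A * Lpe p lborel (\<lambda>x. ?q (down x))"
      unfolding A_def
    proof (rule Lpe_scale_le)
      fix x
      show "norm (indicator \<Omega> x *\<^sub>R (w x - ?c x)) \<le> (1 + B) * norm (?q (down x))"
      proof (cases "x \<in> \<Omega> \<and> x \<in> N")
        case True
        then have "0 < down x \<bullet> e" using chart[of x] by (simp add: down_inner_e)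
        then have q: "?q (down x) = curl F (down x) - wf (down x)" using F(2) by simp
        have "w x - ?c x = - ((curl F (down x) - wf (down x)) + (grad g x \<bullet> (curl F (down x) - wf (down x))) *\<^sub>R e)"
          by (simp add: cc wf_def grad_down inner_diff_right algebra_simps)
        then have "norm (w x - ?c x) \<le> (1 + B) * norm (curl F (down x) - wf (down x))"
          using norm_shear_le(2)[of "curl F (down x) - wf (down x)" x] by (simp only: norm_minus_cancel)
        then show ?thesis using True q by simp
      next
        case False
        then consider "x \<notin> \<Omega>" | "x \<notin> N" by blast
        then show ?thesis
        proof cases
          case 2
          then have "w x = 0" "?c x = 0" using suppK[of x] K(2) F0(2)[of x] by (auto simp: cc)
          then show ?thesis using B_nonneg by simp
        qed (use B_nonneg in simp)
      qed
    qed (use B_nonneg p in auto)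
    also have "Lpe p lborel (\<lambda>x. ?q (down x)) = Lpe p lborel (\<lambda>y. ?q (down (up y)))"
      by (rule Lpe_up[symmetric, of "\<lambda>x. ?q (down x)"]) measurable
    also have "\<dots> = Lpe p lborel ?q" by (simp only: up_down)
    also have "ennreal A * Lpe p lborel ?q \<le> ennreal A * ennreal c" by (rule mult_left_mono[OF F(5)]) simp
    also have "\<dots> \<le> ennreal (A * (1 + B) * c)"
      using A A2(2) c(1) by (simp add: ennreal_mult[symmetric] ennreal_leI mult_right_mono)
    finally show ?thesis .
  qed
  have [measurable]: "(\<lambda>x. indicator S x *\<^sub>R cross3 (\<nu> x) (X x)) \<in> borel_measurable borel"
    if [measurable]: "X \<in> borel_measurable borel" for X
  proof -
    have "(\<lambda>x. indicator S x *\<^sub>R cross3 (\<nu> x) (X x)) = (\<lambda>x. cross3 (indicator S x *\<^sub>R \<nu> x) (X x))"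
      by (simp add: cross_mult_left)
    then show ?thesis using \<nu>_meas by simp
  qed
  let ?d = "\<lambda>z. cross3 (F (emb z)) e - tf z"
  have tbound: "Lpe p H2 (\<lambda>x. indicator S x *\<^sub>R (t x - cross3 (\<nu> x) (?v x))) \<le> ennreal (A * (1 + B) * c)"
  proof -
    have "Lpe p H2 (\<lambda>x. indicator S x *\<^sub>R (t x - cross3 (\<nu> x) (?v x))) \<le> ennreal A * Lpe p H2 (\<lambda>x. indicator gr x *\<^sub>R ?d (prj x))"
      unfolding A_def
    proof (rule Lpe_scale_le)
      fix x
      show "norm (indicator S x *\<^sub>R (t x - cross3 (\<nu> x) (?v x))) \<le> (1 + B) * norm (indicator gr x *\<^sub>R ?d (prj x))"
      proof (cases "x \<in> S \<and> x \<in> N")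
        case True
        then have x: "x \<in> gr" using chart[of x] by (simp add: gr_def)
        define z where "z = prj x"
        have pz: "par z = x" unfolding z_def by (rule par_prj[OF x])
        have dx: "down x = emb z" using down_par[of z] pz by simp
        have gz: "grad g (emb z) = grad g x" using grad_up[of "emb z"] pz by (simp add: par_def)
        have jz: "jac (emb z) = jac x" by (simp add: jac_def gz)
        have j: "0 < jac x" "1 \<le> jac x" by (rule jac_pos, rule jac_ge_1)
        have tz: "tf z = jac x *\<^sub>R (t x - (grad g x \<bullet> t x) *\<^sub>R e)" by (simp add: tf_def pz gz jz)
        have na: "cross3 (grad g x - e) (?v x) = cross3 (F (emb z)) e + (grad g x \<bullet> cross3 (F (emb z)) e) *\<^sub>R e"
          unfolding v dx by (rule normal_algebra) simp
        have nu: "cross3 (\<nu> x) (?v x) = cross3 (grad g x - e) (?v x) /\<^sub>R jac x"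
          using True by (simp only: normal(2) cross_mult_left)
        \<comment> \<open>\<open>jac\<close> is both the density in \<open>tf\<close> and the length
          of the unnormalised normal, so multiplying by it matches the two traces. Being at least 1,
          it can be inserted at no cost.\<close>
        have "jac x *\<^sub>R (t x - cross3 (\<nu> x) (?v x)) = jac x *\<^sub>R t x - cross3 (grad g x - e) (?v x)"
          using j nu by (simp add: scaleR_diff_right)
        also have "\<dots> = - (?d z + (grad g x \<bullet> ?d z) *\<^sub>R e)"
          unfolding na tz by (simp add: inner_diff_right algebra_simps)
        finally have eq: "jac x *\<^sub>R (t x - cross3 (\<nu> x) (?v x)) = - (?d z + (grad g x \<bullet> ?d z) *\<^sub>R e)" .
        have "norm (t x - cross3 (\<nu> x) (?v x)) \<le> jac x * norm (t x - cross3 (\<nu> x) (?v x))"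
          using mult_right_mono[OF j(2), of "norm (t x - cross3 (\<nu> x) (?v x))"] by simp
        also have "\<dots> = norm (?d z + (grad g x \<bullet> ?d z) *\<^sub>R e)"
          using arg_cong[OF eq, of norm] j(1) by (simp only: norm_minus_cancel norm_scaleR abs_of_pos)
        also have "\<dots> \<le> (1 + B) * norm (?d z)" by (rule norm_shear_le(2))
        finally show ?thesis using True x by (simp add: z_def)
      next
        case False
        then consider "x \<notin> S" | "x \<notin> N" by blast
        then show ?thesis
        proof cases
          case 2
          then have "t x = 0" "?v x = 0" using suppK[of x] K(2) F0(1)[of x] by (auto simp: v)
          then show ?thesis using B_nonneg by simp
        qed (use B_nonneg in simp)
      qed
    qed (use B_nonneg p in auto)
    also have "Lpe p H2 (\<lambda>x. indicator gr x *\<^sub>R ?d (prj x)) = (\<integral>\<^sup>+x. indicator gr x * ennreal (norm (?d (prj x)) powr p) \<partial>H2)"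
      unfolding Lpe_def by (intro nn_integral_cong) (use p in \<open>auto simp: indicator_def\<close>)
    also have "\<dots> = (\<integral>\<^sup>+z. ennreal (jac (emb z)) * ennreal (norm (?d (prj (par z))) powr p) \<partial>lborel)"
      by (rule nn_integral_gr) measurable
    also have "\<dots> \<le> (\<integral>\<^sup>+z. ennreal (1 + B) * ennreal (norm (?d z) powr p) \<partial>lborel)"
      by (intro nn_integral_mono) (simp add: mult_right_mono ennreal_leI jac_le)
    also have "\<dots> = ennreal (1 + B) * Lpe p lborel ?d"
      unfolding Lpe_def by (rule nn_integral_cmult) measurable
    also have "\<dots> \<le> ennreal (1 + B) * ennreal c" by (rule mult_left_mono[OF F(6)]) simp
    finally have "Lpe p H2 (\<lambda>x. indicator S x *\<^sub>R (t x - cross3 (\<nu> x) (?v x))) \<le> ennreal A * (ennreal (1 + B) * ennreal c)"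
      by (simp add: mult_left_mono)
    then show ?thesis using A B_nonneg c(1) by (simp add: ennreal_mult mult.assoc)
  qed
  have tsmall: "Lpe p H2 (\<lambda>x. indicator S x *\<^sub>R cross3 (\<nu> x) (?v x - \<Phi> x)) \<le> ennreal c"
  proof -
    have "Lpe p H2 (\<lambda>x. indicator S x *\<^sub>R cross3 (\<nu> x) (?v x - \<Phi> x)) \<le> ennreal (\<tau> powr p) * emeasure H2 S"
    proof (rule Lpe_const_le)
      fix x
      show "norm (indicator S x *\<^sub>R cross3 (\<nu> x) (?v x - \<Phi> x)) \<le> \<tau> * indicator S x"
      proof (cases "x \<in> S")
        case True
        have "norm (cross3 (\<nu> x) (?v x - \<Phi> x)) \<le> norm (\<nu> x) * norm (?v x - \<Phi> x)" by (rule norm_cross3_le)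
        also have "\<dots> \<le> 1 * \<tau>" using normal(1)[OF True] \<Phi>(2)[of x] inR[of x] True
          by (intro mult_mono) (auto simp: norm_minus_commute)
        finally show ?thesis using True by simp
      qed simp
    qed (use p \<tau> in auto)
    also have "\<dots> \<le> ennreal c" unfolding hS(1) using \<tau>(3) hS(2) by (simp add: ennreal_mult[symmetric] ennreal_leI)
    finally show ?thesis .
  qed
  show "\<exists>\<Phi>. Cinf \<Phi> \<and> Lpe p lborel (\<lambda>x. indicator \<Omega> x *\<^sub>R (u x - \<Phi> x)) \<le> e' \<and>
     Lpe p lborel (\<lambda>x. indicator \<Omega> x *\<^sub>R (w x - curl \<Phi> x)) \<le> e' \<and>
     Lpe p H2 (\<lambda>x. indicator S x *\<^sub>R (t x - cross3 (\<nu> x) (\<Phi> x))) \<le> e'"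
  proof (intro exI[of _ \<Phi>] conjI)
    show "Cinf \<Phi>" by fact
    have "Lpe p lborel (\<lambda>x. indicator \<Omega> x *\<^sub>R (u x - \<Phi> x))
        = Lpe p lborel (\<lambda>x. indicator \<Omega> x *\<^sub>R (u x - ?v x) + indicator \<Omega> x *\<^sub>R (?v x - \<Phi> x))"
      by (simp add: scaleR_add_right[symmetric])
    also have "\<dots> \<le> ennreal T * (Lpe p lborel (\<lambda>x. indicator \<Omega> x *\<^sub>R (u x - ?v x)) + Lpe p lborel (\<lambda>x. indicator \<Omega> x *\<^sub>R (?v x - \<Phi> x)))"
      unfolding T_def by (rule Lpe_add[OF _ _ p1]) measurable
    also have "\<dots> \<le> e'" by (rule sum[OF ubound small]) (use \<Phi>(2) in \<open>simp add: norm_minus_commute\<close>)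
    finally show "Lpe p lborel (\<lambda>x. indicator \<Omega> x *\<^sub>R (u x - \<Phi> x)) \<le> e'" .
    have "Lpe p lborel (\<lambda>x. indicator \<Omega> x *\<^sub>R (w x - curl \<Phi> x))
        = Lpe p lborel (\<lambda>x. indicator \<Omega> x *\<^sub>R (w x - ?c x) + indicator \<Omega> x *\<^sub>R (?c x - curl \<Phi> x))"
      by (simp add: scaleR_add_right[symmetric])
    also have "\<dots> \<le> ennreal T * (Lpe p lborel (\<lambda>x. indicator \<Omega> x *\<^sub>R (w x - ?c x)) + Lpe p lborel (\<lambda>x. indicator \<Omega> x *\<^sub>R (?c x - curl \<Phi> x)))"
      unfolding T_def by (rule Lpe_add[OF _ _ p1]) measurable
    also have "\<dots> \<le> e'" by (rule sum[OF wbound small]) (use \<Phi>(3) in \<open>simp add: norm_minus_commute\<close>)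
    finally show "Lpe p lborel (\<lambda>x. indicator \<Omega> x *\<^sub>R (w x - curl \<Phi> x)) \<le> e'" .
    have "Lpe p H2 (\<lambda>x. indicator S x *\<^sub>R (t x - cross3 (\<nu> x) (\<Phi> x)))
        = Lpe p H2 (\<lambda>x. indicator S x *\<^sub>R (t x - cross3 (\<nu> x) (?v x)) + indicator S x *\<^sub>R cross3 (\<nu> x) (?v x - \<Phi> x))"
      by (simp add: scaleR_add_right[symmetric] Cross3.right_diff_distrib)
    also have "\<dots> \<le> ennreal T * (Lpe p H2 (\<lambda>x. indicator S x *\<^sub>R (t x - cross3 (\<nu> x) (?v x))) + Lpe p H2 (\<lambda>x. indicator S x *\<^sub>R cross3 (\<nu> x) (?v x - \<Phi> x)))"
      unfolding T_def scaleR_diff_right[of "indicator S _" "t _"] by (rule Lpe_add[OF _ _ p1]) measurable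
    also have "\<dots> \<le> e'" by (rule sum[OF tbound tsmall])
    finally show "Lpe p H2 (\<lambda>x. indicator S x *\<^sub>R (t x - cross3 (\<nu> x) (\<Phi> x))) \<le> e'" .
  qed
qed

end

section \<open>Boundary charts\<close>

text \<open>Turns a function known only near a into one of class C1 on all of space with bounded
  gradient, as \<open>graph\<close> demands, without changing it near a.\<close>

lemma C1_cutoff:
  fixes \<gamma> :: "real^3 \<Rightarrow> real"
  assumes V: "open V" "a \<in> V" and d: "\<And>y. y \<in> V \<Longrightarrow> (\<gamma> has_derivative (\<lambda>h. D y \<bullet> h)) (at y)" and D: "continuous_on V D"
  obtains m r where "0 < r" "ball a r \<subseteq> V" "Ck 1 m" "\<And>y. y \<in> ball a r \<Longrightarrow> m y = \<gamma> y" "bounded (range (grad m))"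
proof -
  obtain r where r: "0 < r" "cball a r \<subseteq> V" using V open_contains_cball by blast
  obtain \<beta> where \<beta>: "Cinf \<beta>" "\<And>x. dist a x \<le> r / 2 \<Longrightarrow> \<beta> x = (1::real)" "\<And>x. r \<le> dist a x \<Longrightarrow> \<beta> x = 0"
    by (rule ex_plateau[OF r(1), of a]) (rule that)
  define m where "m y = \<beta> y * (if y \<in> V then \<gamma> y else 0)" for y
  define E where "E y = (if y \<in> V then \<gamma> y *\<^sub>R grad \<beta> y + \<beta> y *\<^sub>R D y else 0)" for y
  have dm: "(m has_derivative (\<lambda>h. E y \<bullet> h)) (at y)" if "y \<in> V" for y
  proof (rule has_derivative_transform_within_open[OF _ V(1) that])
    show "((\<lambda>y. \<beta> y * \<gamma> y) has_derivative (\<lambda>h. E y \<bullet> h)) (at y)"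
      by (rule has_derivative_eq_rhs[OF has_derivative_mult[OF Cinf_has_derivative_grad[OF \<beta>(1)] d[OF that]]])
        (simp add: E_def that inner_add_left fun_eq_iff)
  qed (simp add: m_def)
  let ?O = "- cball a r"
  have oO: "open ?O" by (simp add: open_Compl)
  have m0: "m y = 0" "\<beta> y = 0" if "y \<in> ?O" for y using \<beta>(3)[of y] that by (auto simp: m_def)
  have dO: "(m has_derivative (\<lambda>h. 0)) (at y)" "(\<beta> has_derivative (\<lambda>h. 0)) (at y)" if "y \<in> ?O" for y
    by (rule has_derivative_transform_within_open[OF has_derivative_const oO that], simp add: m0)+
  have E0: "E y = 0" if "y \<in> ?O" for y
    using grad_eqI[of \<beta> 0 y] dO(2)[OF that] m0[OF that] by (simp add: E_def)
  have cov: "V \<union> ?O = UNIV" using r(2) by blast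
  have dall: "(m has_derivative (\<lambda>h. E y \<bullet> h)) (at y)" for y
  proof (cases "y \<in> V")
    case False
    then have "y \<in> ?O" using cov by blast
    then show ?thesis using dO(1) by (simp add: E0)
  qed (rule dm)
  have c\<gamma>: "continuous_on V \<gamma>" by (intro has_derivative_continuous_on[OF has_derivative_at_withinI[OF d]])
  have cE: "continuous_on (V \<union> ?O) E"
  proof (rule continuous_on_open_Un[OF V(1) oO])
    have "continuous_on V (\<lambda>y. \<gamma> y *\<^sub>R grad \<beta> y + \<beta> y *\<^sub>R D y)"
      by (intro continuous_intros c\<gamma> D continuous_on_subset[OF Cinf_continuous[OF \<beta>(1)]] continuous_on_subset[OF Cinf_continuous[OF Cinf_grad[OF \<beta>(1)]]]) auto
    then show "continuous_on V E" by (rule continuous_on_eq) (simp add: E_def)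
    show "continuous_on ?O E" by (rule continuous_on_eq[OF continuous_on_const[of _ 0]]) (simp add: E0)
  qed
  have gm: "grad m = E" by (rule ext) (rule grad_eqI[OF dall])
  have "compact (E ` cball a r)" using cE by (intro compact_continuous_image) (auto simp: cov intro: continuous_on_subset)
  then have "bounded (insert 0 (E ` cball a r))" by (simp add: compact_imp_bounded)
  moreover have "range E \<subseteq> insert 0 (E ` cball a r)" using E0 by blast
  ultimately have bd: "bounded (range (grad m))" unfolding gm by (rule bounded_subset)
  show thesis
  proof (rule that[OF _ _ _ _ bd])
    show "0 < r / 2" using r(1) by simp
    show "ball a (r / 2) \<subseteq> V" using r by (force simp: subset_iff)
    show "Ck 1 m" by (rule Ck1_I[OF dall]) (use cE cov in simp)
    fix y assume y: "y \<in> ball a (r / 2)"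
    then have "y \<in> V" using \<open>ball a (r / 2) \<subseteq> V\<close> by blast
    then show "m y = \<gamma> y" using \<beta>(2)[of y] y by (simp add: m_def)
  qed
qed

text \<open>The implicit function theorem. With e the inner unit normal at x0, the map \<Psi>
  replaces the e coordinate of x by -\<rho> x; its local inverse evaluated at e coordinate 0 gives
  the height of the boundary.\<close>

lemma frontier_chart:
  assumes ld: "local_defining_fun \<Omega> x0 r \<rho>" and x0: "x0 \<in> frontier \<Omega>"
  obtains f1 f2 e g B s where "graph f1 f2 e g B" "0 < s"
    "\<And>x. x \<in> ball x0 s \<Longrightarrow> (x \<in> \<Omega> \<longleftrightarrow> g x < x \<bullet> e) \<and> (x \<in> frontier \<Omega> \<longleftrightarrow> x \<bullet> e = g x)"
proof -
  have r: "0 < r" and \<rho>1: "Ck 1 \<rho>" and df: "\<And>y. y \<in> ball x0 r \<Longrightarrow> (y \<in> \<Omega> \<longleftrightarrow> \<rho> y < 0) \<and> (y \<in> frontier \<Omega> \<longleftrightarrow> \<rho> y = 0) \<and> grad \<rho> y \<noteq> 0"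
    using ld unfolding local_defining_fun_def by auto
  define n where "n = norm (grad \<rho> x0)"
  have n: "0 < n" and \<rho>0: "\<rho> x0 = 0" using df[of x0] r x0 by (auto simp: n_def)
  define e where "e = - (grad \<rho> x0 /\<^sub>R n)"
  have ne: "norm e = 1" using n by (simp add: e_def n_def)
  then have ee: "e \<bullet> e = 1" by (simp add: power2_norm_eq_inner[symmetric])
  have G0: "grad \<rho> x0 = - n *\<^sub>R e" using n by (simp add: e_def)
  obtain f1 f2 where "frame f1 f2 e" using ex_frame[OF ne] .
  then interpret frame f1 f2 e .
  have d\<rho>: "(\<rho> has_derivative (\<lambda>h. grad \<rho> x \<bullet> h)) (at x)" for x using has_derivative_grad[of 0 \<rho>] \<rho>1 by simp
  have cG: "continuous_on UNIV (grad \<rho>)" using Ck_grad[of 0 \<rho>] \<rho>1 by simp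
  define \<Psi> where "\<Psi> x = x - (x \<bullet> e + \<rho> x) *\<^sub>R e" for x
  define \<Psi>' where "\<Psi>' x = id_blinfun - (blinfun_scaleR_left e o\<^sub>L blinfun_inner_right (e + grad \<rho> x))" for x
  have \<Psi>'[simp]: "blinfun_apply (\<Psi>' x) h = h - (e \<bullet> h + grad \<rho> x \<bullet> h) *\<^sub>R e" for x h
    by (simp add: \<Psi>'_def blinfun.diff_left inner_add_left)
  have d\<Psi>: "(\<Psi> has_derivative blinfun_apply (\<Psi>' x)) (at x)" for x
    unfolding \<Psi>_def[abs_def]
    by (rule has_derivative_eq_rhs, rule derivative_eq_intros d\<rho> refl | simp)+ (auto simp: fun_eq_iff inner_commute algebra_simps)
  have c\<Psi>: "continuous_on UNIV \<Psi>'"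
    unfolding \<Psi>'_def[abs_def]
    by (intro continuous_intros bounded_bilinear.continuous_on[OF bounded_bilinear_blinfun_compose]
        bounded_linear.continuous_on[OF bounded_linear_blinfun_inner_right] cG)
  \<comment> \<open>The differential of \<Psi> at x0 stretches e by n and fixes the plane; this c
    makes \<Xi> shrink e by 1 / n.\<close>
  define c where "c = 1 - 1 / n"
  have cn: "c * n = n - 1" using n by (simp add: c_def field_simps)
  define \<Xi> where "\<Xi> = id_blinfun - (blinfun_scaleR_left e o\<^sub>L blinfun_inner_right (c *\<^sub>R e))"
  have inv: "\<Xi> o\<^sub>L \<Psi>' x0 = id_blinfun"
  proof (rule blinfun_eqI)
    fix i
    have "blinfun_apply (\<Xi> o\<^sub>L \<Psi>' x0) i = i - ((1 - n) * (e \<bullet> i)) *\<^sub>R e - (c * n * (e \<bullet> i)) *\<^sub>R e"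
      by (simp add: \<Xi>_def blinfun.diff_left G0 ee inner_diff_right algebra_simps)
    also have "\<dots> = i" unfolding cn by (simp add: algebra_simps)
    finally show "blinfun_apply (\<Xi> o\<^sub>L \<Psi>' x0) i = blinfun_apply id_blinfun i" by simp
  qed
  obtain U V \<Theta> \<Theta>' where UV: "open U" "x0 \<in> U" "open V" "\<Psi> x0 \<in> V" "homeomorphism U V \<Psi> \<Theta>"
    "\<And>y. y \<in> V \<Longrightarrow> (\<Theta> has_derivative (\<Theta>' y)) (at y)"
    by (rule inverse_function_theorem[OF open_UNIV d\<Psi> c\<Psi> UNIV_I inv]) (rule that)
  have \<Psi>\<Theta>: "\<Psi> (\<Theta> y) = y" if "y \<in> V" for y using homeomorphism_apply2[OF UV(5) that] .
  define P where "P y = y - (y \<bullet> e) *\<^sub>R e" for y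
  define \<gamma> where "\<gamma> y = \<Theta> y \<bullet> e" for y
  have \<rho>\<Theta>: "\<rho> (\<Theta> y) = - (y \<bullet> e)" "\<Theta> y = P y + \<gamma> y *\<^sub>R e" if "y \<in> V" for y
  proof -
    have *: "\<Theta> y = y + (\<Theta> y \<bullet> e + \<rho> (\<Theta> y)) *\<^sub>R e" using \<Psi>\<Theta>[OF that] by (simp add: \<Psi>_def algebra_simps)
    from arg_cong[OF this, of "\<lambda>v. v \<bullet> e"] show 1: "\<rho> (\<Theta> y) = - (y \<bullet> e)" by (simp add: inner_add_left ee)
    show "\<Theta> y = P y + \<gamma> y *\<^sub>R e" using * unfolding 1 P_def \<gamma>_def by (simp add: algebra_simps)
  qed
  have c\<Theta>: "continuous_on V \<Theta>" by (rule has_derivative_continuous_on[OF has_derivative_at_withinI[OF UV(6)]])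
  \<comment> \<open>The gradient of \<gamma>, found by differentiating \<rho> (\<Theta> y) = -(y
    \<bullet> e). Only differentiability of \<Theta> was taken from the inverse function theorem;
    this formula in terms of \<open>grad \<rho>\<close> shows that the gradient is
    continuous.\<close>
  define D where "D y = (- e - grad \<rho> (\<Theta> y) + (grad \<rho> (\<Theta> y) \<bullet> e) *\<^sub>R e) /\<^sub>R (grad \<rho> (\<Theta> y) \<bullet> e)" for y
  have d\<gamma>: "(\<gamma> has_derivative (\<lambda>h. D y \<bullet> h)) (at y) \<and> grad \<rho> (\<Theta> y) \<bullet> e \<noteq> 0" if y: "y \<in> V" for y
  proof -
    let ?G = "grad \<rho> (\<Theta> y)"
    have dg: "(\<gamma> has_derivative (\<lambda>h. \<Theta>' y h \<bullet> e)) (at y)"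
      unfolding \<gamma>_def[abs_def] by (rule has_derivative_inner_left[OF UV(6)[OF y]])
    have "((\<lambda>y. P y + \<gamma> y *\<^sub>R e) has_derivative (\<lambda>h. h - (h \<bullet> e) *\<^sub>R e + (\<Theta>' y h \<bullet> e) *\<^sub>R e)) (at y)"
      unfolding P_def by (intro has_derivative_add has_derivative_diff has_derivative_ident has_derivative_scaleR_left has_derivative_inner_left dg)
    then have "(\<Theta> has_derivative (\<lambda>h. h - (h \<bullet> e) *\<^sub>R e + (\<Theta>' y h \<bullet> e) *\<^sub>R e)) (at y)"
      by (rule has_derivative_transform_within_open[OF _ UV(3) y]) (simp add: \<rho>\<Theta>(2))
    from has_derivative_compose[OF this d\<rho>]
    have 1: "((\<lambda>y. \<rho> (\<Theta> y)) has_derivative (\<lambda>h. ?G \<bullet> (h - (h \<bullet> e) *\<^sub>R e + (\<Theta>' y h \<bullet> e) *\<^sub>R e))) (at y)" .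
    have "((\<lambda>y. - (y \<bullet> e)) has_derivative (\<lambda>h. - (h \<bullet> e))) (at y)"
      by (intro has_derivative_minus has_derivative_inner_left has_derivative_ident)
    then have 2: "((\<lambda>y. \<rho> (\<Theta> y)) has_derivative (\<lambda>h. - (h \<bullet> e))) (at y)"
      by (rule has_derivative_transform_within_open[OF _ UV(3) y]) (simp add: \<rho>\<Theta>(1))
    have eq: "?G \<bullet> (h - (h \<bullet> e) *\<^sub>R e + (\<Theta>' y h \<bullet> e) *\<^sub>R e) = - (h \<bullet> e)" for h
      using has_derivative_unique[OF 1 2] by (rule fun_cong)
    then have eq': "?G \<bullet> h - (h \<bullet> e) * (?G \<bullet> e) + (\<Theta>' y h \<bullet> e) * (?G \<bullet> e) = - (h \<bullet> e)" for h
      by (simp add: inner_diff_right inner_add_right)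
    have nz: "?G \<bullet> e \<noteq> 0"
    proof
      assume "?G \<bullet> e = 0"
      then show False using eq'[of e] ee by simp
    qed
    have "(\<lambda>h. \<Theta>' y h \<bullet> e) = (\<lambda>h. D y \<bullet> h)"
    proof
      fix h
      have "\<Theta>' y h \<bullet> e = (- (h \<bullet> e) - ?G \<bullet> h + (h \<bullet> e) * (?G \<bullet> e)) / (?G \<bullet> e)"
        using eq'[of h] nz by (simp add: eq_divide_eq)
      also have "\<dots> = D y \<bullet> h"
        by (simp add: D_def inner_add_left inner_diff_left inner_commute[of h] divide_inverse mult.commute)
      finally show "\<Theta>' y h \<bullet> e = D y \<bullet> h" .
    qed
    then show ?thesis using dg nz by simp
  qed
  have cD: "continuous_on V D"
    unfolding D_def[abs_def] using d\<gamma>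
    by (intro continuous_intros continuous_on_compose2[OF cG c\<Theta>]) auto
  obtain m r1 where m: "0 < r1" "ball (\<Psi> x0) r1 \<subseteq> V" "Ck 1 m" "\<And>y. y \<in> ball (\<Psi> x0) r1 \<Longrightarrow> m y = \<gamma> y" "bounded (range (grad m))"
    by (rule C1_cutoff[OF UV(3,4) conjunct1[OF d\<gamma>] cD]) (assumption, rule that)
  obtain M where M: "\<And>y. norm (grad m y) \<le> M" using m(5) unfolding bounded_iff by blast
  \<comment> \<open>Composition with the projection P makes the height constant along e and
    evaluates it at \<rho> = 0.\<close>
  define g where "g y = m (P y)" for y
  have linP: "bounded_linear P"
    unfolding P_def[abs_def] by (intro bounded_linear_sub bounded_linear_ident bounded_linear_compose[OF bounded_linear_scaleR_left] bounded_linear_inner_left)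
  have g1: "Ck 1 g" unfolding g_def[abs_def] by (rule Ck_compose[OF m(3) Ck_bounded_linear[OF linP]])
  have Pe: "P (x + s *\<^sub>R e) = P x" for x s by (simp add: P_def inner_add_left ee algebra_simps)
  have gg: "grad g x = grad m (P x) - (grad m (P x) \<bullet> e) *\<^sub>R e" for x
  proof (rule grad_eqI)
    have "(m has_derivative (\<lambda>h. grad m (P x) \<bullet> h)) (at (P x))" using has_derivative_grad[of 0 m] m(3) by simp
    from has_derivative_compose[OF bounded_linear_imp_has_derivative[OF linP] this]
    have "(g has_derivative (\<lambda>h. grad m (P x) \<bullet> P h)) (at x)" unfolding g_def[abs_def] .
    moreover have "(\<lambda>h. grad m (P x) \<bullet> P h) = (\<lambda>h. (grad m (P x) - (grad m (P x) \<bullet> e) *\<^sub>R e) \<bullet> h)"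
      by (simp add: P_def fun_eq_iff inner_diff_left inner_diff_right inner_commute mult.commute)
    ultimately show "(g has_derivative (\<lambda>h. (grad m (P x) - (grad m (P x) \<bullet> e) *\<^sub>R e) \<bullet> h)) (at x)" by simp
  qed
  have graph: "graph f1 f2 e g (M + M)"
  proof
    show "Ck 1 g" by (rule g1)
    show "g (x + s *\<^sub>R e) = g x" for x s by (simp add: g_def Pe)
    show "norm (grad g x) \<le> M + M" for x
    proof -
      have "norm ((grad m (P x) \<bullet> e) *\<^sub>R e) \<le> M"
        using Cauchy_Schwarz_ineq2[of "grad m (P x)" e] M[of "P x"] by (simp add: ne)
      then show ?thesis unfolding gg using norm_triangle_ineq4[of "grad m (P x)" "(grad m (P x) \<bullet> e) *\<^sub>R e"] M[of "P x"] by linarith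
    qed
  qed
  have Px0: "P x0 = \<Psi> x0" by (simp add: P_def \<Psi>_def \<rho>0)
  have \<Theta>x0: "\<Theta> (\<Psi> x0) = x0" using homeomorphism_apply1[OF UV(5,2)] .
  \<comment> \<open>Near x0 the function \<rho> strictly decreases along e. The final radius s is
    chosen so that x and the boundary point on its vertical line both lie in this region.\<close>
  have "open {x. grad \<rho> x \<bullet> e < 0}" by (intro open_Collect_less continuous_intros cG)
  moreover have "x0 \<in> {x. grad \<rho> x \<bullet> e < 0}" using n by (simp add: G0 ee)
  ultimately obtain r3 where r3: "0 < r3" "ball x0 r3 \<subseteq> {x. grad \<rho> x \<bullet> e < 0}" using open_contains_ball by blast
  have cP: "continuous_on UNIV P" using linP by (rule linear_continuous_on)
  have oV: "open (\<Theta> -` ball x0 r3 \<inter> V)"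
    using c\<Theta> UV(3) by (simp add: continuous_on_open_vimage)
  have "open (P -` (\<Theta> -` ball x0 r3 \<inter> V \<inter> ball (\<Psi> x0) r1))" by (rule open_vimage[OF open_Int[OF oV open_ball] cP])
  then have "open (P -` (\<Theta> -` ball x0 r3 \<inter> V \<inter> ball (\<Psi> x0) r1) \<inter> (ball x0 r3 \<inter> ball x0 r))" by (intro open_Int open_ball)
  moreover have "x0 \<in> P -` (\<Theta> -` ball x0 r3 \<inter> V \<inter> ball (\<Psi> x0) r1) \<inter> (ball x0 r3 \<inter> ball x0 r)"
    using r3(1) r m(1) UV(4) by (simp add: Px0 \<Theta>x0)
  ultimately obtain s where s: "0 < s" "ball x0 s \<subseteq> P -` (\<Theta> -` ball x0 r3 \<inter> V \<inter> ball (\<Psi> x0) r1) \<inter> (ball x0 r3 \<inter> ball x0 r)"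
    using open_contains_ball by blast
  have chart: "(x \<in> \<Omega> \<longleftrightarrow> g x < x \<bullet> e) \<and> (x \<in> frontier \<Omega> \<longleftrightarrow> x \<bullet> e = g x)" if "x \<in> ball x0 s" for x
  proof -
    have x: "P x \<in> V" "P x \<in> ball (\<Psi> x0) r1" "\<Theta> (P x) \<in> ball x0 r3" "x \<in> ball x0 r3" "x \<in> ball x0 r" using s(2) that by auto
    \<comment> \<open>The signed height of the graph above x. The mean value theorem on the vertical
      segment gives \<rho> x = k q with q > 0, so \<rho> and k have the same sign.\<close>
    define k where "k = g x - x \<bullet> e"
    have Te: "\<Theta> (P x) = x + k *\<^sub>R e"
      unfolding \<rho>\<Theta>(2)[OF x(1)] m(4)[OF x(2), symmetric] k_def g_def
      by (simp add: P_def inner_diff_left ee algebra_simps)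
    have \<rho>T: "\<rho> (x + k *\<^sub>R e) = 0" unfolding Te[symmetric] \<rho>\<Theta>(1)[OF x(1)] by (simp add: P_def inner_diff_left ee)
    have seg: "x + (\<tau> * k) *\<^sub>R e \<in> ball x0 r3" if "0 \<le> \<tau>" "\<tau> \<le> 1" for \<tau>
    proof -
      have "(1 - \<tau>) *\<^sub>R x + \<tau> *\<^sub>R (x + k *\<^sub>R e) \<in> ball x0 r3"
        by (rule convexD_alt[OF convex_ball x(4) x(3)[unfolded Te] that])
      then show ?thesis by (simp add: algebra_simps)
    qed
    have der: "((\<lambda>\<tau>. \<rho> (x + (\<tau> * k) *\<^sub>R e)) has_real_derivative k * (grad \<rho> (x + (\<tau> * k) *\<^sub>R e) \<bullet> e)) (at \<tau>)" for \<tau>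
    proof -
      have "((\<lambda>\<tau>. x + (\<tau> * k) *\<^sub>R e) has_derivative (\<lambda>h. (h * k) *\<^sub>R e)) (at \<tau>)"
        by (auto intro!: derivative_eq_intros)
      from has_derivative_compose[OF this d\<rho>]
      have "((\<lambda>\<tau>. \<rho> (x + (\<tau> * k) *\<^sub>R e)) has_derivative (\<lambda>h. grad \<rho> (x + (\<tau> * k) *\<^sub>R e) \<bullet> ((h * k) *\<^sub>R e))) (at \<tau>)" .
      moreover have "(\<lambda>h. grad \<rho> (x + (\<tau> * k) *\<^sub>R e) \<bullet> ((h * k) *\<^sub>R e)) = (*) (k * (grad \<rho> (x + (\<tau> * k) *\<^sub>R e) \<bullet> e))"
        by (simp add: fun_eq_iff algebra_simps)
      ultimately show ?thesis unfolding has_field_derivative_def by simp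
    qed
    obtain \<tau> where \<tau>: "0 < \<tau>" "\<tau> < 1" "\<rho> (x + (1 * k) *\<^sub>R e) - \<rho> (x + (0 * k) *\<^sub>R e) = (1 - 0) * (k * (grad \<rho> (x + (\<tau> * k) *\<^sub>R e) \<bullet> e))"
      using MVT2[of 0 1 "\<lambda>\<tau>. \<rho> (x + (\<tau> * k) *\<^sub>R e)" "\<lambda>\<tau>. k * (grad \<rho> (x + (\<tau> * k) *\<^sub>R e) \<bullet> e)"] der by auto
    define q where "q = - (grad \<rho> (x + (\<tau> * k) *\<^sub>R e) \<bullet> e)"
    have q: "0 < q" using seg[of \<tau>] \<tau> r3(2) by (auto simp: q_def)
    have "\<rho> x = k * q" using \<tau>(3) \<rho>T by (simp add: q_def)
    then have "\<rho> x < 0 \<longleftrightarrow> k < 0" "\<rho> x = 0 \<longleftrightarrow> k = 0" using q by (auto simp: mult_less_0_iff)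
    then show ?thesis using df[OF x(5)] by (auto simp: k_def)
  qed
  show thesis by (rule that[OF graph s(1) chart])
qed

text \<open>At an interior point a constant graph, a plane at height x0 \<bullet> e - s, stays below
  a ball contained in \<Omega>; it satisfies the same equivalences with no boundary in
  sight.\<close>

lemma ex_chart:
  assumes \<Omega>: "bounded_C1_domain \<Omega>" and x0: "x0 \<in> closure \<Omega>"
  obtains f1 f2 e g B s where "graph f1 f2 e g B" "0 < s"
    "\<And>x. x \<in> ball x0 s \<Longrightarrow> (x \<in> \<Omega> \<longleftrightarrow> g x < x \<bullet> e) \<and> (x \<in> frontier \<Omega> \<longleftrightarrow> x \<bullet> e = g x)"
proof (cases "x0 \<in> \<Omega>")
  case False
  then have f: "x0 \<in> frontier \<Omega>" using x0 \<Omega> by (simp add: frontier_def interior_open bounded_C1_domain_def)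
  then obtain r \<rho> where "local_defining_fun \<Omega> x0 r \<rho>" using \<Omega> unfolding bounded_C1_domain_def C1_boundary_def by blast
  from frontier_chart[OF this f] that show thesis .
next
  case True
  have o: "open \<Omega>" using \<Omega> by (simp add: bounded_C1_domain_def)
  then obtain s where s: "0 < s" "ball x0 s \<subseteq> \<Omega>" using True open_contains_ball by blast
  define e :: "real^3" where "e = axis 1 1"
  have ne: "norm e = 1" by (simp add: e_def)
  obtain f1 f2 where "frame f1 f2 e" using ex_frame[OF ne] .
  then interpret frame f1 f2 e .
  have g0: "grad (\<lambda>_. x0 \<bullet> e - s) x = 0" for x by (rule grad_eqI) simp
  have gr: "graph f1 f2 e (\<lambda>_. x0 \<bullet> e - s) 0" by unfold_locales (auto simp: g0 intro: Ck_const[of 1, simplified])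
  show thesis
  proof (rule that[OF gr s(1)])
    fix x assume x: "x \<in> ball x0 s"
    have "\<bar>(x0 - x) \<bullet> e\<bar> < s" using Cauchy_Schwarz_ineq2[of "x0 - x" e] x ne by (simp add: dist_norm)
    then have "x0 \<bullet> e - s < x \<bullet> e" by (simp add: inner_diff_left)
    moreover have "x \<in> \<Omega>" using s x by blast
    moreover from this have "x \<notin> frontier \<Omega>" using o by (simp add: frontier_def interior_open)
    ultimately show "(x \<in> \<Omega> \<longleftrightarrow> x0 \<bullet> e - s < x \<bullet> e) \<and> (x \<in> frontier \<Omega> \<longleftrightarrow> x \<bullet> e = x0 \<bullet> e - s)" by simp
  qed
qed

text \<open>\<open>outward_normal\<close> is a choice among all local defining functions, hence the
  need for uniqueness. If the unit gradients a and b differed, a small step along a - b would make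
  one function positive and the other negative, yet both are negative exactly in \<Omega>.\<close>

lemma local_defining_fun_unit_grad_unique:
  assumes 1: "local_defining_fun \<Omega> x r1 \<rho>1" and 2: "local_defining_fun \<Omega> x r2 \<rho>2" and x: "x \<in> frontier \<Omega>"
  shows "grad \<rho>1 x /\<^sub>R norm (grad \<rho>1 x) = grad \<rho>2 x /\<^sub>R norm (grad \<rho>2 x)"
proof (rule ccontr)
  assume ne: "\<not> ?thesis"
  define a where "a = grad \<rho>1 x /\<^sub>R norm (grad \<rho>1 x)"
  define b where "b = grad \<rho>2 x /\<^sub>R norm (grad \<rho>2 x)"
  have G: "grad \<rho>1 x \<noteq> 0" "grad \<rho>2 x \<noteq> 0" and z: "\<rho>1 x = 0" "\<rho>2 x = 0" and r: "0 < r1" "0 < r2"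
    using 1 2 x unfolding local_defining_fun_def by auto
  have u: "norm a = 1" "norm b = 1" using G by (auto simp: a_def b_def)
  then have aa: "a \<bullet> a = 1" "b \<bullet> b = 1" by (simp_all add: power2_norm_eq_inner[symmetric])
  have "0 < (a - b) \<bullet> (a - b)" using ne by (simp add: a_def b_def)
  then have ab: "a \<bullet> b < 1" by (simp add: inner_diff_left inner_diff_right inner_commute aa)
  have "0 < a \<bullet> (a - b)" "b \<bullet> (a - b) < 0" using ab by (simp_all add: inner_diff_right inner_commute aa)
  moreover have "grad \<rho>1 x = norm (grad \<rho>1 x) *\<^sub>R a" "grad \<rho>2 x = norm (grad \<rho>2 x) *\<^sub>R b" using G by (simp_all add: a_def b_def)
  ultimately have s: "0 < grad \<rho>1 x \<bullet> (a - b)" "grad \<rho>2 x \<bullet> (a - b) < 0"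
    using G by (metis inner_scaleR_left zero_less_norm_iff mult_pos_pos, metis inner_scaleR_left zero_less_norm_iff mult_pos_neg)
  have der: "((\<lambda>\<tau>. \<rho> (x + \<tau> *\<^sub>R (a - b))) has_real_derivative grad \<rho> x \<bullet> (a - b)) (at 0)" if "Ck 1 \<rho>" for \<rho>
  proof -
    have "(\<rho> has_derivative (\<lambda>h. grad \<rho> x \<bullet> h)) (at (x + 0 *\<^sub>R (a - b)))" using has_derivative_grad[of 0 \<rho>] that by simp
    moreover have "((\<lambda>\<tau>. x + \<tau> *\<^sub>R (a - b)) has_derivative (\<lambda>h. h *\<^sub>R (a - b))) (at 0)" by (auto intro!: derivative_eq_intros)
    ultimately have "((\<lambda>\<tau>. \<rho> (x + \<tau> *\<^sub>R (a - b))) has_derivative (\<lambda>h. grad \<rho> x \<bullet> (h *\<^sub>R (a - b)))) (at 0)"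
      by (rule has_derivative_compose[rotated])
    moreover have "(\<lambda>h. grad \<rho> x \<bullet> (h *\<^sub>R (a - b))) = (*) (grad \<rho> x \<bullet> (a - b))" by (simp add: fun_eq_iff mult.commute)
    ultimately show ?thesis unfolding has_field_derivative_def by simp
  qed
  have C: "Ck 1 \<rho>1" "Ck 1 \<rho>2" using 1 2 by (auto simp: local_defining_fun_def)
  obtain d1 where d1: "0 < d1" "\<And>\<tau>. 0 < \<tau> \<Longrightarrow> \<tau> < d1 \<Longrightarrow> 0 < \<rho>1 (x + \<tau> *\<^sub>R (a - b))"
    using DERIV_pos_inc_right[OF der[OF C(1)] s(1)] z by auto
  obtain d2 where d2: "0 < d2" "\<And>\<tau>. 0 < \<tau> \<Longrightarrow> \<tau> < d2 \<Longrightarrow> \<rho>2 (x + \<tau> *\<^sub>R (a - b)) < 0"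
    using DERIV_neg_dec_right[OF der[OF C(2)] s(2)] z by auto
  define \<tau> where "\<tau> = min (min d1 d2) (min r1 r2) / 3"
  have \<tau>: "0 < \<tau>" "\<tau> < d1" "\<tau> < d2" "3 * \<tau> \<le> r1" "3 * \<tau> \<le> r2" using d1(1) d2(1) r by (auto simp: \<tau>_def)
  have "norm (a - b) \<le> 2" using norm_triangle_ineq4[of a b] u by simp
  then have "norm (\<tau> *\<^sub>R (a - b)) \<le> \<tau> * 2" using \<tau>(1) by simp
  then have "norm (\<tau> *\<^sub>R (a - b)) < r1" "norm (\<tau> *\<^sub>R (a - b)) < r2" using \<tau> by linarith+
  then have "x + \<tau> *\<^sub>R (a - b) \<in> ball x r1" "x + \<tau> *\<^sub>R (a - b) \<in> ball x r2" by (simp_all add: dist_norm)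
  then have "\<rho>1 (x + \<tau> *\<^sub>R (a - b)) < 0 \<longleftrightarrow> \<rho>2 (x + \<tau> *\<^sub>R (a - b)) < 0"
    using 1 2 unfolding local_defining_fun_def by blast
  then show False using d1(2)[OF \<tau>(1,2)] d2(2)[OF \<tau>(1,3)] by simp
qed

lemma (in graph) norm_grad_minus_e: "norm (grad g x - e) = jac x"
proof -
  have "(norm (grad g x - e))\<^sup>2 = 1 + (norm (grad g x))\<^sup>2"
    unfolding power2_norm_eq_inner by (simp add: inner_diff_left inner_diff_right)
  then show ?thesis unfolding jac_def by (metis norm_ge_zero real_sqrt_abs abs_of_nonneg)
qed

text \<open>g y - y \<bullet> e is itself a local defining function, so uniqueness identifies the
  chosen normal with its normalised gradient.\<close>

lemma (in graph) outward_normal_chart: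
  assumes s: "\<And>x. x \<in> ball x0 s \<Longrightarrow> (x \<in> \<Omega> \<longleftrightarrow> g x < x \<bullet> e) \<and> (x \<in> frontier \<Omega> \<longleftrightarrow> x \<bullet> e = g x)"
    and x: "x \<in> ball x0 s" "x \<in> frontier \<Omega>"
  shows "outward_normal \<Omega> x = (grad g x - e) /\<^sub>R jac x"
proof -
  define \<sigma> where "\<sigma> y = g y - y \<bullet> e" for y
  have g\<sigma>: "grad \<sigma> y = grad g y - e" for y
  proof (rule grad_eqI)
    show "(\<sigma> has_derivative (\<lambda>h. (grad g y - e) \<bullet> h)) (at y)"
      unfolding \<sigma>_def[abs_def]
      by (rule has_derivative_eq_rhs[OF has_derivative_diff[OF g_deriv has_derivative_inner_left[OF has_derivative_ident]]])
        (simp add: fun_eq_iff inner_diff_left inner_diff_right inner_commute)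
  qed
  have nz: "grad g y - e \<noteq> 0" for y
  proof
    assume "grad g y - e = 0"
    then have "(grad g y - e) \<bullet> e = 0" by simp
    then show False by (simp add: inner_diff_left)
  qed
  obtain r where r: "0 < r" "ball x r \<subseteq> ball x0 s" using x(1) open_contains_ball[of "ball x0 s"] open_ball by metis
  have ld: "local_defining_fun \<Omega> x r \<sigma>"
    unfolding local_defining_fun_def
  proof (intro conjI ballI)
    show "Ck 1 \<sigma>" unfolding \<sigma>_def[abs_def] by (intro Ck_diff g1 Ck_inner Ck_id Ck_const)
    fix y assume "y \<in> ball x r"
    then have "y \<in> ball x0 s" using r by blast
    from s[OF this] show "(y \<in> \<Omega>) = (\<sigma> y < 0)" "(y \<in> frontier \<Omega>) = (\<sigma> y = 0)" by (auto simp: \<sigma>_def)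
    show "grad \<sigma> y \<noteq> 0" using nz by (simp add: g\<sigma>)
  qed (rule r)
  have "\<exists>r \<rho>. local_defining_fun \<Omega> x r \<rho> \<and> outward_normal \<Omega> x = grad \<rho> x /\<^sub>R norm (grad \<rho> x)"
    unfolding outward_normal_def by (rule someI_ex) (use ld in blast)
  then obtain r' \<rho> where r': "local_defining_fun \<Omega> x r' \<rho>" "outward_normal \<Omega> x = grad \<rho> x /\<^sub>R norm (grad \<rho> x)" by blast
  show ?thesis unfolding r'(2) local_defining_fun_unit_grad_unique[OF r'(1) ld x(2)] g\<sigma> norm_grad_minus_e ..
qed

section \<open>Partition of unity\<close>

lemma (in graph) emeasure_gr_cball: "emeasure H2 (gr \<inter> cball 0 R) < \<infinity>"
proof -
  have "emeasure H2 (gr \<inter> cball 0 R) = (\<integral>\<^sup>+x. indicator gr x * indicator (cball 0 R) x \<partial>H2)"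
    by (simp add: indicator_inter_arith[symmetric] nn_integral_indicator)
  also have "\<dots> = (\<integral>\<^sup>+z. ennreal (jac (emb z)) * indicator (cball 0 R) (par z) \<partial>lborel)"
    by (rule nn_integral_gr) (rule borel_measurable_indicator, simp)
  also have "\<dots> \<le> (\<integral>\<^sup>+z. ennreal (1 + B) * indicator (cball (0 :: real^2) R) z \<partial>lborel)"
  proof (rule nn_integral_mono)
    fix z
    have "norm z \<le> norm (par z)" using norm_prj_le[of "par z"] by simp
    then have "indicator (cball 0 R) (par z) \<le> (indicator (cball 0 R) z :: ennreal)" by (auto simp: indicator_def)
    then show "ennreal (jac (emb z)) * indicator (cball 0 R) (par z) \<le> ennreal (1 + B) * indicator (cball 0 R) z"
      by (intro mult_mono ennreal_leI jac_le) auto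
  qed
  also have "\<dots> = ennreal (1 + B) * emeasure lborel (cball (0 :: real^2) R)" by (rule nn_integral_cmult_indicator) simp
  also have "\<dots> < \<infinity>" using emeasure_lborel_cball_finite[of "0 :: real^2" R] by (simp add: ennreal_mult_less_top)
  finally show ?thesis .
qed

context
  fixes \<Omega> :: "(real^3) set" and R :: real
  assumes \<Omega>: "bounded_C1_domain \<Omega>" and R: "\<Omega> \<subseteq> cball 0 R"
begin

lemma open_\<Omega>: "open \<Omega>" using \<Omega> by (simp add: bounded_C1_domain_def)

lemma closure_R: "closure \<Omega> \<subseteq> cball 0 R" by (rule closure_minimal[OF R closed_cball])

lemma frontier_closure: "frontier \<Omega> \<subseteq> closure \<Omega>" by (auto simp: frontier_def)

lemma compacts: "compact (closure \<Omega>)" "compact (frontier \<Omega>)"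
  using closure_R frontier_closure compact_cball
  by (meson bounded_subset compact_eq_bounded_closed closed_closure frontier_closed order_trans)+

text \<open>All three are local and read off a chart; compactness of the frontier makes the area
  finite. Continuity matters because a normal defined by choice is not evidently measurable.\<close>

lemma
  shows norm_outward_normal: "x \<in> frontier \<Omega> \<Longrightarrow> norm (outward_normal \<Omega> x) = 1"
    and continuous_outward_normal: "continuous_on (frontier \<Omega>) (outward_normal \<Omega>)"
    and finite_surface: "emeasure H2 (frontier \<Omega>) < \<infinity>"
proof -
  have loc: "norm (outward_normal \<Omega> x0) = 1 \<and> continuous (at x0 within frontier \<Omega>) (outward_normal \<Omega>)
      \<and> (\<exists>s>0. frontier \<Omega> \<inter> ball x0 s \<in> fmeasurable H2)" if x0: "x0 \<in> frontier \<Omega>" for x0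
  proof -
    obtain f1 f2 e g B s where gr: "graph f1 f2 e g B" and s: "0 < s"
      and ch: "\<And>x. x \<in> ball x0 s \<Longrightarrow> (x \<in> \<Omega> \<longleftrightarrow> g x < x \<bullet> e) \<and> (x \<in> frontier \<Omega> \<longleftrightarrow> x \<bullet> e = g x)"
      by (rule ex_chart[OF \<Omega> subsetD[OF frontier_closure x0]]) (rule that)
    interpret graph f1 f2 e g B by (rule gr)
    have n: "outward_normal \<Omega> x = (grad g x - e) /\<^sub>R jac x" if "x \<in> ball x0 s" "x \<in> frontier \<Omega>" for x
      by (rule outward_normal_chart[OF ch that])
    have "norm (outward_normal \<Omega> x0) = 1"
      using n[of x0] s x0 jac_pos[of x0] by (simp add: norm_grad_minus_e)
    moreover have "continuous (at x0 within frontier \<Omega>) (outward_normal \<Omega>)"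
    proof (rule continuous_transform_within[OF _ s x0])
      have cj: "continuous_on UNIV jac" unfolding jac_def[abs_def] by (intro continuous_intros grad_g_cont)
      have "continuous_on UNIV (\<lambda>x. (grad g x - e) /\<^sub>R jac x)"
        by (intro continuous_intros grad_g_cont cj) (use jac_pos in \<open>auto simp: less_imp_neq[symmetric]\<close>)
      then show "continuous (at x0 within frontier \<Omega>) (\<lambda>x. (grad g x - e) /\<^sub>R jac x)"
        by (simp add: continuous_on_eq_continuous_at continuous_at_imp_continuous_at_within)
      fix x assume "x \<in> frontier \<Omega>" "dist x x0 < s"
      then show "(grad g x - e) /\<^sub>R jac x = outward_normal \<Omega> x" using n[of x] by (simp add: dist_commute)
    qed
    moreover have "frontier \<Omega> \<inter> ball x0 s \<in> fmeasurable H2"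
    proof (rule fmeasurableI)
      show "frontier \<Omega> \<inter> ball x0 s \<in> sets H2" by simp
      have "frontier \<Omega> \<inter> ball x0 s \<subseteq> gr \<inter> cball 0 R"
        using ch frontier_closure closure_R by (auto simp: gr_def)
      then have "emeasure H2 (frontier \<Omega> \<inter> ball x0 s) \<le> emeasure H2 (gr \<inter> cball 0 R)" by (rule emeasure_mono) simp
      then show "emeasure H2 (frontier \<Omega> \<inter> ball x0 s) < \<infinity>" using emeasure_gr_cball by (rule order_le_less_trans)
    qed
    ultimately show ?thesis using s by blast
  qed
  then show "x \<in> frontier \<Omega> \<Longrightarrow> norm (outward_normal \<Omega> x) = 1" and "continuous_on (frontier \<Omega>) (outward_normal \<Omega>)"
    by (auto simp: continuous_on_eq_continuous_within)
  obtain s where s: "\<And>x. x \<in> frontier \<Omega> \<Longrightarrow> 0 < s x \<and> frontier \<Omega> \<inter> ball x (s x) \<in> fmeasurable H2"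
    using loc by metis
  obtain D where D: "D \<subseteq> frontier \<Omega>" "finite D" "frontier \<Omega> \<subseteq> (\<Union>x\<in>D. ball x (s x))"
    by (rule compactE_image[OF compacts(2), of "frontier \<Omega>" "\<lambda>x. ball x (s x)"]) (use s in force)+
  have "(\<Union>x\<in>D. frontier \<Omega> \<inter> ball x (s x)) \<in> fmeasurable H2"
    using D s by (intro fmeasurable.finite_UN) auto
  moreover have "(\<Union>x\<in>D. frontier \<Omega> \<inter> ball x (s x)) = frontier \<Omega>" using D(3) by blast
  ultimately show "emeasure H2 (frontier \<Omega>) < \<infinity>" by (simp add: fmeasurable_def)
qed

lemma outward_normal_borel: "(\<lambda>x. indicator (frontier \<Omega>) x *\<^sub>R outward_normal \<Omega> x) \<in> borel_measurable borel"
  by (rule borel_measurable_continuous_on_indicator[OF _ continuous_outward_normal]) simp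

section \<open>Localisation, gluing and the global approximation\<close>

context
  fixes p :: real
  assumes p: "1 < p"
begin

text \<open>Testing Green's formula with \<eta> \<phi> and applying the product rule for the curl
  shifts the extra term with \<open>grad \<eta>\<close> from the test field to the data. The trace
  is simply multiplied by \<eta>.\<close>

lemma green_triple_localize:
  assumes gt: "green_triple \<Omega> (frontier \<Omega>) p u w t" and \<eta>: "Cinf \<eta>"
  shows "green_triple \<Omega> (frontier \<Omega>) p (\<lambda>x. \<eta> x *\<^sub>R u x) (\<lambda>x. \<eta> x *\<^sub>R w x + cross3 (grad \<eta> x) (u x)) (\<lambda>x. \<eta> x *\<^sub>R t x)"
proof -
  have [measurable]: "u \<in> borel_measurable borel" "w \<in> borel_measurable borel" "t \<in> borel_measurable borel"
    and fin: "Lpe p lborel u < \<infinity>" "Lpe p lborel w < \<infinity>" "Lpe p H2 t < \<infinity>"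
    and z: "\<And>x. x \<notin> \<Omega> \<Longrightarrow> u x = 0 \<and> w x = 0" "\<And>x. x \<notin> frontier \<Omega> \<Longrightarrow> t x = 0"
    and green: "\<And>\<phi>. Cinf \<phi> \<Longrightarrow> (\<integral>x. w x \<bullet> \<phi> x - u x \<bullet> curl \<phi> x \<partial>lborel) = (\<integral>x. t x \<bullet> \<phi> x \<partial>H2)"
    using gt unfolding green_triple_def by auto
  have c: "continuous_on UNIV \<eta>" "continuous_on UNIV (grad \<eta>)" using Cinf_continuous[OF \<eta>] Cinf_continuous[OF Cinf_grad[OF \<eta>]] .
  have [measurable]: "\<eta> \<in> borel_measurable borel" "grad \<eta> \<in> borel_measurable borel"
    by (rule borel_measurable_continuous_onI[OF c(1)], rule borel_measurable_continuous_onI[OF c(2)])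
  have "bounded (\<eta> ` cball 0 R)" "bounded (grad \<eta> ` cball 0 R)"
    by (intro compact_imp_bounded compact_continuous_image continuous_on_subset[OF c(1)] continuous_on_subset[OF c(2)]; simp)+
  then obtain C1 C2 where C1: "\<And>x. x \<in> cball 0 R \<Longrightarrow> norm (\<eta> x) \<le> C1" and C2: "\<And>x. x \<in> cball 0 R \<Longrightarrow> norm (grad \<eta> x) \<le> C2"
    unfolding bounded_iff by blast
  define C where "C = \<bar>C1\<bar> + \<bar>C2\<bar>"
  have C: "\<bar>\<eta> x\<bar> \<le> C" "norm (grad \<eta> x) \<le> C" if "x \<in> cball 0 R" for x using C1[OF that] C2[OF that] by (auto simp: C_def)
  have C0: "0 \<le> C" by (simp add: C_def)
  have m: "ennreal a * X < \<infinity>" if "X < \<infinity>" for a X using that by (simp add: ennreal_mult_less_top)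
  have scale: "norm (\<eta> x *\<^sub>R v x) \<le> C * norm (v x)" "norm (cross3 (grad \<eta> x) (v x)) \<le> C * norm (v x)"
    if "\<And>x. x \<notin> cball 0 R \<Longrightarrow> v x = 0" for v :: "real^3 \<Rightarrow> real^3" and x
  proof -
    have le: "\<bar>\<eta> x\<bar> * norm (v x) \<le> C * norm (v x)" "norm (grad \<eta> x) * norm (v x) \<le> C * norm (v x)"
      using C[of x] that[of x] by (cases "x \<in> cball 0 R"; simp add: mult_right_mono)+
    show "norm (\<eta> x *\<^sub>R v x) \<le> C * norm (v x)" using le(1) by simp
    show "norm (cross3 (grad \<eta> x) (v x)) \<le> C * norm (v x)" by (rule order_trans[OF norm_cross3_le le(2)])
  qed
  have out: "u x = 0" "w x = 0" "t x = 0" if "x \<notin> cball 0 R" for x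
    using that z[of x] R closure_R frontier_closure by blast+
  have "Lpe p lborel (\<lambda>x. \<eta> x *\<^sub>R u x) \<le> ennreal (C powr p) * Lpe p lborel u"
    by (rule Lpe_scale_le) (use scale(1)[OF out(1)] C0 p in auto)
  then have 1: "Lpe p lborel (\<lambda>x. \<eta> x *\<^sub>R u x) < \<infinity>" using m[OF fin(1)] by (rule order_le_less_trans)
  have "Lpe p lborel (\<lambda>x. \<eta> x *\<^sub>R w x) \<le> ennreal (C powr p) * Lpe p lborel w"
    by (rule Lpe_scale_le) (use scale(1)[OF out(2)] C0 p in auto)
  then have 2: "Lpe p lborel (\<lambda>x. \<eta> x *\<^sub>R w x) < \<infinity>" using m[OF fin(2)] by (rule order_le_less_trans)
  have "Lpe p lborel (\<lambda>x. cross3 (grad \<eta> x) (u x)) \<le> ennreal (C powr p) * Lpe p lborel u"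
    by (rule Lpe_scale_le) (use scale(2)[OF out(1)] C0 p in auto)
  then have 3: "Lpe p lborel (\<lambda>x. cross3 (grad \<eta> x) (u x)) < \<infinity>" using m[OF fin(1)] by (rule order_le_less_trans)
  have "Lpe p H2 (\<lambda>x. \<eta> x *\<^sub>R t x) \<le> ennreal (C powr p) * Lpe p H2 t"
    by (rule Lpe_scale_le) (use scale(1)[OF out(3)] C0 p in auto)
  then have 4: "Lpe p H2 (\<lambda>x. \<eta> x *\<^sub>R t x) < \<infinity>" using m[OF fin(3)] by (rule order_le_less_trans)
  have "Lpe p lborel (\<lambda>x. \<eta> x *\<^sub>R w x + cross3 (grad \<eta> x) (u x)) \<le>
      ennreal (2 powr p) * (Lpe p lborel (\<lambda>x. \<eta> x *\<^sub>R w x) + Lpe p lborel (\<lambda>x. cross3 (grad \<eta> x) (u x)))"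
    by (rule Lpe_add) (use p in auto)
  also have "\<dots> < \<infinity>" by (rule m) (use 2 3 in simp)
  finally have 5: "Lpe p lborel (\<lambda>x. \<eta> x *\<^sub>R w x + cross3 (grad \<eta> x) (u x)) < \<infinity>" .
  have gr: "(\<integral>x. (\<eta> x *\<^sub>R w x + cross3 (grad \<eta> x) (u x)) \<bullet> \<phi> x - (\<eta> x *\<^sub>R u x) \<bullet> curl \<phi> x \<partial>lborel) = (\<integral>x. (\<eta> x *\<^sub>R t x) \<bullet> \<phi> x \<partial>H2)"
    if \<phi>: "Cinf \<phi>" for \<phi>
  proof -
    have cu: "curl (\<lambda>y. \<eta> y *\<^sub>R \<phi> y) x = \<eta> x *\<^sub>R curl \<phi> x + cross3 (grad \<eta> x) (\<phi> x)" for x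
      by (rule curl_scaleR_const_plus[OF Cinf_has_derivative_grad[OF \<eta>] Cinf_has_derivative[OF \<phi>]])
    have tri: "cross3 a b \<bullet> c = - (b \<bullet> cross3 a c)" for a b c :: "real^3"
      by (simp add: cross3_def inner_vec_def sum_3 algebra_simps)
    have "(\<integral>x. (\<eta> x *\<^sub>R w x + cross3 (grad \<eta> x) (u x)) \<bullet> \<phi> x - (\<eta> x *\<^sub>R u x) \<bullet> curl \<phi> x \<partial>lborel)
      = (\<integral>x. w x \<bullet> (\<eta> x *\<^sub>R \<phi> x) - u x \<bullet> curl (\<lambda>y. \<eta> y *\<^sub>R \<phi> y) x \<partial>lborel)"
      by (simp add: cu inner_add_left inner_add_right tri algebra_simps)
    also have "\<dots> = (\<integral>x. t x \<bullet> (\<eta> x *\<^sub>R \<phi> x) \<partial>H2)" by (rule green[OF Cinf_scaleR[OF \<eta> \<phi>]])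
    finally show ?thesis by simp
  qed
  show ?thesis unfolding green_triple_def using 1 4 5 gr z by (auto simp: Cross3.cross_zero_right)
qed

lemma approximable_add:
  assumes gt1: "green_triple \<Omega> (frontier \<Omega>) p u1 w1 t1" and gt2: "green_triple \<Omega> (frontier \<Omega>) p u2 w2 t2"
    and 1: "approximable \<Omega> (frontier \<Omega>) (outward_normal \<Omega>) p u1 w1 t1" and 2: "approximable \<Omega> (frontier \<Omega>) (outward_normal \<Omega>) p u2 w2 t2"
  shows "approximable \<Omega> (frontier \<Omega>) (outward_normal \<Omega>) p (\<lambda>x. u1 x + u2 x) (\<lambda>x. w1 x + w2 x) (\<lambda>x. t1 x + t2 x)"
  unfolding approximable_def
proof (intro allI impI)
  fix e' :: ennreal assume e': "0 < e'"
  have [measurable]: "u1 \<in> borel_measurable borel" "w1 \<in> borel_measurable borel" "t1 \<in> borel_measurable borel"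
    "u2 \<in> borel_measurable borel" "w2 \<in> borel_measurable borel" "t2 \<in> borel_measurable borel"
    using gt1 gt2 unfolding green_triple_def by auto
  have [measurable]: "\<Omega> \<in> sets borel" using open_\<Omega> by simp
  define T where "T = (2::real) powr p"
  have T: "0 \<le> T * 2" by (simp add: T_def)
  obtain d where d: "d > 0" "ennreal ((T * 2) * d) < e'" using ex_ennreal_fraction[OF e' T] .
  obtain \<Phi>1 where \<Phi>1: "Cinf \<Phi>1" "Lpe p lborel (\<lambda>x. indicator \<Omega> x *\<^sub>R (u1 x - \<Phi>1 x)) \<le> ennreal d"
     "Lpe p lborel (\<lambda>x. indicator \<Omega> x *\<^sub>R (w1 x - curl \<Phi>1 x)) \<le> ennreal d"
     "Lpe p H2 (\<lambda>x. indicator (frontier \<Omega>) x *\<^sub>R (t1 x - cross3 (outward_normal \<Omega> x) (\<Phi>1 x))) \<le> ennreal d"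
    using 1 d(1) unfolding approximable_def by (meson ennreal_less_zero_iff)
  obtain \<Phi>2 where \<Phi>2: "Cinf \<Phi>2" "Lpe p lborel (\<lambda>x. indicator \<Omega> x *\<^sub>R (u2 x - \<Phi>2 x)) \<le> ennreal d"
     "Lpe p lborel (\<lambda>x. indicator \<Omega> x *\<^sub>R (w2 x - curl \<Phi>2 x)) \<le> ennreal d"
     "Lpe p H2 (\<lambda>x. indicator (frontier \<Omega>) x *\<^sub>R (t2 x - cross3 (outward_normal \<Omega> x) (\<Phi>2 x))) \<le> ennreal d"
    using 2 d(1) unfolding approximable_def by (meson ennreal_less_zero_iff)
  have cc: "curl (\<lambda>x. \<Phi>1 x + \<Phi>2 x) x = curl \<Phi>1 x + curl \<Phi>2 x" for x
    unfolding curl_cross[OF Cinf_has_derivative[OF \<Phi>1(1)]] curl_cross[OF Cinf_has_derivative[OF \<Phi>2(1)]]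
      curl_cross[OF has_derivative_add[OF Cinf_has_derivative[OF \<Phi>1(1)] Cinf_has_derivative[OF \<Phi>2(1)]]]
    by (simp add: cross_add_right)
  have [measurable]: "\<Phi>1 \<in> borel_measurable borel" "curl \<Phi>1 \<in> borel_measurable borel" "\<Phi>2 \<in> borel_measurable borel" "curl \<Phi>2 \<in> borel_measurable borel"
    using \<Phi>1(1) \<Phi>2(1) by (auto intro!: borel_measurable_continuous_onI Cinf_continuous Cinf_curl)
  have meas: "(\<lambda>x. indicator (frontier \<Omega>) x *\<^sub>R (f x - cross3 (outward_normal \<Omega> x) (h x))) \<in> borel_measurable H2"
    if [measurable]: "f \<in> borel_measurable borel" "h \<in> borel_measurable borel" for f h
  proof -
    have "(\<lambda>x. indicator (frontier \<Omega>) x *\<^sub>R (f x - cross3 (outward_normal \<Omega> x) (h x))) =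
      (\<lambda>x. indicator (frontier \<Omega>) x *\<^sub>R f x - cross3 (indicator (frontier \<Omega>) x *\<^sub>R outward_normal \<Omega> x) (h x))"
      by (simp add: scaleR_diff_right cross_mult_left)
    moreover have [measurable]: "frontier \<Omega> \<in> sets borel" by simp
    note [measurable] = outward_normal_borel
    have "(\<lambda>x. indicator (frontier \<Omega>) x *\<^sub>R f x - cross3 (indicator (frontier \<Omega>) x *\<^sub>R outward_normal \<Omega> x) (h x)) \<in> borel_measurable H2"
      by measurable
    ultimately show ?thesis by simp
  qed
  have add: "Lpe p M h \<le> e'" if "Lpe p M f1 \<le> ennreal d" "Lpe p M f2 \<le> ennreal d" "f1 \<in> borel_measurable M" "f2 \<in> borel_measurable M"
     "\<And>x. h x = f1 x + f2 x" for M and h f1 f2 :: "real^3 \<Rightarrow> real^3"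
  proof -
    have "Lpe p M h = Lpe p M (\<lambda>x. f1 x + f2 x)" by (simp add: that(5)[abs_def])
    also have "\<dots> \<le> ennreal T * (Lpe p M f1 + Lpe p M f2)" unfolding T_def by (rule Lpe_add) (use that p in auto)
    also have "\<dots> \<le> ennreal T * (ennreal d + ennreal d)" by (intro mult_left_mono add_mono that) simp
    also have "\<dots> = ennreal ((T * 2) * d)"
      using d(1) by (simp add: T_def ennreal_plus[symmetric] ennreal_mult[symmetric] del: ennreal_plus)
    finally show ?thesis using d(2) by simp
  qed
  show "\<exists>\<Phi>. Cinf \<Phi> \<and> Lpe p lborel (\<lambda>x. indicator \<Omega> x *\<^sub>R (u1 x + u2 x - \<Phi> x)) \<le> e' \<and>
     Lpe p lborel (\<lambda>x. indicator \<Omega> x *\<^sub>R (w1 x + w2 x - curl \<Phi> x)) \<le> e' \<and>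
     Lpe p H2 (\<lambda>x. indicator (frontier \<Omega>) x *\<^sub>R (t1 x + t2 x - cross3 (outward_normal \<Omega> x) (\<Phi> x))) \<le> e'"
  proof (intro exI[of _ "\<lambda>x. \<Phi>1 x + \<Phi>2 x"] conjI)
    show "Cinf (\<lambda>x. \<Phi>1 x + \<Phi>2 x)" by (rule Cinf_add[OF \<Phi>1(1) \<Phi>2(1)])
    show "Lpe p lborel (\<lambda>x. indicator \<Omega> x *\<^sub>R (u1 x + u2 x - (\<Phi>1 x + \<Phi>2 x))) \<le> e'"
      by (rule add[OF \<Phi>1(2) \<Phi>2(2)]) (measurable, simp add: algebra_simps)
    show "Lpe p lborel (\<lambda>x. indicator \<Omega> x *\<^sub>R (w1 x + w2 x - curl (\<lambda>x. \<Phi>1 x + \<Phi>2 x) x)) \<le> e'"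
      by (rule add[OF \<Phi>1(3) \<Phi>2(3)]) (measurable, simp add: cc algebra_simps)
    show "Lpe p H2 (\<lambda>x. indicator (frontier \<Omega>) x *\<^sub>R (t1 x + t2 x - cross3 (outward_normal \<Omega> x) (\<Phi>1 x + \<Phi>2 x))) \<le> e'"
      by (rule add[OF \<Phi>1(4) \<Phi>2(4) meas meas]) (measurable, simp add: cross_add_right algebra_simps)
  qed
qed

lemma grad_locally_const:
  fixes f :: "real^3 \<Rightarrow> real"
  assumes "open U" "x \<in> U" "\<And>y. y \<in> U \<Longrightarrow> f y = c" shows "grad f x = 0"
proof (rule grad_eqI)
  have "(f has_derivative (\<lambda>_. 0)) (at x)"
    by (rule has_derivative_transform_within_open[OF has_derivative_const assms(1,2)]) (simp add: assms(3))
  then show "(f has_derivative (\<lambda>h. 0 \<bullet> h)) (at x)" by simp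
qed

lemma piece_approximable:
  assumes gt: "green_triple \<Omega> (frontier \<Omega>) p u w t" and \<beta>: "Cinf \<beta>" "\<And>x. s / 2 \<le> dist x0 x \<Longrightarrow> \<beta> x = 0" and s: "0 < s"
    and gr: "graph f1 f2 e g B" and ch: "\<And>x. x \<in> ball x0 s \<Longrightarrow> (x \<in> \<Omega> \<longleftrightarrow> g x < x \<bullet> e) \<and> (x \<in> frontier \<Omega> \<longleftrightarrow> x \<bullet> e = g x)"
  shows "approximable \<Omega> (frontier \<Omega>) (outward_normal \<Omega>) p
    (\<lambda>x. \<beta> x *\<^sub>R u x) (\<lambda>x. \<beta> x *\<^sub>R w x + cross3 (grad \<beta> x) (u x)) (\<lambda>x. \<beta> x *\<^sub>R t x)"
proof -
  interpret graph f1 f2 e g B by (rule gr)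
  interpret local_chart f1 f2 e g B \<Omega> "ball x0 s" "cball x0 (s / 2)" "frontier \<Omega>" "outward_normal \<Omega>" p R
    "\<lambda>x. \<beta> x *\<^sub>R u x" "\<lambda>x. \<beta> x *\<^sub>R w x + cross3 (grad \<beta> x) (u x)" "\<lambda>x. \<beta> x *\<^sub>R t x"
  proof
    show "cball x0 (s / 2) \<subseteq> ball x0 s" using s by auto
    show "frontier \<Omega> \<subseteq> cball 0 R" using frontier_closure closure_R by blast
    show "norm (outward_normal \<Omega> x) \<le> 1" if "x \<in> frontier \<Omega>" for x using norm_outward_normal[OF that] by simp
    show "outward_normal \<Omega> x = (grad g x - e) /\<^sub>R jac x" if "x \<in> frontier \<Omega>" "x \<in> ball x0 s" for x
      by (rule outward_normal_chart[OF ch that(2,1)])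
    show "\<beta> x *\<^sub>R u x = 0 \<and> \<beta> x *\<^sub>R w x + cross3 (grad \<beta> x) (u x) = 0 \<and> \<beta> x *\<^sub>R t x = 0" if "x \<notin> cball x0 (s / 2)" for x
    proof -
      have "grad \<beta> x = 0"
        by (rule grad_locally_const[of "- cball x0 (s / 2)" _ _ 0]) (use that \<beta>(2) in \<open>auto simp: open_Compl\<close>)
      then show ?thesis using that \<beta>(2)[of x] by simp
    qed
  qed (use open_\<Omega> R ch p outward_normal_borel finite_surface green_triple_localize[OF gt \<beta>(1)] in auto)
  show ?thesis by (rule local_approximable)
qed

text \<open>Instead of a normalised partition of unity, a cutoff \<eta> with approximable product is
  enlarged ball by ball. The new piece is localised twice, by 1 - \<eta> and by the plateau of the
  next chart.\<close>

lemma green_triple_approximable: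
  assumes gt: "green_triple \<Omega> (frontier \<Omega>) p u w t"
  shows "approximable \<Omega> (frontier \<Omega>) (outward_normal \<Omega>) p u w t"
proof -
  define chart where "chart x0 s \<longleftrightarrow> 0 < s \<and> (\<exists>f1 f2 e g B. graph f1 f2 e g B \<and>
    (\<forall>x\<in>ball x0 s. (x \<in> \<Omega> \<longleftrightarrow> g x < x \<bullet> e) \<and> (x \<in> frontier \<Omega> \<longleftrightarrow> x \<bullet> e = g x)))" for x0 s
  have "\<exists>s. chart x0 s" if "x0 \<in> closure \<Omega>" for x0
    by (rule ex_chart[OF \<Omega> that]) (unfold chart_def, blast)
  then obtain s where s: "\<And>x. x \<in> closure \<Omega> \<Longrightarrow> chart x (s x)" by metis
  then have s0: "\<And>x. x \<in> closure \<Omega> \<Longrightarrow> 0 < s x" by (simp add: chart_def)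
  let ?ap = "approximable \<Omega> (frontier \<Omega>) (outward_normal \<Omega>) p"
  let ?w = "\<lambda>\<eta> x. \<eta> x *\<^sub>R w x + cross3 (grad \<eta> x) (u x)"
  \<comment> \<open>Being 1 on balls, not just at points, makes \<open>grad \<eta>\<close> vanish on
    the closure of \<Omega>, so that in the end the localised curl is w itself. The radius s / 4 is
    half of the plateau radius s / 2.\<close>
  let ?Q = "\<lambda>D \<eta>. Cinf \<eta> \<and> (\<forall>x\<in>D. \<forall>y\<in>ball x (s x / 4). \<eta> y = (1::real)) \<and> ?ap (\<lambda>x. \<eta> x *\<^sub>R u x) (?w \<eta>) (\<lambda>x. \<eta> x *\<^sub>R t x)"
  have ind: "\<exists>\<eta>. ?Q D \<eta>" if "finite D" "D \<subseteq> closure \<Omega>" for D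
    using that
  proof (induction D rule: finite_induct)
    case empty
    have "Lpe p lborel (\<lambda>x :: real^3. 0 :: real^3) = 0" "Lpe p H2 (\<lambda>x. 0 :: real^3) = 0" by (simp_all add: Lpe_def)
    then have "?ap (\<lambda>x. 0) (\<lambda>x. 0) (\<lambda>x. 0)"
      unfolding approximable_def by (auto intro!: exI[of _ "\<lambda>x. 0"] Cinf_const simp: curl_const Cross3.cross_zero_right)
    moreover have "grad (\<lambda>x. 0) x = 0" for x by (rule grad_locally_const[of UNIV]) auto
    ultimately show ?case by (intro exI[of _ "\<lambda>x. 0"]) (simp add: Cinf_const)
  next
    case (insert x0 D)
    then obtain \<eta> where \<eta>: "?Q D \<eta>" by blast
    then have C: "Cinf \<eta>" by blast
    have x0: "x0 \<in> closure \<Omega>" using insert by simp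
    obtain f1 f2 e g B where gr: "graph f1 f2 e g B"
      and ch: "\<And>x. x \<in> ball x0 (s x0) \<Longrightarrow> (x \<in> \<Omega> \<longleftrightarrow> g x < x \<bullet> e) \<and> (x \<in> frontier \<Omega> \<longleftrightarrow> x \<bullet> e = g x)"
      using s[OF x0] unfolding chart_def by blast
    obtain \<beta> where \<beta>: "Cinf \<beta>" "\<And>x. dist x0 x \<le> s x0 / 2 / 2 \<Longrightarrow> \<beta> x = (1::real)" "\<And>x. s x0 / 2 \<le> dist x0 x \<Longrightarrow> \<beta> x = 0"
      by (rule ex_plateau[of "s x0 / 2" x0]) (use s0[OF x0] that in auto)
    define \<kappa> where "\<kappa> x = 1 - \<eta> x" for x
    have \<kappa>: "Cinf \<kappa>" unfolding \<kappa>_def[abs_def] by (intro Cinf_diff Cinf_const C)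
    \<comment> \<open>Equivalently 1 - \<eta>' = (1 - \<eta>) (1 - \<beta>): points already reached
      keep the value 1, and the plateau of \<beta> is added.\<close>
    define \<eta>' where "\<eta>' x = \<eta> x + \<beta> x * \<kappa> x" for x
    have \<eta>': "Cinf \<eta>'" unfolding \<eta>'_def[abs_def] by (intro Cinf_add Cinf_mult C \<beta> \<kappa>)
    have g\<kappa>: "grad \<kappa> x = - grad \<eta> x" for x
    proof (rule grad_eqI)
      show "(\<kappa> has_derivative (\<lambda>h. (- grad \<eta> x) \<bullet> h)) (at x)"
        unfolding \<kappa>_def[abs_def]
        by (rule has_derivative_eq_rhs[OF has_derivative_diff[OF has_derivative_const Cinf_has_derivative_grad[OF C]]]) simp
    qed
    have g\<eta>': "grad \<eta>' x = grad \<eta> x + \<beta> x *\<^sub>R grad \<kappa> x + \<kappa> x *\<^sub>R grad \<beta> x" for x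
    proof (rule grad_eqI)
      show "(\<eta>' has_derivative (\<lambda>h. (grad \<eta> x + \<beta> x *\<^sub>R grad \<kappa> x + \<kappa> x *\<^sub>R grad \<beta> x) \<bullet> h)) (at x)"
        unfolding \<eta>'_def[abs_def]
        by (rule has_derivative_eq_rhs[OF has_derivative_add[OF Cinf_has_derivative_grad[OF C]
              has_derivative_mult[OF Cinf_has_derivative_grad[OF \<beta>(1)] Cinf_has_derivative_grad[OF \<kappa>]]]])
          (simp add: fun_eq_iff inner_add_left)
    qed
    note gt2 = green_triple_localize[OF gt \<kappa>]
    have ap2: "?ap (\<lambda>x. \<beta> x *\<^sub>R \<kappa> x *\<^sub>R u x) (\<lambda>x. \<beta> x *\<^sub>R ?w \<kappa> x + cross3 (grad \<beta> x) (\<kappa> x *\<^sub>R u x)) (\<lambda>x. \<beta> x *\<^sub>R \<kappa> x *\<^sub>R t x)"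
      by (rule piece_approximable[OF gt2 \<beta>(1,3) s0[OF x0] gr ch])
    have "?ap (\<lambda>x. \<eta> x *\<^sub>R u x + \<beta> x *\<^sub>R \<kappa> x *\<^sub>R u x) (\<lambda>x. ?w \<eta> x + (\<beta> x *\<^sub>R ?w \<kappa> x + cross3 (grad \<beta> x) (\<kappa> x *\<^sub>R u x)))
        (\<lambda>x. \<eta> x *\<^sub>R t x + \<beta> x *\<^sub>R \<kappa> x *\<^sub>R t x)"
      by (rule approximable_add[OF green_triple_localize[OF gt C] green_triple_localize[OF gt2 \<beta>(1)] _ ap2]) (use \<eta> in blast)
    moreover have "\<eta> x *\<^sub>R v + \<beta> x *\<^sub>R \<kappa> x *\<^sub>R v = \<eta>' x *\<^sub>R v" for x and v :: "real^3"
      by (simp add: \<eta>'_def algebra_simps)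
    moreover have "?w \<eta> x + (\<beta> x *\<^sub>R ?w \<kappa> x + cross3 (grad \<beta> x) (\<kappa> x *\<^sub>R u x)) = ?w \<eta>' x" for x
      unfolding g\<eta>' by (simp add: \<eta>'_def cross_add_left cross_mult_left cross_mult_right algebra_simps)
    ultimately have "?ap (\<lambda>x. \<eta>' x *\<^sub>R u x) (?w \<eta>') (\<lambda>x. \<eta>' x *\<^sub>R t x)" by simp
    moreover have "\<eta>' y = 1" if "x \<in> insert x0 D" "y \<in> ball x (s x / 4)" for x y
    proof (cases "x = x0")
      case True
      then show ?thesis using \<beta>(2)[of y] that(2) by (simp add: \<eta>'_def \<kappa>_def)
    next
      case False
      then have "\<eta> y = 1" using that \<eta> by blast
      then show ?thesis by (simp add: \<eta>'_def \<kappa>_def)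
    qed
    ultimately show ?case using \<eta>' by blast
  qed
  obtain D where D: "D \<subseteq> closure \<Omega>" "finite D" "closure \<Omega> \<subseteq> (\<Union>x\<in>D. ball x (s x / 4))"
    by (rule compactE_image[OF compacts(1), of "closure \<Omega>" "\<lambda>x. ball x (s x / 4)"]) (use s0 in force)+
  obtain \<eta> where \<eta>: "?Q D \<eta>" using ind[OF D(2,1)] by blast
  have one: "\<eta> x = 1" "grad \<eta> x = 0" if x: "x \<in> closure \<Omega>" for x
  proof -
    obtain x1 where x1: "x1 \<in> D" "x \<in> ball x1 (s x1 / 4)" using x D(3) by blast
    show "\<eta> x = 1" using \<eta> x1 by blast
    show "grad \<eta> x = 0" by (rule grad_locally_const[OF open_ball x1(2)]) (use \<eta> x1(1) in blast)
  qed
  have z: "u x = 0" "w x = 0" "t x = 0" if "x \<notin> closure \<Omega>" for x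
    using gt that frontier_closure closure_subset[of \<Omega>] unfolding green_triple_def by blast+
  have "\<eta> x *\<^sub>R u x = u x" "?w \<eta> x = w x" "\<eta> x *\<^sub>R t x = t x" for x
    using one[of x] z[of x] by (cases "x \<in> closure \<Omega>"; simp)+
  then show ?thesis using \<eta> by simp
qed

end

end

section \<open>The density theorem\<close>

text \<open>The given fields are Lebesgue measurable on \<Omega>, while Tonelli, convolution and the
  shear are used for Borel functions on all of space. A change on a null set affects neither norms
  nor Green's formula.\<close>

lemma ex_borel_representative:
  fixes f :: "real^3 \<Rightarrow> real^3"
  assumes \<Omega>: "open \<Omega>" and f: "f \<in> borel_measurable (lebesgue_on \<Omega>)"
  obtains f0 where "f0 \<in> borel_measurable borel" "AE x in lebesgue_on \<Omega>. f x = f0 x" "\<And>x. x \<notin> \<Omega> \<Longrightarrow> f0 x = 0"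
proof -
  have sl: "\<Omega> \<inter> space lebesgue \<in> sets lebesgue" using \<Omega> by (simp add: borel_open)
  have m: "(\<lambda>x. indicator \<Omega> x *\<^sub>R f x) \<in> borel_measurable lebesgue" using f borel_measurable_restrict_space_iff[OF sl] by blast
  have "\<exists>h\<in>borel_measurable lborel. AE x in lborel. (indicator \<Omega> x *\<^sub>R f x) $ i = h x" for i
  proof (rule completion_ex_borel_measurable_real)
    have "(\<lambda>x. (indicator \<Omega> x *\<^sub>R f x) \<bullet> axis i 1) \<in> borel_measurable lebesgue"
      by (rule borel_measurable_inner[OF m borel_measurable_const])
    then show "(\<lambda>x. (indicator \<Omega> x *\<^sub>R f x) $ i) \<in> borel_measurable lebesgue" by (simp only: inner_axis inner_real_def mult_1_right)
  qed
  then have "\<forall>i. \<exists>h. h \<in> borel_measurable lborel \<and> (AE x in lborel. (indicator \<Omega> x *\<^sub>R f x) $ i = h x)" by blast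
  from choice[OF this] obtain h where h: "\<And>i. h i \<in> borel_measurable lborel" "\<And>i. AE x in lborel. (indicator \<Omega> x *\<^sub>R f x) $ i = h i x"
    by blast
  define k where "k x = (\<Sum>i\<in>UNIV. h i x *\<^sub>R axis i (1::real))" for x
  have ki: "k x $ i = h i x" for x i by (simp add: k_def axis_def if_distrib cong: if_cong)
  have [measurable]: "h i \<in> borel_measurable borel" for i using h(1) by simp
  have [measurable]: "k \<in> borel_measurable borel" unfolding k_def[abs_def] by measurable
  have [measurable]: "\<Omega> \<in> sets borel" using \<Omega> by simp
  have "AE x in lborel. \<forall>i\<in>UNIV. (indicator \<Omega> x *\<^sub>R f x) $ i = h i x" by (rule AE_finite_allI) (simp, rule h)
  then have "AE x in lborel. x \<in> \<Omega> \<longrightarrow> f x = indicator \<Omega> x *\<^sub>R k x"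
    by eventually_elim (auto simp: vec_eq_iff ki)
  then have "AE x in lebesgue. x \<in> \<Omega> \<longrightarrow> f x = indicator \<Omega> x *\<^sub>R k x" by (rule AE_completion)
  then have ae: "AE x in lebesgue_on \<Omega>. f x = indicator \<Omega> x *\<^sub>R k x" by (subst AE_restrict_space_iff[OF sl])
  have "(\<lambda>x. indicator \<Omega> x *\<^sub>R k x) \<in> borel_measurable borel" by measurable
  from this ae show thesis by (rule that) simp
qed

lemma Lpe_lebesgue_on:
  assumes \<Omega>: "open \<Omega>" and f: "AE x in lebesgue_on \<Omega>. f x = f0 x"
  shows "Lpe p (lebesgue_on \<Omega>) f = Lpe p lborel (\<lambda>x. indicator \<Omega> x *\<^sub>R f0 x)"
proof -
  have sl: "\<Omega> \<inter> space lebesgue \<in> sets lebesgue" using \<Omega> by (simp add: borel_open)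
  have "Lpe p (lebesgue_on \<Omega>) f = Lpe p (lebesgue_on \<Omega>) f0"
    unfolding Lpe_def by (rule nn_integral_cong_AE) (use f in eventually_elim, simp)
  also have "\<dots> = (\<integral>\<^sup>+x. ennreal (norm (f0 x) powr p) * indicator \<Omega> x \<partial>lborel)"
    unfolding Lpe_def nn_integral_restrict_space[OF sl] by (rule nn_integral_completion)
  also have "\<dots> = Lpe p lborel (\<lambda>x. indicator \<Omega> x *\<^sub>R f0 x)"
    unfolding Lpe_def by (intro nn_integral_cong) (simp add: indicator_def)
  finally show ?thesis .
qed

lemma Lpe_restrict_space:
  assumes "S \<in> sets M"
  shows "Lpe p (restrict_space M S) f = Lpe p M (\<lambda>x. indicator S x *\<^sub>R f x)"
  unfolding Lpe_def using assms sets.sets_into_space[OF assms]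
  by (subst nn_integral_restrict_space) (auto intro!: nn_integral_cong simp: indicator_def Int_absorb2)

lemma Lp_norm_le:
  assumes f: "f \<in> borel_measurable M" and le: "Lpe p M f \<le> ennreal (d powr p)" and d: "0 \<le> d" and p: "0 < p"
  shows "Lp_norm M p f \<le> d"
proof -
  have [measurable]: "f \<in> borel_measurable M" by (rule f)
  have "(\<integral>x. norm (f x) powr p \<partial>M) = enn2real (Lpe p M f)"
    unfolding Lpe_def by (rule integral_eq_nn_integral) auto
  also have "\<dots> \<le> enn2real (ennreal (d powr p))" by (rule enn2real_mono[OF le]) simp
  finally have "(\<integral>x. norm (f x) powr p \<partial>M) \<le> d powr p" by simp
  moreover have "0 \<le> (\<integral>x. norm (f x) powr p \<partial>M)" by (rule integral_nonneg_AE) simp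
  ultimately have "Lp_norm M p f \<le> (d powr p) powr (1 / p)" unfolding Lp_norm_def using p by (intro powr_mono2) auto
  also have "\<dots> = d" using d p by (simp add: powr_powr)
  finally show ?thesis .
qed

lemma Lp_imp_Lpe_finite: "Lp M p f \<Longrightarrow> Lpe p M f < \<infinity>"
  unfolding Lp_def Lpe_def by (simp add: integrable_iff_bounded)

theorem theorem5p5:
  fixes \<Omega> :: "(real^3) set" and p :: real
  assumes "bounded_C1_domain \<Omega>" and "1 < p"
  shows "\<forall>u w t. W_imp_curl \<Omega> p u w t \<longrightarrow>
           (\<forall>\<epsilon>>0. \<exists>\<phi>. Cinf \<phi> \<and> W_imp_dist \<Omega> p u w t \<phi> < \<epsilon>)"
proof (intro allI impI)
  fix u w t and \<epsilon> :: real
  assume W: "W_imp_curl \<Omega> p u w t" and \<epsilon>: "0 < \<epsilon>"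
  have o: "open \<Omega>" using assms(1) by (simp add: bounded_C1_domain_def)
  have bd: "bounded \<Omega>" using assms(1) by (simp add: bounded_C1_domain_def)
  then obtain R where R: "\<Omega> \<subseteq> cball 0 R" by (auto simp: bounded_iff subset_iff)
  have [measurable]: "\<Omega> \<in> sets borel" "frontier \<Omega> \<in> sets borel" using o by auto
  have sl: "\<Omega> \<inter> space lebesgue \<in> sets lebesgue" using o by (simp add: borel_open)
  have sf: "frontier \<Omega> \<inter> space H2 \<in> sets H2" by simp
  have Lpu: "Lp (lebesgue_on \<Omega>) p u" and Lpw: "Lp (lebesgue_on \<Omega>) p w" and Lpt: "Lp (surface_measure \<Omega>) p t"
    and tr: "tangential_trace \<Omega> u w t"
    using W by (auto simp: W_imp_curl_def Lp_tangential_def)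
  have mu: "u \<in> borel_measurable (lebesgue_on \<Omega>)" and mw: "w \<in> borel_measurable (lebesgue_on \<Omega>)"
    and mt: "t \<in> borel_measurable (surface_measure \<Omega>)"
    using Lpu Lpw Lpt by (auto simp: Lp_def)
  obtain u0 where u0: "u0 \<in> borel_measurable borel" "AE x in lebesgue_on \<Omega>. u x = u0 x" "\<And>x. x \<notin> \<Omega> \<Longrightarrow> u0 x = 0"
    by (rule ex_borel_representative[OF o mu]) (rule that)
  obtain w0 where w0: "w0 \<in> borel_measurable borel" "AE x in lebesgue_on \<Omega>. w x = w0 x" "\<And>x. x \<notin> \<Omega> \<Longrightarrow> w0 x = 0"
    by (rule ex_borel_representative[OF o mw]) (rule that)
  \<comment> \<open>The surface measure lives on Borel sets, so t only has to be extended by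
    zero.\<close>
  define t0 where "t0 x = indicator (frontier \<Omega>) x *\<^sub>R t x" for x
  have t0m: "t0 \<in> borel_measurable borel"
    using mt borel_measurable_restrict_space_iff[OF sf, of t] unfolding surface_measure_def t0_def[abs_def] by simp
  note [measurable] = u0(1) w0(1) t0m
  have ind: "indicator \<Omega> x *\<^sub>R u0 x = u0 x" "indicator \<Omega> x *\<^sub>R w0 x = w0 x" for x
    using u0(3)[of x] w0(3)[of x] by (auto simp: indicator_def)
  have leb: "h \<in> borel_measurable (lebesgue_on \<Omega>)" if "h \<in> borel_measurable borel" for h :: "real^3 \<Rightarrow> 'b::euclidean_space"
    using that by (intro measurable_restrict_space1 measurable_completion) simp
  \<comment> \<open>Green's formula is carried from \<open>lebesgue_on \<Omega>\<close> and the
    surface measure to integrals over all of space.\<close>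
  have green: "(\<integral>x. w0 x \<bullet> \<phi> x - u0 x \<bullet> curl \<phi> x \<partial>lborel) = (\<integral>x. t0 x \<bullet> \<phi> x \<partial>H2)" if \<phi>: "Cinf \<phi>" for \<phi>
  proof -
    have [measurable]: "\<phi> \<in> borel_measurable borel" "curl \<phi> \<in> borel_measurable borel"
      using \<phi> by (auto intro!: borel_measurable_continuous_onI Cinf_continuous Cinf_curl)
    let ?h = "\<lambda>x. w0 x \<bullet> \<phi> x - u0 x \<bullet> curl \<phi> x"
    have hm: "?h \<in> borel_measurable borel" by measurable
    have "(\<integral>x. ?h x \<partial>lborel) = (\<integral>x. ?h x \<partial>lebesgue)" by (rule integral_completion[symmetric]) (use hm in simp)
    also have "\<dots> = (\<integral>x. indicator \<Omega> x *\<^sub>R ?h x \<partial>lebesgue)"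
      by (rule Bochner_Integration.integral_cong[OF refl]) (use u0(3) w0(3) in \<open>auto simp: indicator_def\<close>)
    also have "\<dots> = (\<integral>x. ?h x \<partial>lebesgue_on \<Omega>)" by (rule integral_restrict_space[OF sl, symmetric])
    also have "\<dots> = (\<integral>x. w x \<bullet> \<phi> x - u x \<bullet> curl \<phi> x \<partial>lebesgue_on \<Omega>)"
    proof (rule integral_cong_AE)
      show "?h \<in> borel_measurable (lebesgue_on \<Omega>)" by (rule leb[OF hm])
      show "(\<lambda>x. w x \<bullet> \<phi> x - u x \<bullet> curl \<phi> x) \<in> borel_measurable (lebesgue_on \<Omega>)"
        using mu mw leb[of \<phi>] leb[of "curl \<phi>"] by (intro borel_measurable_diff borel_measurable_inner) auto
      show "AE x in lebesgue_on \<Omega>. ?h x = w x \<bullet> \<phi> x - u x \<bullet> curl \<phi> x"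
        using u0(2) w0(2) by eventually_elim simp
    qed
    also have "\<dots> = (\<integral>x. t x \<bullet> \<phi> x \<partial>surface_measure \<Omega>)" using tr \<phi> by (simp add: tangential_trace_def)
    also have "\<dots> = (\<integral>x. indicator (frontier \<Omega>) x *\<^sub>R (t x \<bullet> \<phi> x) \<partial>H2)"
      unfolding surface_measure_def by (rule integral_restrict_space[OF sf])
    finally show ?thesis by (simp add: t0_def)
  qed
  have "green_triple \<Omega> (frontier \<Omega>) p u0 w0 t0"
    unfolding green_triple_def
  proof (intro conjI allI impI)
    show "Lpe p lborel u0 < \<infinity>" "Lpe p lborel w0 < \<infinity>"
      using Lp_imp_Lpe_finite[OF Lpu] Lp_imp_Lpe_finite[OF Lpw]
      unfolding Lpe_lebesgue_on[OF o u0(2)] Lpe_lebesgue_on[OF o w0(2)] ind .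
    have "Lpe p (surface_measure \<Omega>) t = Lpe p H2 t0"
      unfolding surface_measure_def t0_def[abs_def] by (rule Lpe_restrict_space) simp
    then show "Lpe p H2 t0 < \<infinity>" using Lp_imp_Lpe_finite[OF Lpt] by simp
  qed (use u0 w0 t0m green in \<open>simp_all add: t0_def\<close>)
  from green_triple_approximable[OF assms(1) R assms(2) this]
  have ap: "approximable \<Omega> (frontier \<Omega>) (outward_normal \<Omega>) p u0 w0 t0" .
  \<comment> \<open>Three error terms of at most d each stay below \<epsilon>.\<close>
  define d where "d = \<epsilon> / 4"
  have d: "0 < d" "0 < ennreal (d powr p)" using \<epsilon> by (auto simp: d_def)
  obtain \<phi> where \<phi>: "Cinf \<phi>"
    and a1: "Lpe p lborel (\<lambda>x. indicator \<Omega> x *\<^sub>R (u0 x - \<phi> x)) \<le> ennreal (d powr p)"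
    and a2: "Lpe p lborel (\<lambda>x. indicator \<Omega> x *\<^sub>R (w0 x - curl \<phi> x)) \<le> ennreal (d powr p)"
    and a3: "Lpe p H2 (\<lambda>x. indicator (frontier \<Omega>) x *\<^sub>R (t0 x - cross3 (outward_normal \<Omega> x) (\<phi> x))) \<le> ennreal (d powr p)"
    using ap d(2) unfolding approximable_def by blast
  have [measurable]: "\<phi> \<in> borel_measurable borel" "curl \<phi> \<in> borel_measurable borel"
    using \<phi> by (auto intro!: borel_measurable_continuous_onI Cinf_continuous Cinf_curl)
  have e1: "AE x in lebesgue_on \<Omega>. u x - \<phi> x = u0 x - \<phi> x" and e2: "AE x in lebesgue_on \<Omega>. w x - curl \<phi> x = w0 x - curl \<phi> x"
    using u0(2) w0(2) by (auto elim: eventually_mono)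
  have "Lp_norm (lebesgue_on \<Omega>) p (\<lambda>x. u x - \<phi> x) \<le> d"
    by (rule Lp_norm_le) (use a1 Lpe_lebesgue_on[OF o e1, of p] mu leb[of \<phi>] d assms(2) in auto)
  moreover have "Lp_norm (lebesgue_on \<Omega>) p (\<lambda>x. w x - curl \<phi> x) \<le> d"
    by (rule Lp_norm_le) (use a2 Lpe_lebesgue_on[OF o e2, of p] mw leb[of "curl \<phi>"] d assms(2) in auto)
  moreover have "Lp_norm (surface_measure \<Omega>) p (\<lambda>x. t x - cross3 (outward_normal \<Omega> x) (\<phi> x)) \<le> d"
  proof (rule Lp_norm_le)
    let ?r = "\<lambda>x. t x - cross3 (outward_normal \<Omega> x) (\<phi> x)"
    have eq: "indicator (frontier \<Omega>) x *\<^sub>R ?r x = t0 x - cross3 (indicator (frontier \<Omega>) x *\<^sub>R outward_normal \<Omega> x) (\<phi> x)" for x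
      by (simp add: t0_def scaleR_diff_right cross_mult_left)
    note [measurable] = outward_normal_borel[OF assms(1) R]
    have "(\<lambda>x. indicator (frontier \<Omega>) x *\<^sub>R ?r x) \<in> borel_measurable H2" unfolding eq by measurable
    then show "?r \<in> borel_measurable (surface_measure \<Omega>)"
      unfolding surface_measure_def by (simp add: borel_measurable_restrict_space_iff[OF sf])
    have "Lpe p (surface_measure \<Omega>) ?r = Lpe p H2 (\<lambda>x. indicator (frontier \<Omega>) x *\<^sub>R ?r x)"
      unfolding surface_measure_def by (rule Lpe_restrict_space) simp
    also have "\<dots> = Lpe p H2 (\<lambda>x. indicator (frontier \<Omega>) x *\<^sub>R (t0 x - cross3 (outward_normal \<Omega> x) (\<phi> x)))"
      by (rule arg_cong[where f="Lpe p H2"]) (auto simp: t0_def indicator_def fun_eq_iff)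
    finally show "Lpe p (surface_measure \<Omega>) ?r \<le> ennreal (d powr p)" using a3 by simp
  qed (use d assms(2) in auto)
  ultimately have "W_imp_dist \<Omega> p u w t \<phi> \<le> d + d + d" unfolding W_imp_dist_def by linarith
  then have "W_imp_dist \<Omega> p u w t \<phi> < \<epsilon>" using \<epsilon> by (simp add: d_def)
  then show "\<exists>\<phi>. Cinf \<phi> \<and> W_imp_dist \<Omega> p u w t \<phi> < \<epsilon>" using \<phi> by blast
qed

end
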